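(* Let $\Bbbk$ be a field with $\mathrm{char}(\Bbbk)\neq2$, let $\underline Q$ be a skewed-gentle polarized quiver, $\mathbf x,\mathbf y\in\mathrm{Adm}(\underline Q)$, $X$ a finite-dimensional $A_{\mathbf x}$-module and $Y$ a finite-dimensional $A_{\mathbf y}$-module. Then $$\mathrm{Hom}_{\Bbbk\underline Q}(M^o_{\mathbf x}(X),M^o_{\mathbf y}(Y))=\bigoplus_{L\in\mathcal H_{\underline Q}(\mathbf x,\mathbf y)}\mathrm{Hom}_{\Bbbk\underline Q}(M^o_{\mathbf x}(X),M^o_{\mathbf y}(Y))_L\;\cong\bigoplus_{L'\in\mathcal R_{\underline Q}(\mathbf x,\mathbf y)}\mathrm{Hom}_{A_{L'}}(X,Y),$$ where $\mathcal H_{\underline Q}(\mathbf x,\mathbf y)$ is the set of long h-lines and $\mathcal R_{\underline Q}(\mathbf x,\mathbf y)$ the set of real h-lines of $H_{\underline Q}(\mathbf x,\mathbf y)$. Here, for each $L\in\mathcal H_{\underline Q}(\mathbf x,\mathbf y)$ and each $(j,i)\in L_0$, the projection $$\mathrm{Hom}_{\Bbbk\underline Q}(M^o_{\mathbf x}(X),M^o_{\mathbf y}(Y))_L\to\mathrm{Hom}_{A_L}(X,Y),\qquad f\mapsto f_{j,i},$$ is a well-defined $\Bbbk$-linear isomorphism.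
   Context: **Polarized quivers.** A skewed-gentle polarized quiver $\underline Q$ consists of finite sets $Q_0$ (vertices) and $Q_1=Q_1^{sp}\sqcup Q_1^{ord}$ (special and ordinary arrows) and injective maps $\underline s=(s,s_1),\ \underline t=(t,t_1):Q_1\to Q_0\times\{-1,1\}$, such that every special arrow is a loop $\varepsilon$ with $s_1(\varepsilon)=t_1(\varepsilon)=-1$, and such that there are only finitely many admissible paths, i.e. sequences of arrows $\alpha_1\cdots\alpha_l$ with $\underline s(\alpha_k)=-\underline t(\alpha_{k+1})$, where $-(i,\rho):=(i,-\rho)$. At each vertex $i$ there is at most one special loop, denoted $\varepsilon_i$; $Q_0^{sp}$ is the set of vertices with a special loop. **Letters and words.** The letters of $\underline Q$ are: direct letters $\alpha$ and inverse letters $\alpha^{-1}$ for $\alpha\in Q_1^{ord}$, with $\underline s(\alpha^{-1})=\underline t(\alpha)$, $\underline t(\alpha^{-1})=\underline s(\alpha)$; a special letter $\varepsilon_i^*=(\varepsilon_i^* )^{-1}$ for $i\in Q_0^{sp}$, with $\underline s=\underline t=(i,-1)$; and for each $(i,\rho)\in Q_0\times\{-1,1\}$ not of the form $(i,-1)$ with $i\in Q_0^{sp}$, a trivial letter $\mathbf 1_{i,\rho}$ with $\underline t=(i,\rho)$, $\underline s=*$, and its inverse $\mathbf 1_{i,\rho}^{-1}$ with $\underline s=(i,\rho)$, $\underline t=*$. Distinct letters are comparable iff they have the same $\underline t\in Q_0\times\{-1,1\}$, and then $\alpha<\mathbf 1_{i,\rho}<\beta^{-1}$. A word is a sequence of letters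 $w_0\cdots w_n$ with $\underline s(w_k)=-\underline t(w_{k+1})\in Q_0\times\{-1,1\}$; $\mathbf w_{[k]}:=w_0\cdots w_k$, $\mathbf w^{[k]}:=w_k\cdots w_n$, $\mathbf w^{-1}:=w_n^{-1}\cdots w_0^{-1}$. Finite or right-infinite words are compared lexicographically. A string is a word beginning with an inverse trivial letter and ending with a trivial letter. A band is a nonempty word $\mathbf w$ with $\mathbf w\mathbf w$ a word; it is primitive if not a proper power, and a primitive band is symmetric if its inverse is one of its rotations $\mathbf w^{[k+1]}\mathbf w_{[k]}$. **Admissible words.** $\underline{\widehat Q}$ is the gentle polarized quiver with the same vertices, arrows and $\underline s,\underline t$ as $\underline Q$, but with all arrows ordinary; so for $i\in Q_0^{sp}$ it has letters $\varepsilon_i\prec\mathbf 1_{i,-1}\prec\varepsilon_i^{-1}$ (its order is written $\prec$); $\mathbf 1_{i,-1}^{\pm1}$ with $i\in Q_0^{sp}$ are called punctured. $F$ maps words of $\underline{\widehat Q}$ to words of $\underline Q$ letterwise, $\varepsilon_i^{\pm1},\mathbf 1_{i,-1}^{\pm1}\mapsto\varepsilon_i^*$ ($i\in Q_0^{sp}$), other letters fixed. A string $x_0\cdots x_l$ of $\underline{\widehat Q}$ has type $(a,b)\in\{u,p\}^2$, $a=p$ (resp. $b=p$) iff $x_0$ (resp. $x_l$) is punctured; bands have type $(b)$. The completion $\overline{\mathbf x}$ is $F(\mathbf x)$ for types $(u,u)$ and $(b)$; $F(\mathbf x)F(x_{l-1}^{-1}\cdots x_0^{-1})$ for $(u,p)$;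 $F(x_l^{-1}\cdots x_1^{-1})F(\mathbf x)$ for $(p,u)$; $F(\mathbf x)F(x_{l-1}^{-1}\cdots x_1^{-1})$ for $(p,p)$. A string $\mathbf x=x_0\cdots x_n$ of $\underline{\widehat Q}$ is admissible if for all $0<k<n$ with $F(x_k)$ special one has $\mathbf x_{[k-1]}^{-1}\ne\mathbf x^{[k+1]}$ and $x_k$ is direct iff $\mathbf x_{[k-1]}^{-1}\succ\mathbf x^{[k+1]}$, and, for type $(p,p)$, $\overline{\mathbf x}$ is a primitive band. A band $\mathbf x=x_0\cdots x_n$ of $\underline{\widehat Q}$ is admissible if for all $k$ with $F(x_k)$ special, $\mathbf z:=\mathbf x^{[k+1]}\mathbf x_{[k-1]}$ satisfies $\mathbf z^{-1}\neq\mathbf z$ and $x_k$ is direct iff $\mathbf z^{-1}\succ\mathbf z$, and $F(\mathbf x)$ is a primitive asymmetric band. $\mathrm{Adm}(\underline Q)$ is the set of admissible strings and bands. **The quivers $H(\mathbf x)$.** For an admissible string $\mathbf x=x_0\cdots x_n$, $H(\mathbf x)$ has vertices $1,\dots,n$, for $1\le i\le n-1$ an ordinary arrow $\nu_i$, which is $i+1\to i$ with $G_{\mathbf x}(\nu_i)=x_i$ if $x_i$ is direct, and $i\to i+1$ with $G_{\mathbf x}(\nu_i)=x_i^{-1}$ if $x_i$ is inverse; a special loop $\eta_0$ at $1$ iff $x_0$ is punctured, and a special loop $\eta_1$ at $n$ iff $x_n$ is punctured, sent by $G_{\mathbf x}$ to the special loop of $\underline Q$ at $s(x_0)$ resp.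 $t(x_n)$. $G_{\mathbf x}(i)=t(x_i)$. For an admissible band $x_0\cdots x_n$, $H(\mathbf x)$ is a cycle with vertices $0,\dots,n$ and ordinary arrows $\nu_i$ ($0\le i\le n$) between $i$ and $i+1$ (mod $n+1$) oriented and mapped by the same rule, $G_{\mathbf x}(i)=t(x_i)$. (Ordinary arrows of $H(\mathbf x)$ may be mapped to special loops of $\underline Q$.) **Reading words.** $\overline{\overline{\mathbf x}}$ is the word $\overline{\mathbf x}$ if $\mathbf x$ is a string not of type $(p,p)$, and the bi-infinite periodic word $\cdots\overline{\mathbf x}\,\overline{\mathbf x}\,\overline{\mathbf x}\cdots$ otherwise; its letters are indexed such that $\overline{\overline x}_k=F(x_k)$ for the letters of $\mathbf x$ itself (in the periodic cases the copy of $\overline{\mathbf x}$ starting at index $0$). For a vertex $i$ of $H(\mathbf x)$ and $\rho\in\{-1,1\}$, $\overline{\overline{\mathbf x}}(i,\rho)$ is $\overline{\overline x}_i\overline{\overline x}_{i+1}\cdots$ if $t_1(\overline{\overline x}_i)=\rho$, and $\overline{\overline x}_{i-1}^{-1}\overline{\overline x}_{i-2}^{-1}\cdots$ if $t_1(\overline{\overline x}_i)=-\rho$. **The quiver $H_{\underline Q}(\mathbf x,\mathbf y)$ and h-lines.** Vertices: $(j,i)\in H_0(\mathbf y)\times H_0(\mathbf x)$ with $G_{\mathbf y}(j)=G_{\mathbf x}(i)$. Arrows: $H_{1,+}$: $(\beta,\alpha)_+:(s\beta,s\alpha)\to(t\beta,t\alpha)$ for $\beta,\alpha$ both ordinary or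 both special with $G_{\mathbf y}(\beta)=G_{\mathbf x}(\alpha)$; $H_{1,\times}$: $(\nu,\mu)_\times:(t\nu,s\mu)\to(s\nu,t\mu)$ for $\nu,\mu$ ordinary with $G_{\mathbf y}(\nu)=G_{\mathbf x}(\mu)\in Q_1^{sp}$; $H_{1,o}$: $(\nu,\eta)_\ominus:(t\nu,s\eta)\to(s\nu,t\eta)$ for $\nu$ ordinary in $H(\mathbf y)$, $\eta$ special in $H(\mathbf x)$, $G_{\mathbf y}(\nu)=G_{\mathbf x}(\eta)$, and $(\eta,\mu)_\oplus:(s\eta,s\mu)\to(t\eta,t\mu)$ for $\eta$ special in $H(\mathbf y)$, $\mu$ ordinary in $H(\mathbf x)$, $G_{\mathbf y}(\eta)=G_{\mathbf x}(\mu)$. A vertex $(j,i)$ is red if for some $\rho\in\{-1,1\}$ the first letter of $\overline{\overline{\mathbf y}}(j,\rho)$ is strictly larger than that of $\overline{\overline{\mathbf x}}(i,\rho)$; orange if it is the target of an arrow in $H_{1,\times}$; purple if it is the target of an arrow in $H_{1,o}$. A real h-line is a connected component, without red, orange or purple vertices, of the subquiver with all vertices and the arrows $H_{1,+}$. A long h-line is a connected component of $H_{\underline Q}(\mathbf x,\mathbf y)$ without red vertices. $L_0$ denotes the set of vertices of $L$. The underlying graphs of these components are of type $\mathsf A_n$ (path), $\mathsf D'_n$ (path with a loop at one end), $\widetilde{\mathsf A}_n$ (cycle) or $\widetilde{\mathsf D}'_n$ (path with a loop at each end); the latter two occur only if $\mathbf x,\mathbf y$ are both of type $(b)$ resp.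 both of type $(p,p)$ and $\mathbf y$ is $\mathbf x$ or $\mathbf x^{-1}$ up to rotation of bands. **The algebra and the modules.** $\Bbbk\underline Q$ is the path algebra of $Q$ modulo the relations $\alpha\beta$ ($\alpha$ after $\beta$) for $\alpha,\beta\in Q_1^{ord}$ with $\underline s(\alpha)=\underline t(\beta)$, and $\varepsilon_i^2-e_i$ for $i\in Q_0^{sp}$. The algebra $A_{\mathbf x}$ is $\Bbbk$ for type $(u,u)$; $\Bbbk[T]/(T^2-1)$ for types $(u,p)$ and $(p,u)$; $\Bbbk\langle S,T\rangle/(S^2-1,T^2-1)$ for type $(p,p)$; $\Bbbk[T,T^{-1}]$ for type $(b)$. $H^o(\mathbf x)$ is obtained from $H(\mathbf x)$ by adding for each non-loop arrow $\nu$ with $G_{\mathbf x}(\nu)\in Q_1^{sp}$ an arrow $\nu'$ in the opposite direction with the same image. Each arrow $\nu$ of $H^o(\mathbf x)$ gets a unit $U_{\mathbf x}(\nu)\in A_{\mathbf x}$, equal to $1$ except: $U_{\mathbf x}(\eta_1)=T$ for type $(u,p)$; $U_{\mathbf x}(\eta_0)=T$ for type $(p,u)$; $U_{\mathbf x}(\eta_0)=S$, $U_{\mathbf x}(\eta_1)=T$ for type $(p,p)$; $U_{\mathbf x}(\nu_0)=T$ (resp. $T^{-1}$) for type $(b)$ with $x_0$ direct (resp. inverse). For an $A_{\mathbf x}$-module $X$, $M^o_{\mathbf x}(X)$ is the representation of $\Bbbk\underline Q$ with space $\bigoplus_{l\in G_{\mathbf x}^{-1}(a)}X$ at the vertex $a$,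 on which an arrow $\alpha\in Q_1$ acts by the sum over all arrows $\nu:l\to l'$ of $H^o(\mathbf x)$ with image $\alpha$ of the maps from the $l$-th copy of $X$ to the $l'$-th copy of $X$ given by the action of $U_{\mathbf x}(\nu)$. A homomorphism $f:M^o_{\mathbf x}(X)\to M^o_{\mathbf y}(Y)$ is thus a block matrix $(f_{j,i})$ indexed by the vertices $(j,i)$ of $H_{\underline Q}(\mathbf x,\mathbf y)$, with $f_{j,i}\in\mathrm{Hom}_{\Bbbk}(X,Y)$ the component from the $i$-th copy of $X$ to the $j$-th copy of $Y$. For a long h-line $L$, $\mathrm{Hom}_{\Bbbk\underline Q}(M^o_{\mathbf x}(X),M^o_{\mathbf y}(Y))_L$ is the space of homomorphisms $f$ with $f_{j,i}=0$ for all $(j,i)\notin L_0$. **The algebras $A_L$.** For a (long or real) h-line $L$, the algebra $A_L$ is $\Bbbk$ if $L$ is of type $\mathsf A$; $\Bbbk[T]/(T^2-1)$ if $L$ is of type $\mathsf D'$; $\Bbbk[T,T^{-1}]$ if $L$ is of type $\widetilde{\mathsf A}$; and $\Bbbk\langle S,T\rangle/(S^2-1,T^2-1)$ if $L$ is of type $\widetilde{\mathsf D}'$. $X$ and $Y$ become $A_L$-modules by restriction along injective algebra homomorphisms $f_{\mathbf x}:A_L\to A_{\mathbf x}$ and $f_{\mathbf y}:A_L\to A_{\mathbf y}$: for type $\mathsf A$ these are the structure homomorphisms of the $\Bbbk$-algebras; for type $\mathsf D'$ with loop $(\eta_2,\eta_1)$, where $\eta_2$ is a loop of $H(\mathbf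 y)$ and $\eta_1$ a loop of $H(\mathbf x)$, one sets $f_{\mathbf x}(T)=U_{\mathbf x}(\eta_1)$ and $f_{\mathbf y}(T)=U_{\mathbf y}(\eta_2)$; for types $\widetilde{\mathsf A}$ and $\widetilde{\mathsf D}'$ one has $A_L=A_{\mathbf x}=A_{\mathbf y}$ and both homomorphisms are the identity.
   Formalization: Corrected: U(ν_0') is the inverse of U(ν_0); if y is x^{-1} up to rotation, A_x and A_y are identified by S↔T (resp. T↔T^{-1}); on D' lines, at vertices cut off from the loop by H_{1,o} arrows, f↦f_{j,i} is an isomorphism only after composing with units of A_x, A_y. *)

theory Defs
  imports Complex_Main "HOL-Algebra.QuotRing" "HOL-Library.Function_Algebras"
begin

section \<open>Polarized quivers\<close>

datatype polarity = Neg | Pos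

fun opp :: "'v \<times> polarity \<Rightarrow> 'v \<times> polarity" where
  "opp (i, Neg) = (i, Pos)"
| "opp (i, Pos) = (i, Neg)"

text \<open>The fields \<open>src\<close> and \<open>tgt\<close> are the maps written with an underlined \<open>s\<close> and \<open>t\<close>, so
  \<^prop>\<open>src Q \<alpha> = (i, \<rho>)\<close> says that \<open>\<alpha>\<close> starts at the vertex \<open>i\<close> with polarity \<open>\<rho>\<close>.\<close>

record ('v, 'a) pquiver =
  verts :: "'v set"
  sp_arrows :: "'a set"
  ord_arrows :: "'a set"
  src :: "'a \<Rightarrow> 'v \<times> polarity"
  tgt :: "'a \<Rightarrow> 'v \<times> polarity"

definition arrows :: "('v, 'a) pquiver \<Rightarrow> 'a set" where
  "arrows Q = sp_arrows Q \<union> ord_arrows Q"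

definition admissible_path :: "('v, 'a) pquiver \<Rightarrow> 'a list \<Rightarrow> bool" where
  "admissible_path Q p \<longleftrightarrow> p \<noteq> [] \<and> set p \<subseteq> arrows Q \<and>
     (\<forall>k. Suc k < length p \<longrightarrow> src Q (p ! k) = opp (tgt Q (p ! Suc k)))"

definition skewed_gentle :: "('v, 'a) pquiver \<Rightarrow> bool" where
  "skewed_gentle Q \<longleftrightarrow>
     finite (verts Q) \<and> finite (arrows Q) \<and> sp_arrows Q \<inter> ord_arrows Q = {} \<and>
     src Q ` arrows Q \<subseteq> verts Q \<times> UNIV \<and> tgt Q ` arrows Q \<subseteq> verts Q \<times> UNIV \<and>
     inj_on (src Q) (arrows Q) \<and> inj_on (tgt Q) (arrows Q) \<and>
     (\<forall>\<epsilon>\<in>sp_arrows Q. src Q \<epsilon> = tgt Q \<epsilon> \<and> snd (src Q \<epsilon>) = Neg) \<and>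
     finite {p. admissible_path Q p}"

definition sp_verts :: "('v, 'a) pquiver \<Rightarrow> 'v set" where
  "sp_verts Q = (\<lambda>\<epsilon>. fst (src Q \<epsilon>)) ` sp_arrows Q"

definition sp_loop :: "('v, 'a) pquiver \<Rightarrow> 'v \<Rightarrow> 'a" where
  "sp_loop Q i = (THE \<epsilon>. \<epsilon> \<in> sp_arrows Q \<and> fst (src Q \<epsilon>) = i)"

definition hatQ :: "('v, 'a) pquiver \<Rightarrow> ('v, 'a) pquiver" where
  "hatQ Q = Q\<lparr>sp_arrows := {}, ord_arrows := arrows Q\<rparr>"

section \<open>Letters and words\<close>

datatype ('v, 'a) letter =
    Dir 'a | Inv 'a | Special 'v | Triv 'v polarity | TrivInv 'v polarity

definition letters :: "('v, 'a) pquiver \<Rightarrow> ('v, 'a) letter set" where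
  "letters Q = Dir ` ord_arrows Q \<union> Inv ` ord_arrows Q \<union> Special ` sp_verts Q \<union>
     {l. \<exists>i \<rho>. i \<in> verts Q \<and> \<not> (i \<in> sp_verts Q \<and> \<rho> = Neg) \<and> (l = Triv i \<rho> \<or> l = TrivInv i \<rho>)}"

fun linv :: "('v, 'a) letter \<Rightarrow> ('v, 'a) letter" where
  "linv (Dir \<alpha>) = Inv \<alpha>"
| "linv (Inv \<alpha>) = Dir \<alpha>"
| "linv (Special i) = Special i"
| "linv (Triv i \<rho>) = TrivInv i \<rho>"
| "linv (TrivInv i \<rho>) = Triv i \<rho>"

text \<open>\<^const>\<open>None\<close> is the value \<open>*\<close> of the source (target) of a (an inverse) trivial letter.\<close>

fun lsrc :: "('v, 'a) pquiver \<Rightarrow> ('v, 'a) letter \<Rightarrow> ('v \<times> polarity) option" where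
  "lsrc Q (Dir \<alpha>) = Some (src Q \<alpha>)"
| "lsrc Q (Inv \<alpha>) = Some (tgt Q \<alpha>)"
| "lsrc Q (Special i) = Some (i, Neg)"
| "lsrc Q (Triv i \<rho>) = None"
| "lsrc Q (TrivInv i \<rho>) = Some (i, \<rho>)"

fun ltgt :: "('v, 'a) pquiver \<Rightarrow> ('v, 'a) letter \<Rightarrow> ('v \<times> polarity) option" where
  "ltgt Q (Dir \<alpha>) = Some (tgt Q \<alpha>)"
| "ltgt Q (Inv \<alpha>) = Some (src Q \<alpha>)"
| "ltgt Q (Special i) = Some (i, Neg)"
| "ltgt Q (Triv i \<rho>) = Some (i, \<rho>)"
| "ltgt Q (TrivInv i \<rho>) = None"

fun is_direct :: "('v, 'a) letter \<Rightarrow> bool" where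
  "is_direct (Dir \<alpha>) = True"
| "is_direct _ = False"

fun is_special :: "('v, 'a) letter \<Rightarrow> bool" where
  "is_special (Special i) = True"
| "is_special _ = False"

text \<open>The order \<open>\<alpha> < 1 < \<beta>\<^sup>-\<^sup>1\<close> on the letters with a given target in
  \<open>verts Q \<times> {Neg, Pos}\<close>. A special letter is the only letter of \<open>Q\<close> with its target.\<close>

definition letter_less ::
    "('v, 'a) pquiver \<Rightarrow> ('v, 'a) letter \<Rightarrow> ('v, 'a) letter \<Rightarrow> bool" where
  "letter_less Q a b \<longleftrightarrow> a \<in> letters Q \<and> b \<in> letters Q \<and> ltgt Q a \<noteq> None \<and> ltgt Q a = ltgt Q b \<and>
     ((\<exists>\<alpha> \<beta>. a = Dir \<alpha> \<and> b = Inv \<beta>) \<or> (\<exists>\<alpha> i \<rho>. a = Dir \<alpha> \<and> b = Triv i \<rho>) \<or>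
      (\<exists>\<beta> i \<rho>. a = Triv i \<rho> \<and> b = Inv \<beta>))"

definition is_word :: "('v, 'a) pquiver \<Rightarrow> ('v, 'a) letter list \<Rightarrow> bool" where
  "is_word Q w \<longleftrightarrow> w \<noteq> [] \<and> set w \<subseteq> letters Q \<and>
     (\<forall>k. Suc k < length w \<longrightarrow>
        (\<exists>p. ltgt Q (w ! Suc k) = Some p \<and> lsrc Q (w ! k) = Some (opp p)))"

definition winv :: "('v, 'a) letter list \<Rightarrow> ('v, 'a) letter list" where
  "winv w = rev (map linv w)"

definition word_less ::
    "('v, 'a) pquiver \<Rightarrow> ('v, 'a) letter list \<Rightarrow> ('v, 'a) letter list \<Rightarrow> bool" where
  "word_less Q u v \<longleftrightarrow> (\<exists>k. k < length u \<and> k < length v \<and> take k u = take k v \<and>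
     letter_less Q (u ! k) (v ! k))"

definition is_string :: "('v, 'a) pquiver \<Rightarrow> ('v, 'a) letter list \<Rightarrow> bool" where
  "is_string Q w \<longleftrightarrow> is_word Q w \<and> (\<exists>i \<rho>. hd w = TrivInv i \<rho>) \<and> (\<exists>i \<rho>. last w = Triv i \<rho>)"

definition is_band :: "('v, 'a) pquiver \<Rightarrow> ('v, 'a) letter list \<Rightarrow> bool" where
  "is_band Q w \<longleftrightarrow> w \<noteq> [] \<and> is_word Q w \<and> is_word Q (w @ w)"

definition primitive :: "('v, 'a) letter list \<Rightarrow> bool" where
  "primitive w \<longleftrightarrow> \<not> (\<exists>v m. m \<ge> 2 \<and> w = concat (replicate m v))"

definition rotation_of :: "'b list \<Rightarrow> 'b list \<Rightarrow> bool" where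
  "rotation_of v w \<longleftrightarrow> (\<exists>k<length w. v = drop (Suc k) w @ take (Suc k) w)"

definition symmetric_band :: "('v, 'a) letter list \<Rightarrow> bool" where
  "symmetric_band w \<longleftrightarrow> rotation_of (winv w) w"

section \<open>Admissible words\<close>

text \<open>The words in this section are words of \<^term>\<open>hatQ Q\<close>; \<open>F\<close> is the map from its letters to those
  of \<open>Q\<close>.\<close>

definition punctured :: "('v, 'a) pquiver \<Rightarrow> ('v, 'a) letter \<Rightarrow> bool" where
  "punctured Q l \<longleftrightarrow> (\<exists>i\<in>sp_verts Q. l = Triv i Neg \<or> l = TrivInv i Neg)"

fun F :: "('v, 'a) pquiver \<Rightarrow> ('v, 'a) letter \<Rightarrow> ('v, 'a) letter" where
  "F Q (Dir \<alpha>) = (if \<alpha> \<in> sp_arrows Q then Special (fst (src Q \<alpha>)) else Dir \<alpha>)"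
| "F Q (Inv \<alpha>) = (if \<alpha> \<in> sp_arrows Q then Special (fst (src Q \<alpha>)) else Inv \<alpha>)"
| "F Q (Triv i \<rho>) = (if i \<in> sp_verts Q \<and> \<rho> = Neg then Special i else Triv i \<rho>)"
| "F Q (TrivInv i \<rho>) = (if i \<in> sp_verts Q \<and> \<rho> = Neg then Special i else TrivInv i \<rho>)"
| "F Q (Special i) = Special i"

datatype wtype = UU | UP | PU | PP | Band

definition wtype_of :: "('v, 'a) pquiver \<Rightarrow> ('v, 'a) letter list \<Rightarrow> wtype" where
  "wtype_of Q x =
     (if is_string (hatQ Q) x
      then if punctured Q (hd x) then if punctured Q (last x) then PP else PU
           else if punctured Q (last x) then UP else UU
      else Band)"

definition completion :: "('v, 'a) pquiver \<Rightarrow> ('v, 'a) letter list \<Rightarrow> ('v, 'a) letter list" where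
  "completion Q x = map (F Q)
     (case wtype_of Q x of
        UU \<Rightarrow> x
      | Band \<Rightarrow> x
      | UP \<Rightarrow> x @ winv (butlast x)
      | PU \<Rightarrow> winv (tl x) @ x
      | PP \<Rightarrow> x @ winv (tl (butlast x)))"

definition admissible_string :: "('v, 'a) pquiver \<Rightarrow> ('v, 'a) letter list \<Rightarrow> bool" where
  "admissible_string Q x \<longleftrightarrow> is_string (hatQ Q) x \<and>
     (\<forall>k. 0 < k \<and> k < length x - 1 \<and> is_special (F Q (x ! k)) \<longrightarrow>
        winv (take k x) \<noteq> drop (Suc k) x \<and>
        (is_direct (x ! k) \<longleftrightarrow> word_less (hatQ Q) (drop (Suc k) x) (winv (take k x)))) \<and>
     (wtype_of Q x = PP \<longrightarrow> is_band Q (completion Q x) \<and> primitive (completion Q x))"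

definition admissible_band :: "('v, 'a) pquiver \<Rightarrow> ('v, 'a) letter list \<Rightarrow> bool" where
  "admissible_band Q x \<longleftrightarrow> is_band (hatQ Q) x \<and>
     (\<forall>k < length x. is_special (F Q (x ! k)) \<longrightarrow>
        (let z = drop (Suc k) x @ take k x
         in winv z \<noteq> z \<and> (is_direct (x ! k) \<longleftrightarrow> word_less (hatQ Q) z (winv z)))) \<and>
     is_band Q (map (F Q) x) \<and> primitive (map (F Q) x) \<and> \<not> symmetric_band (map (F Q) x)"

definition Adm :: "('v, 'a) pquiver \<Rightarrow> ('v, 'a) letter list set" where
  "Adm Q = {x. admissible_string Q x \<or> admissible_band Q x}"

section \<open>The quivers of admissible words\<close>

text \<open>\<open>NuOp i\<close> is the arrow opposite to \<open>Nu i\<close>; it belongs to \<open>H\<^sup>o(x)\<close>, not to \<open>H(x)\<close>.\<close>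

datatype harrow = Nu nat | NuOp nat | Eta0 | Eta1

definition H_verts :: "('v, 'a) pquiver \<Rightarrow> ('v, 'a) letter list \<Rightarrow> nat set" where
  "H_verts Q x = (if wtype_of Q x = Band then {0..<length x} else {1..length x - 1})"

definition H_ord :: "('v, 'a) pquiver \<Rightarrow> ('v, 'a) letter list \<Rightarrow> harrow set" where
  "H_ord Q x = Nu ` (if wtype_of Q x = Band then {0..<length x} else {1..<length x - 1})"

definition H_sp :: "('v, 'a) pquiver \<Rightarrow> ('v, 'a) letter list \<Rightarrow> harrow set" where
  "H_sp Q x = {\<eta>. \<eta> = Eta0 \<and> wtype_of Q x \<in> {PU, PP} \<or> \<eta> = Eta1 \<and> wtype_of Q x \<in> {UP, PP}}"

definition H_next :: "('v, 'a) pquiver \<Rightarrow> ('v, 'a) letter list \<Rightarrow> nat \<Rightarrow> nat" where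
  "H_next Q x i = (if wtype_of Q x = Band then Suc i mod length x else Suc i)"

fun H_src :: "('v, 'a) pquiver \<Rightarrow> ('v, 'a) letter list \<Rightarrow> harrow \<Rightarrow> nat" where
  "H_src Q x (Nu i) = (if is_direct (x ! i) then H_next Q x i else i)"
| "H_src Q x (NuOp i) = (if is_direct (x ! i) then i else H_next Q x i)"
| "H_src Q x Eta0 = 1"
| "H_src Q x Eta1 = length x - 1"

fun H_tgt :: "('v, 'a) pquiver \<Rightarrow> ('v, 'a) letter list \<Rightarrow> harrow \<Rightarrow> nat" where
  "H_tgt Q x (Nu i) = (if is_direct (x ! i) then i else H_next Q x i)"
| "H_tgt Q x (NuOp i) = (if is_direct (x ! i) then H_next Q x i else i)"
| "H_tgt Q x Eta0 = 1"
| "H_tgt Q x Eta1 = length x - 1"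

definition G_vert :: "('v, 'a) pquiver \<Rightarrow> ('v, 'a) letter list \<Rightarrow> nat \<Rightarrow> 'v" where
  "G_vert Q x i = fst (the (ltgt (hatQ Q) (x ! i)))"

fun letter_arrow :: "('v, 'a) letter \<Rightarrow> 'a" where
  "letter_arrow (Dir \<alpha>) = \<alpha>"
| "letter_arrow (Inv \<alpha>) = \<alpha>"

fun G_arr :: "('v, 'a) pquiver \<Rightarrow> ('v, 'a) letter list \<Rightarrow> harrow \<Rightarrow> 'a" where
  "G_arr Q x (Nu i) = letter_arrow (x ! i)"
| "G_arr Q x (NuOp i) = letter_arrow (x ! i)"
| "G_arr Q x Eta0 = sp_loop Q (fst (the (lsrc (hatQ Q) (hd x))))"
| "G_arr Q x Eta1 = sp_loop Q (fst (the (ltgt (hatQ Q) (last x))))"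

definition Ho_arrows :: "('v, 'a) pquiver \<Rightarrow> ('v, 'a) letter list \<Rightarrow> harrow set" where
  "Ho_arrows Q x = H_ord Q x \<union> H_sp Q x \<union>
     {NuOp i |i. Nu i \<in> H_ord Q x \<and> G_arr Q x (Nu i) \<in> sp_arrows Q}"

section \<open>Reading words\<close>

text \<open>The completion (repeated periodically for types \<open>PP\<close> and \<open>Band\<close>) as a partial function on
  the integers, indexed so that the letter of \<open>F(x)\<close> with number \<open>k\<close> stands at \<open>k\<close>. For type \<open>PU\<close>
  the letters of \<open>F(x)\<close> are preceded by \<^term>\<open>length x - 1\<close> others.\<close>

definition dbl :: "('v, 'a) pquiver \<Rightarrow> ('v, 'a) letter list \<Rightarrow> int \<Rightarrow> ('v, 'a) letter option" where
  "dbl Q x k =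
     (let c = completion Q x; n = int (length c);
          m = (if wtype_of Q x = PU then k + int (length x - 1) else k)
      in if wtype_of Q x \<in> {PP, Band} then Some (c ! nat (k mod n))
         else if 0 \<le> m \<and> m < n then Some (c ! nat m) else None)"

definition reading ::
    "('v, 'a) pquiver \<Rightarrow> ('v, 'a) letter list \<Rightarrow> nat \<Rightarrow> polarity \<Rightarrow> nat \<Rightarrow> ('v, 'a) letter option" where
  "reading Q x i \<rho> m =
     (if snd (the (ltgt Q (the (dbl Q x (int i))))) = \<rho>
      then dbl Q x (int i + int m)
      else map_option linv (dbl Q x (int i - 1 - int m)))"

section \<open>The quiver of a pair of admissible words and its h-lines\<close>

text \<open>\<open>HOminus \<nu> \<eta>\<close> and \<open>HOplus \<eta> \<mu>\<close> are the two kinds of arrows in \<open>H\<^sub>1\<^sub>,\<^sub>o\<close>. In every pair the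
  first component belongs to \<open>y\<close> and the second one to \<open>x\<close>.\<close>

datatype qarrow =
    HPlus harrow harrow | HTimes harrow harrow | HOminus harrow harrow | HOplus harrow harrow

definition HQ_verts ::
    "('v, 'a) pquiver \<Rightarrow> ('v, 'a) letter list \<Rightarrow> ('v, 'a) letter list \<Rightarrow> (nat \<times> nat) set" where
  "HQ_verts Q x y = {(j, i). j \<in> H_verts Q y \<and> i \<in> H_verts Q x \<and> G_vert Q y j = G_vert Q x i}"

definition HQ_plus ::
    "('v, 'a) pquiver \<Rightarrow> ('v, 'a) letter list \<Rightarrow> ('v, 'a) letter list \<Rightarrow> qarrow set" where
  "HQ_plus Q x y = {HPlus \<beta> \<alpha> |\<beta> \<alpha>.
     (\<beta> \<in> H_ord Q y \<and> \<alpha> \<in> H_ord Q x \<or> \<beta> \<in> H_sp Q y \<and> \<alpha> \<in> H_sp Q x) \<and> G_arr Q y \<beta> = G_arr Q x \<alpha>}"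

definition HQ_times ::
    "('v, 'a) pquiver \<Rightarrow> ('v, 'a) letter list \<Rightarrow> ('v, 'a) letter list \<Rightarrow> qarrow set" where
  "HQ_times Q x y = {HTimes \<nu> \<mu> |\<nu> \<mu>. \<nu> \<in> H_ord Q y \<and> \<mu> \<in> H_ord Q x \<and>
     G_arr Q y \<nu> = G_arr Q x \<mu> \<and> G_arr Q x \<mu> \<in> sp_arrows Q}"

definition HQ_o ::
    "('v, 'a) pquiver \<Rightarrow> ('v, 'a) letter list \<Rightarrow> ('v, 'a) letter list \<Rightarrow> qarrow set" where
  "HQ_o Q x y =
     {HOminus \<nu> \<eta> |\<nu> \<eta>. \<nu> \<in> H_ord Q y \<and> \<eta> \<in> H_sp Q x \<and> G_arr Q y \<nu> = G_arr Q x \<eta>} \<union>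
     {HOplus \<eta> \<mu> |\<eta> \<mu>. \<eta> \<in> H_sp Q y \<and> \<mu> \<in> H_ord Q x \<and> G_arr Q y \<eta> = G_arr Q x \<mu>}"

definition HQ_arrows ::
    "('v, 'a) pquiver \<Rightarrow> ('v, 'a) letter list \<Rightarrow> ('v, 'a) letter list \<Rightarrow> qarrow set" where
  "HQ_arrows Q x y = HQ_plus Q x y \<union> HQ_times Q x y \<union> HQ_o Q x y"

fun HQ_src :: "('v, 'a) pquiver \<Rightarrow> ('v, 'a) letter list \<Rightarrow> ('v, 'a) letter list \<Rightarrow> qarrow \<Rightarrow> nat \<times> nat" where
  "HQ_src Q x y (HPlus \<beta> \<alpha>) = (H_src Q y \<beta>, H_src Q x \<alpha>)"
| "HQ_src Q x y (HTimes \<nu> \<mu>) = (H_tgt Q y \<nu>, H_src Q x \<mu>)"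
| "HQ_src Q x y (HOminus \<nu> \<eta>) = (H_tgt Q y \<nu>, H_src Q x \<eta>)"
| "HQ_src Q x y (HOplus \<eta> \<mu>) = (H_src Q y \<eta>, H_src Q x \<mu>)"

fun HQ_tgt :: "('v, 'a) pquiver \<Rightarrow> ('v, 'a) letter list \<Rightarrow> ('v, 'a) letter list \<Rightarrow> qarrow \<Rightarrow> nat \<times> nat" where
  "HQ_tgt Q x y (HPlus \<beta> \<alpha>) = (H_tgt Q y \<beta>, H_tgt Q x \<alpha>)"
| "HQ_tgt Q x y (HTimes \<nu> \<mu>) = (H_src Q y \<nu>, H_tgt Q x \<mu>)"
| "HQ_tgt Q x y (HOminus \<nu> \<eta>) = (H_src Q y \<nu>, H_tgt Q x \<eta>)"
| "HQ_tgt Q x y (HOplus \<eta> \<mu>) = (H_tgt Q y \<eta>, H_tgt Q x \<mu>)"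

definition red ::
    "('v, 'a) pquiver \<Rightarrow> ('v, 'a) letter list \<Rightarrow> ('v, 'a) letter list \<Rightarrow> (nat \<times> nat) set" where
  "red Q x y = {(j, i). (j, i) \<in> HQ_verts Q x y \<and> (\<exists>\<rho> a b.
     reading Q x i \<rho> 0 = Some a \<and> reading Q y j \<rho> 0 = Some b \<and> letter_less Q a b)}"

definition orange ::
    "('v, 'a) pquiver \<Rightarrow> ('v, 'a) letter list \<Rightarrow> ('v, 'a) letter list \<Rightarrow> (nat \<times> nat) set" where
  "orange Q x y = HQ_tgt Q x y ` HQ_times Q x y"

definition purple ::
    "('v, 'a) pquiver \<Rightarrow> ('v, 'a) letter list \<Rightarrow> ('v, 'a) letter list \<Rightarrow> (nat \<times> nat) set" where
  "purple Q x y = HQ_tgt Q x y ` HQ_o Q x y"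

definition connected :: "('e \<Rightarrow> 'w) \<Rightarrow> ('e \<Rightarrow> 'w) \<Rightarrow> 'e set \<Rightarrow> ('w \<times> 'w) set" where
  "connected s t E = {(u, v). \<exists>e\<in>E. {s e, t e} = {u, v}}\<^sup>*"

text \<open>A connected component of a quiver is the pair of its sets of vertices and of arrows.\<close>

definition components ::
    "('e \<Rightarrow> 'w) \<Rightarrow> ('e \<Rightarrow> 'w) \<Rightarrow> 'w set \<Rightarrow> 'e set \<Rightarrow> ('w set \<times> 'e set) set" where
  "components s t V E =
     {(C, {e\<in>E. s e \<in> C}) |C. \<exists>u\<in>V. C = {v. (u, v) \<in> connected s t E}}"

type_synonym hline = "(nat \<times> nat) set \<times> qarrow set"

definition real_hlines ::
    "('v, 'a) pquiver \<Rightarrow> ('v, 'a) letter list \<Rightarrow> ('v, 'a) letter list \<Rightarrow> hline set" where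
  "real_hlines Q x y =
     {L \<in> components (HQ_src Q x y) (HQ_tgt Q x y) (HQ_verts Q x y) (HQ_plus Q x y).
        fst L \<inter> (red Q x y \<union> orange Q x y \<union> purple Q x y) = {}}"

definition long_hlines ::
    "('v, 'a) pquiver \<Rightarrow> ('v, 'a) letter list \<Rightarrow> ('v, 'a) letter list \<Rightarrow> hline set" where
  "long_hlines Q x y =
     {L \<in> components (HQ_src Q x y) (HQ_tgt Q x y) (HQ_verts Q x y) (HQ_arrows Q x y).
        fst L \<inter> red Q x y = {}}"

datatype ltype = LA | LD' | LA_tilde | LD'_tilde

definition is_path ::
    "('e \<Rightarrow> 'w) \<Rightarrow> ('e \<Rightarrow> 'w) \<Rightarrow> 'w set \<Rightarrow> 'e set \<Rightarrow> 'w list \<Rightarrow> bool" where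
  "is_path s t C E vs \<longleftrightarrow> vs \<noteq> [] \<and> distinct vs \<and> set vs = C \<and>
     (\<exists>es. distinct es \<and> set es = E \<and> length vs = Suc (length es) \<and>
       (\<forall>k < length es. {s (es ! k), t (es ! k)} = {vs ! k, vs ! Suc k}))"

definition is_cycle ::
    "('e \<Rightarrow> 'w) \<Rightarrow> ('e \<Rightarrow> 'w) \<Rightarrow> 'w set \<Rightarrow> 'e set \<Rightarrow> 'w list \<Rightarrow> bool" where
  "is_cycle s t C E vs \<longleftrightarrow> length vs \<ge> 2 \<and> distinct vs \<and> set vs = C \<and>
     (\<exists>es. distinct es \<and> set es = E \<and> length vs = length es \<and>
       (\<forall>k < length es. {s (es ! k), t (es ! k)} = {vs ! k, vs ! (Suc k mod length vs)}))"

fun has_ltype :: "('e \<Rightarrow> 'w) \<Rightarrow> ('e \<Rightarrow> 'w) \<Rightarrow> 'w set \<times> 'e set \<Rightarrow> ltype \<Rightarrow> bool" where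
  "has_ltype s t (C, E) LA = (\<exists>vs. is_path s t C E vs)"
| "has_ltype s t (C, E) LD' = (\<exists>vs. \<exists>l\<in>E. is_path s t C (E - {l}) vs \<and> s l = hd vs \<and> t l = hd vs)"
| "has_ltype s t (C, E) LA_tilde = (\<exists>vs. is_cycle s t C E vs)"
| "has_ltype s t (C, E) LD'_tilde =
     (\<exists>vs. \<exists>l\<in>E. \<exists>m\<in>E. l \<noteq> m \<and> is_path s t C (E - {l, m}) vs \<and>
        s l = hd vs \<and> t l = hd vs \<and> s m = last vs \<and> t m = last vs)"

definition ltype_of ::
    "('v, 'a) pquiver \<Rightarrow> ('v, 'a) letter list \<Rightarrow> ('v, 'a) letter list \<Rightarrow> hline \<Rightarrow> ltype" where
  "ltype_of Q x y L = (THE K. has_ltype (HQ_src Q x y) (HQ_tgt Q x y) L K)"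

section \<open>Algebras given by generators and relations\<close>

text \<open>The free associative algebra on the set \<open>G\<close>: finitely supported functions on the words in
  \<open>G\<close>, with the convolution product.\<close>

definition free_algebra :: "'g set \<Rightarrow> ('g list \<Rightarrow> 'k::field) ring" where
  "free_algebra G =
     \<lparr>carrier = {p. finite {w. p w \<noteq> 0} \<and> {w. p w \<noteq> 0} \<subseteq> lists G},
      mult = (\<lambda>p q w. \<Sum>n\<le>length w. p (take n w) * q (drop n w)),
      one = (\<lambda>w. if w = [] then 1 else 0),
      zero = (\<lambda>w. 0),
      add = (\<lambda>p q w. p w + q w)\<rparr>"

definition monomial :: "'g list \<Rightarrow> 'g list \<Rightarrow> 'k::field" where
  "monomial u = (\<lambda>w. if w = u then 1 else 0)"

datatype gen = gS | gT | gTinv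

datatype akind = K_triv | K_T | K_ST | K_Laurent

fun gens :: "akind \<Rightarrow> gen set" where
  "gens K_triv = {}"
| "gens K_T = {gT}"
| "gens K_ST = {gS, gT}"
| "gens K_Laurent = {gT, gTinv}"

fun rels :: "akind \<Rightarrow> (gen list \<Rightarrow> 'k::field) set" where
  "rels K_triv = {}"
| "rels K_T = {monomial [gT, gT] - monomial []}"
| "rels K_ST = {monomial [gS, gS] - monomial [], monomial [gT, gT] - monomial []}"
| "rels K_Laurent = {monomial [gT, gTinv] - monomial [], monomial [gTinv, gT] - monomial []}"

text \<open>The algebras \<open>k\<close>, \<open>k[T]/(T\<^sup>2-1)\<close>, \<open>k\<langle>S,T\<rangle>/(S\<^sup>2-1,T\<^sup>2-1)\<close> and \<open>k[T,T\<^sup>-\<^sup>1]\<close>.\<close>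

type_synonym 'k alg_elt = "(gen list \<Rightarrow> 'k) set"

definition kideal :: "akind \<Rightarrow> (gen list \<Rightarrow> 'k::field) set" where
  "kideal K = genideal (free_algebra (gens K)) (rels K)"

definition kalg :: "akind \<Rightarrow> 'k::field alg_elt ring" where
  "kalg K = free_algebra (gens K) Quot kideal K"

definition kclass :: "akind \<Rightarrow> (gen list \<Rightarrow> 'k::field) \<Rightarrow> 'k alg_elt" where
  "kclass K p = kideal K +>\<^bsub>free_algebra (gens K)\<^esub> p"

definition kgen :: "akind \<Rightarrow> gen \<Rightarrow> 'k::field alg_elt" where
  "kgen K g = kclass K (monomial [g])"

definition kscalar :: "akind \<Rightarrow> 'k::field \<Rightarrow> 'k alg_elt" where
  "kscalar K c = kclass K (\<lambda>w. c * monomial [] w)"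

definition kalg_hom :: "akind \<Rightarrow> akind \<Rightarrow> ('k::field alg_elt \<Rightarrow> 'k alg_elt) \<Rightarrow> bool" where
  "kalg_hom K K' h \<longleftrightarrow> h \<in> ring_hom (kalg K) (kalg K') \<and> (\<forall>c. h (kscalar K c) = kscalar K' c)"

text \<open>The algebra homomorphism with prescribed values on the generators.\<close>

definition kalg_map :: "akind \<Rightarrow> akind \<Rightarrow> (gen \<Rightarrow> 'k::field alg_elt) \<Rightarrow> 'k alg_elt \<Rightarrow> 'k alg_elt" where
  "kalg_map K K' \<phi> = (THE h. kalg_hom K K' h \<and> (\<forall>g\<in>gens K. h (kgen K g) = \<phi> g) \<and>
     h \<in> extensional (carrier (kalg K)))"

text \<open>An \<open>A\<close>-module is a vector space \<open>X\<close> with a homomorphism of \<open>k\<close>-algebras \<open>A \<rightarrow> End\<^sub>k(X)\<close>.\<close>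

definition kalg_module ::
    "akind \<Rightarrow> ('k::field \<Rightarrow> 'x::ab_group_add \<Rightarrow> 'x) \<Rightarrow> ('k alg_elt \<Rightarrow> 'x \<Rightarrow> 'x) \<Rightarrow> bool" where
  "kalg_module K sX \<rho> \<longleftrightarrow> vector_space sX \<and>
     (\<forall>a\<in>carrier (kalg K). Vector_Spaces.linear sX sX (\<rho> a)) \<and>
     (\<forall>a\<in>carrier (kalg K). \<forall>b\<in>carrier (kalg K). \<forall>v.
        \<rho> (a \<oplus>\<^bsub>kalg K\<^esub> b) v = \<rho> a v + \<rho> b v \<and> \<rho> (a \<otimes>\<^bsub>kalg K\<^esub> b) v = \<rho> a (\<rho> b v)) \<and>
     (\<forall>c v. \<rho> (kscalar K c) v = sX c v)"

section \<open>Vector spaces of functions\<close>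

text \<open>Spaces of functions carry the pointwise operations. Functions on a subset are
  continued by \<open>0\<close>.\<close>

definition fscale :: "('k \<Rightarrow> 'y \<Rightarrow> 'y) \<Rightarrow> 'k \<Rightarrow> ('z \<Rightarrow> 'y) \<Rightarrow> 'z \<Rightarrow> 'y" where
  "fscale s c h = (\<lambda>z. s c (h z))"

definition linear_on ::
    "('k \<Rightarrow> 'x \<Rightarrow> 'x) \<Rightarrow> ('k \<Rightarrow> 'y \<Rightarrow> 'y) \<Rightarrow> 'x::ab_group_add set \<Rightarrow> ('x \<Rightarrow> 'y::ab_group_add) \<Rightarrow> bool" where
  "linear_on s1 s2 V h \<longleftrightarrow>
     (\<forall>u\<in>V. \<forall>v\<in>V. h (u + v) = h u + h v) \<and> (\<forall>c. \<forall>u\<in>V. h (s1 c u) = s2 c (h u))"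

definition linear_iso ::
    "('k::field \<Rightarrow> 'x \<Rightarrow> 'x) \<Rightarrow> ('k \<Rightarrow> 'y \<Rightarrow> 'y) \<Rightarrow> ('x::ab_group_add \<Rightarrow> 'y::ab_group_add) \<Rightarrow>
       'x set \<Rightarrow> 'y set \<Rightarrow> bool" where
  "linear_iso s1 s2 h V W \<longleftrightarrow> module.subspace s1 V \<and> module.subspace s2 W \<and>
     linear_on s1 s2 V h \<and> bij_betw h V W"

definition direct_sum :: "'i set \<Rightarrow> ('i \<Rightarrow> 'x::ab_group_add set) \<Rightarrow> ('i \<Rightarrow> 'x) set" where
  "direct_sum I W = {h. (\<forall>i\<in>I. h i \<in> W i) \<and> (\<forall>i. i \<notin> I \<longrightarrow> h i = 0) \<and> finite {i. h i \<noteq> 0}}"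

text \<open>\<open>V\<close> is the internal direct sum of its subspaces \<open>W i\<close>.\<close>

definition internal_direct_sum ::
    "('k::field \<Rightarrow> 'x \<Rightarrow> 'x) \<Rightarrow> 'x::ab_group_add set \<Rightarrow> 'i set \<Rightarrow> ('i \<Rightarrow> 'x set) \<Rightarrow> bool" where
  "internal_direct_sum s V I W \<longleftrightarrow>
     module.subspace s V \<and> (\<forall>i\<in>I. module.subspace s (W i) \<and> W i \<subseteq> V) \<and>
     bij_betw (\<lambda>h. \<Sum>i | h i \<noteq> 0. h i) (direct_sum I W) V"

section \<open>Representations\<close>

record ('v, 'a, 'm) quiver_rep =
  space :: "'v \<Rightarrow> 'm set"
  act :: "'a \<Rightarrow> 'm \<Rightarrow> 'm"

definition kQ_rep ::
    "('v, 'a) pquiver \<Rightarrow> ('k::field \<Rightarrow> 'm \<Rightarrow> 'm) \<Rightarrow> ('v, 'a, 'm::ab_group_add) quiver_rep \<Rightarrow> bool" where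
  "kQ_rep Q sM M \<longleftrightarrow>
     (\<forall>a\<in>verts Q. module.subspace sM (space M a)) \<and>
     (\<forall>\<alpha>\<in>arrows Q. act M \<alpha> ` space M (fst (src Q \<alpha>)) \<subseteq> space M (fst (tgt Q \<alpha>)) \<and>
        linear_on sM sM (space M (fst (src Q \<alpha>))) (act M \<alpha>)) \<and>
     (\<forall>\<alpha>\<in>ord_arrows Q. \<forall>\<beta>\<in>ord_arrows Q. src Q \<alpha> = tgt Q \<beta> \<longrightarrow>
        (\<forall>m\<in>space M (fst (src Q \<beta>)). act M \<alpha> (act M \<beta> m) = 0)) \<and>
     (\<forall>\<epsilon>\<in>sp_arrows Q. \<forall>m\<in>space M (fst (src Q \<epsilon>)). act M \<epsilon> (act M \<epsilon> m) = m)"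

definition kQ_Hom ::
    "('v, 'a) pquiver \<Rightarrow> ('k::field \<Rightarrow> 'm \<Rightarrow> 'm) \<Rightarrow> ('k \<Rightarrow> 'n \<Rightarrow> 'n) \<Rightarrow>
       ('v, 'a, 'm::ab_group_add) quiver_rep \<Rightarrow> ('v, 'a, 'n::ab_group_add) quiver_rep \<Rightarrow>
       ('v \<Rightarrow> 'm \<Rightarrow> 'n) set" where
  "kQ_Hom Q sM sN M N = {f.
     (\<forall>a\<in>verts Q. f a ` space M a \<subseteq> space N a \<and> linear_on sM sN (space M a) (f a)) \<and>
     (\<forall>\<alpha>\<in>arrows Q. \<forall>m\<in>space M (fst (src Q \<alpha>)).
        f (fst (tgt Q \<alpha>)) (act M \<alpha> m) = act N \<alpha> (f (fst (src Q \<alpha>)) m)) \<and>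
     (\<forall>a m. a \<notin> verts Q \<or> m \<notin> space M a \<longrightarrow> f a m = 0)}"

section \<open>The modules of admissible words\<close>

definition akind_of :: "('v, 'a) pquiver \<Rightarrow> ('v, 'a) letter list \<Rightarrow> akind" where
  "akind_of Q x =
     (case wtype_of Q x of UU \<Rightarrow> K_triv | UP \<Rightarrow> K_T | PU \<Rightarrow> K_T | PP \<Rightarrow> K_ST | Band \<Rightarrow> K_Laurent)"

text \<open>The arrow \<open>NuOp i\<close> acts by the inverse of the unit of \<open>Nu i\<close>, as required by the relation
  \<open>\<epsilon>\<^sup>2 = e\<close> at special loops. This unit is different from \<open>1\<close> only for \<open>i = 0\<close> in a band.\<close>

fun U_val :: "('v, 'a) pquiver \<Rightarrow> ('v, 'a) letter list \<Rightarrow> harrow \<Rightarrow> 'k::field alg_elt" where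
  "U_val Q x Eta1 = kgen (akind_of Q x) gT"
| "U_val Q x Eta0 = kgen (akind_of Q x) (if wtype_of Q x = PU then gT else gS)"
| "U_val Q x (Nu i) =
     (if wtype_of Q x = Band \<and> i = 0 then kgen (akind_of Q x) (if is_direct (x ! 0) then gT else gTinv)
      else \<one>\<^bsub>kalg (akind_of Q x)\<^esub>)"
| "U_val Q x (NuOp i) =
     (if wtype_of Q x = Band \<and> i = 0 then kgen (akind_of Q x) (if is_direct (x ! 0) then gTinv else gT)
      else \<one>\<^bsub>kalg (akind_of Q x)\<^esub>)"

text \<open>The space at \<open>a\<close> consists of the families \<open>m\<close> of elements of \<open>X\<close> indexed by the vertices
  of \<open>H(x)\<close> over \<open>a\<close>.\<close>

definition Mo ::
    "('v, 'a) pquiver \<Rightarrow> ('v, 'a) letter list \<Rightarrow> ('k::field alg_elt \<Rightarrow> 'x \<Rightarrow> 'x) \<Rightarrow>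
       ('v, 'a, nat \<Rightarrow> 'x::ab_group_add) quiver_rep" where
  "Mo Q x \<rho> =
     \<lparr>space = (\<lambda>a. {m. \<forall>l. \<not> (l \<in> H_verts Q x \<and> G_vert Q x l = a) \<longrightarrow> m l = 0}),
      act = (\<lambda>\<alpha> m l'. \<Sum>\<nu> | \<nu> \<in> Ho_arrows Q x \<and> G_arr Q x \<nu> = \<alpha> \<and> H_tgt Q x \<nu> = l'.
               \<rho> (U_val Q x \<nu>) (m (H_src Q x \<nu>)))\<rparr>"

definition Mo_Hom ::
    "('v, 'a) pquiver \<Rightarrow> ('v, 'a) letter list \<Rightarrow> ('v, 'a) letter list \<Rightarrow>
       ('k::field \<Rightarrow> 'x \<Rightarrow> 'x) \<Rightarrow> ('k \<Rightarrow> 'y \<Rightarrow> 'y) \<Rightarrow>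
       ('k alg_elt \<Rightarrow> 'x::ab_group_add \<Rightarrow> 'x) \<Rightarrow> ('k alg_elt \<Rightarrow> 'y::ab_group_add \<Rightarrow> 'y) \<Rightarrow>
       ('v \<Rightarrow> (nat \<Rightarrow> 'x) \<Rightarrow> nat \<Rightarrow> 'y) set" where
  "Mo_Hom Q x y sX sY \<rho>X \<rho>Y = kQ_Hom Q (fscale sX) (fscale sY) (Mo Q x \<rho>X) (Mo Q y \<rho>Y)"

text \<open>The block \<open>f\<^sub>j\<^sub>,\<^sub>i\<close> of a homomorphism.\<close>

definition block ::
    "('v, 'a) pquiver \<Rightarrow> ('v, 'a) letter list \<Rightarrow>
       ('v \<Rightarrow> (nat \<Rightarrow> 'x::zero) \<Rightarrow> nat \<Rightarrow> 'y) \<Rightarrow> nat \<times> nat \<Rightarrow> 'x \<Rightarrow> 'y" where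
  "block Q x f = (\<lambda>(j, i) v. f (G_vert Q x i) (\<lambda>l. if l = i then v else 0) j)"

definition Mo_Hom_at ::
    "('v, 'a) pquiver \<Rightarrow> ('v, 'a) letter list \<Rightarrow> ('v, 'a) letter list \<Rightarrow>
       ('k::field \<Rightarrow> 'x \<Rightarrow> 'x) \<Rightarrow> ('k \<Rightarrow> 'y \<Rightarrow> 'y) \<Rightarrow>
       ('k alg_elt \<Rightarrow> 'x::ab_group_add \<Rightarrow> 'x) \<Rightarrow> ('k alg_elt \<Rightarrow> 'y::ab_group_add \<Rightarrow> 'y) \<Rightarrow> hline \<Rightarrow>
       ('v \<Rightarrow> (nat \<Rightarrow> 'x) \<Rightarrow> nat \<Rightarrow> 'y) set" where
  "Mo_Hom_at Q x y sX sY \<rho>X \<rho>Y L =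
     {f \<in> Mo_Hom Q x y sX sY \<rho>X \<rho>Y. \<forall>p \<in> HQ_verts Q x y - fst L. block Q x f p = 0}"

section \<open>The algebras of h-lines\<close>

fun akind_of_ltype :: "ltype \<Rightarrow> akind" where
  "akind_of_ltype LA = K_triv"
| "akind_of_ltype LD' = K_T"
| "akind_of_ltype LA_tilde = K_Laurent"
| "akind_of_ltype LD'_tilde = K_ST"

definition line_loop ::
    "('v, 'a) pquiver \<Rightarrow> ('v, 'a) letter list \<Rightarrow> ('v, 'a) letter list \<Rightarrow> hline \<Rightarrow> harrow \<times> harrow" where
  "line_loop Q x y L = (THE p. HPlus (fst p) (snd p) \<in> snd L \<and>
     HQ_src Q x y (HPlus (fst p) (snd p)) = HQ_tgt Q x y (HPlus (fst p) (snd p)))"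

definition line_alg ::
    "('v, 'a) pquiver \<Rightarrow> ('v, 'a) letter list \<Rightarrow> ('v, 'a) letter list \<Rightarrow> hline \<Rightarrow> 'k::field alg_elt ring" where
  "line_alg Q x y L = kalg (akind_of_ltype (ltype_of Q x y L))"

definition f_x ::
    "('v, 'a) pquiver \<Rightarrow> ('v, 'a) letter list \<Rightarrow> ('v, 'a) letter list \<Rightarrow> hline \<Rightarrow>
       'k::field alg_elt \<Rightarrow> 'k alg_elt" where
  "f_x Q x y L =
     (case ltype_of Q x y L of
        LA \<Rightarrow> kalg_map K_triv (akind_of Q x) (\<lambda>_. undefined)
      | LD' \<Rightarrow> kalg_map K_T (akind_of Q x) (\<lambda>_. U_val Q x (snd (line_loop Q x y L)))
      | LA_tilde \<Rightarrow> (\<lambda>a. a)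
      | LD'_tilde \<Rightarrow> (\<lambda>a. a))"

text \<open>A line of type \<open>LA_tilde\<close> or \<open>LD'_tilde\<close> exists only if \<open>y\<close> is, up to rotation of bands, \<open>x\<close>
  or the inverse of \<open>x\<close>. In the first case the algebras of the line, of \<open>x\<close> and of \<open>y\<close> are
  identified by the identity. Inverting a word reverses \<open>H(x)\<close>: it exchanges the two loops of a
  string of type \<open>PP\<close>, and it replaces the action of \<open>T\<close> around a band by that of its inverse. Thus
  in the second case the algebras of \<open>x\<close> and \<open>y\<close> are identified by the isomorphism that exchanges
  \<open>S\<close> with \<open>T\<close>, or \<open>T\<close> with its inverse.\<close>

fun dual_gen :: "akind \<Rightarrow> gen \<Rightarrow> gen" where
  "dual_gen K_ST gS = gT"
| "dual_gen K_ST gT = gS"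
| "dual_gen K_Laurent gT = gTinv"
| "dual_gen K_Laurent gTinv = gT"
| "dual_gen _ g = g"

definition same_word :: "('v, 'a) pquiver \<Rightarrow> ('v, 'a) letter list \<Rightarrow> ('v, 'a) letter list \<Rightarrow> bool" where
  "same_word Q x y \<longleftrightarrow> y = x \<or> wtype_of Q x = Band \<and> rotation_of y x"

definition identification ::
    "('v, 'a) pquiver \<Rightarrow> ('v, 'a) letter list \<Rightarrow> ('v, 'a) letter list \<Rightarrow> 'k::field alg_elt \<Rightarrow> 'k alg_elt" where
  "identification Q x y =
     (if same_word Q x y then (\<lambda>a. a)
      else kalg_map (akind_of Q x) (akind_of Q y) (\<lambda>g. kgen (akind_of Q y) (dual_gen (akind_of Q x) g)))"

definition f_y ::
    "('v, 'a) pquiver \<Rightarrow> ('v, 'a) letter list \<Rightarrow> ('v, 'a) letter list \<Rightarrow> hline \<Rightarrow>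
       'k::field alg_elt \<Rightarrow> 'k alg_elt" where
  "f_y Q x y L =
     (case ltype_of Q x y L of
        LA \<Rightarrow> kalg_map K_triv (akind_of Q y) (\<lambda>_. undefined)
      | LD' \<Rightarrow> kalg_map K_T (akind_of Q y) (\<lambda>_. U_val Q y (fst (line_loop Q x y L)))
      | LA_tilde \<Rightarrow> identification Q x y
      | LD'_tilde \<Rightarrow> identification Q x y)"

text \<open>Homomorphisms between the restrictions of \<open>X\<close> and \<open>Y\<close> to the algebra of \<open>L\<close>.\<close>

definition line_Hom ::
    "('v, 'a) pquiver \<Rightarrow> ('v, 'a) letter list \<Rightarrow> ('v, 'a) letter list \<Rightarrow>
       ('k::field \<Rightarrow> 'x \<Rightarrow> 'x) \<Rightarrow> ('k \<Rightarrow> 'y \<Rightarrow> 'y) \<Rightarrow>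
       ('k alg_elt \<Rightarrow> 'x::ab_group_add \<Rightarrow> 'x) \<Rightarrow> ('k alg_elt \<Rightarrow> 'y::ab_group_add \<Rightarrow> 'y) \<Rightarrow> hline \<Rightarrow>
       ('x \<Rightarrow> 'y) set" where
  "line_Hom Q x y sX sY \<rho>X \<rho>Y L =
     {g. Vector_Spaces.linear sX sY g \<and>
         (\<forall>a\<in>carrier (line_alg Q x y L). \<forall>v. g (\<rho>X (f_x Q x y L a) v) = \<rho>Y (f_y Q x y L a) (g v))}"

text \<open>Along an arrow of \<open>H\<^sub>1\<^sub>,\<^sub>o\<close> the block of a homomorphism is multiplied by the unit \<open>U(\<eta>)\<close> of a
  special loop of \<open>H(x)\<close> or \<open>H(y)\<close>. In a line of type \<open>LD'\<close> this unit need not commute with the one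
  of the loop of the line if \<open>x\<close> or \<open>y\<close> has type \<open>PP\<close>. At the vertices that are separated from the
  loop by such an arrow the block is a homomorphism of modules over the algebra of the line only
  up to composition with units.\<close>

definition separated ::
    "('v, 'a) pquiver \<Rightarrow> ('v, 'a) letter list \<Rightarrow> ('v, 'a) letter list \<Rightarrow> hline \<Rightarrow> nat \<times> nat \<Rightarrow> bool" where
  "separated Q x y L v \<longleftrightarrow> ltype_of Q x y L = LD' \<and>
     (HQ_src Q x y (HPlus (fst (line_loop Q x y L)) (snd (line_loop Q x y L))), v)
       \<notin> connected (HQ_src Q x y) (HQ_tgt Q x y) (snd L - HQ_o Q x y)"

end

theory Submission
  imports Defs
begin

text \<open>
  A homomorphism is the same as a matrix \<open>\<phi>\<close>, indexed by the vertices of the quiver of the pair, that vanishes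
  at the red vertices and is transported by units of the two algebras along the half-edges of this quiver.
  Hence it is supported on the components without red vertices, and on such a component it is determined
  by a single block, which is constrained only by the loops of a path or the holonomy of a cycle: this
  gives the homomorphisms over \<open>A\<^sub>L\<close>.

  It remains to see that each long line contains exactly one real line, and that this real line has the same type
  and the same loops. By admissibility, the sign of a special letter compares the words read from it in
  both directions. Each arrow of a long line that does not belong to \<open>H\<^sub>1\<^sub>,\<^sub>+\<close> is therefore the first
  difference in a comparison of the words of \<open>y\<close> and \<open>x\<close>, and comparing these words at two such arrows
  shows that, in the absence of red vertices, the line cannot be entered from both sides. So these
  arrows all point away from one segment of the line, which is the real line; the remaining segments
  contain the target of such an arrow. On a cyclic line, and on a path with two loops, the words of
  \<open>y\<close> and \<open>x\<close> read from any vertex of the line agree, hence so do the signs, and there are no such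
  arrows at all.
\<close>

section \<open>The algebras\<close>

text \<open>The first obstacle is that admissibility compares words of \<open>hatQ Q\<close>, whose
  letters over special loops carry the very signs to be determined, while red vertices and lines see
  only letters of \<open>Q\<close>. An induction on the distance of the first asymmetry around a
  special letter shows that its sign is already the lexicographic comparison of the words of
  \<open>Q\<close> on both sides. Only the ranks 0, 1, 2 of direct, trivial or special, and inverse
  letters matter here, because source and target are injective; padding finite words by 1 turns all
  comparisons into ones of infinite sequences. The second obstacle is circularity: the words
  compared at one arrow of a line run through the segment up to a second arrow and past it, and
  conversely. It is broken by the position of the first difference, which would have to decrease
  with every passage. Working with half-edges makes the two reading directions symmetric and treats
  open ends, loops and cycles by one invertible walk.\<close>

lemma polarity_swap [simp]: "opp (opp p) = p"
  by (cases p rule: opp.cases) auto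

section \<open>The free algebra as functions under convolution\<close>

definition conv :: "('g list \<Rightarrow> 'k::field) \<Rightarrow> ('g list \<Rightarrow> 'k) \<Rightarrow> 'g list \<Rightarrow> 'k" where
  "conv p q w = (\<Sum>n\<le>length w. p (take n w) * q (drop n w))"

lemma conv_Nil [simp]: "conv p q [] = p [] * q []"
  by (simp add: conv_def)

text \<open>Splits off the summand in which \<open>p\<close> takes the empty word. The rest is the
  convolution with the left derivative \<open>\<lambda>u. p (a # u)\<close>, so that associativity
  becomes an induction on the word with \<open>p\<close> varying.\<close>

lemma conv_Cons:
  "conv p q (a # w) = p [] * q (a # w) + conv (\<lambda>u. p (a # u)) q w"
  by (simp add: conv_def sum.atMost_Suc_shift del: sum.atMost_Suc)

lemma conv_add_left: "conv (\<lambda>w. p w + q w) r w = conv p r w + conv q r w"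
  by (simp add: conv_def distrib_right sum.distrib)

lemma conv_add_right: "conv p (\<lambda>w. q w + r w) w = conv p q w + conv p r w"
  by (simp add: conv_def distrib_left sum.distrib)

lemma conv_scale_left: "conv (\<lambda>w. c * p w) q w = c * conv p q w"
  by (simp add: conv_def sum_distrib_left mult.assoc)

lemma conv_assoc: "conv (conv p q) r = conv p (conv q r)"
proof
  fix w show "conv (conv p q) r w = conv p (conv q r) w"
  proof (induction w arbitrary: p)
    case (Cons a w)
    have "conv (conv p q) r (a # w) =
        p [] * q [] * r (a # w) + conv (\<lambda>u. p [] * q (a # u) + conv (\<lambda>u. p (a # u)) q u) r w"
      by (simp add: conv_Cons)
    also have "\<dots> = p [] * q [] * r (a # w) +
        (p [] * conv (\<lambda>u. q (a # u)) r w + conv (conv (\<lambda>u. p (a # u)) q) r w)"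
      by (simp add: conv_add_left conv_scale_left)
    also have "conv (conv (\<lambda>u. p (a # u)) q) r w = conv (\<lambda>u. p (a # u)) (conv q r) w"
      by (rule Cons.IH)
    finally show ?case by (simp add: conv_Cons algebra_simps)
  qed (simp add: mult.assoc)
qed

lemma conv_support: "{w. conv p q w \<noteq> 0} \<subseteq> (\<lambda>(u, v). u @ v) ` ({w. p w \<noteq> 0} \<times> {w. q w \<noteq> 0})"
proof
  fix w assume "w \<in> {w. conv p q w \<noteq> 0}"
  then obtain n where "p (take n w) * q (drop n w) \<noteq> 0"
    by (auto simp: conv_def elim: sum.not_neutral_contains_not_neutral)
  thus "w \<in> (\<lambda>(u, v). u @ v) ` ({w. p w \<noteq> 0} \<times> {w. q w \<noteq> 0})"
    by (intro image_eqI[of _ _ "(take n w, drop n w)"]) auto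
qed

lemma carrier_free_algebra:
  "p \<in> carrier (free_algebra G) \<longleftrightarrow> finite {w. p w \<noteq> 0} \<and> {w. p w \<noteq> 0} \<subseteq> lists G"
  by (simp add: free_algebra_def)

lemma free_algebra_ops:
  "p \<otimes>\<^bsub>free_algebra G\<^esub> q = conv p q" "p \<oplus>\<^bsub>free_algebra G\<^esub> q = (\<lambda>w. p w + q w)"
  "\<zero>\<^bsub>free_algebra G\<^esub> = (\<lambda>w. 0)" "\<one>\<^bsub>free_algebra G\<^esub> = monomial []"
  by (simp_all add: free_algebra_def monomial_def conv_def fun_eq_iff)

lemma conv_monomial_left: "conv (monomial u) q w = (if take (length u) w = u then q (drop (length u) w) else 0)"
proof (cases "take (length u) w = u")
  case True
  hence l: "length u \<le> length w" by (metis length_take min.cobounded1)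
  have "conv (monomial u) q w = (\<Sum>n\<in>{length u}. monomial u (take n w) * q (drop n w))"
    unfolding conv_def
    by (rule sum.mono_neutral_right) (use l in \<open>auto simp: monomial_def min_def split: if_splits\<close>)
  thus ?thesis using True by (simp add: monomial_def)
next
  case False
  hence "take n w \<noteq> u" if "n \<le> length w" for n
    using that by auto
  thus ?thesis using False by (auto simp: conv_def monomial_def intro!: sum.neutral)
qed

lemma conv_one_left [simp]: "conv (monomial []) q = q"
  by (simp add: fun_eq_iff conv_monomial_left)

lemma conv_one_right [simp]: "conv p (monomial []) = p"
proof
  fix w
  have "conv p (monomial []) w = (\<Sum>n\<in>{length w}. p (take n w) * monomial [] (drop n w))"
    unfolding conv_def by (rule sum.mono_neutral_right) (auto simp: monomial_def)
  thus "conv p (monomial []) w = p w" by (simp add: monomial_def)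
qed

lemma conv_carrier:
  assumes "p \<in> carrier (free_algebra G)" "q \<in> carrier (free_algebra G)"
  shows "conv p q \<in> carrier (free_algebra G)"
proof -
  have "finite ((\<lambda>(u, v). u @ v) ` ({w. p w \<noteq> 0} \<times> {w. q w \<noteq> 0}))"
    using assms by (auto simp: carrier_free_algebra)
  moreover have "(\<lambda>(u, v). u @ v) ` ({w. p w \<noteq> 0} \<times> {w. q w \<noteq> 0}) \<subseteq> lists G"
    using assms by (fastforce simp: carrier_free_algebra)
  ultimately show ?thesis
    unfolding carrier_free_algebra
    using conv_support[of p q] by (meson finite_subset subset_trans)
qed

lemma add_carrier:
  assumes "p \<in> carrier (free_algebra G)" "q \<in> carrier (free_algebra G)"
  shows "(\<lambda>w. p w + q w) \<in> carrier (free_algebra G)"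
proof -
  have "{w. p w + q w \<noteq> 0} \<subseteq> {w. p w \<noteq> 0} \<union> {w. q w \<noteq> 0}" by auto
  thus ?thesis using assms unfolding carrier_free_algebra
    by (meson finite_UnI finite_subset le_sup_iff subset_trans)
qed

lemma one_carrier: "monomial [] \<in> carrier (free_algebra G)"
  by (auto simp: carrier_free_algebra monomial_def)

lemma ring_free_algebra: "ring (free_algebra G)"
proof (intro ringI abelian_groupI monoidI)
  fix p :: "'a list \<Rightarrow> 'b"
  assume p: "p \<in> carrier (free_algebra G)"
  show "\<exists>p'\<in>carrier (free_algebra G). p' \<oplus>\<^bsub>free_algebra G\<^esub> p = \<zero>\<^bsub>free_algebra G\<^esub>"
    using p by (intro bexI[of _ "\<lambda>w. - p w"]) (auto simp: free_algebra_ops carrier_free_algebra)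
next
  show "\<zero>\<^bsub>free_algebra G\<^esub> \<in> carrier (free_algebra G)"
    by (simp add: free_algebra_ops carrier_free_algebra)
qed (simp_all add: free_algebra_ops conv_assoc conv_carrier add_carrier one_carrier conv_add_left conv_add_right
      fun_eq_iff add_ac)

lemma monomial_carrier: "set w \<subseteq> G \<Longrightarrow> (\<lambda>v. c * monomial w v) \<in> carrier (free_algebra G)"
  by (auto simp: carrier_free_algebra monomial_def)

lemma monomial_diff_carrier:
  assumes "set u \<subseteq> G" "set v \<subseteq> G"
  shows "monomial u - monomial v \<in> carrier (free_algebra G)"
proof -
  have "{w. (monomial u - monomial v) w \<noteq> (0::'b)} \<subseteq> {u, v}" by (auto simp: monomial_def)
  thus ?thesis using assms unfolding carrier_free_algebra
    by (meson finite.emptyI finite_insert finite_subset in_listsI insert_subset empty_subsetI subset_code(1) subset_trans)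
qed

section \<open>The quotients by the relations\<close>

lemma rels_carrier: "rels K \<subseteq> carrier (free_algebra (gens K))"
  by (cases K) (auto intro!: monomial_diff_carrier)

lemma ideal_kideal: "ideal (kideal K) (free_algebra (gens K))"
  unfolding kideal_def by (intro ring.genideal_ideal ring_free_algebra rels_carrier)

lemma ring_kalg: "ring (kalg K)"
  unfolding kalg_def by (intro ideal.quotient_is_ring ideal_kideal)

lemma kclass_hom: "kclass K \<in> ring_hom (free_algebra (gens K)) (kalg K)"
  unfolding kalg_def kclass_def by (rule ideal.rcos_ring_hom[OF ideal_kideal])

lemma carrier_kalg: "carrier (kalg K) = kclass K ` carrier (free_algebra (gens K))"
  by (auto simp: kalg_def FactRing_def A_RCOSETS_def' kclass_def)

lemma free_algebra_minus:
  assumes "q \<in> carrier (free_algebra G)" "p \<in> carrier (free_algebra G)"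
  shows "p \<ominus>\<^bsub>free_algebra G\<^esub> q = p - q"
proof -
  interpret R: ring "free_algebra G" by (rule ring_free_algebra)
  have "- q \<in> carrier (free_algebra G)" using assms by (simp add: carrier_free_algebra)
  hence "\<ominus>\<^bsub>free_algebra G\<^esub> q = - q"
    using assms by (intro R.minus_equality) (auto simp: free_algebra_ops fun_eq_iff)
  thus ?thesis by (simp add: a_minus_def free_algebra_ops fun_eq_iff)
qed

lemma kclass_eqI:
  assumes "p - q \<in> kideal K" "p \<in> carrier (free_algebra (gens K))" "q \<in> carrier (free_algebra (gens K))"
  shows "kclass K p = kclass K q"
  using assms ring.quotient_eq_iff_same_a_r_cos[OF ring_free_algebra ideal_kideal assms(2,3)]
  by (simp add: kclass_def free_algebra_minus)

lemma kclass_eqD: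
  assumes "kclass K p = kclass K q" "p \<in> carrier (free_algebra (gens K))" "q \<in> carrier (free_algebra (gens K))"
  shows "p - q \<in> kideal K"
  using assms ring.quotient_eq_iff_same_a_r_cos[OF ring_free_algebra ideal_kideal assms(2,3)]
  by (simp add: kclass_def free_algebra_minus)

lemma rels_kideal: "rels K \<subseteq> kideal K"
  unfolding kideal_def by (intro ring.genideal_self ring_free_algebra rels_carrier)

lemma kclass_mult: "\<lbrakk>p \<in> carrier (free_algebra (gens K)); q \<in> carrier (free_algebra (gens K))\<rbrakk> \<Longrightarrow>
    kclass K p \<otimes>\<^bsub>kalg K\<^esub> kclass K q = kclass K (conv p q)"
  using ring_hom_mult[OF kclass_hom, of p K q] by (simp add: free_algebra_ops)

lemma kclass_add: "\<lbrakk>p \<in> carrier (free_algebra (gens K)); q \<in> carrier (free_algebra (gens K))\<rbrakk> \<Longrightarrow>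
    kclass K p \<oplus>\<^bsub>kalg K\<^esub> kclass K q = kclass K (\<lambda>w. p w + q w)"
  using ring_hom_add[OF kclass_hom, of p K q] by (simp add: free_algebra_ops)

lemma kclass_one: "\<one>\<^bsub>kalg K\<^esub> = kclass K (monomial [])"
  unfolding free_algebra_ops(4)[of "gens K", symmetric] by (rule ring_hom_one[OF kclass_hom, symmetric])

lemma kscalar_one: "kscalar K 1 = \<one>\<^bsub>kalg K\<^esub>"
  by (simp add: kscalar_def kclass_one)

lemma kscalar_carrier: "kscalar K c \<in> carrier (kalg K)"
  unfolding kscalar_def carrier_kalg by (intro imageI monomial_carrier) simp

lemma monomial_carrier1: "set w \<subseteq> G \<Longrightarrow> monomial w \<in> carrier (free_algebra G)"
  using monomial_carrier[of w G 1] by simp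

lemma kgen_carrier: "g \<in> gens K \<Longrightarrow> kgen K g \<in> carrier (kalg K)"
  unfolding kgen_def carrier_kalg by (intro imageI monomial_carrier1) simp

lemma conv_monomials:
  "conv (monomial u) (monomial v) = (monomial (u @ v) :: 'a list \<Rightarrow> 'b::field)"
proof
  fix w
  have "take (length u) w = u \<and> drop (length u) w = v \<longleftrightarrow> w = u @ v"
    by (metis append_eq_conv_conj)
  thus "conv (monomial u) (monomial v) w = (monomial (u @ v) w :: 'b)"
    unfolding conv_monomial_left by (auto simp: monomial_def)
qed

lemma kgen_mult_kgen:
  assumes "monomial [g, g'] - monomial [] \<in> (rels K :: (gen list \<Rightarrow> 'k::field) set)" "g \<in> gens K" "g' \<in> gens K"
  shows "kgen K g \<otimes>\<^bsub>kalg K\<^esub> kgen K g' = (\<one>\<^bsub>kalg K\<^esub> :: 'k alg_elt)"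
proof -
  have "kgen K g \<otimes>\<^bsub>kalg K\<^esub> kgen K g' = (kclass K (monomial [g, g']) :: 'k alg_elt)"
    unfolding kgen_def using assms by (simp add: kclass_mult monomial_carrier1 conv_monomials)
  also have "\<dots> = kclass K (monomial [])"
    using assms by (intro kclass_eqI monomial_carrier1 subsetD[OF rels_kideal]) auto
  finally show ?thesis by (simp add: kclass_one)
qed

lemma kgen_relations:
  "kgen K_T gT \<otimes>\<^bsub>kalg K_T\<^esub> kgen K_T gT = \<one>\<^bsub>kalg K_T\<^esub>"
  "kgen K_ST gT \<otimes>\<^bsub>kalg K_ST\<^esub> kgen K_ST gT = \<one>\<^bsub>kalg K_ST\<^esub>"
  "kgen K_ST gS \<otimes>\<^bsub>kalg K_ST\<^esub> kgen K_ST gS = \<one>\<^bsub>kalg K_ST\<^esub>"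
  "kgen K_Laurent gT \<otimes>\<^bsub>kalg K_Laurent\<^esub> kgen K_Laurent gTinv = \<one>\<^bsub>kalg K_Laurent\<^esub>"
  "kgen K_Laurent gTinv \<otimes>\<^bsub>kalg K_Laurent\<^esub> kgen K_Laurent gT = \<one>\<^bsub>kalg K_Laurent\<^esub>"
  by (rule kgen_mult_kgen; simp)+

text \<open>A representative has finite support, which is removed one word at a time, and a monomial
  is a scalar multiplied successively by generators. This reduces identities in the quotients to
  generators without any normal form.\<close>

lemma kalg_induct [consumes 1, case_names scalar gen add mult]:
  assumes a: "a \<in> carrier (kalg K)"
    and scalar: "\<And>c. P (kscalar K c)"
    and gen: "\<And>g. g \<in> gens K \<Longrightarrow> P (kgen K g)"
    and add: "\<And>a b. \<lbrakk>a \<in> carrier (kalg K); b \<in> carrier (kalg K); P a; P b\<rbrakk> \<Longrightarrow> P (a \<oplus>\<^bsub>kalg K\<^esub> b)"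
    and mult: "\<And>a b. \<lbrakk>a \<in> carrier (kalg K); b \<in> carrier (kalg K); P a; P b\<rbrakk> \<Longrightarrow> P (a \<otimes>\<^bsub>kalg K\<^esub> b)"
  shows "P a"
proof -
  have car: "kclass K p \<in> carrier (kalg K)" if "p \<in> carrier (free_algebra (gens K))" for p
    using that by (auto simp: carrier_kalg)
  have mono: "P (kclass K (\<lambda>v. c * monomial w v))" if "set w \<subseteq> gens K" for c w
    using that
  proof (induction w arbitrary: c)
    case Nil
    thus ?case using scalar[of c] by (simp add: kscalar_def)
  next
    case (Cons g w)
    have "kgen K g \<otimes>\<^bsub>kalg K\<^esub> kclass K (\<lambda>v. c * monomial w v) =
        kclass K (conv (monomial [g]) (\<lambda>v. c * monomial w v))"
      unfolding kgen_def using Cons.prems by (intro kclass_mult monomial_carrier1 monomial_carrier) auto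
    also have "conv (monomial [g]) (\<lambda>v. c * monomial w v) = (\<lambda>v. c * monomial (g # w) v)"
    proof
      fix v show "conv (monomial [g]) (\<lambda>v. c * monomial w v) v = c * monomial (g # w) v"
        unfolding conv_monomial_left by (cases v) (auto simp: monomial_def)
    qed
    finally show ?case
      using mult[OF kgen_carrier car[OF monomial_carrier] gen Cons.IH, of g c] Cons.prems by simp
  qed
  obtain p where p: "p \<in> carrier (free_algebra (gens K))" and "a = kclass K p"
    using a by (auto simp: carrier_kalg)
  \<comment> \<open>The set \<open>S\<close> only has to contain the support, so the induction
    hypothesis applies to \<open>q\<close> without computing its support.\<close>
  have "P (kclass K p)" if "finite S" "{w. p w \<noteq> 0} \<subseteq> S" "S \<subseteq> lists (gens K)" for p S
    using that
  proof (induction S arbitrary: p rule: finite_induct)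
    case empty
    hence "p = (\<lambda>v. 0 * monomial [] v)" by auto
    thus ?case using mono[of "[]" 0] by simp
  next
    case (insert u S)
    define q where "q = p(u := 0)"
    have q: "{w. q w \<noteq> 0} \<subseteq> S" using insert.prems by (auto simp: q_def)
    have qc: "q \<in> carrier (free_algebra (gens K))"
      using q insert.prems insert.hyps by (auto simp: carrier_free_algebra intro: finite_subset)
    have u: "set u \<subseteq> gens K" using insert.prems by auto
    have "p = (\<lambda>w. p u * monomial u w + q w)" by (auto simp: q_def monomial_def)
    hence "kclass K p = kclass K (\<lambda>w. p u * monomial u w) \<oplus>\<^bsub>kalg K\<^esub> kclass K q"
      using kclass_add[OF monomial_carrier[OF u] qc, of "p u"] by simp
    thus ?case
      using add[OF car[OF monomial_carrier[OF u]] car[OF qc] mono[OF u] insert.IH[OF q]] insert.prems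
      by simp
  qed
  from this[of "{w. p w \<noteq> 0}" p] show ?thesis
    using p \<open>a = kclass K p\<close> by (simp add: carrier_free_algebra)
qed

section \<open>Homomorphisms determined by the generators\<close>

lemma kalg_hom_unique:
  assumes "kalg_hom K K' h" "kalg_hom K K' h'"
    and "\<And>g. g \<in> gens K \<Longrightarrow> h (kgen K g) = h' (kgen K g)" "a \<in> carrier (kalg K)"
  shows "h a = h' a"
  using assms(4)
proof (induction rule: kalg_induct)
  case (scalar c)
  thus ?case using assms(1,2) by (simp add: kalg_hom_def)
next
  case (add a b)
  thus ?case using assms(1,2)
    by (auto simp: kalg_hom_def ring_hom_add[of h "kalg K" "kalg K'"] ring_hom_add[of h' "kalg K" "kalg K'"])
next
  case (mult a b)
  thus ?case using assms(1,2)
    by (auto simp: kalg_hom_def ring_hom_mult[of h "kalg K" "kalg K'"] ring_hom_mult[of h' "kalg K" "kalg K'"])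
qed (use assms(3) in simp)

text \<open>All the homomorphisms that occur below are induced by an involution of the generators.\<close>

lemma kalg_hom_relabel:
  fixes K K' :: akind
  assumes inv: "\<And>g. \<sigma> (\<sigma> g) = g" and gens: "\<And>g. g \<in> gens K \<Longrightarrow> \<sigma> g \<in> gens K'"
    and rels: "\<And>p. p \<in> rels K \<Longrightarrow> p \<circ> map \<sigma> \<in> (kideal K' :: (gen list \<Rightarrow> 'k::field) set)"
  shows "\<exists>h :: 'k alg_elt \<Rightarrow> 'k alg_elt. kalg_hom K K' h \<and> (\<forall>g\<in>gens K. h (kgen K g) = kgen K' (\<sigma> g))"
proof -
  let ?F = "free_algebra (gens K) :: (gen list \<Rightarrow> 'k) ring" and ?F' = "free_algebra (gens K') :: (gen list \<Rightarrow> 'k) ring"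
  \<comment> \<open>As \<sigma> is its own inverse, precomposition with \<open>map \<sigma>\<close>
    is the substitution of \<open>\<sigma> g\<close> for \<open>g\<close>: it permutes the words of
    a support instead of summing over fibres.\<close>
  have mm: "map \<sigma> (map \<sigma> w) = w" for w using inv by (simp add: map_idI)
  have car: "p \<circ> map \<sigma> \<in> carrier ?F'" if "p \<in> carrier ?F" for p :: "gen list \<Rightarrow> 'k"
  proof -
    have "{w. (p \<circ> map \<sigma>) w \<noteq> 0} \<subseteq> map \<sigma> ` {w. p w \<noteq> 0}"
      by (auto intro!: image_eqI[of _ "map \<sigma>", OF mm[symmetric]])
    moreover have "map \<sigma> ` {w. p w \<noteq> 0} \<subseteq> lists (gens K')"
      using that gens by (force simp: carrier_free_algebra)
    ultimately show ?thesis using that unfolding carrier_free_algebra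
      by (meson finite_imageI finite_subset subset_trans)
  qed
  have mon: "monomial w \<circ> map \<sigma> = (monomial (map \<sigma> w) :: gen list \<Rightarrow> 'k)" for w
    by (rule ext) (metis comp_apply mm monomial_def)
  define \<Psi> where "\<Psi> p = kclass K' (p \<circ> map \<sigma>)" for p :: "gen list \<Rightarrow> 'k"
  have \<Psi>: "\<Psi> \<in> ring_hom ?F (kalg K')"
  proof (rule ring_hom_memI)
    fix p q :: "gen list \<Rightarrow> 'k" assume pq: "p \<in> carrier ?F" "q \<in> carrier ?F"
    show "\<Psi> p \<in> carrier (kalg K')" using car[OF pq(1)] by (auto simp: \<Psi>_def carrier_kalg)
    have "conv p q \<circ> map \<sigma> = conv (p \<circ> map \<sigma>) (q \<circ> map \<sigma>)"
      by (auto simp: conv_def fun_eq_iff take_map drop_map)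
    thus "\<Psi> (p \<otimes>\<^bsub>?F\<^esub> q) = \<Psi> p \<otimes>\<^bsub>kalg K'\<^esub> \<Psi> q"
      unfolding \<Psi>_def free_algebra_ops using kclass_mult[OF car[OF pq(1)] car[OF pq(2)]] by simp
    show "\<Psi> (p \<oplus>\<^bsub>?F\<^esub> q) = \<Psi> p \<oplus>\<^bsub>kalg K'\<^esub> \<Psi> q"
      unfolding \<Psi>_def free_algebra_ops using kclass_add[OF car[OF pq(1)] car[OF pq(2)]]
      by (simp add: comp_def)
  next
    show "\<Psi> \<one>\<^bsub>?F\<^esub> = \<one>\<^bsub>kalg K'\<^esub>"
      by (simp add: \<Psi>_def free_algebra_ops kclass_one mon)
  qed
  interpret \<Psi>: ring_hom_ring ?F "kalg K'" \<Psi>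
    by (intro ring_hom_ringI2 ring_free_algebra ring_kalg \<Psi>)
  have zero: "\<zero>\<^bsub>kalg K'\<^esub> = kclass K' (\<lambda>w. 0)"
    unfolding free_algebra_ops(3)[of "gens K'", symmetric]
    by (rule ring_hom_zero[OF kclass_hom ring_free_algebra ring_kalg, symmetric])
  have "kideal K \<subseteq> a_kernel ?F (kalg K') \<Psi>"
    unfolding kideal_def
  proof (rule \<Psi>.R.genideal_minimal[OF \<Psi>.kernel_is_ideal], rule subsetI)
    fix p :: "gen list \<Rightarrow> 'k" assume p: "p \<in> rels K"
    have "kclass K' (p \<circ> map \<sigma>) = kclass K' (\<lambda>w. 0)"
    proof (rule kclass_eqI)
      show "(p \<circ> map \<sigma>) - (\<lambda>w. 0) \<in> kideal K'"
        using rels[OF p] by (simp add: fun_diff_def comp_def)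
      show "p \<circ> map \<sigma> \<in> carrier ?F'"
        using p rels_carrier by (intro car) auto
    qed (simp add: carrier_free_algebra)
    thus "p \<in> a_kernel ?F (kalg K') \<Psi>"
      using p rels_carrier by (auto simp: a_kernel_def' \<Psi>_def zero)
  qed
  \<comment> \<open>\<open>\<Psi>\<close> kills the ideal and is therefore constant on classes, so
    \<open>h\<close> may evaluate it at any representative.\<close>
  hence eq: "\<Psi> p = \<Psi> q" if "kclass K p = kclass K q" "p \<in> carrier ?F" "q \<in> carrier ?F" for p q
  proof -
    have "p \<ominus>\<^bsub>?F\<^esub> q \<in> a_kernel ?F (kalg K') \<Psi>"
      using kclass_eqD[OF that] that \<open>kideal K \<subseteq> _\<close> by (auto simp: free_algebra_minus)
    hence "\<Psi> p \<oplus>\<^bsub>kalg K'\<^esub> \<ominus>\<^bsub>kalg K'\<^esub> \<Psi> q = \<zero>\<^bsub>kalg K'\<^esub>"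
    proof -
      have "\<Psi> (p \<ominus>\<^bsub>?F\<^esub> q) = \<Psi> p \<oplus>\<^bsub>kalg K'\<^esub> \<ominus>\<^bsub>kalg K'\<^esub> \<Psi> q"
        unfolding a_minus_def \<Psi>.hom_add[OF that(2) \<Psi>.R.a_inv_closed[OF that(3)]] \<Psi>.hom_a_inv[OF that(3)] ..
      moreover have "\<Psi> (p \<ominus>\<^bsub>?F\<^esub> q) = \<zero>\<^bsub>kalg K'\<^esub>"
        using \<open>p \<ominus>\<^bsub>?F\<^esub> q \<in> _\<close> unfolding a_kernel_def' by blast
      ultimately show ?thesis by (rule trans[OF sym])
    qed
    hence "\<ominus>\<^bsub>kalg K'\<^esub> (\<ominus>\<^bsub>kalg K'\<^esub> \<Psi> q) = \<Psi> p"
      using that(2,3) by (intro \<Psi>.S.minus_equality) auto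
    thus ?thesis using that(2,3) by simp
  qed
  define h where "h a = \<Psi> (SOME p. p \<in> carrier ?F \<and> kclass K p = a)" for a
  have h: "h (kclass K p) = \<Psi> p" if "p \<in> carrier ?F" for p
  proof -
    have "(SOME q. q \<in> carrier ?F \<and> kclass K q = kclass K p) \<in> carrier ?F \<and>
        kclass K (SOME q. q \<in> carrier ?F \<and> kclass K q = kclass K p) = kclass K p"
      using that by (intro someI[of "\<lambda>q. q \<in> carrier ?F \<and> kclass K q = kclass K p" p]) simp
    thus ?thesis unfolding h_def using eq that by blast
  qed
  have "kalg_hom K K' h"
    unfolding kalg_hom_def
  proof (intro conjI allI ring_hom_memI)
    fix a b :: "'k alg_elt" assume "a \<in> carrier (kalg K)" "b \<in> carrier (kalg K)"
    then obtain p q where p: "p \<in> carrier ?F" "a = kclass K p" and q: "q \<in> carrier ?F" "b = kclass K q"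
      by (auto simp: carrier_kalg)
    show "h a \<in> carrier (kalg K')" using p h by simp
    show "h (a \<otimes>\<^bsub>kalg K\<^esub> b) = h a \<otimes>\<^bsub>kalg K'\<^esub> h b"
      using p q h conv_carrier[OF p(1) q(1)] \<Psi>.hom_mult by (simp add: kclass_mult free_algebra_ops)
    show "h (a \<oplus>\<^bsub>kalg K\<^esub> b) = h a \<oplus>\<^bsub>kalg K'\<^esub> h b"
      using p q h add_carrier[OF p(1) q(1)] \<Psi>.hom_add by (simp add: kclass_add free_algebra_ops)
  next
    show "h \<one>\<^bsub>kalg K\<^esub> = \<one>\<^bsub>kalg K'\<^esub>"
      using h[OF monomial_carrier1[of "[]"]] by (simp add: kclass_one \<Psi>_def mon)
  next
    fix c :: 'k
    have "(\<lambda>w. c * monomial [] w) \<circ> map \<sigma> = (\<lambda>w. c * monomial [] w)"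
      by (simp add: fun_eq_iff monomial_def)
    thus "h (kscalar K c) = kscalar K' c"
      unfolding kscalar_def using h[OF monomial_carrier[of "[]"]] by (simp add: \<Psi>_def)
  qed
  moreover have "h (kgen K g) = kgen K' (\<sigma> g)" if "g \<in> gens K" for g
    unfolding kgen_def using h[OF monomial_carrier1[of "[g]"]] that by (simp add: \<Psi>_def mon)
  ultimately show ?thesis by blast
qed

text \<open>\<open>kalg_map\<close> is a definite description of an extensional map. Existence comes
  from the relabelling restricted to the carrier, uniqueness from the values on the
  generators.\<close>

lemma kalg_map_props:
  fixes \<phi> :: "gen \<Rightarrow> 'k::field alg_elt"
  assumes inv: "\<And>g. \<sigma> (\<sigma> g) = g" and gens: "\<And>g. g \<in> gens K \<Longrightarrow> \<sigma> g \<in> gens K'"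
    and rels: "\<And>p. p \<in> rels K \<Longrightarrow> p \<circ> map \<sigma> \<in> (kideal K' :: (gen list \<Rightarrow> 'k) set)"
    and \<phi>: "\<And>g. g \<in> gens K \<Longrightarrow> \<phi> g = kgen K' (\<sigma> g)"
  shows "kalg_hom K K' (kalg_map K K' \<phi>)" "\<And>g. g \<in> gens K \<Longrightarrow> kalg_map K K' \<phi> (kgen K g) = \<phi> g"
proof -
  obtain h :: "'k alg_elt \<Rightarrow> 'k alg_elt" where h: "kalg_hom K K' h" "\<And>g. g \<in> gens K \<Longrightarrow> h (kgen K g) = kgen K' (\<sigma> g)"
    using kalg_hom_relabel[of \<sigma> K K', OF inv gens rels] by blast
  let ?P = "\<lambda>h :: 'k alg_elt \<Rightarrow> 'k alg_elt. kalg_hom K K' h \<and> (\<forall>g\<in>gens K. h (kgen K g) = \<phi> g) \<and> h \<in> extensional (carrier (kalg K))"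
  let ?h = "restrict h (carrier (kalg K))"
  interpret ring "kalg K" by (rule ring_kalg)
  have "kalg_hom K K' ?h"
    using h(1) by (auto simp: kalg_hom_def ring_hom_def kscalar_carrier)
  hence "?P ?h"
    using h(2) \<phi> by (auto simp: kgen_carrier)
  moreover have "h' = ?h" if "?P h'" for h'
  proof (rule extensionalityI[of _ "carrier (kalg K)"])
    fix a :: "'k alg_elt" assume "a \<in> carrier (kalg K)"
    thus "h' a = ?h a"
      using kalg_hom_unique[of K K' h' ?h a] that \<open>?P ?h\<close> by (metis (no_types, lifting))
  qed (use that \<open>?P ?h\<close> in auto)
  ultimately have "?P (kalg_map K K' \<phi>)"
    unfolding kalg_map_def by (rule theI)
  thus "kalg_hom K K' (kalg_map K K' \<phi>)" "\<And>g. g \<in> gens K \<Longrightarrow> kalg_map K K' \<phi> (kgen K g) = \<phi> g"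
    by auto
qed


lemma kalg_hom_id: "kalg_hom K K (\<lambda>a. a)"
  by (simp add: kalg_hom_def ring_hom_def)

text \<open>Sending \<open>gT\<close> to a generator \<open>g\<close> is not an involution by
  itself; the transposition of \<open>g\<close> and \<open>gT\<close> is one and brings this case
  under the relabelling lemma.\<close>

definition swap_gen :: "gen \<Rightarrow> gen \<Rightarrow> gen \<Rightarrow> gen" where
  "swap_gen a b g = (if g = a then b else if g = b then a else g)"

lemma swap_gen_involution: "swap_gen a b (swap_gen a b g) = g"
  by (simp add: swap_gen_def)

lemma relabel_rel:
  assumes "\<And>g. \<sigma> (\<sigma> g) = g"
    and "monomial (map \<sigma> u) - monomial (map \<sigma> v) \<in> (rels K :: (gen list \<Rightarrow> 'k::field) set)"
  shows "(monomial u - monomial v) \<circ> map \<sigma> \<in> (kideal K :: (gen list \<Rightarrow> 'k) set)"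
proof -
  have "(map \<sigma> w = u) = (w = map \<sigma> u)" for u w
    using assms(1) by (metis list.map_comp list.map_id comp_apply id_apply list.map_ident_strong)
  hence "(monomial u - monomial v) \<circ> map \<sigma> = (monomial (map \<sigma> u) - monomial (map \<sigma> v) :: gen list \<Rightarrow> 'k)"
    by (simp add: fun_eq_iff monomial_def)
  thus ?thesis using subsetD[OF rels_kideal assms(2)] by simp
qed

lemma kalg_map_triv:
  "kalg_hom K_triv K (kalg_map K_triv K (\<lambda>_. undefined))"
  by (rule kalg_map_props[of "\<lambda>g. g"]) auto

lemma kalg_map_T:
  assumes "K \<in> {K_T, K_ST}" "g \<in> gens K"
  shows "kalg_hom K_T K (kalg_map K_T K (\<lambda>_. kgen K g) :: 'k::field alg_elt \<Rightarrow> _)"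
    "kalg_map K_T K (\<lambda>_. kgen K g) (kgen K_T gT) = (kgen K g :: 'k::field alg_elt)"
proof -
  have *: "p \<circ> map (swap_gen g gT) \<in> kideal K" if "p \<in> rels K_T" for p :: "gen list \<Rightarrow> 'k"
    using that assms by (cases K; auto intro!: relabel_rel swap_gen_involution; auto simp: swap_gen_def)
  have **: "swap_gen g gT h \<in> gens K" if "h \<in> gens K_T" for h
    using that assms by (auto simp: swap_gen_def)
  show "kalg_hom K_T K (kalg_map K_T K (\<lambda>_. kgen K g) :: 'k alg_elt \<Rightarrow> _)"
    by (rule kalg_map_props(1)[of "swap_gen g gT", OF swap_gen_involution ** *]) (auto simp: swap_gen_def)
  show "kalg_map K_T K (\<lambda>_. kgen K g) (kgen K_T gT) = (kgen K g :: 'k alg_elt)"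
    by (rule kalg_map_props(2)[of "swap_gen g gT" K_T K, OF swap_gen_involution ** *]) (auto simp: swap_gen_def)
qed

lemma dual_gen_involution: "dual_gen K (dual_gen K g) = g"
  by (cases K; cases g) auto

lemma dual_gen_gens: "g \<in> gens K \<Longrightarrow> dual_gen K g \<in> gens K"
  by (cases K) auto

lemma kalg_map_dual:
  shows "kalg_hom K K (kalg_map K K (\<lambda>g. kgen K (dual_gen K g)) :: 'k::field alg_elt \<Rightarrow> _)"
    "g \<in> gens K \<Longrightarrow> kalg_map K K (\<lambda>g. kgen K (dual_gen K g)) (kgen K g) = (kgen K (dual_gen K g) :: 'k::field alg_elt)"
proof -
  have *: "p \<circ> map (dual_gen K) \<in> kideal K" if "p \<in> rels K" for p :: "gen list \<Rightarrow> 'k"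
    using that by (cases K; auto intro!: relabel_rel dual_gen_involution)
  show "kalg_hom K K (kalg_map K K (\<lambda>g. kgen K (dual_gen K g)) :: 'k alg_elt \<Rightarrow> _)"
    by (rule kalg_map_props(1)[of "dual_gen K", OF dual_gen_involution dual_gen_gens *]) auto
  show "kalg_map K K (\<lambda>g. kgen K (dual_gen K g)) (kgen K g) = (kgen K (dual_gen K g) :: 'k alg_elt)"
    if "g \<in> gens K"
    by (rule kalg_map_props(2)[of "dual_gen K" K K, OF dual_gen_involution dual_gen_gens *]) (use that in auto)
qed

lemma kalg_hom_add: "\<lbrakk>kalg_hom K K' h; a \<in> carrier (kalg K); b \<in> carrier (kalg K)\<rbrakk> \<Longrightarrow>
    h (a \<oplus>\<^bsub>kalg K\<^esub> b) = h a \<oplus>\<^bsub>kalg K'\<^esub> h b"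
  by (simp add: kalg_hom_def ring_hom_def)

lemma kalg_hom_mult: "\<lbrakk>kalg_hom K K' h; a \<in> carrier (kalg K); b \<in> carrier (kalg K)\<rbrakk> \<Longrightarrow>
    h (a \<otimes>\<^bsub>kalg K\<^esub> b) = h a \<otimes>\<^bsub>kalg K'\<^esub> h b"
  by (simp add: kalg_hom_def ring_hom_def)

lemma kalg_hom_carrier: "kalg_hom K K' h \<Longrightarrow> a \<in> carrier (kalg K) \<Longrightarrow> h a \<in> carrier (kalg K')"
  by (auto simp: kalg_hom_def ring_hom_def)

section \<open>Modules over the algebras\<close>

locale kmodule =
  fixes K :: akind and s :: "'k::field \<Rightarrow> 'x::ab_group_add \<Rightarrow> 'x" and \<rho> :: "'k alg_elt \<Rightarrow> 'x \<Rightarrow> 'x"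
  assumes module: "kalg_module K s \<rho>"
begin

sublocale vector_space s
  using module by (simp add: kalg_module_def)

sublocale A: ring "kalg K" by (rule ring_kalg)

lemma linear_act: "a \<in> carrier (kalg K) \<Longrightarrow> Vector_Spaces.linear s s (\<rho> a)"
  using module by (simp add: kalg_module_def)

lemma act_mult: "\<lbrakk>a \<in> carrier (kalg K); b \<in> carrier (kalg K)\<rbrakk> \<Longrightarrow> \<rho> (a \<otimes>\<^bsub>kalg K\<^esub> b) v = \<rho> a (\<rho> b v)"
  using module by (simp add: kalg_module_def)

lemma act_add: "\<lbrakk>a \<in> carrier (kalg K); b \<in> carrier (kalg K)\<rbrakk> \<Longrightarrow> \<rho> (a \<oplus>\<^bsub>kalg K\<^esub> b) v = \<rho> a v + \<rho> b v"
  using module by (simp add: kalg_module_def)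

lemma act_scalar: "\<rho> (kscalar K c) v = s c v"
  using module by (simp add: kalg_module_def)

lemma act_one [simp]: "\<rho> \<one>\<^bsub>kalg K\<^esub> v = v"
  using act_scalar[of 1] by (simp add: kscalar_one)

lemma act_plus: "a \<in> carrier (kalg K) \<Longrightarrow> \<rho> a (v + w) = \<rho> a v + \<rho> a w"
  using linear_act[of a] unfolding Vector_Spaces.linear_iff by simp

lemma act_scale: "a \<in> carrier (kalg K) \<Longrightarrow> \<rho> a (s c v) = s c (\<rho> a v)"
  using linear_act[of a] unfolding Vector_Spaces.linear_iff by simp

lemma act_zero: "a \<in> carrier (kalg K) \<Longrightarrow> \<rho> a 0 = 0"
  using act_scale[of a 0 0] by simp

lemma act_inverse:
  "\<lbrakk>a \<in> carrier (kalg K); b \<in> carrier (kalg K); a \<otimes>\<^bsub>kalg K\<^esub> b = \<one>\<^bsub>kalg K\<^esub>\<rbrakk> \<Longrightarrow> \<rho> a (\<rho> b v) = v"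
  using act_mult by (metis act_one)

end

text \<open>The elements of the algebra intertwined by \<open>g\<close> include the scalars, by
  linearity, and are closed under sums and products. Hence membership in \<open>line_Hom\<close> can
  be tested on generators.\<close>

lemma intertwining_generators:
  assumes X: "kalg_module KX sX \<rho>X" and Y: "kalg_module KY sY \<rho>Y"
    and fX: "kalg_hom K KX fX" and fY: "kalg_hom K KY fY" and g: "Vector_Spaces.linear sX sY g"
  shows "(\<forall>a\<in>carrier (kalg K). \<forall>v. g (\<rho>X (fX a) v) = \<rho>Y (fY a) (g v)) \<longleftrightarrow>
    (\<forall>a\<in>gens K. \<forall>v. g (\<rho>X (fX (kgen K a)) v) = \<rho>Y (fY (kgen K a)) (g v))"
proof
  assume *: "\<forall>a\<in>gens K. \<forall>v. g (\<rho>X (fX (kgen K a)) v) = \<rho>Y (fY (kgen K a)) (g v)"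
  interpret X: kmodule KX sX \<rho>X by unfold_locales (rule X)
  interpret Y: kmodule KY sY \<rho>Y by unfold_locales (rule Y)
  have "\<forall>v. g (\<rho>X (fX a) v) = \<rho>Y (fY a) (g v)" if "a \<in> carrier (kalg K)" for a
    using that
  proof (induction rule: kalg_induct)
    case (scalar c)
    thus ?case using fX fY g
      by (simp add: kalg_hom_def X.act_scalar Y.act_scalar Vector_Spaces.linear_iff)
  next
    case (gen a)
    thus ?case using * by blast
  next
    case (add a b)
    have "fX (a \<oplus>\<^bsub>kalg K\<^esub> b) = fX a \<oplus>\<^bsub>kalg KX\<^esub> fX b" "fY (a \<oplus>\<^bsub>kalg K\<^esub> b) = fY a \<oplus>\<^bsub>kalg KY\<^esub> fY b"
      using kalg_hom_add[OF fX] kalg_hom_add[OF fY] add.hyps by simp_all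
    moreover have "g (u + v) = g u + g v" for u v
      using g by (simp add: Vector_Spaces.linear_iff)
    ultimately show ?case using add kalg_hom_carrier[OF fX] kalg_hom_carrier[OF fY]
      by (simp add: X.act_add Y.act_add)
  next
    case (mult a b)
    have "fX (a \<otimes>\<^bsub>kalg K\<^esub> b) = fX a \<otimes>\<^bsub>kalg KX\<^esub> fX b" "fY (a \<otimes>\<^bsub>kalg K\<^esub> b) = fY a \<otimes>\<^bsub>kalg KY\<^esub> fY b"
      using kalg_hom_mult[OF fX] kalg_hom_mult[OF fY] mult.hyps by simp_all
    thus ?case using mult kalg_hom_carrier[OF fX] kalg_hom_carrier[OF fY]
      by (simp add: X.act_mult Y.act_mult)
  qed
  thus "\<forall>a\<in>carrier (kalg K). \<forall>v. g (\<rho>X (fX a) v) = \<rho>Y (fY a) (g v)" by blast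
qed (use kgen_carrier in blast)

section \<open>The quiver of an admissible word\<close>

lemma fst_opp [simp]: "fst (opp p) = fst p"
  by (cases p rule: opp.cases) auto

lemma snd_opp_pair [simp]: "snd (opp (i, \<rho>)) \<noteq> \<rho>" "\<rho> \<noteq> snd (opp (i, \<rho>))"
  by (cases \<rho>; simp)+

lemma opp_neq [simp]: "opp p \<noteq> p" "p \<noteq> opp p"
  by (cases p rule: opp.cases; auto)+

lemma opp_eq_iff [simp]: "opp p = opp q \<longleftrightarrow> p = q"
  by (metis polarity_swap)

lemma polarity_cases: "q = p \<or> q = opp p \<or> fst q \<noteq> fst p"
  by (cases p rule: opp.cases; cases q rule: opp.cases) auto

lemma ltgt_linv [simp]: "ltgt Q (linv l) = lsrc Q l" and lsrc_linv [simp]: "lsrc Q (linv l) = ltgt Q l"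
  by (cases l; simp)+

lemma linv_linv [simp]: "linv (linv l) = l"
  by (cases l) auto

lemma linv_eq_iff [simp]: "linv l = linv m \<longleftrightarrow> l = m"
  by (metis linv_linv)

lemma hatQ_simps [simp]:
  "verts (hatQ Q) = verts Q" "sp_arrows (hatQ Q) = {}" "ord_arrows (hatQ Q) = arrows Q"
  "src (hatQ Q) = src Q" "tgt (hatQ Q) = tgt Q" "sp_verts (hatQ Q) = {}"
  by (simp_all add: hatQ_def sp_verts_def)

lemma letters_hatQ:
  "l \<in> letters (hatQ Q) \<longleftrightarrow> (case l of Dir \<alpha> \<Rightarrow> \<alpha> \<in> arrows Q | Inv \<alpha> \<Rightarrow> \<alpha> \<in> arrows Q | Special i \<Rightarrow> False
     | Triv i \<rho> \<Rightarrow> i \<in> verts Q | TrivInv i \<rho> \<Rightarrow> i \<in> verts Q)"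
  by (cases l) (auto simp: letters_def)

lemma linv_letters_hatQ [simp]: "linv l \<in> letters (hatQ Q) \<longleftrightarrow> l \<in> letters (hatQ Q)"
  by (cases l) (auto simp: letters_hatQ)

lemma letter_arrow_linv: "l \<in> range Dir \<union> range Inv \<Longrightarrow> letter_arrow (linv l) = letter_arrow l"
  by auto

type_synonym half_edge = "nat \<times> polarity"

locale sg_quiver =
  fixes Q :: "('v, 'a) pquiver"
  assumes skewed_gentle: "skewed_gentle Q"
begin

lemma inj_src: "\<lbrakk>\<alpha> \<in> arrows Q; \<beta> \<in> arrows Q; src Q \<alpha> = src Q \<beta>\<rbrakk> \<Longrightarrow> \<alpha> = \<beta>"
  and inj_tgt: "\<lbrakk>\<alpha> \<in> arrows Q; \<beta> \<in> arrows Q; tgt Q \<alpha> = tgt Q \<beta>\<rbrakk> \<Longrightarrow> \<alpha> = \<beta>"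
  using skewed_gentle by (auto simp: skewed_gentle_def inj_on_def)

lemma arrow_verts: "\<alpha> \<in> arrows Q \<Longrightarrow> fst (src Q \<alpha>) \<in> verts Q" "\<alpha> \<in> arrows Q \<Longrightarrow> fst (tgt Q \<alpha>) \<in> verts Q"
  using skewed_gentle by (auto simp: skewed_gentle_def image_subset_iff mem_Times_iff)

lemma sp_arrowsD:
  assumes "\<epsilon> \<in> sp_arrows Q"
  shows "\<epsilon> \<in> arrows Q" "src Q \<epsilon> = (fst (src Q \<epsilon>), Neg)" "tgt Q \<epsilon> = (fst (src Q \<epsilon>), Neg)"
    "fst (src Q \<epsilon>) \<in> sp_verts Q"
proof -
  show "\<epsilon> \<in> arrows Q" "fst (src Q \<epsilon>) \<in> sp_verts Q"
    using assms by (auto simp: arrows_def sp_verts_def)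
  have "src Q \<epsilon> = tgt Q \<epsilon>" "snd (src Q \<epsilon>) = Neg"
    using assms skewed_gentle by (auto simp: skewed_gentle_def)
  thus "src Q \<epsilon> = (fst (src Q \<epsilon>), Neg)" "tgt Q \<epsilon> = (fst (src Q \<epsilon>), Neg)"
    by (metis prod.collapse)+
qed

lemma sp_loop:
  assumes "i \<in> sp_verts Q"
  shows "sp_loop Q i \<in> sp_arrows Q" "sp_loop Q i \<in> arrows Q"
    "src Q (sp_loop Q i) = (i, Neg)" "tgt Q (sp_loop Q i) = (i, Neg)"
proof -
  obtain \<epsilon> where \<epsilon>: "\<epsilon> \<in> sp_arrows Q" "fst (src Q \<epsilon>) = i"
    using assms by (auto simp: sp_verts_def)
  have "sp_loop Q i = \<epsilon>"
    unfolding sp_loop_def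
  proof (rule the_equality)
    fix \<epsilon>' assume "\<epsilon>' \<in> sp_arrows Q \<and> fst (src Q \<epsilon>') = i"
    thus "\<epsilon>' = \<epsilon>"
      using \<epsilon> sp_arrowsD[of \<epsilon>] sp_arrowsD[of \<epsilon>'] inj_src by metis
  qed (use \<epsilon> in simp)
  thus "sp_loop Q i \<in> sp_arrows Q" "sp_loop Q i \<in> arrows Q"
    "src Q (sp_loop Q i) = (i, Neg)" "tgt Q (sp_loop Q i) = (i, Neg)"
    using \<epsilon> sp_arrowsD[of \<epsilon>] by auto
qed

text \<open>The special loop occupies \<open>(i, Neg)\<close> as source and as target, and both maps
  are injective. So whether a letter lies over a special one can be seen from its base
  alone.\<close>

lemma special_base_arrow:
  assumes "\<alpha> \<in> arrows Q" "i \<in> sp_verts Q" "src Q \<alpha> = (i, Neg) \<or> tgt Q \<alpha> = (i, Neg)"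
  shows "\<alpha> = sp_loop Q i"
  using assms sp_loop[of i] inj_src[of \<alpha> "sp_loop Q i"] inj_tgt[of \<alpha> "sp_loop Q i"] by auto

lemma sp_arrow_iff: "\<alpha> \<in> arrows Q \<Longrightarrow> \<alpha> \<in> sp_arrows Q \<longleftrightarrow> (snd (tgt Q \<alpha>) = Neg \<and> fst (tgt Q \<alpha>) \<in> sp_verts Q)"
  using special_base_arrow[of \<alpha> "fst (tgt Q \<alpha>)"] sp_arrowsD[of \<alpha>] sp_loop(1)
  by (metis fst_conv prod.collapse snd_conv)

lemma sp_arrow_iff_src: "\<alpha> \<in> arrows Q \<Longrightarrow> \<alpha> \<in> sp_arrows Q \<longleftrightarrow> (snd (src Q \<alpha>) = Neg \<and> fst (src Q \<alpha>) \<in> sp_verts Q)"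
  using special_base_arrow[of \<alpha> "fst (src Q \<alpha>)"] sp_arrowsD[of \<alpha>] sp_loop(1)
  by (metis fst_conv prod.collapse snd_conv)

text \<open>Its powers would be infinitely many admissible paths.\<close>

lemma no_admissible_loop:
  assumes "\<alpha> \<in> arrows Q" shows "src Q \<alpha> \<noteq> opp (tgt Q \<alpha>)"
proof
  assume *: "src Q \<alpha> = opp (tgt Q \<alpha>)"
  have "admissible_path Q (replicate (Suc n) \<alpha>)" for n
    using assms * by (auto simp: admissible_path_def nth_Cons split: nat.split simp del: replicate_Suc) 
  hence "range (\<lambda>n. replicate (Suc n) \<alpha>) \<subseteq> {p. admissible_path Q p}" by blast
  hence "finite (range (\<lambda>n. replicate (Suc n) \<alpha>))"
    using skewed_gentle by (auto simp: skewed_gentle_def intro: finite_subset)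
  moreover have "inj (\<lambda>n. replicate (Suc n) \<alpha>)"
    by (rule injI) (metis length_replicate nat.inject)
  ultimately show False using finite_imageD by blast
qed

end

section \<open>Half-edges of the quiver of an admissible word\<close>

locale adm_word = sg_quiver Q for Q :: "('v, 'a) pquiver" +
  fixes x :: "('v, 'a) letter list"
  assumes adm: "x \<in> Adm Q"
begin

abbreviation len :: nat where "len \<equiv> length x"
abbreviation hQ :: "('v, 'a) pquiver" where "hQ \<equiv> hatQ Q"
abbreviation band :: bool where "band \<equiv> wtype_of Q x = Band"
abbreviation V :: "nat set" where "V \<equiv> H_verts Q x"
abbreviation G :: "nat \<Rightarrow> 'v" where "G \<equiv> G_vert Q x"

text \<open>Adding \<open>len\<close> first keeps the cyclic predecessor of 0 clear of truncated
  subtraction.\<close>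

definition prv :: "nat \<Rightarrow> nat" where
  "prv i = (if band then (i + len - 1) mod len else i - 1)"

text \<open>The polarity with which the word is read to the right from the vertex \<open>i\<close>.\<close>

definition rp :: "nat \<Rightarrow> polarity" where
  "rp i = snd (the (ltgt hQ (x ! i)))"

text \<open>A pair \<open>(i, \<rho>)\<close> of a vertex and a polarity is a half-edge of \<open>H(x)\<close>. Here \<open>hl\<close> is the letter
  read at it, \<open>oe\<close> is the other half of its edge (or itself at a loop and at an end of the word), and
  \<open>ar\<close> is the arrow carried by its edge.\<close>

definition hl :: "half_edge \<Rightarrow> ('v, 'a) letter" where
  "hl s = (if snd s = rp (fst s) then x ! fst s else linv (x ! prv (fst s)))"

definition is_end :: "half_edge \<Rightarrow> bool" where
  "is_end s \<longleftrightarrow> \<not> band \<and> (if snd s = rp (fst s) then fst s = len - 1 else fst s = 1)"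

definition oe :: "half_edge \<Rightarrow> half_edge" where
  "oe s = (if is_end s then s
     else if snd s = rp (fst s) then opp (H_next Q x (fst s), rp (H_next Q x (fst s)))
     else (prv (fst s), rp (prv (fst s))))"

definition ar :: "half_edge \<Rightarrow> harrow" where
  "ar s = (if is_end s then if snd s = rp (fst s) then Eta1 else Eta0
     else if snd s = rp (fst s) then Nu (fst s) else Nu (prv (fst s)))"

text \<open>\<open>wtype_of\<close> tests for strings only, so the type \<open>Band\<close> has to
  be justified for admissible bands: their first letter follows their last one and so has a target,
  unlike an inverse trivial letter.\<close>

lemma band_not_string:
  assumes "admissible_band Q x" shows "\<not> is_string hQ x"
proof
  assume "is_string hQ x"
  then obtain i \<rho> where x0: "x ! 0 = TrivInv i \<rho>" and "x \<noteq> []"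
    by (auto simp: is_string_def is_word_def hd_conv_nth)
  have "is_word hQ (x @ x)" using assms by (simp add: admissible_band_def is_band_def)
  hence "\<exists>p. ltgt hQ ((x @ x) ! Suc (len - 1)) = Some p"
    using \<open>x \<noteq> []\<close> unfolding is_word_def by (metis Suc_diff_1 length_append length_greater_0_conv less_add_same_cancel1)
  thus False using x0 \<open>x \<noteq> []\<close> by (simp add: nth_append)
qed

lemma string_cases: "\<not> band \<Longrightarrow> admissible_string Q x \<and> is_string hQ x"
  and band_cases: "band \<Longrightarrow> admissible_band Q x"
  using adm band_not_string by (auto simp: Adm_def wtype_of_def admissible_string_def split: if_splits)

lemma word: "is_word hQ x"
  using string_cases band_cases by (cases band) (auto simp: is_string_def admissible_band_def is_band_def)

lemma len_pos: "len > 0"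
  using word by (auto simp: is_word_def)

lemma letter_in: "i < len \<Longrightarrow> x ! i \<in> letters hQ"
  using word by (auto simp: is_word_def)

lemma consecutive: "Suc k < len \<Longrightarrow> \<exists>p. ltgt hQ (x ! Suc k) = Some p \<and> lsrc hQ (x ! k) = Some (opp p)"
  using word by (auto simp: is_word_def)

lemma consecutive_wrap: "band \<Longrightarrow> \<exists>p. ltgt hQ (x ! 0) = Some p \<and> lsrc hQ (x ! (len - 1)) = Some (opp p)"
proof -
  assume band
  hence "is_word hQ (x @ x)" using band_cases by (simp add: admissible_band_def is_band_def)
  hence "\<exists>p. ltgt hQ ((x @ x) ! Suc (len - 1)) = Some p \<and> lsrc hQ ((x @ x) ! (len - 1)) = Some (opp p)"
    using len_pos unfolding is_word_def by (metis Suc_diff_1 length_append less_add_same_cancel1)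
  thus ?thesis using len_pos by (simp add: nth_append)
qed

lemma string_ends:
  assumes "\<not> band"
  shows "\<exists>i \<rho>. x ! 0 = TrivInv i \<rho>" "\<exists>i \<rho>. x ! (len - 1) = Triv i \<rho>" "len \<ge> 2"
proof -
  show *: "\<exists>i \<rho>. x ! 0 = TrivInv i \<rho>" "\<exists>i \<rho>. x ! (len - 1) = Triv i \<rho>"
    using string_cases[OF assms] len_pos by (auto simp: is_string_def hd_conv_nth last_conv_nth)
  hence "len - 1 \<noteq> 0" by (metis letter.distinct(19))
  thus "len \<ge> 2" by linarith
qed

lemma H_verts_iff: "i \<in> V \<longleftrightarrow> (if band then i < len else 1 \<le> i \<and> i \<le> len - 1)"
  by (auto simp: H_verts_def)

lemma V_less: "i \<in> V \<Longrightarrow> i < len"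
  using len_pos by (auto simp: H_verts_iff split: if_splits)

lemma finite_V: "finite V"
  by (simp add: H_verts_def)

lemma ltgt_right: "i \<in> V \<Longrightarrow> ltgt hQ (x ! i) = Some (G i, rp i)"
proof -
  assume i: "i \<in> V"
  have "\<exists>p. ltgt hQ (x ! i) = Some p"
  proof (cases i)
    case 0
    thus ?thesis using i consecutive_wrap by (auto simp: H_verts_iff split: if_splits)
  next
    case (Suc k)
    thus ?thesis using V_less[OF i] consecutive[of k] by auto
  qed
  thus ?thesis by (auto simp: G_vert_def rp_def)
qed

lemma lsrc_left: "i \<in> V \<Longrightarrow> lsrc hQ (x ! prv i) = Some (opp (G i, rp i))"
proof -
  assume i: "i \<in> V"
  show ?thesis
  proof (cases i)
    case 0
    hence "band" using i by (auto simp: H_verts_iff split: if_splits)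
    thus ?thesis using 0 consecutive_wrap ltgt_right[OF i] len_pos by (auto simp: prv_def)
  next
    case (Suc k)
    have "prv i = k" using Suc V_less[OF i] by (auto simp: prv_def)
    thus ?thesis using Suc V_less[OF i] consecutive[of k] ltgt_right[OF i] by auto
  qed
qed

lemma prv_less: "i \<in> V \<Longrightarrow> prv i < len"
  using V_less[of i] len_pos by (auto simp: prv_def H_verts_iff)

lemma ltgt_hl: "fst s \<in> V \<Longrightarrow> ltgt hQ (hl s) = Some (G (fst s), snd s)"
proof -
  assume s: "fst s \<in> V"
  have "opp (G (fst s), rp (fst s)) = (G (fst s), snd s)" if "snd s \<noteq> rp (fst s)"
    using that polarity_cases[of "(G (fst s), snd s)" "(G (fst s), rp (fst s))"] by auto
  thus ?thesis using s by (auto simp: hl_def ltgt_right lsrc_left)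
qed

lemma hl_letters: "fst s \<in> V \<Longrightarrow> hl s \<in> letters hQ"
  using V_less prv_less by (auto simp: hl_def letter_in)

lemma hl_cases: "fst s \<in> V \<Longrightarrow> (\<exists>\<alpha>. hl s = Dir \<alpha>) \<or> (\<exists>\<alpha>. hl s = Inv \<alpha>) \<or> hl s = Triv (G (fst s)) (snd s)"
  using ltgt_hl[of s] hl_letters[of s] by (cases "hl s") (auto simp: letters_hatQ)

lemma hl_Dir: "fst s \<in> V \<Longrightarrow> hl s = Dir \<alpha> \<Longrightarrow> \<alpha> \<in> arrows Q \<and> tgt Q \<alpha> = (G (fst s), snd s)"
  using ltgt_hl[of s] hl_letters[of s] by (auto simp: letters_hatQ)

lemma hl_Inv: "fst s \<in> V \<Longrightarrow> hl s = Inv \<alpha> \<Longrightarrow> \<alpha> \<in> arrows Q \<and> src Q \<alpha> = (G (fst s), snd s)"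
  using ltgt_hl[of s] hl_letters[of s] by (auto simp: letters_hatQ)

text \<open>A band of length one would be an arrow composable with itself, giving infinitely many
  admissible paths. The bound keeps the ordinary arrows of H(x) from being loops.\<close>

lemma len_ge2: "len \<ge> 2"
proof (cases band)
  case True
  have "len \<noteq> 1"
  proof
    assume len: "len = 1"
    have 0: "0 \<in> V" using True len_pos by (simp add: H_verts_iff)
    have p: "prv 0 = 0" using True len by (simp add: prv_def)
    have l: "ltgt hQ (x ! 0) = Some (G 0, rp 0)" "lsrc hQ (x ! 0) = Some (opp (G 0, rp 0))" "x ! 0 \<in> letters hQ"
      using ltgt_right[OF 0] lsrc_left[OF 0] p letter_in[of 0] len_pos by auto
    thus False
    proof (cases "x ! 0")
      case (Dir \<alpha>)
      thus False using l no_admissible_loop[of \<alpha>] by (auto simp: letters_hatQ)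
    next
      case (Inv \<alpha>)
      hence "\<alpha> \<in> arrows Q" "tgt Q \<alpha> = opp (src Q \<alpha>)" using l by (auto simp: letters_hatQ)
      thus False using no_admissible_loop[of \<alpha>] by simp
    qed (auto simp: letters_hatQ)
  qed
  thus ?thesis using len_pos by linarith
qed (use string_ends in simp)

lemma nxt_prv: "i \<in> V \<Longrightarrow> (band \<or> i \<noteq> 1) \<Longrightarrow> H_next Q x (prv i) = i \<and> prv i \<in> V \<and> prv i \<noteq> i"
  using len_ge2 by (cases i) (auto simp: H_next_def prv_def H_verts_iff mod_Suc split: if_splits)

lemma prv_nxt: "i \<in> V \<Longrightarrow> (band \<or> i \<noteq> len - 1) \<Longrightarrow> prv (H_next Q x i) = i \<and> H_next Q x i \<in> V \<and> H_next Q x i \<noteq> i"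
  using len_ge2 by (auto simp: H_next_def prv_def H_verts_iff mod_Suc split: if_splits)

text \<open>Among letters with a target only the trivial ones lack a source. Past a half-edge that
  is not an end another vertex follows, so its letter has a source.\<close>

lemma is_end_iff: "fst s \<in> V \<Longrightarrow> is_end s \<longleftrightarrow> hl s = Triv (G (fst s)) (snd s)"
proof -
  assume s: "fst s \<in> V"
  show ?thesis
  proof (cases "is_end s")
    case True
    hence nb: "\<not> band" by (simp add: is_end_def)
    show ?thesis
    proof (cases "snd s = rp (fst s)")
      case r: True
      hence "hl s = x ! (len - 1)" using True by (simp add: hl_def is_end_def)
      thus ?thesis using True string_ends(2)[OF nb] ltgt_hl[OF s] by auto
    next
      case l: False
      hence "hl s = linv (x ! 0)" using True nb by (simp add: hl_def is_end_def prv_def)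
      thus ?thesis using True string_ends(1)[OF nb] ltgt_hl[OF s] by auto
    qed
  next
    case False
    have "lsrc hQ (hl s) \<noteq> None"
    proof (cases "snd s = rp (fst s)")
      case r: True
      hence n: "H_next Q x (fst s) \<in> V \<and> prv (H_next Q x (fst s)) = fst s"
        using prv_nxt[OF s] False by (auto simp: is_end_def)
      thus ?thesis using lsrc_left[of "H_next Q x (fst s)"] r by (auto simp: hl_def)
    next
      case l: False
      hence n: "prv (fst s) \<in> V" using nxt_prv[OF s] False by (auto simp: is_end_def)
      thus ?thesis using ltgt_right[of "prv (fst s)"] l by (auto simp: hl_def)
    qed
    thus ?thesis using False by auto
  qed
qed

lemma oe_end: "is_end s \<Longrightarrow> oe s = s"
  by (simp add: oe_def)

text \<open>The dictionary between half-edges and arrows: a letter is direct at the half where its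
  arrow ends and inverse at the half where it starts. The two cases of the proof are mirror images,
  the edge being met from its left or from its right vertex.\<close>

lemma oe_not_end:
  assumes s: "fst s \<in> V" and e: "\<not> is_end s"
  shows "fst (oe s) \<in> V" "hl (oe s) = linv (hl s)" (is ?A1) "oe (oe s) = s" "ar (oe s) = ar s"
    "fst (oe s) \<noteq> fst s" (is ?A2) "\<not> is_end (oe s)" "ar s \<in> H_ord Q x"
    "G_arr Q x (ar s) = letter_arrow (hl s)" (is ?A3)
    "(\<exists>\<alpha>. hl s = Dir \<alpha>) \<Longrightarrow> H_tgt Q x (ar s) = fst s \<and> H_src Q x (ar s) = fst (oe s)"
    "(\<exists>\<alpha>. hl s = Inv \<alpha>) \<Longrightarrow> H_src Q x (ar s) = fst s \<and> H_tgt Q x (ar s) = fst (oe s)"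
proof -
  have hlD: "(\<exists>\<alpha>. hl s = Dir \<alpha>) \<or> (\<exists>\<alpha>. hl s = Inv \<alpha>)"
    using hl_cases[OF s] is_end_iff[OF s] e by auto
  have *: "fst (oe s) \<in> V \<and> ?A1 \<and> oe (oe s) = s \<and> ar (oe s) = ar s \<and>
      ?A2 \<and> \<not> is_end (oe s) \<and> ar s \<in> H_ord Q x \<and> ?A3 \<and>
      (is_direct (hl s) \<longrightarrow> H_tgt Q x (ar s) = fst s \<and> H_src Q x (ar s) = fst (oe s)) \<and>
      (\<not> is_direct (hl s) \<longrightarrow> H_src Q x (ar s) = fst s \<and> H_tgt Q x (ar s) = fst (oe s))"
  proof (cases "snd s = rp (fst s)")
    case True
    define n where "n = H_next Q x (fst s)"
    have n: "prv n = fst s" "n \<in> V" "n \<noteq> fst s"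
      using prv_nxt[OF s] e True by (auto simp: is_end_def n_def)
    have oe: "oe s = opp (n, rp n)" using e True by (simp add: oe_def n_def)
    have ne: "\<not> is_end (oe s)" using e s n(1,2) True oe
      by (auto simp: is_end_def H_verts_iff prv_def split: if_splits)
    have ss: "s = (fst s, rp (fst s))" using True by (metis prod.collapse)
    have "oe (oe s) = s" using ne n ss by (simp add: oe_def[of "oe s"]) (simp add: oe)
    moreover have "ar s = Nu (fst s)" using e True by (simp add: ar_def)
    moreover have "ar (oe s) = Nu (fst s)" using ne n by (simp add: ar_def) (simp add: oe n)
    moreover have "hl s = x ! fst s" "hl (oe s) = linv (x ! fst s)" using True n by (simp_all add: hl_def oe)
    moreover have "fst (oe s) = n" by (simp add: oe)
    moreover have "Nu (fst s) \<in> H_ord Q x" using s e True by (auto simp: H_ord_def H_verts_iff is_end_def split: if_splits)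
    ultimately show ?thesis using n ne by (simp add: n_def[symmetric])
  next
    case False
    define n where "n = prv (fst s)"
    have n: "H_next Q x n = fst s" "n \<in> V" "n \<noteq> fst s"
      using nxt_prv[OF s] e False by (auto simp: is_end_def n_def)
    have oe: "oe s = (n, rp n)" using e False by (simp add: oe_def n_def)
    have ne: "\<not> is_end (oe s)" using e s n(1,2) False oe
      by (auto simp: is_end_def H_verts_iff H_next_def split: if_splits)
    have ss: "s = opp (fst s, rp (fst s))" using False polarity_cases[of s "(fst s, rp (fst s))"] by (auto simp: prod_eq_iff)
    have "oe (oe s) = s" using ne n ss by (simp add: oe_def[of "oe s"]) (simp add: oe n)
    moreover have "ar s = Nu n" using e False by (simp add: ar_def n_def)
    moreover have "ar (oe s) = Nu n" using ne n by (simp add: ar_def) (simp add: oe n)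
    moreover have "hl s = linv (x ! n)" "hl (oe s) = x ! n" using False n by (simp_all add: hl_def oe n_def)
    moreover have "fst (oe s) = n" by (simp add: oe)
    moreover have "Nu n \<in> H_ord Q x" using n e False s by (auto simp: H_ord_def H_verts_iff is_end_def H_next_def split: if_splits)
    moreover have "x ! n \<in> range Dir \<union> range Inv" using hlD calculation(4) by (metis Un_iff linv.simps(1,2) linv_linv rangeI)
    ultimately show ?thesis using n ne hlD letter_arrow_linv[of "x ! n"] by auto
  qed
  thus "fst (oe s) \<in> V" ?A1 "oe (oe s) = s" "ar (oe s) = ar s"
    ?A2 "\<not> is_end (oe s)" "ar s \<in> H_ord Q x"
    ?A3 by auto
  show "(\<exists>\<alpha>. hl s = Dir \<alpha>) \<Longrightarrow> H_tgt Q x (ar s) = fst s \<and> H_src Q x (ar s) = fst (oe s)"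
    "(\<exists>\<alpha>. hl s = Inv \<alpha>) \<Longrightarrow> H_src Q x (ar s) = fst s \<and> H_tgt Q x (ar s) = fst (oe s)"
    using * by auto
qed

lemma fst_oe: "fst s \<in> V \<Longrightarrow> fst (oe s) \<in> V"
  using oe_end oe_not_end(1) by (cases "is_end s") auto

lemma oe_oe: "fst s \<in> V \<Longrightarrow> oe (oe s) = s"
  using oe_end oe_not_end(3) by (cases "is_end s") auto

lemma hl_oe: "fst s \<in> V \<Longrightarrow> \<not> is_end s \<Longrightarrow> hl (oe s) = linv (hl s)"
  by (rule oe_not_end(2))

definition spc :: "half_edge \<Rightarrow> bool" where
  "spc s \<longleftrightarrow> G (fst s) \<in> sp_verts Q \<and> snd s = Neg"

text \<open>A punctured end carries a special loop of H(x). Thus the live half-edges are those with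
  an edge, and the completed word is read on across them.\<close>

definition live :: "half_edge \<Rightarrow> bool" where
  "live s \<longleftrightarrow> \<not> is_end s \<or> spc s"

lemma end_punctured:
  assumes s: "fst s \<in> V" and e: "is_end s"
  shows "spc s \<longleftrightarrow> ar s \<in> H_sp Q x" (is ?A1) "H_src Q x (ar s) = fst s" (is ?A2) "H_tgt Q x (ar s) = fst s" (is ?A3)
    "G_arr Q x (ar s) = sp_loop Q (G (fst s))" (is ?A4)
proof -
  have nb: "\<not> band" and st: "is_string hQ x" using e string_cases by (auto simp: is_end_def)
  have h: "hl s = Triv (G (fst s)) (snd s)" using is_end_iff[OF s] e by simp
  have "(?A1) \<and> ?A2 \<and> ?A3 \<and> ?A4"
  proof (cases "snd s = rp (fst s)")
    case True
    hence f: "fst s = len - 1" and a: "ar s = Eta1" using e by (auto simp: is_end_def ar_def)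
    have l: "last x = Triv (G (fst s)) (snd s)"
      using h True f len_pos by (simp add: hl_def last_conv_nth)
    have "punctured Q (last x) \<longleftrightarrow> spc s" by (auto simp: l punctured_def spc_def)
    hence "spc s \<longleftrightarrow> wtype_of Q x \<in> {UP, PP}" using st by (auto simp: wtype_of_def)
    thus ?thesis using a f l by (auto simp: H_sp_def)
  next
    case False
    hence f: "fst s = 1" and a: "ar s = Eta0" using e by (auto simp: is_end_def ar_def)
    have l: "hd x = TrivInv (G (fst s)) (snd s)"
    proof -
      have "linv (x ! 0) = Triv (G (fst s)) (snd s)" using h False f nb by (simp add: hl_def prv_def)
      thus ?thesis using len_pos by (metis hd_conv_nth length_greater_0_conv linv.simps(4) linv_linv)
    qed
    have "punctured Q (hd x) \<longleftrightarrow> spc s" by (auto simp: l punctured_def spc_def)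
    hence "spc s \<longleftrightarrow> wtype_of Q x \<in> {PU, PP}" using st by (auto simp: wtype_of_def)
    thus ?thesis using a f l by (auto simp: H_sp_def)
  qed
  thus ?A1 ?A2 ?A3 ?A4 by blast+
qed

lemma H_ord_half_edge:
  assumes "\<nu> \<in> H_ord Q x"
  shows "\<exists>s. fst s \<in> V \<and> \<not> is_end s \<and> ar s = \<nu> \<and> hl s = Dir (G_arr Q x \<nu>)"
    "\<exists>s. fst s \<in> V \<and> \<not> is_end s \<and> ar s = \<nu> \<and> hl s = Inv (G_arr Q x \<nu>)"
proof -
  obtain k where k: "\<nu> = Nu k" "k \<in> V" "band \<or> k \<noteq> len - 1"
    using assms by (auto simp: H_ord_def H_verts_iff split: if_splits)
  define s where "s = (k, rp k)"
  have s: "fst s \<in> V" "\<not> is_end s" "ar s = \<nu>" using k by (auto simp: s_def is_end_def ar_def)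
  have "hl s = Dir (letter_arrow (hl s)) \<or> hl s = Inv (letter_arrow (hl s))"
    using hl_cases[OF s(1)] is_end_iff[OF s(1)] s(2) by auto
  moreover have "letter_arrow (hl s) = G_arr Q x \<nu>" using oe_not_end(8)[OF s(1,2)] s(3) by simp
  moreover have "fst (oe s) \<in> V" "\<not> is_end (oe s)" "ar (oe s) = \<nu>" "hl (oe s) = linv (hl s)"
    using oe_not_end[OF s(1,2)] s(3) by auto
  ultimately show "\<exists>s. fst s \<in> V \<and> \<not> is_end s \<and> ar s = \<nu> \<and> hl s = Dir (G_arr Q x \<nu>)"
    "\<exists>s. fst s \<in> V \<and> \<not> is_end s \<and> ar s = \<nu> \<and> hl s = Inv (G_arr Q x \<nu>)"
    using s by (metis linv.simps)+
qed

lemma H_sp_half_edge: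
  assumes "\<eta> \<in> H_sp Q x"
  shows "\<exists>s. fst s \<in> V \<and> is_end s \<and> ar s = \<eta> \<and> spc s"
proof -
  have nb: "\<not> band" using assms by (auto simp: H_sp_def)
  obtain s where "fst s \<in> V" "is_end s" "ar s = \<eta>"
  proof (cases \<eta>)
    case Eta0
    show thesis by (rule that[of "opp (1, rp 1)"]) 
      (use nb len_ge2 Eta0 in \<open>auto simp: is_end_def H_verts_iff ar_def\<close>)
  next
    case Eta1
    show thesis by (rule that[of "(len - 1, rp (len - 1))"])
      (use nb len_ge2 Eta1 in \<open>auto simp: is_end_def H_verts_iff ar_def\<close>)
  qed (use assms in \<open>auto simp: H_sp_def\<close>)
  thus ?thesis using end_punctured(1) assms by metis
qed

lemma ar_inj_end: "\<lbrakk>fst s \<in> V; fst s' \<in> V; is_end s; ar s = ar s'\<rbrakk> \<Longrightarrow> s' = s"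
  using polarity_cases[of s' s] polarity_cases[of s "(fst s, rp (fst s))"] polarity_cases[of s' "(fst s', rp (fst s'))"]
  by (auto simp: ar_def is_end_def split: if_splits)

lemma ar_inj:
  assumes s: "fst s \<in> V" and s': "fst s' \<in> V" and e: "\<not> is_end s" and a: "ar s = ar s'"
  shows "s' = s \<or> s' = oe s"
proof -
  have e': "\<not> is_end s'" using e a by (auto simp: ar_def split: if_splits)
  have *: "\<exists>r. (t = r \<or> t = oe r) \<and> r = (fst r, rp (fst r)) \<and> ar t = Nu (fst r) \<and> oe (oe t) = t \<and> oe (oe r) = r"
    if t: "fst t \<in> V" "\<not> is_end t" for t
  proof (cases "snd t = rp (fst t)")
    case True
    thus ?thesis using t oe_oe[OF t(1)] by (intro exI[of _ t]) (auto simp: ar_def prod_eq_iff)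
  next
    case False
    hence "oe t = (prv (fst t), rp (prv (fst t)))" "ar t = Nu (prv (fst t))"
      using t by (auto simp: oe_def ar_def)
    thus ?thesis using t oe_oe[OF t(1)] by (intro exI[of _ "oe t"]) auto
  qed
  show ?thesis using *[OF s e] *[OF s' e'] a by (metis harrow.inject(1))
qed

end

section \<open>The modules of admissible words\<close>

lemma vector_space_fscale: "vector_space s \<Longrightarrow> vector_space (fscale s)"
  unfolding vector_space_def fscale_def by (simp add: fun_eq_iff)

lemma module_subspace_iff:
  "vector_space s \<Longrightarrow> module.subspace s S \<longleftrightarrow> 0 \<in> S \<and> (\<forall>u\<in>S. \<forall>v\<in>S. u + v \<in> S) \<and> (\<forall>c. \<forall>u\<in>S. s c u \<in> S)"
  by (simp add: module.subspace_def module_iff_vector_space)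

text \<open>Special loops of H(x) are their own opposites, which matches the fact that their units
  square to 1.\<close>

fun arrow_op :: "harrow \<Rightarrow> harrow" where
  "arrow_op (Nu k) = NuOp k"
| "arrow_op \<nu> = \<nu>"

context adm_word
begin

text \<open>The unit of the arrow of \<open>H\<^sup>o(x)\<close> that leaves the vertex through the half-edge \<open>s\<close>; for an
  ordinary arrow of \<open>Q\<close> read backwards this is the inverse of the unit of the arrow.\<close>

definition cu :: "half_edge \<Rightarrow> 'k::field alg_elt" where
  "cu s = U_val Q x (if is_direct (hl s) then arrow_op (ar s) else ar s)"

definition inn :: "half_edge \<Rightarrow> harrow" where
  "inn s = (if \<exists>\<alpha>. hl s = Inv \<alpha> then arrow_op (ar s) else ar s)"

text \<open>Describes where a summand of the action of \<alpha> arrives. Over a special loop of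
  \<open>Q\<close> every half-edge receives one, since \<open>Ho_arrows\<close> also contains the
  opposites of the ordinary arrows there; an ordinary \<alpha> arrives only where its direct letter
  is read.\<close>

definition entering :: "'a \<Rightarrow> half_edge \<Rightarrow> bool" where
  "entering \<alpha> s \<longleftrightarrow> fst s \<in> V \<and> tgt Q \<alpha> = (G (fst s), snd s) \<and> (\<alpha> \<in> sp_arrows Q \<or> hl s = Dir \<alpha>)"

abbreviation K :: akind where "K \<equiv> akind_of Q x"

lemma U_cu: "fst s \<in> V \<Longrightarrow> U_val Q x (inn s) = cu (oe s)"
proof (cases "is_end s")
  case True
  moreover assume "fst s \<in> V"
  ultimately show ?thesis by (simp add: inn_def cu_def oe_end is_end_iff)
next
  case False
  moreover assume "fst s \<in> V"
  ultimately show ?thesis using hl_cases[of s] is_end_iff[of s] by (auto simp: inn_def cu_def oe_not_end)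
qed

lemma sp_base: "\<epsilon> \<in> sp_arrows Q \<Longrightarrow> tgt Q \<epsilon> = (G (fst s), snd s) \<Longrightarrow> spc s \<and> \<epsilon> = sp_loop Q (G (fst s))"
  using sp_arrowsD[of \<epsilon>] special_base_arrow[of \<epsilon> "G (fst s)"] by (auto simp: spc_def)

lemma spc_hl:
  assumes s: "fst s \<in> V" "spc s"
  shows "hl s \<in> {Dir (sp_loop Q (G (fst s))), Inv (sp_loop Q (G (fst s))), Triv (G (fst s)) Neg}"
  using hl_cases[OF s(1)] hl_Dir[OF s(1)] hl_Inv[OF s(1)] special_base_arrow[of _ "G (fst s)"] s(2)
  by (auto simp: spc_def)

lemma inn_props:
  assumes \<alpha>: "\<alpha> \<in> arrows Q" and e: "entering \<alpha> s"
  shows "inn s \<in> Ho_arrows Q x" (is ?A1) "G_arr Q x (inn s) = \<alpha>" (is ?A2) "H_tgt Q x (inn s) = fst s" (is ?A3) "H_src Q x (inn s) = fst (oe s)" (is ?A4)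
proof -
  have s: "fst s \<in> V" and t: "tgt Q \<alpha> = (G (fst s), snd s)" and d: "\<alpha> \<in> sp_arrows Q \<or> hl s = Dir \<alpha>"
    using e by (auto simp: entering_def)
  have "?A1 \<and> ?A2 \<and> ?A3 \<and> ?A4"
  proof (cases "is_end s")
    case True
    hence h: "hl s = Triv (G (fst s)) (snd s)" using is_end_iff[OF s] by simp
    hence "\<alpha> \<in> sp_arrows Q" using d by auto
    hence "spc s" "\<alpha> = sp_loop Q (G (fst s))" using sp_base t by auto
    moreover have "inn s = ar s" using h by (simp add: inn_def)
    ultimately show ?thesis
      using end_punctured[OF s True] oe_end[OF True] by (simp add: Ho_arrows_def)
  next
    case False
    note oe = oe_not_end[OF s False]
    show ?thesis
    proof (cases "hl s = Dir \<alpha>")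
      case True
      thus ?thesis using oe by (simp add: inn_def Ho_arrows_def)
    next
      case nd: False
      hence sp: "\<alpha> \<in> sp_arrows Q" using d by auto
      hence "spc s" "\<alpha> = sp_loop Q (G (fst s))" using sp_base t by auto
      hence h: "hl s = Inv \<alpha>" using spc_hl[OF s] nd is_end_iff[OF s] False by (auto simp: spc_def)
      obtain k where k: "ar s = Nu k" using oe(7) by (auto simp: H_ord_def)
      have i: "inn s = NuOp k" using h k by (simp add: inn_def)
      have "G_arr Q x (Nu k) = \<alpha>" using oe(8) k h by simp
      moreover have "H_src Q x (Nu k) = fst s" "H_tgt Q x (Nu k) = fst (oe s)" using oe(10) k h by auto
      ultimately show ?thesis using oe(7) i k sp by (auto simp: Ho_arrows_def)
    qed
  qed
  thus ?A1 ?A2 ?A3 ?A4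
    by auto
qed

lemma Ho_arrow_entering:
  assumes "\<nu> \<in> Ho_arrows Q x"
  shows "\<exists>s. entering (G_arr Q x \<nu>) s \<and> \<nu> = inn s"
proof -
  consider "\<nu> \<in> H_ord Q x" | "\<nu> \<in> H_sp Q x" | k where "\<nu> = NuOp k" "Nu k \<in> H_ord Q x" "G_arr Q x (Nu k) \<in> sp_arrows Q"
    using assms by (auto simp: Ho_arrows_def)
  thus ?thesis
  proof cases
    case 1
    then obtain s where "fst s \<in> V" "ar s = \<nu>" "hl s = Dir (G_arr Q x \<nu>)"
      using H_ord_half_edge by blast
    thus ?thesis using hl_Dir[of s] by (intro exI[of _ s]) (auto simp: entering_def inn_def)
  next
    case 2
    then obtain s where s: "fst s \<in> V" "ar s = \<nu>" "is_end s" "spc s"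
      using H_sp_half_edge by blast
    moreover have "hl s = Triv (G (fst s)) (snd s)" using s is_end_iff by blast
    ultimately show ?thesis using end_punctured[of s] sp_loop[of "G (fst s)"]
      by (intro exI[of _ s]) (auto simp: entering_def inn_def spc_def)
  next
    case 3
    then obtain s where s: "fst s \<in> V" "ar s = Nu k" "hl s = Inv (G_arr Q x (Nu k))"
      using H_ord_half_edge by blast
    thus ?thesis using hl_Inv[of s] 3 sp_arrowsD[of "G_arr Q x (Nu k)"]
      by (intro exI[of _ s]) (auto simp: entering_def inn_def)
  qed
qed

lemma entering_oe:
  assumes "\<alpha> \<in> arrows Q" "entering \<alpha> s"
  shows "fst (oe s) \<in> V" "src Q \<alpha> = (G (fst (oe s)), snd (oe s))" "oe (oe s) = s" "live s"
    "\<alpha> \<notin> sp_arrows Q \<Longrightarrow> hl (oe s) = Inv \<alpha>" "\<alpha> \<in> sp_arrows Q \<Longrightarrow> entering \<alpha> (oe s)"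
proof -
  have s: "fst s \<in> V" and t: "tgt Q \<alpha> = (G (fst s), snd s)" and d: "\<alpha> \<in> sp_arrows Q \<or> hl s = Dir \<alpha>"
    using assms by (auto simp: entering_def)
  show oeV: "fst (oe s) \<in> V" and "oe (oe s) = s" using fst_oe oe_oe s by auto
  show inv: "hl (oe s) = Inv \<alpha>" if "\<alpha> \<notin> sp_arrows Q"
    using d that hl_oe[OF s] is_end_iff[OF s] by auto
  have sp: "spc s \<and> \<alpha> = sp_loop Q (G (fst s))" if "\<alpha> \<in> sp_arrows Q"
    using sp_base[OF that t] .
  show "live s" using sp d is_end_iff[OF s] by (auto simp: live_def)
  show src: "src Q \<alpha> = (G (fst (oe s)), snd (oe s))"
  proof (cases "is_end s")
    case True
    hence "\<alpha> \<in> sp_arrows Q" using d is_end_iff[OF s] by auto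
    thus ?thesis using t oe_end[OF True] sp_arrowsD[of \<alpha>] by simp
  next
    case False
    show ?thesis
    proof (cases "hl s = Dir \<alpha>")
      case True
      thus ?thesis using hl_oe[OF s False] hl_Inv[OF oeV] by auto
    next
      case nd: False
      hence a: "\<alpha> \<in> sp_arrows Q" using d by auto
      hence "hl s = Inv \<alpha>" using spc_hl[OF s] sp nd is_end_iff[OF s] False by (auto simp: spc_def)
      hence "hl (oe s) = Dir \<alpha>" using hl_oe[OF s False] by simp
      thus ?thesis using hl_Dir[OF oeV] sp_arrowsD[OF a] by simp
    qed
  qed
  show "\<alpha> \<in> sp_arrows Q \<Longrightarrow> entering \<alpha> (oe s)"
    using oeV src sp_arrowsD[of \<alpha>] by (simp add: entering_def)
qed

lemma K_gens:
  "wtype_of Q x = UP \<Longrightarrow> K = K_T" "wtype_of Q x = PU \<Longrightarrow> K = K_T" "wtype_of Q x = PP \<Longrightarrow> K = K_ST"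
  "band \<Longrightarrow> K = K_Laurent"
  by (simp_all add: akind_of_def)

lemma live_ar:
  assumes "fst s \<in> V" "live s"
  shows "ar s \<in> H_ord Q x \<and> \<not> is_end s \<or> ar s \<in> H_sp Q x \<and> is_end s \<and> spc s"
  using assms oe_not_end(7)[of s] end_punctured(1)[of s] by (auto simp: live_def)

lemma U_carrier:
  assumes "\<nu> \<in> H_ord Q x \<union> H_sp Q x"
  shows "U_val Q x \<nu> \<in> carrier (kalg K)" (is ?A1) "U_val Q x (arrow_op \<nu>) \<in> carrier (kalg K)" (is ?A2)
    "U_val Q x \<nu> \<otimes>\<^bsub>kalg K\<^esub> U_val Q x (arrow_op \<nu>) = \<one>\<^bsub>kalg K\<^esub>" (is ?A3)
    "U_val Q x (arrow_op \<nu>) \<otimes>\<^bsub>kalg K\<^esub> U_val Q x \<nu> = \<one>\<^bsub>kalg K\<^esub>" (is ?A4)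
proof -
  interpret A: ring "kalg K" by (rule ring_kalg)
  have "?A1 \<and> ?A2 \<and> ?A3 \<and> ?A4"
  proof (cases \<nu>)
    case (Nu k)
    thus ?thesis
      by (auto simp: K_gens kgen_relations kgen_carrier)
  next
    case Eta0
    hence "wtype_of Q x = PU \<or> wtype_of Q x = PP" using assms by (auto simp: H_sp_def H_ord_def)
    thus ?thesis using Eta0 by (auto simp: K_gens kgen_relations kgen_carrier)
  next
    case Eta1
    hence "wtype_of Q x = UP \<or> wtype_of Q x = PP" using assms by (auto simp: H_sp_def H_ord_def)
    thus ?thesis using Eta1 by (auto simp: K_gens kgen_relations kgen_carrier)
  qed (use assms in \<open>auto simp: H_ord_def H_sp_def\<close>)
  thus ?A1 ?A2 ?A3 ?A4 by auto
qed

lemma cu_carrier: "fst s \<in> V \<Longrightarrow> live s \<Longrightarrow> cu s \<in> carrier (kalg K)"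
  using live_ar[of s] by (auto simp: cu_def intro!: U_carrier)

lemma live_oe: "fst s \<in> V \<Longrightarrow> live (oe s) \<longleftrightarrow> live s"
  by (metis live_def oe_end oe_not_end(6))

lemma cu_inverse: "fst s \<in> V \<Longrightarrow> live s \<Longrightarrow> cu (oe s) \<otimes>\<^bsub>kalg K\<^esub> cu s = (\<one>\<^bsub>kalg K\<^esub> :: 'k::field alg_elt)"
proof -
  assume s: "fst s \<in> V" and l: "live s"
  have a: "ar s \<in> H_ord Q x \<union> H_sp Q x" using live_ar[OF s l] by auto
  show ?thesis
  proof (cases "is_end s")
    case True
    then obtain k where "arrow_op (ar s) = ar s" by (auto simp: ar_def)
    moreover have "U_val Q x (ar s) \<otimes>\<^bsub>kalg K\<^esub> U_val Q x (arrow_op (ar s)) = (\<one>\<^bsub>kalg K\<^esub> :: 'k alg_elt)"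
      by (rule U_carrier(3)[OF a])
    ultimately show ?thesis by (simp add: cu_def oe_end[OF True])
  next
    case False
    have "is_direct (hl (oe s)) \<longleftrightarrow> \<not> is_direct (hl s)"
      using hl_cases[OF s] is_end_iff[OF s] False hl_oe[OF s False] by auto
    thus ?thesis by (simp add: cu_def oe_not_end(4)[OF s False] U_carrier[OF a])
  qed
qed

lemma cu_inverse': "fst s \<in> V \<Longrightarrow> live s \<Longrightarrow> cu s \<otimes>\<^bsub>kalg K\<^esub> cu (oe s) = \<one>\<^bsub>kalg K\<^esub>"
  using cu_inverse[of "oe s"] fst_oe[of s] oe_oe[of s] live_oe[of s] by simp

lemma cu_Units: "fst s \<in> V \<Longrightarrow> live s \<Longrightarrow> cu s \<in> Units (kalg K)"
  unfolding Units_def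
  by (auto simp: cu_carrier live_oe fst_oe intro!: bexI[of _ "cu (oe s)"] cu_inverse cu_inverse')

lemma cu_ordinary: "\<not> band \<Longrightarrow> \<not> is_end s \<Longrightarrow> cu s = \<one>\<^bsub>kalg K\<^esub>"
  by (auto simp: cu_def ar_def)

end

locale word_module = adm_word Q x + kmodule "akind_of Q x" s \<rho>
  for Q :: "('v, 'a) pquiver" and x and s :: "'k::field \<Rightarrow> 'x::ab_group_add \<Rightarrow> 'x" and \<rho>
begin

abbreviation M :: "('v, 'a, nat \<Rightarrow> 'x) quiver_rep" where "M \<equiv> Mo Q x \<rho>"

lemma space_M: "m \<in> space M a \<longleftrightarrow> (\<forall>l. \<not> (l \<in> V \<and> G l = a) \<longrightarrow> m l = 0)"
  by (simp add: Mo_def)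

text \<open>A vertex has a single half-edge with the polarity of the target of \<alpha>, so the sum
  in \<open>Mo\<close> has at most one term.\<close>

lemma act_M:
  assumes \<alpha>: "\<alpha> \<in> arrows Q"
  shows "act M \<alpha> m l = (let p = (l, snd (tgt Q \<alpha>)) in if entering \<alpha> p then \<rho> (cu (oe p)) (m (fst (oe p))) else 0)"
proof -
  define p where "p = (l, snd (tgt Q \<alpha>))"
  have "{\<nu>. \<nu> \<in> Ho_arrows Q x \<and> G_arr Q x \<nu> = \<alpha> \<and> H_tgt Q x \<nu> = l} = (if entering \<alpha> p then {inn p} else {})"
  proof -
    have "\<nu> = inn p \<and> entering \<alpha> p" if \<nu>: "\<nu> \<in> Ho_arrows Q x" "G_arr Q x \<nu> = \<alpha>" "H_tgt Q x \<nu> = l" for \<nu>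
    proof -
      obtain q where q: "entering \<alpha> q" "\<nu> = inn q" using Ho_arrow_entering[OF \<nu>(1)] \<nu>(2) by auto
      hence "fst q = l" using inn_props(3)[OF \<alpha> q(1)] \<nu>(3) by simp
      hence "q = p" using q(1) by (auto simp: p_def entering_def prod_eq_iff)
      thus ?thesis using q by simp
    qed
    moreover have "H_tgt Q x (inn p) = l" if "entering \<alpha> p" using inn_props(3)[OF \<alpha> that] by (simp add: p_def)
    ultimately show ?thesis using inn_props[OF \<alpha>, of p] by auto
  qed
  hence "act M \<alpha> m l = (if entering \<alpha> p then \<rho> (U_val Q x (inn p)) (m (H_src Q x (inn p))) else 0)"
    by (simp add: Mo_def)
  also have "\<dots> = (if entering \<alpha> p then \<rho> (cu (oe p)) (m (fst (oe p))) else 0)"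
    using inn_props[OF \<alpha>, of p] by (auto simp: U_cu entering_def)
  finally show ?thesis by (simp add: p_def Let_def)
qed

text \<open>If an ordinary \<alpha> enters at \<open>p\<close>, the letter at \<open>oe p\<close> is
  \<open>Inv \<alpha>\<close>; an ordinary \<beta> could enter there only with a direct letter, so
  the product vanishes. A special loop acts across an edge and back, with inverse units.\<close>

lemma kQ_rep_M: "kQ_rep Q (fscale s) M"
  unfolding kQ_rep_def
proof (intro conjI ballI allI impI)
  fix a show "module.subspace (fscale s) (space M a)"
    unfolding module_subspace_iff[OF vector_space_fscale[OF vector_space_axioms]]
    by (auto simp: space_M fscale_def)
next
  fix \<alpha> assume \<alpha>: "\<alpha> \<in> arrows Q"
  show "act M \<alpha> ` space M (fst (src Q \<alpha>)) \<subseteq> space M (fst (tgt Q \<alpha>))"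
    using \<alpha> by (auto simp: space_M act_M Let_def entering_def fst_conv[of "G _", symmetric] simp del: fst_conv) (metis fst_conv)+
  have "\<rho> (cu (oe p)) (u + v) = \<rho> (cu (oe p)) u + \<rho> (cu (oe p)) v \<and> \<rho> (cu (oe p)) (s c u) = s c (\<rho> (cu (oe p)) u)"
    if "entering \<alpha> p" for p u v c
  proof -
    have "(cu (oe p) :: 'k alg_elt) \<in> carrier (kalg K)" using entering_oe[OF \<alpha> that] that
      by (intro cu_carrier) (auto simp: live_oe entering_def)
    thus ?thesis by (simp add: act_plus act_scale)
  qed
  thus "linear_on (fscale s) (fscale s) (space M (fst (src Q \<alpha>))) (act M \<alpha>)"
    using \<alpha> by (auto simp: linear_on_def fun_eq_iff act_M Let_def fscale_def)
next
  fix \<alpha> \<beta> m assume \<alpha>: "\<alpha> \<in> ord_arrows Q" and \<beta>: "\<beta> \<in> ord_arrows Q" and c: "src Q \<alpha> = tgt Q \<beta>"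
  have \<alpha>': "\<alpha> \<in> arrows Q" "\<alpha> \<notin> sp_arrows Q" and \<beta>': "\<beta> \<in> arrows Q" "\<beta> \<notin> sp_arrows Q"
    using \<alpha> \<beta> skewed_gentle by (auto simp: arrows_def skewed_gentle_def)
  show "act M \<alpha> (act M \<beta> m) = 0"
  proof
    fix l :: nat
    let ?p = "(l, snd (tgt Q \<alpha>))"
    have "act M \<beta> m (fst (oe ?p)) = 0 \<and> \<rho> (cu (oe ?p)) 0 = 0" if e: "entering \<alpha> ?p"
    proof -
      have "(fst (oe ?p), snd (tgt Q \<beta>)) = oe ?p" using entering_oe(2)[OF \<alpha>'(1) e] c by simp
      hence "\<not> entering \<beta> (fst (oe ?p), snd (tgt Q \<beta>))"
        using entering_oe(5)[OF \<alpha>'(1) e \<alpha>'(2)] \<beta>'(2) by (simp add: entering_def)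
      moreover have "(cu (oe ?p) :: 'k alg_elt) \<in> carrier (kalg K)" using entering_oe[OF \<alpha>'(1) e] e
        by (intro cu_carrier) (auto simp: live_oe entering_def)
      ultimately show ?thesis by (simp add: act_M[OF \<beta>'(1)] Let_def act_zero)
    qed
    thus "act M \<alpha> (act M \<beta> m) l = 0 l" by (simp add: act_M[OF \<alpha>'(1)] Let_def)
  qed
next
  fix \<epsilon> m assume \<epsilon>: "\<epsilon> \<in> sp_arrows Q" and m: "m \<in> space M (fst (src Q \<epsilon>))"
  have \<epsilon>': "\<epsilon> \<in> arrows Q" using sp_arrowsD[OF \<epsilon>] by simp
  show "act M \<epsilon> (act M \<epsilon> m) = m"
  proof
    fix l :: nat
    let ?p = "(l, snd (tgt Q \<epsilon>))"
    show "act M \<epsilon> (act M \<epsilon> m) l = m l"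
    proof (cases "entering \<epsilon> ?p")
      case True
      note oe = entering_oe[OF \<epsilon>' True]
      have "(fst (oe ?p), snd (tgt Q \<epsilon>)) = oe ?p" using oe(2) sp_arrowsD[OF \<epsilon>] by (metis prod.collapse snd_conv)
      hence "act M \<epsilon> m (fst (oe ?p)) = \<rho> (cu ?p) (m l)"
        using oe(6)[OF \<epsilon>] oe(3) by (simp add: act_M[OF \<epsilon>'] Let_def)
      moreover have "\<rho> (cu (oe ?p)) (\<rho> (cu ?p) (m l)) = m l"
        using True oe by (intro act_inverse cu_carrier cu_inverse) (auto simp: live_oe entering_def)
      ultimately show ?thesis using True by (simp add: act_M[OF \<epsilon>'] Let_def)
    next
      case False
      hence "\<not> (l \<in> V \<and> G l = fst (src Q \<epsilon>))"
        using \<epsilon> sp_arrowsD[OF \<epsilon>] by (auto simp: entering_def)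
      thus ?thesis using False m by (simp add: act_M[OF \<epsilon>'] Let_def space_M)
    qed
  qed
qed

end

section \<open>Homomorphisms as matrices\<close>

text \<open>The order of the letters with a given target as numbers, arranged so that inversion is
  \<open>2 - r\<close>. Nothing is lost: as source and target are injective, target and rank
  determine a letter of \<open>hatQ Q\<close>.\<close>

fun rank :: "('v, 'a) letter \<Rightarrow> nat" where
  "rank (Dir \<alpha>) = 0"
| "rank (Inv \<alpha>) = 2"
| "rank _ = 1"

type_synonym pair_half_edge = "(nat \<times> nat) \<times> polarity"

locale adm_pair = X: adm_word Q x + Y: adm_word Q y
  for Q :: "('v, 'a) pquiver" and x y
begin

abbreviation VP :: "(nat \<times> nat) set" where "VP \<equiv> HQ_verts Q x y"

lemma VP_iff: "(j, i) \<in> VP \<longleftrightarrow> j \<in> Y.V \<and> i \<in> X.V \<and> Y.G j = X.G i"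
  by (simp add: HQ_verts_def)

lemma finite_VP: "finite VP"
proof (rule finite_subset)
  show "VP \<subseteq> Y.V \<times> X.V" by (auto simp: HQ_verts_def)
qed (use X.finite_V Y.finite_V in simp)

abbreviation hx :: "pair_half_edge \<Rightarrow> half_edge" where "hx h \<equiv> (snd (fst h), snd h)"
abbreviation hy :: "pair_half_edge \<Rightarrow> half_edge" where "hy h \<equiv> (fst (fst h), snd h)"

text \<open>The half-edges of the underlying graph of the quiver of the pair are the pairs of half-edges
  of \<open>H(y)\<close> and \<open>H(x)\<close> with the same polarity at which the two words have the same nontrivial
  letter of \<open>Q\<close>.\<close>

definition on :: "pair_half_edge \<Rightarrow> bool" where
  "on h \<longleftrightarrow> fst h \<in> VP \<and> (X.spc (hx h) \<or> \<not> X.is_end (hx h) \<and> X.hl (hx h) = Y.hl (hy h))"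

definition oe :: "pair_half_edge \<Rightarrow> pair_half_edge" where
  "oe h = ((fst (Y.oe (hy h)), fst (X.oe (hx h))), snd (X.oe (hx h)))"

text \<open>Over a special base both letters become the same letter of \<open>Q\<close>, so redness
  is decided at the other half-edges, where \<open>F\<close> leaves the letters unchanged and ranks
  may be compared in \<open>hatQ Q\<close>.\<close>

definition redh :: "pair_half_edge \<Rightarrow> bool" where
  "redh h \<longleftrightarrow> fst h \<in> VP \<and> \<not> X.spc (hx h) \<and> rank (X.hl (hx h)) < rank (Y.hl (hy h))"

lemma VP_D: "fst h \<in> VP \<Longrightarrow> fst (hx h) \<in> X.V \<and> fst (hy h) \<in> Y.V \<and> Y.G (fst (fst h)) = X.G (snd (fst h))"
  by (auto simp: HQ_verts_def)

lemma spc_iff: "fst h \<in> VP \<Longrightarrow> Y.spc (hy h) \<longleftrightarrow> X.spc (hx h)"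
  using VP_D[of h] by (simp add: X.spc_def Y.spc_def)

end

context adm_word
begin

lemma spc_entering: "fst s \<in> V \<Longrightarrow> spc s \<Longrightarrow> entering (sp_loop Q (G (fst s))) s"
  using sp_loop[of "G (fst s)"] by (auto simp: entering_def spc_def)

lemma oe_base:
  assumes s: "fst s \<in> V"
  shows "spc s \<Longrightarrow> (G (fst (oe s)), snd (oe s)) = (G (fst s), Neg)"
    "hl s = Dir \<alpha> \<Longrightarrow> (G (fst (oe s)), snd (oe s)) = src Q \<alpha>"
    "hl s = Inv \<alpha> \<Longrightarrow> (G (fst (oe s)), snd (oe s)) = tgt Q \<alpha>"
proof -
  show "spc s \<Longrightarrow> (G (fst (oe s)), snd (oe s)) = (G (fst s), Neg)"
    using entering_oe(2)[OF _ spc_entering[OF s]] sp_loop[of "G (fst s)"] by (simp add: spc_def)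
  show "hl s = Dir \<alpha> \<Longrightarrow> (G (fst (oe s)), snd (oe s)) = src Q \<alpha>"
    using hl_Dir[OF s] entering_oe(2)[of \<alpha> s] s by (auto simp: entering_def)
  show "hl s = Inv \<alpha> \<Longrightarrow> (G (fst (oe s)), snd (oe s)) = tgt Q \<alpha>"
    using hl_oe[OF s] is_end_iff[OF s] hl_Dir[of "oe s" \<alpha>] fst_oe[OF s] by auto
qed

end

context adm_pair
begin

lemma on_live:
  assumes "on h"
  shows "fst (hx h) \<in> X.V" "fst (hy h) \<in> Y.V" "X.live (hx h)" "Y.live (hy h)"
    "\<not> X.spc (hx h) \<Longrightarrow> (\<exists>\<alpha>. X.hl (hx h) = Dir \<alpha> \<and> Y.hl (hy h) = Dir \<alpha> \<or> X.hl (hx h) = Inv \<alpha> \<and> Y.hl (hy h) = Inv \<alpha>)"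
proof -
  show v: "fst (hx h) \<in> X.V" "fst (hy h) \<in> Y.V" using assms VP_D[of h] by (auto simp: on_def)
  have s: "Y.spc (hy h) \<longleftrightarrow> X.spc (hx h)" using assms spc_iff by (simp add: on_def)
  show "\<not> X.spc (hx h) \<Longrightarrow> (\<exists>\<alpha>. X.hl (hx h) = Dir \<alpha> \<and> Y.hl (hy h) = Dir \<alpha> \<or> X.hl (hx h) = Inv \<alpha> \<and> Y.hl (hy h) = Inv \<alpha>)"
    using assms X.hl_cases[OF v(1)] X.is_end_iff[OF v(1)] by (auto simp: on_def)
  thus "X.live (hx h)" "Y.live (hy h)"
    using assms s Y.is_end_iff[OF v(2)] by (auto simp: on_def X.live_def Y.live_def)
qed

text \<open>The base on the far side of an edge depends only on the letter of \<open>Q\<close>.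
  Crossing the edge in both words therefore leads again to half-edges over the same vertex with the
  same polarity.\<close>

lemma on_oe:
  assumes "on h"
  shows "hx (oe h) = X.oe (hx h)" "hy (oe h) = Y.oe (hy h)" "fst (oe h) \<in> VP" "on (oe h)" "oe (oe h) = h"
    "X.spc (hx (oe h)) \<longleftrightarrow> X.spc (hx h)"
proof -
  note v = on_live[OF assms]
  have h: "fst h \<in> VP" using assms by (simp add: on_def)
  have b: "(Y.G (fst (Y.oe (hy h))), snd (Y.oe (hy h))) = (X.G (fst (X.oe (hx h))), snd (X.oe (hx h)))"
  proof (cases "X.spc (hx h)")
    case True
    thus ?thesis
      using X.oe_base(1)[OF v(1)] Y.oe_base(1)[OF v(2)] VP_D[OF h] spc_iff[OF h] by simp
  next
    case False
    then obtain \<alpha> where "X.hl (hx h) = Dir \<alpha> \<and> Y.hl (hy h) = Dir \<alpha> \<or> X.hl (hx h) = Inv \<alpha> \<and> Y.hl (hy h) = Inv \<alpha>"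
      using v(5) by auto
    thus ?thesis
      using X.oe_base(2,3)[OF v(1), of \<alpha>] Y.oe_base(2,3)[OF v(2), of \<alpha>] by (metis (no_types, lifting))
  qed
  show hx: "hx (oe h) = X.oe (hx h)" and hy: "hy (oe h) = Y.oe (hy h)"
    using b by (simp_all add: oe_def prod_eq_iff)
  have V: "fst (X.oe (hx h)) \<in> X.V" "fst (Y.oe (hy h)) \<in> Y.V" using X.fst_oe[OF v(1)] Y.fst_oe[OF v(2)] by auto
  thus VP: "fst (oe h) \<in> VP" using b by (simp add: oe_def VP_iff)
  have sp: "X.spc (X.oe s) \<longleftrightarrow> X.spc s" if s: "fst s \<in> X.V" "X.live s" for s
  proof -
    have *: "X.spc s \<Longrightarrow> X.spc (X.oe s)" if "fst s \<in> X.V" for s using X.oe_base(1)[OF that] by (auto simp: X.spc_def)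
    show ?thesis using *[OF s(1)] *[OF X.fst_oe[OF s(1)]] X.oe_oe[OF s(1)] by auto
  qed
  thus sp': "X.spc (hx (oe h)) \<longleftrightarrow> X.spc (hx h)" using hx v by simp
  show "on (oe h)"
  proof (cases "X.spc (hx h)")
    case True
    thus ?thesis using VP sp' by (simp add: on_def)
  next
    case False
    hence "\<not> X.is_end (hx h)" "\<not> Y.is_end (hy h)" "X.hl (hx h) = Y.hl (hy h)"
      using assms v(1,2) v(5) X.is_end_iff Y.is_end_iff by auto
    hence "\<not> X.is_end (hx (oe h))" "X.hl (hx (oe h)) = Y.hl (hy (oe h))"
      unfolding hx hy using X.oe_not_end[OF v(1)] Y.oe_not_end[OF v(2)] by auto
    thus ?thesis using VP by (simp add: on_def)
  qed
  have "fst (oe (oe h)) = (fst (Y.oe (hy (oe h))), fst (X.oe (hx (oe h))))" "snd (oe (oe h)) = snd (X.oe (hx (oe h)))"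
    by (simp_all add: oe_def[of "oe h"])
  thus "oe (oe h) = h"
    unfolding hx hy X.oe_oe[OF v(1)] Y.oe_oe[OF v(2)] by (simp add: prod_eq_iff)
qed

end

section \<open>Homomorphisms and flat matrices\<close>

type_synonym ('v, 'x, 'y) hom = "'v \<Rightarrow> (nat \<Rightarrow> 'x) \<Rightarrow> nat \<Rightarrow> 'y"

locale module_pair = X: word_module Q x sX \<rho>X + Y: word_module Q y sY \<rho>Y
  for Q :: "('v, 'a) pquiver" and x y
    and sX :: "'k::field \<Rightarrow> 'x::ab_group_add \<Rightarrow> 'x" and \<rho>X
    and sY :: "'k \<Rightarrow> 'y::ab_group_add \<Rightarrow> 'y" and \<rho>Y
begin

sublocale adm_pair Q x y ..

abbreviation klin :: "('x \<Rightarrow> 'y) \<Rightarrow> bool" where "klin \<equiv> Vector_Spaces.linear sX sY"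

text \<open>Every edge contributes a condition for each of its halves. As the units are invertible
  the two are equivalent, which lets later arguments cross edges in either direction.\<close>

definition flat :: "(nat \<times> nat \<Rightarrow> 'x \<Rightarrow> 'y) \<Rightarrow> bool" where
  "flat \<phi> \<longleftrightarrow> (\<forall>v\<in>VP. klin (\<phi> v)) \<and>
     (\<forall>h u. on h \<longrightarrow> \<phi> (fst (oe h)) (\<rho>X (X.cu (hx h)) u) = \<rho>Y (Y.cu (hy h)) (\<phi> (fst h) u)) \<and>
     (\<forall>h. redh h \<longrightarrow> \<phi> (fst h) = 0) \<and> (\<forall>v. v \<notin> VP \<longrightarrow> \<phi> v = 0)"

definition blk :: "(('v, 'x, 'y) hom) \<Rightarrow> nat \<times> nat \<Rightarrow> 'x \<Rightarrow> 'y" where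
  "blk f v = (if v \<in> VP then block Q x f v else 0)"

abbreviation Hom :: "(('v, 'x, 'y) hom) set" where
  "Hom \<equiv> Mo_Hom Q x y sX sY \<rho>X \<rho>Y"

lemma flat_on: "flat \<phi> \<Longrightarrow> on h \<Longrightarrow> \<phi> (fst (oe h)) (\<rho>X (X.cu (hx h)) u) = \<rho>Y (Y.cu (hy h)) (\<phi> (fst h) u)"
  unfolding flat_def by blast

lemma flat_red: "flat \<phi> \<Longrightarrow> redh h \<Longrightarrow> \<phi> (fst h) = 0"
  unfolding flat_def by blast

lemma flat_linear: "flat \<phi> \<Longrightarrow> v \<in> VP \<Longrightarrow> klin (\<phi> v)"
  unfolding flat_def by blast

lemma flat_outside: "flat \<phi> \<Longrightarrow> v \<notin> VP \<Longrightarrow> \<phi> v = 0"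
  unfolding flat_def by blast

text \<open>One entry of the matrix equation for commuting with \<alpha>: the column is the vertex
  of \<open>s\<close>, where \<alpha> leaves, and the row that of \<open>q\<close>, where it
  arrives.\<close>

definition commutes :: "(nat \<times> nat \<Rightarrow> 'x \<Rightarrow> 'y) \<Rightarrow> 'a \<Rightarrow> half_edge \<Rightarrow> half_edge \<Rightarrow> bool" where
  "commutes \<phi> \<alpha> s q \<longleftrightarrow> (\<forall>u.
     (if X.entering \<alpha> (X.oe s) then \<phi> (fst q, fst (X.oe s)) (\<rho>X (X.cu s) u) else 0) =
     (if Y.entering \<alpha> q then \<rho>Y (Y.cu (Y.oe q)) (\<phi> (fst (Y.oe q), fst s) u) else 0))"

abbreviation composable :: "'a \<Rightarrow> half_edge \<Rightarrow> half_edge \<Rightarrow> bool" where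
  "composable \<alpha> s q \<equiv> \<alpha> \<in> arrows Q \<and> fst s \<in> X.V \<and> fst q \<in> Y.V \<and>
     src Q \<alpha> = (X.G (fst s), snd s) \<and> tgt Q \<alpha> = (Y.G (fst q), snd q)"

lemma rank_eq_iff: "rank l = 0 \<longleftrightarrow> (\<exists>\<alpha>. l = Dir \<alpha>)" "rank l < 2 \<longleftrightarrow> (\<forall>\<alpha>. l \<noteq> Inv \<alpha>)"
  by (cases l; simp)+

lemma act_cu:
  assumes o: "on h"
  shows "\<rho>X (X.cu (hx h)) (\<rho>X (X.cu (X.oe (hx h))) u) = u" (is ?A1) "\<rho>X (X.cu (X.oe (hx h))) (\<rho>X (X.cu (hx h)) u) = u" (is ?A2)
    "\<rho>Y (Y.cu (hy h)) (\<rho>Y (Y.cu (Y.oe (hy h))) w) = w" (is ?A3) "\<rho>Y (Y.cu (Y.oe (hy h))) (\<rho>Y (Y.cu (hy h)) w) = w" (is ?A4)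
proof -
  note v = on_live[OF o]
  have l: "fst (X.oe (hx h)) \<in> X.V" "X.live (X.oe (hx h))" "fst (Y.oe (hy h)) \<in> Y.V" "Y.live (Y.oe (hy h))"
    using X.fst_oe[OF v(1)] X.live_oe[OF v(1)] Y.fst_oe[OF v(2)] Y.live_oe[OF v(2)] v by auto
  show ?A1
    by (rule X.act_inverse[OF X.cu_carrier[OF v(1,3)] X.cu_carrier[OF l(1,2)] X.cu_inverse'[OF v(1,3)]])
  show ?A2
    by (rule X.act_inverse[OF X.cu_carrier[OF l(1,2)] X.cu_carrier[OF v(1,3)] X.cu_inverse[OF v(1,3)]])
  show ?A3
    by (rule Y.act_inverse[OF Y.cu_carrier[OF v(2,4)] Y.cu_carrier[OF l(3,4)] Y.cu_inverse'[OF v(2,4)]])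
  show ?A4
    by (rule Y.act_inverse[OF Y.cu_carrier[OF l(3,4)] Y.cu_carrier[OF v(2,4)] Y.cu_inverse[OF v(2,4)]])
qed

text \<open>An entry in which \<alpha> acts on both sides is a transport condition. If it acts on
  one side only, the block on that side vanishes up to a unit; this happens at the red
  half-edges.\<close>

lemma commutes_imp_flat:
  assumes lin: "\<And>v. v \<in> VP \<Longrightarrow> klin (\<phi> v)" and zero: "\<And>v. v \<notin> VP \<Longrightarrow> \<phi> v = 0"
    and com: "\<And>\<alpha> s q. composable \<alpha> s q \<Longrightarrow> commutes \<phi> \<alpha> s q"
  shows "flat \<phi>"
  unfolding flat_def
proof (intro conjI ballI allI impI)
  show "klin (\<phi> v)" if "v \<in> VP" for v using lin that .
  show "\<phi> v = 0" if "v \<notin> VP" for v using zero that .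
next
  \<comment> \<open>Only half-edges through which an arrow of \<open>Q\<close> leaves are treated
    here; at the remaining ones, with direct ordinary letters, the condition follows from that of
    the other half.\<close>
  have *: "\<phi> (fst (oe h)) (\<rho>X (X.cu (hx h)) u) = \<rho>Y (Y.cu (hy h)) (\<phi> (fst h) u)"
    if h: "on h" "X.spc (hx h) \<or> (\<exists>\<alpha>. X.hl (hx h) = Inv \<alpha>)" for h u
  proof -
    note v = on_live[OF h(1)] and o = on_oe[OF h(1)]
    have VP: "fst h \<in> VP" using h by (simp add: on_def)
    define \<alpha> where "\<alpha> = (if X.spc (hx h) then sp_loop Q (X.G (snd (fst h))) else letter_arrow (X.hl (hx h)))"
    have \<alpha>: "\<alpha> \<in> arrows Q \<and> src Q \<alpha> = (X.G (fst (hx h)), snd (hx h)) \<and> X.entering \<alpha> (X.oe (hx h)) \<and> Y.entering \<alpha> (Y.oe (hy h))"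
    proof (cases "X.spc (hx h)")
      case True
      hence sp: "X.G (snd (fst h)) \<in> sp_verts Q" "snd h = Neg" by (auto simp: X.spc_def)
      have "X.entering \<alpha> (hx h)" "Y.entering \<alpha> (hy h)"
        using X.spc_entering[OF v(1) True] Y.spc_entering[OF v(2)] True spc_iff[OF VP] VP_D[OF VP]
        by (auto simp: \<alpha>_def)
      thus ?thesis
        using X.entering_oe(6)[of \<alpha>] Y.entering_oe(6)[of \<alpha>] X.sp_loop[OF sp(1)] True sp by (auto simp: \<alpha>_def)
    next
      case False
      hence hl: "X.hl (hx h) = Inv \<alpha>" "Y.hl (hy h) = Inv \<alpha>" using h v(5) by (auto simp: \<alpha>_def)
      have "X.hl (X.oe (hx h)) = Dir \<alpha>" "Y.hl (Y.oe (hy h)) = Dir \<alpha>"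
        using X.hl_oe[OF v(1)] Y.hl_oe[OF v(2)] hl X.is_end_iff[OF v(1)] Y.is_end_iff[OF v(2)] by auto
      thus ?thesis using X.hl_Inv[OF v(1) hl(1)] X.hl_Dir[OF X.fst_oe[OF v(1)]] Y.hl_Dir[OF Y.fst_oe[OF v(2)]]
        X.fst_oe[OF v(1)] Y.fst_oe[OF v(2)] by (auto simp: X.entering_def Y.entering_def)
    qed
    have "composable \<alpha> (hx h) (Y.oe (hy h))"
      using \<alpha> v Y.fst_oe[OF v(2)] by (auto simp: Y.entering_def)
    hence "commutes \<phi> \<alpha> (hx h) (Y.oe (hy h))" by (rule com)
    thus ?thesis using \<alpha> Y.oe_oe[OF v(2)] by (simp add: commutes_def oe_def)
  qed
  fix h u assume h: "on h"
  note v = on_live[OF h] and o = on_oe[OF h]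
  show "\<phi> (fst (oe h)) (\<rho>X (X.cu (hx h)) u) = \<rho>Y (Y.cu (hy h)) (\<phi> (fst h) u)"
  proof (cases "X.spc (hx h) \<or> (\<exists>\<alpha>. X.hl (hx h) = Inv \<alpha>)")
    case True
    thus ?thesis using * h by blast
  next
    case False
    hence "\<exists>\<alpha>. X.hl (hx (oe h)) = Inv \<alpha>"
      unfolding o(1) using v(5) X.hl_oe[OF v(1)] X.is_end_iff[OF v(1)] by auto
    hence "\<phi> (fst h) (\<rho>X (X.cu (X.oe (hx h))) (\<rho>X (X.cu (hx h)) u)) = \<rho>Y (Y.cu (Y.oe (hy h))) (\<phi> (fst (oe h)) (\<rho>X (X.cu (hx h)) u))"
      using *[OF o(4)] unfolding o(1,2,5) by blast
    thus ?thesis using act_cu(2,3)[OF h] by metis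
  qed
next
  fix h assume h: "redh h"
  hence VP: "fst h \<in> VP" and ns: "\<not> X.spc (hx h)" and r: "rank (X.hl (hx h)) < rank (Y.hl (hy h))"
    by (auto simp: redh_def)
  have v: "fst (hx h) \<in> X.V" "fst (hy h) \<in> Y.V" and G: "Y.G (fst (fst h)) = X.G (snd (fst h))" using VP_D[OF VP] by auto
  have lin0: "\<phi> (fst h) 0 = 0" using lin[OF VP] by (metis module_hom.zero linear_iff_module_hom)
  \<comment> \<open>Either the letter of \<open>y\<close> is inverse and its arrow acts at
    \<open>h\<close> only in \<open>y\<close>, or it is trivial and the direct letter of
    \<open>x\<close> belongs to an arrow acting only in \<open>x\<close>.\<close>
  show "\<phi> (fst h) = 0"
  proof (cases "\<exists>\<alpha>. Y.hl (hy h) = Inv \<alpha>")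
    case True
    then obtain \<alpha> where hl: "Y.hl (hy h) = Inv \<alpha>" by blast
    have \<alpha>: "\<alpha> \<in> arrows Q" "src Q \<alpha> = (X.G (snd (fst h)), snd h)" using Y.hl_Inv[OF v(2) hl] G by auto
    have nsp: "\<alpha> \<notin> sp_arrows Q" using \<alpha> ns X.sp_arrow_iff_src by (auto simp: X.spc_def)
    have e: "\<not> Y.is_end (hy h)" "Y.hl (Y.oe (hy h)) = Dir \<alpha>" using hl Y.is_end_iff[OF v(2)] Y.hl_oe[OF v(2)] by auto
    have ey: "Y.entering \<alpha> (Y.oe (hy h))" using e Y.hl_Dir[OF Y.fst_oe[OF v(2)]] Y.fst_oe[OF v(2)] by (auto simp: Y.entering_def)
    have "\<not> X.entering \<alpha> (X.oe (hx h))"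
    proof
      assume "X.entering \<alpha> (X.oe (hx h))"
      hence "X.hl (X.oe (X.oe (hx h))) = Inv \<alpha>" using X.entering_oe(5)[OF \<alpha>(1) _ nsp] by blast
      thus False using r hl by (simp add: X.oe_oe[OF v(1)])
    qed
    moreover have "commutes \<phi> \<alpha> (hx h) (Y.oe (hy h))"
      using \<alpha> v ey by (intro com) (auto simp: Y.entering_def)
    ultimately have "\<rho>Y (Y.cu (hy h)) (\<phi> (fst h) u) = 0" for u
      using ey Y.oe_oe[OF v(2)] by (auto simp: commutes_def)
    moreover have l: "Y.live (hy h)" using e by (simp add: Y.live_def)
    moreover have "\<rho>Y (Y.cu (Y.oe (hy h))) (\<rho>Y (Y.cu (hy h)) w) = w" for w
      using v l Y.fst_oe[OF v(2)] by (intro Y.act_inverse Y.cu_carrier Y.cu_inverse) (auto simp: Y.live_oe)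
    moreover have "\<rho>Y (Y.cu (Y.oe (hy h))) 0 = 0"
      using v l Y.fst_oe[OF v(2)] by (intro Y.act_zero Y.cu_carrier) (auto simp: Y.live_oe)
    ultimately show ?thesis by (metis zero_fun_apply ext)
  next
    case False
    hence "rank (Y.hl (hy h)) < 2" by (auto simp: rank_eq_iff)
    hence "rank (X.hl (hx h)) = 0" "rank (Y.hl (hy h)) \<noteq> 0" using r by linarith+
    then obtain \<alpha> where hl: "X.hl (hx h) = Dir \<alpha>" and hly: "Y.hl (hy h) \<noteq> Dir \<alpha>" by (auto simp: rank_eq_iff)
    have \<alpha>: "\<alpha> \<in> arrows Q" "tgt Q \<alpha> = (X.G (snd (fst h)), snd h)" using X.hl_Dir[OF v(1) hl] by auto
    have nsp: "\<alpha> \<notin> sp_arrows Q" using \<alpha> ns X.sp_arrow_iff by (auto simp: X.spc_def)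
    have e: "\<not> X.is_end (hx h)" using hl X.is_end_iff[OF v(1)] by auto
    have ex: "X.entering \<alpha> (hx h)" using v hl \<alpha> by (auto simp: X.entering_def)
    have "\<not> Y.entering \<alpha> (hy h)" using hly nsp by (simp add: Y.entering_def)
    moreover have "commutes \<phi> \<alpha> (X.oe (hx h)) (hy h)"
      using \<alpha> v X.entering_oe[OF \<alpha>(1) ex] G by (intro com) auto
    ultimately have z: "\<phi> (fst h) (\<rho>X (X.cu (X.oe (hx h))) u) = 0" for u
      using ex X.oe_oe[OF v(1)] by (simp add: commutes_def)
    have l: "X.live (hx h)" using e by (simp add: X.live_def)
    have "\<rho>X (X.cu (X.oe (hx h))) (\<rho>X (X.cu (hx h)) u) = u" for u
      using v l X.fst_oe[OF v(1)] by (intro X.act_inverse X.cu_carrier X.cu_inverse) (auto simp: X.live_oe)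
    thus ?thesis using z by (metis zero_fun_apply ext)
  qed
qed

lemma flat_imp_commutes:
  assumes f: "flat \<phi>" and c: "composable \<alpha> s q"
  shows "commutes \<phi> \<alpha> s q"
  unfolding commutes_def
proof
  fix u
  have \<alpha>: "\<alpha> \<in> arrows Q" and v: "fst s \<in> X.V" "fst q \<in> Y.V" and s: "src Q \<alpha> = (X.G (fst s), snd s)"
    and t: "tgt Q \<alpha> = (Y.G (fst q), snd q)" using c by auto
  have voe: "fst (X.oe s) \<in> X.V" "fst (Y.oe q) \<in> Y.V" using X.fst_oe[OF v(1)] Y.fst_oe[OF v(2)] by auto
  consider "X.entering \<alpha> (X.oe s)" "Y.entering \<alpha> q" | "X.entering \<alpha> (X.oe s)" "\<not> Y.entering \<alpha> q"
    | "\<not> X.entering \<alpha> (X.oe s)" "Y.entering \<alpha> q" | "\<not> X.entering \<alpha> (X.oe s)" "\<not> Y.entering \<alpha> q" by blast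
  thus "(if X.entering \<alpha> (X.oe s) then \<phi> (fst q, fst (X.oe s)) (\<rho>X (X.cu s) u) else 0) =
     (if Y.entering \<alpha> q then \<rho>Y (Y.cu (Y.oe q)) (\<phi> (fst (Y.oe q), fst s) u) else 0)"
  proof cases
    case 1
    have b: "src Q \<alpha> = (Y.G (fst (Y.oe q)), snd (Y.oe q))" using Y.entering_oe(2)[OF \<alpha> 1(2)] .
    define h where "h = ((fst (Y.oe q), fst s), snd s)"
    have hx: "hx h = s" and hy: "hy h = Y.oe q" and VP: "fst h \<in> VP"
      using b s v voe by (auto simp: h_def VP_iff prod_eq_iff)
    have "on h"
    proof (cases "\<alpha> \<in> sp_arrows Q")
      case True
      hence "X.spc s" using X.sp_arrow_iff_src[OF \<alpha>] s by (simp add: X.spc_def)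
      thus ?thesis using VP hx by (simp add: on_def)
    next
      case False
      hence "X.hl s = Inv \<alpha>" "Y.hl (Y.oe q) = Inv \<alpha>"
        using X.entering_oe(5)[OF \<alpha> 1(1)] Y.entering_oe(5)[OF \<alpha> 1(2)] X.oe_oe[OF v(1)] by auto
      thus ?thesis using VP hx hy X.is_end_iff[OF v(1)] by (simp add: on_def)
    qed
    hence "\<phi> (fst (oe h)) (\<rho>X (X.cu s) u) = \<rho>Y (Y.cu (Y.oe q)) (\<phi> (fst h) u)"
      using flat_on[OF f, of h u] hx hy by simp
    moreover have "fst (oe h) = (fst q, fst (X.oe s))"
      unfolding oe_def hx hy by (simp add: Y.oe_oe[OF v(2)])
    ultimately show ?thesis using 1 by (simp add: h_def)
  next
    case 2
    \<comment> \<open>A special arrow enters at every half-edge over its base, so the mixed cases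
      concern ordinary arrows only.\<close>
    hence nsp: "\<alpha> \<notin> sp_arrows Q" using v t by (auto simp: Y.entering_def)
    hence hl: "X.hl (X.oe s) = Dir \<alpha>" using 2 by (auto simp: X.entering_def)
    have tx: "tgt Q \<alpha> = (X.G (fst (X.oe s)), snd (X.oe s))" using 2 by (simp add: X.entering_def)
    have hly: "Y.hl q \<noteq> Dir \<beta>" for \<beta>
      using 2(2) Y.hl_Dir[OF v(2), of \<beta>] X.inj_tgt[OF \<alpha>, of \<beta>] t v by (auto simp: Y.entering_def)
    define h where "h = ((fst q, fst (X.oe s)), snd q)"
    have hx: "hx h = X.oe s" and hy: "hy h = q" and VP: "fst h \<in> VP"
      using tx t v voe by (auto simp: h_def VP_iff prod_eq_iff)
    have "\<not> X.spc (X.oe s)" using nsp X.sp_arrow_iff[OF \<alpha>] tx by (auto simp: X.spc_def)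
    moreover have "rank (Y.hl q) \<noteq> 0" using hly by (simp add: rank_eq_iff)
    ultimately have "redh h" unfolding redh_def hx hy using VP hl by simp
    hence "\<phi> (fst h) = 0" by (rule flat_red[OF f])
    thus ?thesis using 2 by (simp add: h_def)
  next
    case 3
    have nsp: "\<alpha> \<notin> sp_arrows Q"
    proof
      assume sp: "\<alpha> \<in> sp_arrows Q"
      have "tgt Q \<alpha> = (X.G (fst s), snd s)" using s X.sp_arrowsD[OF sp] by simp
      hence "X.entering \<alpha> s" using v sp by (simp add: X.entering_def)
      thus False using X.entering_oe(6)[OF \<alpha> _ sp] 3 by blast
    qed
    have hl: "Y.hl (Y.oe q) = Inv \<alpha>" using Y.entering_oe(5)[OF \<alpha> 3(2) nsp] .
    have b: "src Q \<alpha> = (Y.G (fst (Y.oe q)), snd (Y.oe q))" using Y.entering_oe(2)[OF \<alpha> 3(2)] .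
    define h where "h = ((fst (Y.oe q), fst s), snd s)"
    have hx: "hx h = s" and hy: "hy h = Y.oe q" and VP: "fst h \<in> VP"
      using b s v voe by (auto simp: h_def VP_iff prod_eq_iff)
    have "X.hl s \<noteq> Inv \<beta>" for \<beta>
    proof
      assume b: "X.hl s = Inv \<beta>"
      hence "\<beta> = \<alpha>" using X.hl_Inv[OF v(1) b] X.inj_src[OF \<alpha>, of \<beta>] s by auto
      hence "X.hl (X.oe s) = Dir \<alpha>" using X.hl_oe[OF v(1)] b X.is_end_iff[OF v(1)] by auto
      thus False using 3(1) voe X.hl_Dir[OF voe(1)] by (auto simp: X.entering_def)
    qed
    moreover have "\<not> X.spc s" using nsp X.sp_arrow_iff_src[OF \<alpha>] s by (auto simp: X.spc_def)
    ultimately have "redh h" unfolding redh_def hx hy using VP hl by (simp add: rank_eq_iff)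
    hence "\<phi> (fst h) = 0" by (rule flat_red[OF f])
    moreover have "\<rho>Y (Y.cu (Y.oe q)) 0 = 0"
      using Y.entering_oe[OF \<alpha> 3(2)] v voe by (intro Y.act_zero Y.cu_carrier) (auto simp: Y.live_oe)
    ultimately show ?thesis using 3 by (simp add: h_def)
  qed simp
qed

lemma sum_apply: "(\<Sum>i\<in>A. g i) j = (\<Sum>i\<in>A. g i j)"
  by (induction A rule: infinite_finite_induct) auto

lemma linearD:
  assumes "klin g"
  shows "g (u + v) = g u + g v" "g (sX c u) = sY c (g u)" "g 0 = 0"
proof -
  show a: "g (u + v) = g u + g v" for u v using assms by (simp add: Vector_Spaces.linear_iff)
  show "g (sX c u) = sY c (g u)" using assms by (simp add: Vector_Spaces.linear_iff)
  show "g 0 = 0" using a[of 0 0] by simp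
qed

lemma linear_sum: "klin g \<Longrightarrow> g (\<Sum>i\<in>A. u i) = (\<Sum>i\<in>A. g (u i))"
  by (induction A rule: infinite_finite_induct) (simp_all add: linearD)

lemma linearI: "(\<And>u v. g (u + v) = g u + g v) \<Longrightarrow> (\<And>c u. g (sX c u) = sY c (g u)) \<Longrightarrow> klin g"
  using X.vector_space_axioms Y.vector_space_axioms by (simp add: Vector_Spaces.linear_iff)

abbreviation single :: "nat \<Rightarrow> 'x \<Rightarrow> nat \<Rightarrow> 'x" where
  "single i u \<equiv> (\<lambda>l. if l = i then u else 0)"

abbreviation over :: "'v \<Rightarrow> nat set" where "over a \<equiv> {i \<in> X.V. X.G i = a}"

lemma HomD:
  assumes "f \<in> Hom"
  shows "a \<in> verts Q \<Longrightarrow> m \<in> space X.M a \<Longrightarrow> f a m \<in> space Y.M a"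
    "a \<in> verts Q \<Longrightarrow> m \<in> space X.M a \<Longrightarrow> m' \<in> space X.M a \<Longrightarrow> f a (m + m') = f a m + f a m'"
    "a \<in> verts Q \<Longrightarrow> m \<in> space X.M a \<Longrightarrow> f a (fscale sX c m) = fscale sY c (f a m)"
    "\<alpha> \<in> arrows Q \<Longrightarrow> m \<in> space X.M (fst (src Q \<alpha>)) \<Longrightarrow> f (fst (tgt Q \<alpha>)) (act X.M \<alpha> m) = act Y.M \<alpha> (f (fst (src Q \<alpha>)) m)"
    "a \<notin> verts Q \<or> m \<notin> space X.M a \<Longrightarrow> f a m = 0"
  using assms by (auto simp: Mo_Hom_def kQ_Hom_def linear_on_def image_subset_iff)

lemma X_G_verts: "i \<in> X.V \<Longrightarrow> X.G i \<in> verts Q"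
proof -
  assume i: "i \<in> X.V"
  hence h: "X.hl (i, Pos) \<in> letters X.hQ" "ltgt X.hQ (X.hl (i, Pos)) = Some (X.G i, Pos)"
    using X.hl_letters[of "(i, Pos)"] X.ltgt_hl[of "(i, Pos)"] by auto
  thus ?thesis using X.arrow_verts
    by (cases "X.hl (i, Pos)") (auto simp: letters_hatQ, (metis fst_conv)+)
qed

lemma single_space: "i \<in> X.V \<Longrightarrow> single i u \<in> space X.M (X.G i)"
  by (auto simp: X.space_M)

lemma Hom_zero: "f \<in> Hom \<Longrightarrow> f a 0 = 0"
proof (cases "a \<in> verts Q")
  case True
  assume f: "f \<in> Hom"
  have "(0 :: nat \<Rightarrow> 'x) \<in> space X.M a" by (simp add: X.space_M)
  hence "f a 0 = f a 0 + f a 0" using HomD(2)[OF f True, of 0 0] by simp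
  thus ?thesis by simp
qed (use HomD(5) in blast)

lemma Hom_sum_single:
  assumes f: "f \<in> Hom" and S: "finite S" "S \<subseteq> X.V" "\<And>i. i \<in> S \<Longrightarrow> X.G i = a" and a: "a \<in> verts Q"
  shows "f a (\<lambda>l. if l \<in> S then m l else 0) = (\<Sum>i\<in>S. f a (single i (m i)))"
  using S
proof (induction S rule: finite_induct)
  case empty
  have "(\<lambda>l. 0) = (0 :: nat \<Rightarrow> 'x)" by auto
  thus ?case using Hom_zero[OF f] by simp
next
  case (insert i S)
  have "(\<lambda>l. if l \<in> insert i S then m l else 0) = single i (m i) + (\<lambda>l. if l \<in> S then m l else 0)"
    using insert.hyps by auto
  moreover have "single i (m i) \<in> space X.M a" "(\<lambda>l. if l \<in> S then m l else 0) \<in> space X.M a"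
    using insert.prems by (auto simp: X.space_M)
  ultimately show ?case using insert HomD(2)[OF f a] by simp
qed

lemma Hom_block:
  assumes f: "f \<in> Hom" and a: "a \<in> verts Q" and m: "m \<in> space X.M a"
  shows "f a m j = (\<Sum>i\<in>over a. block Q x f (j, i) (m i))"
proof -
  have "m = (\<lambda>l. if l \<in> over a then m l else 0)"
    using m by (auto simp: X.space_M)
  hence "f a m = f a (\<lambda>l. if l \<in> over a then m l else 0)" by (rule arg_cong)
  also have "\<dots> = (\<Sum>i\<in>over a. f a (single i (m i)))"
    using X.finite_V a by (intro Hom_sum_single[OF f]) auto
  finally show ?thesis by (simp add: block_def sum_apply)
qed

lemma Hom_block_outside: "f \<in> Hom \<Longrightarrow> i \<in> X.V \<Longrightarrow> (j, i) \<notin> VP \<Longrightarrow> block Q x f (j, i) u = 0"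
  using HomD(1)[of f "X.G i" "single i u"] single_space[of i u] X_G_verts[of i]
  by (auto simp: block_def Y.space_M VP_iff)

lemma Hom_block_linear:
  assumes f: "f \<in> Hom" and v: "v \<in> VP"
  shows "klin (block Q x f v)"
proof (rule linearI)
  obtain j i where v': "v = (j, i)" by fastforce
  hence i: "i \<in> X.V" using v by (simp add: VP_iff)
  fix u w c
  have "single i (u + w) = single i u + single i w" by auto
  thus "block Q x f v (u + w) = block Q x f v u + block Q x f v w"
    using HomD(2)[OF f X_G_verts[OF i] single_space[OF i] single_space[OF i]] by (simp add: block_def v')
  have "single i (sX c u) = fscale sX c (single i u)" by (auto simp: fscale_def)
  thus "block Q x f v (sX c u) = sY c (block Q x f v u)"
    using HomD(3)[OF f X_G_verts[OF i] single_space[OF i]] by (simp add: block_def v' fscale_def)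
qed

lemma act_single:
  assumes \<alpha>: "\<alpha> \<in> arrows Q" and s: "fst s \<in> X.V" "src Q \<alpha> = (X.G (fst s), snd s)"
  shows "act X.M \<alpha> (single (fst s) u) =
    (if X.entering \<alpha> (X.oe s) then single (fst (X.oe s)) (\<rho>X (X.cu s) u) else 0)"
proof
  fix l :: nat
  let ?p = "(l, snd (tgt Q \<alpha>))"
  have *: "X.entering \<alpha> ?p \<and> fst (X.oe ?p) = fst s \<longleftrightarrow> X.entering \<alpha> (X.oe s) \<and> l = fst (X.oe s)"
  proof
    assume a: "X.entering \<alpha> ?p \<and> fst (X.oe ?p) = fst s"
    hence "X.oe ?p = s" using X.entering_oe(2)[OF \<alpha>, of ?p] s by (auto simp: prod_eq_iff)
    hence "X.oe s = ?p" using X.entering_oe(3)[OF \<alpha>, of ?p] a by simp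
    thus "X.entering \<alpha> (X.oe s) \<and> l = fst (X.oe s)" using a by simp
  next
    assume a: "X.entering \<alpha> (X.oe s) \<and> l = fst (X.oe s)"
    hence "X.oe s = ?p" by (auto simp: X.entering_def prod_eq_iff)
    thus "X.entering \<alpha> ?p \<and> fst (X.oe ?p) = fst s" using a X.oe_oe[OF s(1)] by auto
  qed
  have "X.oe ?p = s" if "X.entering \<alpha> ?p" "fst (X.oe ?p) = fst s"
    using X.entering_oe(2)[OF \<alpha> that(1)] that(2) s by (auto simp: prod_eq_iff)
  moreover have "\<rho>X (X.cu (X.oe ?p)) 0 = 0" if "X.entering \<alpha> ?p"
    using X.entering_oe[OF \<alpha> that] that by (intro X.act_zero X.cu_carrier) (auto simp: X.live_oe X.entering_def)
  ultimately show "act X.M \<alpha> (single (fst s) u) l = (if X.entering \<alpha> (X.oe s) then single (fst (X.oe s)) (\<rho>X (X.cu s) u) else 0) l"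
    using * by (auto simp: X.act_M[OF \<alpha>] Let_def)
qed

lemma Hom_commutes:
  assumes f: "f \<in> Hom" and c: "composable \<alpha> s q"
  shows "commutes (blk f) \<alpha> s q"
  unfolding commutes_def
proof
  fix u
  have \<alpha>: "\<alpha> \<in> arrows Q" and v: "fst s \<in> X.V" "fst q \<in> Y.V" and s: "src Q \<alpha> = (X.G (fst s), snd s)"
    and t: "tgt Q \<alpha> = (Y.G (fst q), snd q)" using c by auto
  have eq: "f (Y.G (fst q)) (act X.M \<alpha> (single (fst s) u)) (fst q) = act Y.M \<alpha> (f (X.G (fst s)) (single (fst s) u)) (fst q)"
    using HomD(4)[OF f \<alpha>, of "single (fst s) u"] single_space[OF v(1)] s t by simp
  have "f (Y.G (fst q)) (act X.M \<alpha> (single (fst s) u)) (fst q) =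
     (if X.entering \<alpha> (X.oe s) then blk f (fst q, fst (X.oe s)) (\<rho>X (X.cu s) u) else 0)"
    unfolding act_single[OF \<alpha> v(1) s] using v t Hom_zero[OF f, of "Y.G (fst q)"]
    by (auto simp: blk_def block_def VP_iff X.entering_def)
  moreover have "act Y.M \<alpha> (f (X.G (fst s)) (single (fst s) u)) (fst q) =
     (if Y.entering \<alpha> q then \<rho>Y (Y.cu (Y.oe q)) (blk f (fst (Y.oe q), fst s) u) else 0)"
    using Y.entering_oe[OF \<alpha>, of q] v s t
    by (auto simp: Y.act_M[OF \<alpha>] Let_def blk_def block_def VP_iff)
  ultimately show "(if X.entering \<alpha> (X.oe s) then blk f (fst q, fst (X.oe s)) (\<rho>X (X.cu s) u) else 0) =
     (if Y.entering \<alpha> q then \<rho>Y (Y.cu (Y.oe q)) (blk f (fst (Y.oe q), fst s) u) else 0)"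
    using eq by simp
qed

lemma blk_flat: "f \<in> Hom \<Longrightarrow> flat (blk f)"
  by (rule commutes_imp_flat) (auto simp: blk_def Hom_block_linear Hom_commutes)

lemma blk_inj:
  assumes "f \<in> Hom" "f' \<in> Hom" "blk f = blk f'"
  shows "f = f'"
proof (intro ext)
  fix a m j
  show "f a m j = f' a m j"
  proof (cases "a \<in> verts Q \<and> m \<in> space X.M a")
    case True
    have "block Q x f (j, i) u = block Q x f' (j, i) u" if "i \<in> over a" for i u
    proof (cases "(j, i) \<in> VP")
      case True
      thus ?thesis using fun_cong[OF assms(3), of "(j, i)"] by (simp add: blk_def)
    qed (use that Hom_block_outside assms in auto)
    thus ?thesis using Hom_block[OF assms(1)] Hom_block[OF assms(2)] True by simp
  next
    case False
    hence "a \<notin> verts Q \<or> m \<notin> space X.M a" by blast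
    thus ?thesis using HomD(5)[OF assms(1)] HomD(5)[OF assms(2)] by simp
  qed
qed

text \<open>Inverse to \<open>blk\<close> on flat matrices. The value 0 off the spaces of the
  representation is demanded by \<open>kQ_Hom\<close>.\<close>

definition mk :: "(nat \<times> nat \<Rightarrow> 'x \<Rightarrow> 'y) \<Rightarrow> ('v, 'x, 'y) hom" where
  "mk \<phi> a m j = (if a \<in> verts Q \<and> m \<in> space X.M a then \<Sum>i\<in>over a. \<phi> (j, i) (m i) else 0)"

lemma flat_linear': "flat \<phi> \<Longrightarrow> klin (\<phi> v)"
  by (cases "v \<in> VP") (auto simp: flat_linear flat_outside intro!: linearI simp: Y.scale_zero_right)

lemma space_closed:
  "m \<in> space X.M a \<Longrightarrow> m' \<in> space X.M a \<Longrightarrow> m + m' \<in> space X.M a" "m \<in> space X.M a \<Longrightarrow> fscale sX c m \<in> space X.M a"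
  by (auto simp: X.space_M fscale_def)

lemma mk_Hom:
  assumes f: "flat \<phi>"
  shows "mk \<phi> \<in> Hom"
  unfolding Mo_Hom_def kQ_Hom_def
proof (intro CollectI conjI ballI allI impI)
  fix a assume a: "a \<in> verts Q"
  have "\<phi> (j, i) = 0" if "i \<in> over a" "\<not> (j \<in> Y.V \<and> Y.G j = a)" for j i
    using that by (intro flat_outside[OF f]) (auto simp: VP_iff)
  thus "mk \<phi> a ` space X.M a \<subseteq> space Y.M a"
    by (fastforce simp: mk_def Y.space_M intro!: sum.neutral)
  show "linear_on (fscale sX) (fscale sY) (space X.M a) (mk \<phi> a)"
    unfolding linear_on_def
  proof (intro conjI ballI allI ext)
    fix u w j assume "u \<in> space X.M a" "w \<in> space X.M a"
    thus "mk \<phi> a (u + w) j = (mk \<phi> a u + mk \<phi> a w) j"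
      using a by (simp add: mk_def space_closed linearD[OF flat_linear'[OF f]] sum.distrib)
  next
    fix c u j assume "u \<in> space X.M a"
    hence "mk \<phi> a (fscale sX c u) j = (\<Sum>i\<in>over a. \<phi> (j, i) (sX c (u i)))"
      using a by (simp add: mk_def space_closed) (simp add: fscale_def)
    thus "mk \<phi> a (fscale sX c u) j = fscale sY c (mk \<phi> a u) j"
      using a \<open>u \<in> _\<close> by (simp add: mk_def fscale_def linearD[OF flat_linear'[OF f]] Y.scale_sum_right)
  qed
next
  fix a m assume "a \<notin> verts Q \<or> m \<notin> space X.M a"
  thus "mk \<phi> a m = 0" by (auto simp: mk_def fun_eq_iff)
next
  fix \<alpha> m assume \<alpha>: "\<alpha> \<in> arrows Q" and m: "m \<in> space X.M (fst (src Q \<alpha>))"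
  let ?a = "fst (src Q \<alpha>)" and ?b = "fst (tgt Q \<alpha>)" and ?\<sigma> = "snd (src Q \<alpha>)" and ?\<tau> = "snd (tgt Q \<alpha>)"
  have ab: "?a \<in> verts Q" "?b \<in> verts Q" using X.arrow_verts[OF \<alpha>] by auto
  have am: "act X.M \<alpha> m \<in> space X.M ?b" using X.kQ_rep_M \<alpha> m unfolding kQ_rep_def by blast
  show "mk \<phi> ?b (act X.M \<alpha> m) = act Y.M \<alpha> (mk \<phi> ?a m)"
  proof
    fix j
    show "mk \<phi> ?b (act X.M \<alpha> m) j = act Y.M \<alpha> (mk \<phi> ?a m) j"
    proof (cases "j \<in> Y.V \<and> Y.G j = ?b")
      case False
      hence "\<phi> (j, i) = 0" if "i \<in> over ?b" for i
        using that by (intro flat_outside[OF f]) (auto simp: VP_iff)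
      moreover have "\<not> Y.entering \<alpha> (j, ?\<tau>)" using False by (auto simp: Y.entering_def prod_eq_iff)
      ultimately show ?thesis by (simp add: mk_def Y.act_M[OF \<alpha>] Let_def)
    next
      case True
      let ?q = "(j, ?\<tau>)"
      have com: "commutes \<phi> \<alpha> (i, ?\<sigma>) ?q" if "i \<in> over ?a" for i
        using that True \<alpha> by (intro flat_imp_commutes[OF f]) (auto simp: prod_eq_iff)
      \<comment> \<open>Lets the element be split into its components, after which both sides are
        sums over columns that agree column by column.\<close>
      have add: "additive (act X.M \<alpha>)"
      proof (unfold_locales, rule ext)
        fix u w l
        have "(X.cu (X.oe p) :: 'k alg_elt) \<in> carrier (kalg X.K)" if "X.entering \<alpha> p" for p
          using X.entering_oe[OF \<alpha> that] that by (intro X.cu_carrier) (auto simp: X.live_oe X.entering_def)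
        thus "act X.M \<alpha> (u + w) l = (act X.M \<alpha> u + act X.M \<alpha> w) l" by (simp add: X.act_M[OF \<alpha>] Let_def X.act_plus)
      qed
      have "m = (\<Sum>i\<in>over ?a. single i (m i))" using m X.finite_V by (auto simp: sum_apply X.space_M fun_eq_iff)
      from trans[OF arg_cong[OF this, of "act X.M \<alpha>"] additive.sum[OF add]]
      have act: "act X.M \<alpha> m = (\<Sum>i\<in>over ?a. act X.M \<alpha> (single i (m i)))" .
      have "mk \<phi> ?b (act X.M \<alpha> m) j = (\<Sum>i'\<in>over ?b. \<phi> (j, i') (act X.M \<alpha> m i'))"
        using ab am by (simp add: mk_def)
      also have "\<dots> = (\<Sum>i\<in>over ?a. \<Sum>i'\<in>over ?b. \<phi> (j, i') (act X.M \<alpha> (single i (m i)) i'))"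
        unfolding act sum_apply linear_sum[OF flat_linear'[OF f]] by (rule sum.swap)
      also have "\<dots> = (\<Sum>i\<in>over ?a. if X.entering \<alpha> (X.oe (i, ?\<sigma>)) then \<phi> (j, fst (X.oe (i, ?\<sigma>))) (\<rho>X (X.cu (i, ?\<sigma>)) (m i)) else 0)"
      proof (intro sum.cong refl)
        fix i assume i: "i \<in> over ?a"
        have s: "act X.M \<alpha> (single i (m i)) = (if X.entering \<alpha> (X.oe (i, ?\<sigma>)) then single (fst (X.oe (i, ?\<sigma>))) (\<rho>X (X.cu (i, ?\<sigma>)) (m i)) else 0)"
          using act_single[OF \<alpha>, of "(i, ?\<sigma>)"] i by (simp add: prod_eq_iff)
        have "\<phi> (j, i') (single k u i') = (if i' = k then \<phi> (j, k) u else 0)" for i' k u by (simp add: linearD(3)[OF flat_linear'[OF f]])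
        thus "(\<Sum>i'\<in>over ?b. \<phi> (j, i') (act X.M \<alpha> (single i (m i)) i')) =
          (if X.entering \<alpha> (X.oe (i, ?\<sigma>)) then \<phi> (j, fst (X.oe (i, ?\<sigma>))) (\<rho>X (X.cu (i, ?\<sigma>)) (m i)) else 0)"
          unfolding s using X.finite_V by (auto simp: X.entering_def linearD(3)[OF flat_linear'[OF f]])
      qed
      also have "\<dots> = (\<Sum>i\<in>over ?a. if Y.entering \<alpha> ?q then \<rho>Y (Y.cu (Y.oe ?q)) (\<phi> (fst (Y.oe ?q), i) (m i)) else 0)"
      proof (intro sum.cong refl)
        fix i assume "i \<in> over ?a"
        from com[OF this, unfolded commutes_def fst_conv, rule_format, of "m i"]
        show "(if X.entering \<alpha> (X.oe (i, ?\<sigma>)) then \<phi> (j, fst (X.oe (i, ?\<sigma>))) (\<rho>X (X.cu (i, ?\<sigma>)) (m i)) else 0) =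
          (if Y.entering \<alpha> ?q then \<rho>Y (Y.cu (Y.oe ?q)) (\<phi> (fst (Y.oe ?q), i) (m i)) else 0)" .
      qed
      also have "\<dots> = act Y.M \<alpha> (mk \<phi> ?a m) j"
      proof (cases "Y.entering \<alpha> ?q")
        case True
        have "(Y.cu (Y.oe ?q) :: 'k alg_elt) \<in> carrier (kalg Y.K)"
          using Y.entering_oe[OF \<alpha> True] True by (intro Y.cu_carrier) (auto simp: Y.live_oe Y.entering_def)
        hence a: "\<rho>Y (Y.cu (Y.oe ?q)) (u + w) = \<rho>Y (Y.cu (Y.oe ?q)) u + \<rho>Y (Y.cu (Y.oe ?q)) w" "\<rho>Y (Y.cu (Y.oe ?q)) 0 = 0" for u w
          by (simp_all add: Y.act_plus Y.act_zero)
        have "\<rho>Y (Y.cu (Y.oe ?q)) (\<Sum>i\<in>A. u i) = (\<Sum>i\<in>A. \<rho>Y (Y.cu (Y.oe ?q)) (u i))" for A :: "nat set" and u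
          by (induction A rule: infinite_finite_induct) (simp_all add: a)
        thus ?thesis using True ab m by (simp add: Y.act_M[OF \<alpha>] Let_def mk_def)
      qed (simp add: Y.act_M[OF \<alpha>] Let_def)
      finally show ?thesis .
    qed
  qed
qed

lemma blk_mk:
  assumes f: "flat \<phi>"
  shows "blk (mk \<phi>) = \<phi>"
proof (intro ext)
  fix v :: "nat \<times> nat" and u
  obtain j i where v: "v = (j, i)" by fastforce
  show "blk (mk \<phi>) v u = \<phi> v u"
  proof (cases "v \<in> VP")
    case True
    hence i: "i \<in> X.V" using v by (simp add: VP_iff)
    have "blk (mk \<phi>) v u = (\<Sum>i'\<in>over (X.G i). \<phi> (j, i') (single i u i'))"
      using True v single_space[OF i] X_G_verts[OF i] by (simp add: blk_def block_def mk_def)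
    also have "\<dots> = (\<Sum>i'\<in>over (X.G i). if i' = i then \<phi> (j, i) u else 0)"
      by (intro sum.cong) (auto simp: linearD(3)[OF flat_linear'[OF f]])
    also have "\<dots> = \<phi> v u" using i v X.finite_V by simp
    finally show ?thesis .
  qed (use f in \<open>simp add: blk_def flat_outside\<close>)
qed

end

section \<open>Graphs in which every vertex has at most two half-edges\<close>

text \<open>Each vertex has two potential half-edges, one for each polarity; \<open>on\<close> marks
  those that carry an edge, and \<open>oe\<close> exchanges the halves of an edge. A loop occupies a
  single half-edge, fixed by \<open>oe\<close>. In this form a component can only be a path,
  possibly with loops at its ends, or a cycle.\<close>

locale half_edge_graph =
  fixes V :: "'w set" and on :: "'w \<times> polarity \<Rightarrow> bool" and oe :: "'w \<times> polarity \<Rightarrow> 'w \<times> polarity"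
    and ed :: "'w \<times> polarity \<Rightarrow> 'e" and s t :: "'e \<Rightarrow> 'w" and E :: "'e set"
  assumes finite: "finite V" and on_V: "on h \<Longrightarrow> fst h \<in> V"
    and on_other: "on h \<Longrightarrow> on (oe h)" and oe_oe: "on h \<Longrightarrow> oe (oe h) = h"
    and fst_oe: "on h \<Longrightarrow> fst (oe h) = fst h \<Longrightarrow> oe h = h"
    and edges: "E = ed ` {h. on h}" and ends: "on h \<Longrightarrow> {s (ed h), t (ed h)} = {fst h, fst (oe h)}"
    and ed_eq: "on h \<Longrightarrow> on h' \<Longrightarrow> ed h = ed h' \<longleftrightarrow> h' = h \<or> h' = oe h"
begin

text \<open>The walk is reflected at loops and at half-edges without an edge, so that it is invertible.\<close>

definition step :: "'w \<times> polarity \<Rightarrow> 'w \<times> polarity" where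
  "step h = (if on h then opp (oe h) else opp h)"

abbreviation W :: "'w \<times> polarity \<Rightarrow> nat \<Rightarrow> 'w \<times> polarity" where "W h k \<equiv> (step ^^ k) h"

definition reflecting :: "'w \<times> polarity \<Rightarrow> bool" where
  "reflecting h \<longleftrightarrow> step h = opp h"

lemma reflecting_iff: "reflecting h \<longleftrightarrow> (on h \<longrightarrow> oe h = h)"
  by (auto simp: reflecting_def step_def)

text \<open>Turning round conjugates the walk into its inverse. This gives injectivity of the step
  and, there being finitely many half-edges, periodicity.\<close>

lemma step_opp_step: "step (opp (step h)) = opp h"
  by (simp add: step_def on_other oe_oe)

lemma inj_step: "inj step"
  by (rule injI) (metis opp_eq_iff step_opp_step)

lemma W_Suc: "W h (Suc k) = step (W h k)" "W h (Suc k) = W (step h) k"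
  by (simp, simp add: funpow_swap1)

lemma W_add: "W (W h a) b = W h (a + b)"
  by (metis add.commute comp_apply funpow_add)

lemma W_opp: "j \<le> k \<Longrightarrow> W (opp (W h k)) j = opp (W h (k - j))"
proof (induction j)
  case (Suc j)
  have "W h (k - j) = step (W h (k - Suc j))"
    using Suc.prems by (metis Suc_diff_Suc Suc_le_lessD W_Suc(1))
  thus ?case using Suc by (simp add: step_opp_step)
qed simp

lemma fst_step: "fst h \<in> V \<Longrightarrow> fst (step h) \<in> V"
  using on_V on_other by (auto simp: step_def)

lemma fst_W: "fst h \<in> V \<Longrightarrow> fst (W h k) \<in> V"
  by (induction k) (auto simp: fst_step)

lemma periodic: assumes "fst h \<in> V" shows "\<exists>p>0. W h p = h"
proof -
  have "{y. \<exists>n. y = W h n} \<subseteq> V \<times> UNIV" using fst_W[OF assms] by (auto simp: mem_Times_iff simp del: split_paired_All)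
      (metis fst_conv)
  moreover have "finite (V \<times> (UNIV :: polarity set))"
  proof -
    have "(UNIV :: polarity set) = {Neg, Pos}" using polarity.exhaust by auto
    thus ?thesis using finite by (metis finite.emptyI finite.insertI finite_cartesian_product)
  qed
  ultimately have "Finite_Set.finite {y. \<exists>n. y = W h n}" by (rule finite_subset)
  thus ?thesis using funpow_inj_finite[OF inj_step] by metis
qed

lemma edge_relation: "{(u, v). \<exists>e\<in>E. {s e, t e} = {u, v}} = {(fst h, fst (oe h)) |h. on h}"
proof (intro equalityI subsetI)
  fix p assume "p \<in> {(u, v). \<exists>e\<in>E. {s e, t e} = {u, v}}"
  then obtain h where h: "on h" "{s (ed h), t (ed h)} = {fst p, snd p}" by (auto simp: edges)
  hence "p = (fst h, fst (oe h)) \<or> p = (fst (oe h), fst (oe (oe h)))"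
    using ends[OF h(1)] oe_oe[OF h(1)] by (auto simp: prod_eq_iff doubleton_eq_iff)
  thus "p \<in> {(fst h, fst (oe h)) |h. on h}" using h on_other by blast
qed (use edges ends in auto)

section \<open>Connected components\<close>

definition compo :: "'w \<Rightarrow> 'w set" where
  "compo u = {v. (u, v) \<in> connected s t E}"

definition closed :: "'w set \<Rightarrow> bool" where
  "closed S \<longleftrightarrow> (\<forall>h. on h \<longrightarrow> fst h \<in> S \<longrightarrow> fst (oe h) \<in> S)"

lemma comp_refl: "u \<in> compo u"
  by (simp add: compo_def connected_def)

lemma comp_on: "v \<in> compo u \<Longrightarrow> on h \<Longrightarrow> fst h = v \<Longrightarrow> fst (oe h) \<in> compo u"
  unfolding compo_def connected_def edge_relation mem_Collect_eq by (blast intro: rtrancl_into_rtrancl)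

lemma closed_comp: "closed (compo u)"
  using comp_on by (auto simp: closed_def)

lemma comp_least: "closed S \<Longrightarrow> u \<in> S \<Longrightarrow> compo u \<subseteq> S"
proof
  fix v assume S: "closed S" "u \<in> S" and "v \<in> compo u"
  hence "(u, v) \<in> {(fst h, fst (oe h)) |h. on h}\<^sup>*" by (simp add: compo_def connected_def edge_relation)
  thus "v \<in> S" by induction (use S in \<open>auto simp: closed_def\<close>)
qed

lemma comp_sym: "v \<in> compo u \<Longrightarrow> u \<in> compo v"
proof -
  have "sym {(fst h, fst (oe h)) |h. on h}"
  proof (rule symI)
    fix a b assume "(a, b) \<in> {(fst h, fst (oe h)) |h. on h}"
    then obtain h where "on h" "a = fst h" "b = fst (oe h)" by auto
    hence "on (oe h) \<and> b = fst (oe h) \<and> a = fst (oe (oe h))" by (simp add: on_other oe_oe)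
    thus "(b, a) \<in> {(fst h, fst (oe h)) |h. on h}" by blast
  qed
  hence "sym ({(fst h, fst (oe h)) |h. on h}\<^sup>*)" by (rule sym_rtrancl)
  thus "v \<in> compo u \<Longrightarrow> u \<in> compo v" by (auto simp: compo_def connected_def edge_relation dest: symD)
qed

lemma comp_eq: "v \<in> compo u \<Longrightarrow> compo v = compo u"
  using comp_least[OF closed_comp] comp_sym by blast

lemma comp_V: "u \<in> V \<Longrightarrow> compo u \<subseteq> V"
  by (rule comp_least) (auto simp: closed_def dest: on_other on_V)

definition edges_of :: "'w set \<Rightarrow> 'e set" where
  "edges_of C = {e \<in> E. s e \<in> C}"

lemma edges_of_comp: "edges_of (compo u) = ed ` {h. on h \<and> fst h \<in> compo u}"
proof (intro equalityI subsetI)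
  fix e assume "e \<in> edges_of (compo u)"
  hence "e \<in> E" "s e \<in> compo u" by (auto simp: edges_of_def)
  then obtain h where h: "on h" "e = ed h" "s e \<in> compo u" unfolding edges by blast
  hence "s e = fst h \<or> s e = fst (oe h)" using ends[OF h(1)] by blast
  thus "e \<in> ed ` {h. on h \<and> fst h \<in> compo u}"
  proof
    assume "s e = fst (oe h)"
    moreover have "ed (oe h) = ed h" using ed_eq[OF h(1) on_other[OF h(1)]] by simp
    ultimately show ?thesis using h on_other[OF h(1)] by (intro image_eqI[of _ _ "oe h"]) auto
  qed (use h in auto)
next
  fix e assume "e \<in> ed ` {h. on h \<and> fst h \<in> compo u}"
  then obtain h where h: "on h" "e = ed h" "fst h \<in> compo u" by auto
  hence "fst (oe h) \<in> compo u" using comp_on by blast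
  moreover have "s e = fst h \<or> s e = fst (oe h)" using ends[OF h(1)] h(2) by blast
  moreover have "e \<in> E" using h unfolding edges by blast
  ultimately show "e \<in> edges_of (compo u)" using h unfolding edges_of_def by auto
qed

lemma components_eq: "components s t V E = {(compo u, edges_of (compo u)) |u. u \<in> V}"
  by (auto simp: components_def compo_def edges_of_def)

text \<open>The vertices so reached form a closed set: at the end of a walk one half-edge prolongs
  it and the other leads back one step; at \<open>u\<close> itself the other half-edge starts the
  walk in the other direction.\<close>

lemma comp_walk:
  assumes "v \<in> compo u"
  obtains \<rho> k where "v = fst (W (u, \<rho>) k)" "\<And>i. i < k \<Longrightarrow> on (W (u, \<rho>) i)"
proof -
  let ?S = "{fst (W (u, \<rho>) k) |\<rho> k. \<forall>i<k. on (W (u, \<rho>) i)}"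
  have "closed ?S"
    unfolding closed_def
  proof (intro allI impI)
    fix h assume h: "on h" "fst h \<in> ?S"
    then obtain \<rho> k where k: "fst h = fst (W (u, \<rho>) k)" "\<forall>i<k. on (W (u, \<rho>) i)" by auto
    then consider "h = W (u, \<rho>) k" | "h = opp (W (u, \<rho>) k)"
      using polarity_cases[of h "W (u, \<rho>) k"] by auto
    thus "fst (oe h) \<in> ?S"
    proof cases
      case 1
      hence "fst (oe h) = fst (W (u, \<rho>) (Suc k))" using h by (simp add: step_def)
      moreover have "\<forall>i<Suc k. on (W (u, \<rho>) i)" using k 1 h by (auto simp: less_Suc_eq)
      ultimately show ?thesis by blast
    next
      case 2
      show ?thesis
      proof (cases k)
        case 0
        hence "fst (oe h) = fst (W (u, snd h) 1)" using 2 h by (cases \<rho>) (auto simp: step_def)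
        moreover have "\<forall>i<1. on (W (u, snd h) i)" using 0 2 h by (cases \<rho>) auto
        ultimately show ?thesis by blast
      next
        case (Suc k')
        hence o: "on (W (u, \<rho>) k')" using k by auto
        hence "h = oe (W (u, \<rho>) k')" using 2 Suc by (simp add: step_def)
        hence "fst (oe h) = fst (W (u, \<rho>) k')" using oe_oe[OF o] by simp
        moreover have "\<forall>i<k'. on (W (u, \<rho>) i)" using k Suc by auto
        ultimately show ?thesis by blast
      qed
    qed
  qed
  moreover have "u \<in> ?S" by (rule CollectI, rule exI[of _ Pos], rule exI[of _ 0]) simp
  ultimately show thesis using comp_least[of ?S u] assms that by blast
qed

text \<open>A walk that comes back reversed retraces its steps, so removing its first and last step
  leaves a shorter walk of the same kind. In the middle there is a reflection.\<close>

lemma W_eq_opp: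
  assumes "W h d = opp h" shows "\<exists>c<d. reflecting (W h c)"
  using assms
proof (induction d arbitrary: h rule: less_induct)
  case (less d)
  consider "d = 0" | "d = 1" | d' where "d = Suc (Suc d')"
    by (metis One_nat_def not0_implies_Suc)
  thus ?case
  proof cases
    case 3
    have "step (W h (Suc d')) = step (opp (step h))" using less.prems 3 by (simp add: step_opp_step)
    hence "W h (Suc d') = opp (step h)" using inj_step by (auto dest: injD)
    hence "W (step h) d' = opp (step h)" by (simp add: funpow_swap1)
    then obtain c where "c < d'" "reflecting (W (step h) c)" using less.IH[of d' "step h"] 3 by auto
    thus ?thesis using 3 by (intro exI[of _ "Suc c"]) (simp add: funpow_swap1)
  qed (use less.prems in \<open>auto simp: reflecting_def\<close>)
qed

text \<open>From the first vertex \<open>h\<close> looks into the path; the outer half-edges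
  \<open>opp h\<close> and \<open>W h m\<close> carry either no edge or a loop.\<close>

definition line :: "'w \<times> polarity \<Rightarrow> nat \<Rightarrow> bool" where
  "line h m \<longleftrightarrow> fst h \<in> V \<and> reflecting (opp h) \<and> reflecting (W h m) \<and> (\<forall>k<m. \<not> reflecting (W h k))"

definition cycle :: "'w \<times> polarity \<Rightarrow> nat \<Rightarrow> bool" where
  "cycle h p \<longleftrightarrow> fst h \<in> V \<and> p > 0 \<and> W h p = h \<and> (\<forall>k. \<not> reflecting (W h k)) \<and> (\<forall>k. 0 < k \<longrightarrow> k < p \<longrightarrow> W h k \<noteq> h)"

lemma not_reflecting_on: "\<not> reflecting h \<Longrightarrow> on h \<and> oe h = opp (step h) \<and> oe h \<noteq> h"
  by (auto simp: reflecting_iff step_def)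

text \<open>Two passages through a vertex in the same direction would bring the final reflection
  forward; two passages in opposite directions enclose a reflection.\<close>

lemma line_distinct: "line h m \<Longrightarrow> a < b \<Longrightarrow> b \<le> m \<Longrightarrow> fst (W h a) \<noteq> fst (W h b)"
proof
  assume l: "line h m" "a < b" "b \<le> m" and eq: "fst (W h a) = fst (W h b)"
  then consider "W h b = W h a" | "W h b = opp (W h a)"
    using polarity_cases[of "W h b" "W h a"] by auto
  thus False
  proof cases
    case 1
    have "W h m = W (W h b) (m - b)" using l by (simp add: W_add)
    also have "\<dots> = W h (a + (m - b))" by (simp add: 1 W_add)
    finally have "reflecting (W h (a + (m - b)))" using l by (simp add: line_def)
    thus False using l by (simp add: line_def)
  next
    case 2
    have "W (W h a) (b - a) = opp (W h a)" using l 2 by (simp add: W_add)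
    then obtain c where "c < b - a" "reflecting (W (W h a) c)" using W_eq_opp by blast
    thus False using l by (auto simp: line_def W_add)
  qed
qed

lemma cycle_distinct: "cycle h p \<Longrightarrow> a < b \<Longrightarrow> b < p \<Longrightarrow> fst (W h a) \<noteq> fst (W h b)"
proof
  assume l: "cycle h p" "a < b" "b < p" and eq: "fst (W h a) = fst (W h b)"
  then consider "W h b = W h a" | "W h b = opp (W h a)"
    using polarity_cases[of "W h b" "W h a"] by auto
  thus False
  proof cases
    case 1
    have "W (W h b) (p - b) = h" using l by (simp add: W_add cycle_def)
    hence "W h (a + (p - b)) = h" by (simp add: 1 W_add)
    thus False using l by (simp add: cycle_def)
  next
    case 2
    have "W (W h a) (b - a) = opp (W h a)" using l 2 by (simp add: W_add)
    then obtain c where "c < b - a" "reflecting (W (W h a) c)" using W_eq_opp by blast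
    thus False using l by (auto simp: cycle_def W_add)
  qed
qed

lemma W_comp: "fst h = u \<Longrightarrow> fst (W h k) \<in> compo u"
proof (induction k)
  case (Suc k)
  have "fst (step g) = fst (oe g) \<or> fst (step g) = fst g" "\<not> on g \<Longrightarrow> fst (step g) = fst g" for g by (auto simp: step_def)
  thus ?case using comp_on[of "fst (W h k)" u "W h k"] Suc by (metis W_Suc(1))
qed (use comp_refl in auto)

lemma line_comp:
  assumes l: "line h m" shows "compo (fst h) = {fst (W h k) |k. k \<le> m}"
proof
  have "closed {fst (W h k) |k. k \<le> m}"
    unfolding closed_def
  proof (intro allI impI)
    fix g assume g: "on g" "fst g \<in> {fst (W h k) |k. k \<le> m}"
    then obtain k where k: "k \<le> m" "fst g = fst (W h k)" by auto
    then consider "g = W h k" | "g = opp (W h k)" using polarity_cases[of g "W h k"] by auto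
    thus "fst (oe g) \<in> {fst (W h k) |k. k \<le> m}"
    proof cases
      case 1
      show ?thesis
      proof (cases "k = m")
        case True
        hence "oe g = g" using 1 g l by (simp add: line_def reflecting_iff)
        thus ?thesis using g by simp
      next
        case False
        hence "fst (oe g) = fst (W h (Suc k))" "Suc k \<le> m" using 1 g k by (auto simp: step_def)
        thus ?thesis by blast
      qed
    next
      case 2
      show ?thesis
      proof (cases k)
        case 0
        hence "oe g = g" using 2 g l by (simp add: line_def reflecting_iff)
        thus ?thesis using g by simp
      next
        case (Suc k')
        hence o: "on (W h k') \<and> oe (W h k') = g" using l k 2 not_reflecting_on[of "W h k'"] by (simp add: line_def)
        hence "fst (oe g) = fst (W h k')" using oe_oe[of "W h k'"] by auto
        thus ?thesis using k Suc by (intro CollectI exI[of _ k']) simp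
      qed
    qed
  qed
  thus "compo (fst h) \<subseteq> {fst (W h k) |k. k \<le> m}"
    by (rule comp_least) (auto intro: exI[of _ 0])
qed (use W_comp[OF refl] in blast)

lemma cycle_on: "cycle h p \<Longrightarrow> fst g = fst (W h k) \<Longrightarrow> on g \<and> oe g \<noteq> g"
proof -
  assume c: "cycle h p" and g: "fst g = fst (W h k)"
  then consider "g = W h k" | "g = opp (W h k)" using polarity_cases[of g "W h k"] by auto
  thus ?thesis
  proof cases
    case 1
    thus ?thesis using c not_reflecting_on[of g] by (metis cycle_def)
  next
    case 2
    \<comment> \<open>Adding a period provides a predecessor even if \<open>k\<close> is 0.\<close>
    have "W h (k + p) = W h k" using c by (metis W_add add.commute cycle_def)
    hence "g = opp (W h (Suc (k + p - 1)))" using c 2 by (simp add: cycle_def)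
    hence "on (W h (k + p - 1)) \<and> oe (W h (k + p - 1)) = g \<and> oe (W h (k + p - 1)) \<noteq> W h (k + p - 1)"
      using c not_reflecting_on[of "W h (k + p - 1)"] by (metis W_Suc(1) cycle_def)
    thus ?thesis using on_other oe_oe by metis
  qed
qed

lemma cycle_comp:
  assumes l: "cycle h p" shows "compo (fst h) = {fst (W h k) |k. k < p}"
proof
  have all: "fst (W h k) \<in> {fst (W h k) |k. k < p}" for k
  proof (induction k rule: less_induct)
    case (less k)
    show ?case
    proof (cases "k < p")
      case False
      have "W h k = W (W h p) (k - p)" using False by (simp add: W_add)
      hence "W h k = W h (k - p)" using l by (simp add: cycle_def)
      thus ?thesis using less[of "k - p"] False l by (simp add: cycle_def)
    qed auto
  qed
  have "closed {fst (W h k) |k. k < p}"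
    unfolding closed_def
  proof (intro allI impI)
    fix g assume g: "on g" "fst g \<in> {fst (W h k) |k. k < p}"
    then obtain k where k: "fst g = fst (W h k)" by auto
    then consider "g = W h k" | "g = opp (W h k)" using polarity_cases[of g "W h k"] by auto
    thus "fst (oe g) \<in> {fst (W h k) |k. k < p}"
    proof cases
      case 1
      hence "fst (oe g) = fst (W h (Suc k))" using g by (simp add: step_def)
      thus ?thesis using all[of "Suc k"] by simp
    next
      case 2
      have "W h (k + p) = W h k" using l by (metis W_add add.commute cycle_def)
      hence "g = opp (W h (Suc (k + p - 1)))" using l 2 by (simp add: cycle_def)
      hence "oe (W h (k + p - 1)) = g" "on (W h (k + p - 1))"
        using l not_reflecting_on[of "W h (k + p - 1)"] by (auto simp: cycle_def)
      hence "oe g = W h (k + p - 1)" using oe_oe by metis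
      thus ?thesis using all[of "k + p - 1"] by simp
    qed
  qed
  thus "compo (fst h) \<subseteq> {fst (W h k) |k. k < p}"
    using l by (intro comp_least) (auto simp: cycle_def intro!: exI[of _ 0])
qed (use W_comp[OF refl] in blast)

lemma cycle_ge2: "cycle h p \<Longrightarrow> p \<ge> 2"
proof -
  assume c: "cycle h p"
  have "p \<noteq> 1"
  proof
    assume "p = 1"
    hence "step h = h" "on h" using c not_reflecting_on[of "W h 0"] by (auto simp: cycle_def) (metis funpow_0)
    hence "opp (oe h) = h" by (simp add: step_def)
    hence "oe h = opp h" by (metis polarity_swap)
    thus False using fst_oe[OF \<open>on h\<close>] by (metis fst_opp opp_neq(1))
  qed
  thus ?thesis using c by (simp add: cycle_def)
qed

lemma cycleI:
  assumes "fst h \<in> V" "\<And>k. \<not> reflecting (W h k)"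
  shows "\<exists>p. cycle h p"
proof -
  have ex: "\<exists>p>0. W h p = h" using periodic[OF assms(1)] .
  define p where "p = (LEAST p. p > 0 \<and> W h p = h)"
  have p: "p > 0 \<and> W h p = h" unfolding p_def by (rule LeastI_ex) (use ex in auto)
  have "W h k \<noteq> h" if "0 < k" "k < p" for k
    using not_less_Least[of k "\<lambda>p. p > 0 \<and> W h p = h"] that by (auto simp: p_def)
  thus ?thesis using p assms by (auto simp: cycle_def)
qed

text \<open>The walk is periodic, and since the step is injective it can return to \<open>h\<close>
  only from \<open>opp h\<close>, which is reflecting. So a reflection is met.\<close>

lemma lineI:
  assumes "fst h \<in> V" "reflecting (opp h)"
  shows "\<exists>m. line h m"
proof -
  obtain p where p: "p > 0" "W h p = h" using periodic[OF assms(1)] by auto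
  hence "step (W h (p - 1)) = step (opp h)" using assms(2)
    by (metis Suc_diff_1 W_Suc(1) polarity_swap reflecting_def)
  hence "W h (p - 1) = opp h" using inj_step by (auto dest: injD)
  hence ex: "\<exists>m. reflecting (W h m)" using assms(2) by metis
  define m where "m = (LEAST m. reflecting (W h m))"
  have "reflecting (W h m)" unfolding m_def by (rule LeastI_ex) (rule ex)
  moreover have "\<not> reflecting (W h k)" if "k < m" for k
    using not_less_Least that by (auto simp: m_def)
  ultimately show ?thesis using assms by (auto simp: line_def)
qed

text \<open>If the walk meets a reflection, turning round there gives the beginning of a
  line.\<close>

lemma line_or_cycle:
  assumes "u \<in> V"
  shows "(\<exists>h m. line h m \<and> fst h \<in> compo u) \<or> (\<exists>p. cycle (u, Pos) p)"
proof (cases "\<exists>k. reflecting (W (u, Pos) k)")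
  case True
  then obtain k where k: "reflecting (W (u, Pos) k)" by auto
  let ?h = "opp (W (u, Pos) k)"
  have "fst ?h \<in> V" "reflecting (opp ?h)" using fst_W[of "(u, Pos)" k] assms k by auto
  then obtain m where "line ?h m" using lineI by blast
  moreover have "fst ?h \<in> compo u" using W_comp[of "(u, Pos)" u k] by simp
  ultimately show ?thesis by blast
next
  case False
  thus ?thesis using cycleI[of "(u, Pos)"] assms by auto
qed

lemma line_reverse:
  assumes l: "line h m" shows "line (opp (W h m)) m" "W (opp (W h m)) m = opp h"
proof -
  show r: "W (opp (W h m)) m = opp h" by (simp add: W_opp)
  have "\<not> reflecting (W (opp (W h m)) k)" if k: "k < m" for k
  proof
    assume "reflecting (W (opp (W h m)) k)"
    hence "step (opp (W h (m - k))) = W h (m - k)" using k by (simp add: W_opp reflecting_def)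
    moreover have "W h (m - k) = step (W h (m - k - 1))" using k by (metis Suc_diff_1 W_Suc(1) zero_less_diff)
    ultimately have "reflecting (W h (m - k - 1))" by (metis opp_eq_iff polarity_swap reflecting_def step_opp_step)
    thus False using l k by (simp add: line_def)
  qed
  thus "line (opp (W h m)) m" using l r fst_W[of h m] by (simp add: line_def)
qed

section \<open>Loops, open ends and the type of a component\<close>

definition loops :: "'w set \<Rightarrow> ('w \<times> polarity) set" where
  "loops C = {h. fst h \<in> C \<and> on h \<and> oe h = h}"

definition allon :: "'w set \<Rightarrow> bool" where
  "allon C \<longleftrightarrow> (\<forall>h. fst h \<in> C \<longrightarrow> on h)"

lemma line_half_edges:
  assumes l: "line h m" and g: "fst g \<in> compo (fst h)" "on g"
  shows "(\<exists>k<m. g = W h k \<or> g = oe (W h k)) \<or> g = opp h \<and> oe g = g \<or> g = W h m \<and> oe g = g"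
proof -
  obtain k where k: "k \<le> m" "fst g = fst (W h k)" using g line_comp[OF l] by auto
  then consider "g = W h k" | "g = opp (W h k)" using polarity_cases[of g "W h k"] by auto
  thus ?thesis
  proof cases
    case 1
    show ?thesis
    proof (cases "k = m")
      case True
      thus ?thesis using 1 l g by (auto simp: line_def reflecting_iff)
    next
      case False
      hence "k < m" using k by simp
      thus ?thesis using 1 by blast
    qed
  next
    case 2
    show ?thesis
    proof (cases k)
      case 0
      thus ?thesis using 2 l g by (auto simp: line_def reflecting_iff)
    next
      case (Suc k')
      hence "oe (W h k') = g" using l k 2 not_reflecting_on[of "W h k'"] by (simp add: line_def)
      moreover have "k' < m" using k Suc by simp
      ultimately show ?thesis by blast
    qed
  qed
qed

lemma line_loops:
  assumes l: "line h m"
  shows "loops (compo (fst h)) = {g. (g = opp h \<or> g = W h m) \<and> on g}" "opp h \<noteq> W h m"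
proof -
  show "opp h \<noteq> W h m"
  proof (cases m)
    case (Suc m')
    thus ?thesis using line_distinct[OF l, of 0 m] by (metis fst_opp funpow_0 order_refl zero_less_Suc)
  qed simp
  have nr: "oe (W h k) \<noteq> W h k \<and> oe (oe (W h k)) \<noteq> oe (W h k)" if "k < m" for k
    using l that not_reflecting_on[of "W h k"] oe_oe[of "W h k"] by (auto simp: line_def)
  show "loops (compo (fst h)) = {g. (g = opp h \<or> g = W h m) \<and> on g}"
  proof (intro equalityI subsetI)
    fix g assume "g \<in> loops (compo (fst h))"
    thus "g \<in> {g. (g = opp h \<or> g = W h m) \<and> on g}"
      using line_half_edges[OF l, of g] nr by (auto simp: loops_def)
  next
    fix g assume "g \<in> {g. (g = opp h \<or> g = W h m) \<and> on g}"
    thus "g \<in> loops (compo (fst h))"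
      using l W_comp[of h "fst h" m] comp_refl by (auto simp: loops_def line_def reflecting_iff)
  qed
qed

lemma line_allon: "line h m \<Longrightarrow> allon (compo (fst h)) \<longleftrightarrow> on (opp h) \<and> on (W h m)"
proof -
  assume l: "line h m"
  show ?thesis
  proof
    assume "allon (compo (fst h))"
    thus "on (opp h) \<and> on (W h m)" using W_comp[of h "fst h" m] comp_refl by (metis allon_def fst_opp)
  next
    assume e: "on (opp h) \<and> on (W h m)"
    show "allon (compo (fst h))"
      unfolding allon_def
    proof (intro allI impI)
      fix g :: "'w \<times> polarity" assume "fst g \<in> compo (fst h)"
      then obtain k where k: "k \<le> m" "fst g = fst (W h k)" using line_comp[OF l] by auto
      then consider "g = W h k" | "g = opp (W h k)" using polarity_cases[of g "W h k"] by auto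
      thus "on g"
      proof cases
        case 1
        thus ?thesis using k l e not_reflecting_on[of "W h k"] by (cases "k = m") (auto simp: line_def)
      next
        case 2
        show ?thesis
        proof (cases k)
          case (Suc k')
          hence "oe (W h k') = g" "on (W h k')" using l k 2 not_reflecting_on[of "W h k'"] by (auto simp: line_def)
          thus ?thesis using on_other by metis
        qed (use 2 e in simp)
      qed
    qed
  qed
qed

lemma edge_loop_iff: "on h \<Longrightarrow> s (ed h) = t (ed h) \<longleftrightarrow> oe h = h"
  using ends[of h] fst_oe[of h] by (auto simp: doubleton_eq_iff)

lemma line_edges:
  assumes l: "line h m"
  shows "edges_of (compo (fst h)) = (\<lambda>k. ed (W h k)) ` {..<m} \<union> ed ` loops (compo (fst h))"
proof -
  have "ed ` {g. on g \<and> fst g \<in> compo (fst h)} = (\<lambda>k. ed (W h k)) ` {..<m} \<union> ed ` loops (compo (fst h))"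
  proof (intro equalityI subsetI)
    fix e assume "e \<in> ed ` {g. on g \<and> fst g \<in> compo (fst h)}"
    then obtain g where g: "on g" "fst g \<in> compo (fst h)" "e = ed g" by auto
    then consider k where "k < m" "g = W h k \<or> g = oe (W h k)" | "oe g = g"
      using line_half_edges[OF l] by blast
    thus "e \<in> (\<lambda>k. ed (W h k)) ` {..<m} \<union> ed ` loops (compo (fst h))"
    proof cases
      case 1
      hence "on (W h k)" using l not_reflecting_on by (auto simp: line_def)
      hence "ed g = ed (W h k)" using 1 ed_eq[OF g(1)] g oe_oe by metis
      thus ?thesis using g 1 by blast
    qed (use g in \<open>auto simp: loops_def\<close>)
  next
    fix e assume "e \<in> (\<lambda>k. ed (W h k)) ` {..<m} \<union> ed ` loops (compo (fst h))"
    then consider k where "k < m" "e = ed (W h k)" | g where "g \<in> loops (compo (fst h))" "e = ed g" by blast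
    thus "e \<in> ed ` {g. on g \<and> fst g \<in> compo (fst h)}"
    proof cases
      case 1
      hence "on (W h k)" using l not_reflecting_on[of "W h k"] by (simp add: line_def)
      thus ?thesis using 1 W_comp[of h "fst h" k] by (intro image_eqI[of _ _ "W h k"]) auto
    qed (auto simp: loops_def)
  qed
  thus ?thesis by (simp add: edges_of_comp)
qed

lemma line_nonloop: "line h m \<Longrightarrow> k < m \<Longrightarrow> on (W h k) \<and> oe (W h k) = opp (W h (Suc k)) \<and> oe (W h k) \<noteq> W h k"
  using not_reflecting_on[of "W h k"] unfolding line_def W_Suc(1) by metis

lemma line_path:
  assumes l: "line h m"
  shows "is_path s t (compo (fst h)) ((\<lambda>k. ed (W h k)) ` {..<m}) (map (\<lambda>k. fst (W h k)) [0..<Suc m])"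
  unfolding is_path_def
proof (intro conjI exI[of _ "map (\<lambda>k. ed (W h k)) [0..<m]"])
  show "distinct (map (\<lambda>k. fst (W h k)) [0..<Suc m])"
    unfolding distinct_map inj_on_def
    by (auto simp del: upt_Suc) (metis less_Suc_eq_le line_distinct[OF l] nat_neq_iff)
  show "set (map (\<lambda>k. fst (W h k)) [0..<Suc m]) = compo (fst h)"
    by (auto simp: line_comp[OF l] less_Suc_eq_le simp del: upt_Suc)
  have "ed (W h a) \<noteq> ed (W h b)" if ab: "a < b" "b < m" for a b
  proof
    assume "ed (W h a) = ed (W h b)"
    hence "W h b = W h a \<or> W h b = opp (W h (Suc a))"
      using ed_eq[of "W h a" "W h b"] line_nonloop[OF l] ab by auto
    hence "W h b = opp (W h (Suc a))" "fst (W h b) = fst (W h (Suc a))"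
      using line_distinct[OF l, of a b] ab by auto
    thus False using line_distinct[OF l, of "Suc a" b] ab by (cases "b = Suc a") auto
  qed
  thus "distinct (map (\<lambda>k. ed (W h k)) [0..<m])"
    unfolding distinct_map by (auto intro!: inj_onI) (metis nat_neq_iff)
  show "\<forall>k<length (map (\<lambda>k. ed (W h k)) [0..<m]).
       {s (map (\<lambda>k. ed (W h k)) [0..<m] ! k), t (map (\<lambda>k. ed (W h k)) [0..<m] ! k)} =
       {map (\<lambda>k. fst (W h k)) [0..<Suc m] ! k, map (\<lambda>k. fst (W h k)) [0..<Suc m] ! Suc k}"
    using line_nonloop[OF l] ends by (auto simp del: upt_Suc)
qed (auto simp del: upt_Suc)

lemma line_ltype:
  assumes l: "line h m"
  defines "C \<equiv> compo (fst h)"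
  shows "\<not> on (opp h) \<Longrightarrow> \<not> on (W h m) \<Longrightarrow> has_ltype s t (C, edges_of C) LA"
    "on (opp h) \<Longrightarrow> \<not> on (W h m) \<Longrightarrow> has_ltype s t (C, edges_of C) LD'"
    "on (opp h) \<Longrightarrow> on (W h m) \<Longrightarrow> has_ltype s t (C, edges_of C) LD'_tilde"
proof -
  let ?vs = "map (\<lambda>k. fst (W h k)) [0..<Suc m]" and ?P = "(\<lambda>k. ed (W h k)) ` {..<m}"
  have path: "is_path s t C ?P ?vs" unfolding C_def by (rule line_path[OF l])
  have E: "edges_of C = ?P \<union> ed ` {g. (g = opp h \<or> g = W h m) \<and> on g}"
    unfolding C_def line_edges[OF l] line_loops(1)[OF l] ..
  have hd: "hd ?vs = fst h" and last: "last ?vs = fst (W h m)" by (simp_all add: hd_map del: upt_Suc) simp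
  have st: "s (ed (opp h)) = fst h" "t (ed (opp h)) = fst h" if "on (opp h)"
    using ends[OF that] l that by (auto simp: line_def reflecting_iff)
  have st': "s (ed (W h m)) = fst (W h m)" "t (ed (W h m)) = fst (W h m)" if "on (W h m)"
    using ends[OF that] l that by (auto simp: line_def reflecting_iff)
  have nl: "s e \<noteq> t e" if e: "e \<in> ?P" for e
  proof -
    obtain k where k: "k < m" "e = ed (W h k)" using e by auto
    thus ?thesis using edge_loop_iff[of "W h k"] line_nonloop[OF l k(1)] by metis
  qed
  have n1: "ed (opp h) \<notin> ?P" if "on (opp h)" using nl st[OF that] by metis
  have n2: "ed (W h m) \<notin> ?P" if "on (W h m)" using nl st'[OF that] by metis
  {
    assume "\<not> on (opp h)" "\<not> on (W h m)"
    hence "edges_of C = ?P" using E by auto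
    thus "has_ltype s t (C, edges_of C) LA" using path by auto
  next
    assume a: "on (opp h)" "\<not> on (W h m)"
    hence "edges_of C = insert (ed (opp h)) ?P" using E by auto
    hence "edges_of C - {ed (opp h)} = ?P" "ed (opp h) \<in> edges_of C" using n1 a by auto
    thus "has_ltype s t (C, edges_of C) LD'" using path st[OF a(1)] hd by (metis has_ltype.simps(2))
  next
    assume a: "on (opp h)" "on (W h m)"
    hence "edges_of C = {ed (opp h), ed (W h m)} \<union> ?P" using E by auto
    hence "edges_of C - {ed (opp h), ed (W h m)} = ?P" "ed (opp h) \<in> edges_of C" "ed (W h m) \<in> edges_of C"
      using n1 n2 a by auto
    moreover have "ed (opp h) \<noteq> ed (W h m)"
    proof
      assume "ed (opp h) = ed (W h m)"
      moreover have "oe (opp h) = opp h" using a l by (simp add: line_def reflecting_iff)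
      ultimately show False using ed_eq[OF a] line_loops(2)[OF l] by auto
    qed
    ultimately show "has_ltype s t (C, edges_of C) LD'_tilde"
      using path st[OF a(1)] st'[OF a(2)] hd last by (metis has_ltype.simps(4))
  }
qed

lemma cycle_ltype:
  assumes c: "cycle h p"
  defines "C \<equiv> compo (fst h)"
  shows "has_ltype s t (C, edges_of C) LA_tilde"
proof -
  let ?vs = "map (\<lambda>k. fst (W h k)) [0..<p]" and ?es = "map (\<lambda>k. ed (W h k)) [0..<p]"
  have on: "on (W h k)" "oe (W h k) = opp (W h (Suc k))" for k
    using c not_reflecting_on[of "W h k"] by (auto simp: cycle_def)
  have Wp: "W h (k mod p) = W h k" for k
    using c by (metis cycle_def funpow_mod_eq)
  have C: "C = {fst (W h k) |k. k < p}" unfolding C_def by (rule cycle_comp[OF c])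
  have "is_cycle s t C (edges_of C) ?vs"
    unfolding is_cycle_def
  proof (intro conjI exI[of _ ?es])
    show "2 \<le> length ?vs" using cycle_ge2[OF c] by simp
    show "distinct ?vs"
      unfolding distinct_map by (auto intro!: inj_onI) (metis cycle_distinct[OF c] nat_neq_iff)
    show "set ?vs = C" by (auto simp: C)
    have "ed (W h a) \<noteq> ed (W h b)" if ab: "a < b" "b < p" for a b
    proof
      assume "ed (W h a) = ed (W h b)"
      hence "W h b = W h a \<or> W h b = opp (W h (Suc a))"
        using ed_eq[of "W h a" "W h b"] on by auto
      hence "W h b = opp (W h (Suc a))" "fst (W h b) = fst (W h (Suc a))"
        using cycle_distinct[OF c, of a b] ab by auto
      thus False using cycle_distinct[OF c, of "Suc a" b] ab by (cases "b = Suc a") auto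
    qed
    thus "distinct ?es"
      unfolding distinct_map by (auto intro!: inj_onI) (metis nat_neq_iff)
    show "set ?es = edges_of C"
    proof -
      have "ed ` {g. on g \<and> fst g \<in> C} \<subseteq> set ?es"
      proof
        fix e assume "e \<in> ed ` {g. on g \<and> fst g \<in> C}"
        then obtain g k where g: "on g" "e = ed g" "k < p" "fst g = fst (W h k)" by (auto simp: C)
        have k: "W h (k + p) = W h k" using c by (metis W_add add.commute cycle_def)
        consider "g = W h k" | "g = opp (W h k)" using polarity_cases[of g "W h k"] g by auto
        thus "e \<in> set ?es"
        proof cases
          case 2
          have "Suc (k + p - 1) = k + p" using c by (simp add: cycle_def)
          hence "g = oe (W h (k + p - 1))" using 2 k on(2)[of "k + p - 1"] by metis
          hence "ed g = ed (W h (k + p - 1))" using ed_eq[OF on(1)[of "k + p - 1"] g(1)] by simp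
          hence "e = ed (W h ((k + p - 1) mod p))" using g Wp by simp
          thus ?thesis using c by (auto simp: cycle_def)
        qed (use g in auto)
      qed
      moreover have "set ?es \<subseteq> ed ` {g. on g \<and> fst g \<in> C}"
      proof
        fix e assume "e \<in> set ?es"
        then obtain k where "k < p" "e = ed (W h k)" by auto
        thus "e \<in> ed ` {g. on g \<and> fst g \<in> C}"
          using on(1)[of k] C by (intro image_eqI[of _ _ "W h k"]) auto
      qed
      ultimately show ?thesis unfolding C_def edges_of_comp by blast
    qed
    show "\<forall>k<length ?es. {s (?es ! k), t (?es ! k)} = {?vs ! k, ?vs ! (Suc k mod length ?vs)}"
      using ends[OF on(1)] on(2) Wp[of "Suc _"] by (auto simp del: funpow.simps)
  qed simp
  thus ?thesis by auto
qed

end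

lemma path_card:
  assumes "is_path s t C E vs" shows "card C = Suc (card E) \<and> finite E \<and> (\<forall>e\<in>E. s e \<noteq> t e)"
proof -
  obtain es where vs: "distinct vs" "set vs = C" and es: "distinct es" "set es = E" "length vs = Suc (length es)"
    "\<And>k. k < length es \<Longrightarrow> {s (es ! k), t (es ! k)} = {vs ! k, vs ! Suc k}"
    using assms by (auto simp: is_path_def)
  have "s e \<noteq> t e" if e: "e \<in> E" for e
  proof -
    obtain k where k: "k < length es" "e = es ! k" using e es by (metis in_set_conv_nth)
    have "vs ! k \<noteq> vs ! Suc k" using vs k es by (simp add: nth_eq_iff_index_eq)
    thus ?thesis using es(4)[OF k(1)] k(2) by (metis doubleton_eq_iff)
  qed
  moreover have "card C = Suc (card E)" using vs es by (metis distinct_card)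
  ultimately show ?thesis using es by auto
qed

lemma cycle_card:
  assumes "is_cycle s t C E vs" shows "card C = card E \<and> finite E \<and> (\<forall>e\<in>E. s e \<noteq> t e)"
proof -
  obtain es where vs: "distinct vs" "set vs = C" "length vs \<ge> 2" and es: "distinct es" "set es = E" "length vs = length es"
    "\<And>k. k < length es \<Longrightarrow> {s (es ! k), t (es ! k)} = {vs ! k, vs ! (Suc k mod length vs)}"
    using assms by (auto simp: is_cycle_def)
  have "s e \<noteq> t e" if e: "e \<in> E" for e
  proof -
    obtain k where k: "k < length es" "e = es ! k" using e es by (metis in_set_conv_nth)
    have "Suc k mod length vs \<noteq> k" "Suc k mod length vs < length vs" using vs(3) k es(3) by (auto simp: mod_Suc)
    hence "vs ! k \<noteq> vs ! (Suc k mod length vs)" using vs k es by (metis nth_eq_iff_index_eq)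
    thus ?thesis using es(4)[OF k(1)] k(2) by (metis doubleton_eq_iff)
  qed
  moreover have "card C = card E" using vs es by (metis distinct_card)
  ultimately show ?thesis using es by auto
qed

text \<open>The number of loops separates the types with 0, 1 and 2 loops; without loops, the
  difference of the numbers of vertices and edges separates paths from cycles. This makes the
  description in \<open>ltype_of\<close> definite.\<close>

lemma has_ltype_unique:
  assumes "has_ltype s t (C, E) K" "has_ltype s t (C, E) K'"
  shows "K = K'"
proof -
  define n where "n = card {e \<in> E. s e = t e}"
  have *: "K = (if n = 0 then if card C = Suc (card E) then LA else LA_tilde else if n = 1 then LD' else LD'_tilde)"
    if K: "has_ltype s t (C, E) K" for K
  proof (cases K)
    case LA
    then obtain vs where "is_path s t C E vs" using K by auto
    hence "card C = Suc (card E)" "n = 0" using path_card[of s t C E vs] by (auto simp: n_def)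
    thus ?thesis using LA by simp
  next
    case LA_tilde
    then obtain vs where "is_cycle s t C E vs" using K by auto
    hence "card C = card E" "n = 0" using cycle_card[of s t C E vs] by (auto simp: n_def)
    thus ?thesis using LA_tilde by simp
  next
    case LD'
    then obtain vs l where l: "is_path s t C (E - {l}) vs" "l \<in> E" "s l = t l" using K by auto
    hence "{e \<in> E. s e = t e} = {l}" using path_card[OF l(1)] by auto
    thus ?thesis using LD' by (simp add: n_def)
  next
    case LD'_tilde
    then obtain vs l m where l: "is_path s t C (E - {l, m}) vs" "l \<in> E" "m \<in> E" "l \<noteq> m" "s l = t l" "s m = t m"
      using K by auto
    hence "{e \<in> E. s e = t e} = {l, m}" using path_card[OF l(1)] by auto
    thus ?thesis using LD'_tilde l by (simp add: n_def)
  qed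
  show ?thesis using *[OF assms(1)] *[OF assms(2)] by simp
qed

context half_edge_graph
begin

text \<open>Open ends and loops decide the type, so lines in two graphs can later be compared
  without exhibiting paths. \<open>LD'\<close> demands the loop at the head of the path; if it sits
  at the other end, the line is read backwards.\<close>

lemma ltype_comp:
  assumes u: "u \<in> V"
  shows "(THE K. has_ltype s t (compo u, edges_of (compo u)) K) =
    (if allon (compo u) then if loops (compo u) = {} then LA_tilde else LD'_tilde
     else if loops (compo u) = {} then LA else LD')" (is "_ = ?K")
proof (rule the_equality)
  show "has_ltype s t (compo u, edges_of (compo u)) ?K"
  proof (cases "\<exists>p. cycle (u, Pos) p")
    case True
    then obtain p where c: "cycle (u, Pos) p" by blast
    have C: "compo u = {fst (W (u, Pos) k) |k. k < p}" using cycle_comp[OF c] by simp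
    have "on g \<and> oe g \<noteq> g" if g: "fst g \<in> compo u" for g
    proof -
      obtain k where "fst g = fst (W (u, Pos) k)" using g C by auto
      thus ?thesis by (rule cycle_on[OF c])
    qed
    hence "allon (compo u)" "loops (compo u) = {}"
      unfolding allon_def loops_def by blast+
    thus ?thesis using cycle_ltype[OF c] by simp
  next
    case False
    then obtain h m where l: "line h m" "fst h \<in> compo u" using line_or_cycle[OF u] by blast
    have C: "compo u = compo (fst h)" using comp_eq[OF l(2)] by simp
    have l': "line (opp (W h m)) m" "W (opp (W h m)) m = opp h" using line_reverse[OF l(1)] by auto
    have C': "compo u = compo (fst (opp (W h m)))" using C comp_eq W_comp[of h "fst h" m] by simp
    note lt = line_ltype[OF l(1), folded C] and lt' = line_ltype(2)[OF l'(1), folded C', unfolded l'(2) polarity_swap]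
    note al = line_allon[OF l(1), folded C] and lo = line_loops(1)[OF l(1), folded C]
    have lo': "loops (compo u) = {} \<longleftrightarrow> \<not> on (opp h) \<and> \<not> on (W h m)" unfolding lo by blast
    show ?thesis unfolding al lo' using lt lt' by (cases "on (opp h)"; cases "on (W h m)") simp_all
  qed
  thus "\<And>K. has_ltype s t (compo u, edges_of (compo u)) K \<Longrightarrow> K = ?K"
    by (rule has_ltype_unique[rotated])
qed

end

section \<open>Sequences\<close>

text \<open>Words enter as infinite sequences of ranks, padded after their ends, so no clause for
  prefixes is needed.\<close>

definition seq_less :: "(nat \<Rightarrow> nat) \<Rightarrow> (nat \<Rightarrow> nat) \<Rightarrow> bool" where
  "seq_less u v \<longleftrightarrow> (\<exists>m. (\<forall>i<m. u i = v i) \<and> u m < v m)"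

definition seq_le :: "(nat \<Rightarrow> nat) \<Rightarrow> (nat \<Rightarrow> nat) \<Rightarrow> bool" where
  "seq_le u v \<longleftrightarrow> u = v \<or> seq_less u v"

lemma first_difference:
  assumes "(u :: nat \<Rightarrow> 'b) \<noteq> v" obtains m where "\<forall>i<m. u i = v i" "u m \<noteq> v m"
proof -
  obtain k where "u k \<noteq> v k" using assms by auto
  hence "u (LEAST k. u k \<noteq> v k) \<noteq> v (LEAST k. u k \<noteq> v k)" by (rule LeastI)
  thus thesis using not_less_Least[of _ "\<lambda>k. u k \<noteq> v k"] that by blast
qed

lemma seq_total: "seq_le u v \<or> seq_less v u"
proof (cases "u = v")
  case False
  then obtain m where "\<forall>i<m. u i = v i" "u m \<noteq> v m" by (rule first_difference)
  thus ?thesis by (metis linorder_neqE_nat seq_le_def seq_less_def)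
qed (simp add: seq_le_def)

lemma seq_le_at: "seq_le u v \<Longrightarrow> (\<forall>i<e. u i = v i) \<Longrightarrow> u e \<le> v e"
proof -
  assume uv: "seq_le u v" and eq: "\<forall>i<e. u i = v i"
  show ?thesis
  proof (cases "u = v")
    case False
    then obtain m where m: "\<forall>i<m. u i = v i" "u m < v m" using uv by (auto simp: seq_le_def seq_less_def)
    hence "\<not> m < e" using eq by auto
    thus ?thesis using m by (cases "m = e") auto
  qed simp
qed

lemma seq_less_irrefl: "\<not> seq_less u u"
  by (simp add: seq_less_def)

lemma seq_less_trans: "seq_less u v \<Longrightarrow> seq_less v w \<Longrightarrow> seq_less u w"
proof -
  assume "seq_less u v" "seq_less v w"
  then obtain m n where m: "\<forall>i<m. u i = v i" "u m < v m" and n: "\<forall>i<n. v i = w i" "v n < w n"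
    by (auto simp: seq_less_def)
  hence "(\<forall>i<min m n. u i = w i) \<and> u (min m n) < w (min m n)"
    by (cases m n rule: linorder_cases) (auto simp: min_def)
  thus ?thesis unfolding seq_less_def by blast
qed

lemma seq_le_trans: "seq_le u v \<Longrightarrow> seq_le v w \<Longrightarrow> seq_le u w"
  using seq_less_trans by (auto simp: seq_le_def)

lemma seq_le_antisym: "seq_le u v \<Longrightarrow> seq_le v u \<Longrightarrow> u = v"
  using seq_less_trans seq_less_irrefl by (auto simp: seq_le_def)

lemma seq_less_le: "seq_less u v \<longleftrightarrow> seq_le u v \<and> u \<noteq> v"
  using seq_less_irrefl by (auto simp: seq_le_def)

lemma seq_not_le: "\<not> seq_le u v \<longleftrightarrow> seq_less v u"
  using seq_total seq_less_le seq_le_antisym by blast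

text \<open>Since \<open>p\<close> and \<open>r\<close> lie between \<open>a\<close> and
  \<open>b\<close>, agreement of \<open>a\<close> and \<open>b\<close> up to \<open>d\<close> would
  force all four to agree there. The bound on the position, not just the inequality, drives the
  descent below.\<close>

lemma sandwich:
  assumes ap: "seq_le a p" and pr: "\<forall>i<d. p i = r i" "p d < r d" and rb: "seq_le r b"
  shows "\<exists>d'\<le>d. (\<forall>i<d'. a i = b i) \<and> a d' < b d'"
proof (rule ccontr)
  assume neg: "\<not> ?thesis"
  have "seq_less p r" using pr by (auto simp: seq_less_def)
  hence "seq_less a b"
    using ap rb by (metis seq_le_def seq_less_trans)
  then obtain d' where d': "\<forall>i<d'. a i = b i" "a d' < b d'" by (auto simp: seq_less_def)
  hence "d < d'" using neg by (meson not_le)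
  hence ab: "a i = b i" if "i \<le> d" for i using d' that by auto
  have "\<forall>i<e. a i = p i" if "e \<le> d" for e
    using that
  proof (induction e)
    case (Suc e)
    hence IH: "\<forall>i<e. a i = p i" and e: "e < d" by auto
    have "a e \<le> p e" using seq_le_at[OF ap] IH by blast
    moreover have "r e \<le> b e" using seq_le_at[OF rb, of e] IH ab pr e by simp
    ultimately have "a e = p e" using pr e ab[of e] by auto
    thus ?case using IH by (auto simp: less_Suc_eq)
  qed simp
  hence eq: "\<forall>i<d. a i = p i" by blast
  have "a d \<le> p d" using seq_le_at[OF ap eq] .
  moreover have "r d \<le> b d" using seq_le_at[OF rb, of d] eq ab pr by simp
  ultimately show False using pr ab[of d] by simp
qed

text \<open>Let \<open>p\<close> and \<open>r\<close> first differ at \<open>e\<close>. By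
  \<open>sandwich\<close>, \<open>a\<close> and \<open>b\<close> differ no later, hence their tails
  \<open>q\<close> and \<open>l\<close> differ before \<open>e\<close>; by \<open>sandwich\<close>
  again so do \<open>c\<close> and \<open>d\<close>, whose tails are \<open>p\<close> and
  \<open>r\<close>. This yields a difference of \<open>p\<close> and \<open>r\<close> before
  \<open>e\<close>.\<close>

lemma mutual_descent:
  assumes "m > 0" and ap: "seq_le a p" and pr: "seq_less p r" and rb: "seq_le r b"
    and ab: "\<forall>i<m. a i = b i" "\<And>i. q i = a (m + i)" "\<And>i. l i = b (m + i)"
    and cq: "seq_le c q" and ld: "seq_le l d"
    and cd: "\<forall>i<m'. c i = d i" "\<And>i. p i = c (m' + i)" "\<And>i. r i = d (m' + i)"
  shows False
proof -
  obtain e where e: "\<forall>i<e. p i = r i" "p e < r e" using pr by (auto simp: seq_less_def)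
  obtain e' where e': "e' \<le> e" "\<forall>i<e'. a i = b i" "a e' < b e'" using sandwich[OF ap e rb] by auto
  have m: "m \<le> e'" using e'(3) ab(1) by (metis less_irrefl not_le)
  have "\<forall>i<e' - m. q i = l i" "q (e' - m) < l (e' - m)" using e' m by (auto simp: ab)
  then obtain e'' where e'': "e'' \<le> e' - m" "\<forall>i<e''. c i = d i" "c e'' < d e''" using sandwich[OF cq _ _ ld] by blast
  have m': "m' \<le> e''" using e''(3) cd(1) by (metis less_irrefl not_le)
  hence "p (e'' - m') < r (e'' - m')" using e'' by (simp add: cd)
  moreover have "e'' - m' < e" using e'' e' m \<open>m > 0\<close> by linarith
  ultimately show False using e(1) by simp
qed

section \<open>Signs of special letters\<close>

text \<open>The letters of a word are numbered by integers; \<open>r k\<close> is the rank of the letter of \<open>Q\<close> with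
  number \<open>k\<close> and \<open>h k\<close> that of the letter of \<open>hatQ Q\<close>. The set \<open>K\<close> contains the ordinary
  and \<open>N\<close> the punctured letters over special ones. Read backwards, a letter of rank \<open>a\<close> has rank
  \<open>2 - a\<close>.\<close>

locale signed_word =
  fixes r h :: "int \<Rightarrow> nat" and K N :: "int set"
  assumes r_le: "r k \<le> 2" and r_special: "k \<in> K \<union> N \<Longrightarrow> r k = 1"
    and h_K: "k \<in> K \<Longrightarrow> h k = 0 \<or> h k = 2" and h_N: "k \<in> N \<Longrightarrow> h k = 1"
    and sym_N: "k \<in> N \<Longrightarrow> r (k + i) = 2 - r (k - i)"
    and admissible: "k \<in> K \<Longrightarrow> \<exists>m>0. (\<forall>i. 0 < i \<longrightarrow> i < m \<longrightarrow> r (k + i) = 2 - r (k - i)) \<and>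
      (if r (k + m) = 2 - r (k - m)
       then k + m \<in> K \<union> N \<and> k - m \<in> K \<union> N \<and> h (k + m) \<noteq> 2 - h (k - m) \<and> (h k = 0 \<longleftrightarrow> h (k + m) < 2 - h (k - m))
       else h k = 0 \<longleftrightarrow> r (k + m) < 2 - r (k - m))"
    and two_centres: "\<lbrakk>k \<in> K; k' \<in> K \<union> N; k \<noteq> k'; \<And>i. r (k + i) = 2 - r (k - i); \<And>i. r (k' + i) = 2 - r (k' - i)\<rbrakk> \<Longrightarrow> False"
begin

lemma r_swap: "r a = 2 - r b \<longleftrightarrow> r b = 2 - r a"
  using r_le[of a] r_le[of b] by linarith

lemma first_asymmetry:
  assumes k: "k \<in> K \<union> N" and "\<not> (\<forall>i. r (k + i) = 2 - r (k - i))"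
  shows "\<exists>e>0. (\<forall>i. 0 < i \<longrightarrow> i < e \<longrightarrow> r (k + i) = 2 - r (k - i)) \<and> r (k + e) \<noteq> 2 - r (k - e)"
proof -
  obtain i where i: "r (k + i) \<noteq> 2 - r (k - i)" using assms by auto
  have "i \<noteq> 0" using i r_special[OF k] by auto
  then obtain n :: nat where n: "n > 0" "r (k + int n) \<noteq> 2 - r (k - int n)"
  proof (cases "i > 0")
    case True
    thus thesis using that[of "nat i"] i by simp
  next
    case False
    thus thesis using that[of "nat (- i)"] i \<open>i \<noteq> 0\<close> r_swap[of "k + i" "k - i"] by simp
  qed
  define e where "e = (LEAST n :: nat. n > 0 \<and> r (k + int n) \<noteq> 2 - r (k - int n))"
  have e: "e > 0 \<and> r (k + int e) \<noteq> 2 - r (k - int e)" unfolding e_def by (rule LeastI) (use n in simp)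
  have "r (k + i) = 2 - r (k - i)" if "0 < i" "i < int e" for i
    using not_less_Least[of "nat i" "\<lambda>n. n > 0 \<and> r (k + int n) \<noteq> 2 - r (k - int n)"] that
    by (auto simp: e_def[symmetric])
  thus ?thesis using e by (intro exI[of _ "int e"]) auto
qed

text \<open>A reflection at \<open>k\<close> exchanges the neighbourhoods of \<open>k - m\<close> and \<open>k + m\<close>, and reverses their signs.\<close>

lemma sign_at:
  assumes "k \<in> K" "e > 0" "\<And>i. 0 < i \<Longrightarrow> i < e \<Longrightarrow> r (k + i) = 2 - r (k - i)" "r (k + e) \<noteq> 2 - r (k - e)"
  shows "h k = 0 \<longleftrightarrow> r (k + e) < 2 - r (k - e)"
  using assms
\<comment> \<open>Induction on the distance of the first asymmetry visible in \<open>Q\<close>.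
  Admissibility decides the sign at some distance \<open>m \<le> e\<close>, possibly by letters that
  differ only in \<open>hatQ Q\<close>.\<close>
proof (induction "nat e" arbitrary: k e rule: less_induct)
  case less
  obtain m where m: "m > 0" "\<And>i. 0 < i \<Longrightarrow> i < m \<Longrightarrow> r (k + i) = 2 - r (k - i)"
    and adm: "if r (k + m) = 2 - r (k - m)
       then k + m \<in> K \<union> N \<and> k - m \<in> K \<union> N \<and> h (k + m) \<noteq> 2 - h (k - m) \<and> (h k = 0 \<longleftrightarrow> h (k + m) < 2 - h (k - m))
       else h k = 0 \<longleftrightarrow> r (k + m) < 2 - r (k - m)"
    using admissible[OF less.prems(1)] by blast
  have "m \<le> e" using m(2)[of e] less.prems by force
  show ?case
  proof (cases "m = e")
    case True
    thus ?thesis using adm less.prems(4) by simp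
  next
    case False
    hence me: "m < e" using \<open>m \<le> e\<close> by simp
    hence k1: "k + m \<in> K \<union> N" and k2: "k - m \<in> K \<union> N" and hne: "h (k + m) \<noteq> 2 - h (k - m)"
      and hk: "h k = 0 \<longleftrightarrow> h (k + m) < 2 - h (k - m)"
      using adm less.prems(3)[OF m(1) me] by auto
    have sym: "r (k + i) = 2 - r (k - i)" if "\<bar>i\<bar> < e" for i
    proof -
      consider "i > 0" | "i = 0" | "i < 0" by linarith
      thus ?thesis
      proof cases
        case 2
        thus ?thesis using r_special less.prems(1) by simp
      next
        case 3
        thus ?thesis using less.prems(3)[of "- i"] that r_swap[of "k + i" "k - i"] by simp
      qed (use less.prems(3) that in simp)
    qed
    let ?k1 = "k + m" and ?k2 = "k - m"
    have mirror: "r (?k2 - i) = 2 - r (?k1 + i)" "r (?k2 + i) = 2 - r (?k1 - i)" if "0 < i" "i < e - m" for i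
      using sym[of "m + i"] sym[of "m - i"] that m(1) r_swap
      by (simp_all add: algebra_simps abs_if)
    \<comment> \<open>If the surroundings of \<open>k + m\<close> become asymmetric within the range
      mirrored by \<open>k\<close>, those of \<open>k - m\<close> do so at the same distance and in
      the opposite sense. Then the two signs are mirror images, against \<open>hne\<close>.\<close>
    show ?thesis
    proof (cases "\<forall>i. 0 < i \<longrightarrow> i < e - m \<longrightarrow> r (?k1 + i) = 2 - r (?k1 - i)")
      case False
      hence ns: "\<not> (\<forall>i. r (?k1 + i) = 2 - r (?k1 - i))" by blast
      obtain e' where e': "e' > 0" "\<And>i. 0 < i \<Longrightarrow> i < e' \<Longrightarrow> r (?k1 + i) = 2 - r (?k1 - i)" "r (?k1 + e') \<noteq> 2 - r (?k1 - e')"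
        using first_asymmetry[OF k1 ns] by blast
      hence e'm: "e' < e - m" using False by (metis linorder_neqE_linordered_idom order.strict_trans)
      have s2: "r (?k2 + i) = 2 - r (?k2 - i)" if "0 < i" "i < e'" for i
        using e'(2)[OF that] mirror[of i] that e'm r_le[of "?k1 + i"] r_le[of "?k1 - i"] by simp
      have n2: "r (?k2 + e') \<noteq> 2 - r (?k2 - e')"
        using e'(3) mirror[of e'] e'(1) e'm r_le[of "?k1 + e'"] r_le[of "?k1 - e'"] by auto
      have K1: "?k1 \<in> K" using k1 e'(3) sym_N by auto
      have K2: "?k2 \<in> K" using k2 n2 sym_N by auto
      have "h ?k1 = 0 \<longleftrightarrow> r (?k1 + e') < 2 - r (?k1 - e')"
        using less.hyps[of e' ?k1] e' e'm m(1) K1 less.prems(2) by simp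
      moreover have "h ?k2 = 0 \<longleftrightarrow> r (?k2 + e') < 2 - r (?k2 - e')"
        using less.hyps[of e' ?k2] e' e'm m(1) K2 s2 n2 less.prems(2) by simp
      ultimately have "h ?k1 = 0 \<longleftrightarrow> h ?k2 \<noteq> 0"
        using mirror[of e'] e'(1,3) e'm r_le[of "?k1 + e'"] r_le[of "?k1 - e'"] by auto
      thus ?thesis using hne h_K[OF K1] h_K[OF K2] by auto
    next
      case True
      \<comment> \<open>The sign at \<open>k + m\<close> compares \<open>?A\<close> with
        \<open>?C\<close>, and that at \<open>k - m\<close> compares \<open>?C\<close> with
        \<open>?B\<close>. By admissibility the two comparisons point the same way unless one of
        them is an equality, so \<open>?A\<close> and \<open>?B\<close> are compared through
        \<open>?C\<close>.\<close>
      let ?A = "r (k + e)" and ?B = "2 - r (k - e)" and ?C = "r (k - m + (e - m))"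
      have C: "2 - r (?k1 - (e - m)) = ?C"
        using sym[of "2 * m - e"] me m(1) r_le[of "k - m + (e - m)"] by (simp add: algebra_simps abs_if)
      have s2: "r (?k2 + i) = 2 - r (?k2 - i)" if "0 < i" "i < e - m" for i
        using True mirror[of i] that r_le[of "?k1 + i"] r_le[of "?k1 - i"] by simp
      have 1: "?k1 \<in> K \<and> (h ?k1 = 0 \<longleftrightarrow> ?A < ?C)" if ne: "?A \<noteq> ?C"
      proof -
        have "r (?k1 + (e - m)) \<noteq> 2 - r (?k1 - (e - m))" using ne C by simp
        moreover from this have "?k1 \<in> K" using k1 sym_N[of ?k1 "e - m"] by blast
        ultimately have "h ?k1 = 0 \<longleftrightarrow> r (?k1 + (e - m)) < 2 - r (?k1 - (e - m))"
          using less.hyps[of "e - m" ?k1] me m(1) True by simp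
        thus ?thesis using C \<open>?k1 \<in> K\<close> by simp
      qed
      have 2: "?k2 \<in> K \<and> (h ?k2 = 0 \<longleftrightarrow> ?C < ?B)" if ne: "?C \<noteq> ?B"
      proof -
        have *: "r (?k2 + (e - m)) \<noteq> 2 - r (?k2 - (e - m))" using ne by simp
        moreover from this have "?k2 \<in> K" using k2 sym_N[of ?k2 "e - m"] by blast
        ultimately have "h ?k2 = 0 \<longleftrightarrow> r (?k2 + (e - m)) < 2 - r (?k2 - (e - m))"
          using less.hyps[of "e - m" ?k2] me m(1) s2 by simp
        thus ?thesis using \<open>?k2 \<in> K\<close> by simp
      qed
      have hle: "h ?k1 \<le> 2" "h ?k2 \<le> 2" using k1 k2 h_K h_N by fastforce+
      consider "?A \<noteq> ?C" "?C \<noteq> ?B" | "?A \<noteq> ?C" "?C = ?B" | "?A = ?C" "?C \<noteq> ?B"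
        using less.prems(4) by fastforce
      thus ?thesis
      proof cases
        case c: 1
        thus ?thesis using 1[OF c(1)] 2[OF c(2)] h_K[of ?k1] h_K[of ?k2] hne hk by auto
      next
        case c: 2
        thus ?thesis using 1[OF c(1)] h_K[of ?k1] hne hk hle by auto
      next
        case c: 3
        thus ?thesis using 2[OF c(2)] h_K[of ?k2] hne hk hle by auto
      qed
    qed
  qed
qed

text \<open>Symmetry about \<open>k\<close> would make the surroundings of \<open>k + m\<close> and
  \<open>k - m\<close> mirror images. Those of \<open>k + m\<close> are not symmetric, as two
  centres are excluded, so \<open>sign_at\<close> gives both places mirrored signs, which
  admissibility forbids.\<close>

lemma asymmetric:
  assumes k: "k \<in> K" shows "\<not> (\<forall>i. r (k + i) = 2 - r (k - i))"
proof
  assume sym: "\<forall>i. r (k + i) = 2 - r (k - i)"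
  obtain m where m: "m > 0"
    and adm: "if r (k + m) = 2 - r (k - m)
       then k + m \<in> K \<union> N \<and> k - m \<in> K \<union> N \<and> h (k + m) \<noteq> 2 - h (k - m) \<and> (h k = 0 \<longleftrightarrow> h (k + m) < 2 - h (k - m))
       else h k = 0 \<longleftrightarrow> r (k + m) < 2 - r (k - m)"
    using admissible[OF k] by blast
  let ?k1 = "k + m" and ?k2 = "k - m"
  have k1: "?k1 \<in> K \<union> N" and k2: "?k2 \<in> K \<union> N" and hne: "h ?k1 \<noteq> 2 - h ?k2"
    using adm sym by auto
  have mirror: "r (?k2 - i) = 2 - r (?k1 + i)" "r (?k2 + i) = 2 - r (?k1 - i)" for i
    using sym[rule_format, of "m + i"] sym[rule_format, of "m - i"] r_swap by (simp_all add: algebra_simps)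
  have ns: "\<not> (\<forall>i. r (?k1 + i) = 2 - r (?k1 - i))" using two_centres[OF k k1] sym m by auto
  obtain e' where e': "e' > 0" "\<And>i. 0 < i \<Longrightarrow> i < e' \<Longrightarrow> r (?k1 + i) = 2 - r (?k1 - i)" "r (?k1 + e') \<noteq> 2 - r (?k1 - e')"
    using first_asymmetry[OF k1 ns] by blast
  have s2: "r (?k2 + i) = 2 - r (?k2 - i)" if "0 < i" "i < e'" for i
    using e'(2)[OF that] mirror[of i] r_le[of "?k1 + i"] r_le[of "?k1 - i"] by simp
  have n2: "r (?k2 + e') \<noteq> 2 - r (?k2 - e')"
    using e'(3) mirror[of e'] r_le[of "?k1 + e'"] r_le[of "?k1 - e'"] by auto
  have K1: "?k1 \<in> K" using k1 e'(3) sym_N by auto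
  have K2: "?k2 \<in> K" using k2 n2 sym_N by auto
  have "h ?k1 = 0 \<longleftrightarrow> h ?k2 \<noteq> 0"
    using sign_at[OF K1 e'] sign_at[OF K2 e'(1) s2 n2] mirror[of e'] e'(3) r_le[of "?k1 + e'"] r_le[of "?k1 - e'"] by auto
  thus False using hne h_K[OF K1] h_K[OF K2] by auto
qed

text \<open>The form in which admissibility is used later: the sign compares the words of
  \<open>Q\<close>, not those of \<open>hatQ Q\<close>, on the two sides.\<close>

lemma sign_less:
  assumes k: "k \<in> K"
  shows "h k = 0 \<longleftrightarrow> seq_less (\<lambda>i. r (k + 1 + int i)) (\<lambda>i. 2 - r (k - 1 - int i))"
    "h k = 2 \<longleftrightarrow> seq_less (\<lambda>i. 2 - r (k - 1 - int i)) (\<lambda>i. r (k + 1 + int i))"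
proof -
  let ?R = "\<lambda>i. r (k + 1 + int i)" and ?L = "\<lambda>i. 2 - r (k - 1 - int i)"
  have "k \<in> K \<union> N" using k by simp
  then obtain e where e: "e > 0" "\<And>i. 0 < i \<Longrightarrow> i < e \<Longrightarrow> r (k + i) = 2 - r (k - i)" "r (k + e) \<noteq> 2 - r (k - e)"
    using first_asymmetry[OF _ asymmetric[OF k]] by blast
  define n where "n = nat (e - 1)"
  have n: "int n = e - 1" using e(1) by (simp add: n_def)
  have eq: "?R i = ?L i" if "i < n" for i
    using e(2)[of "int i + 1"] that n by (simp add: algebra_simps)
  have at: "?R n = r (k + e)" "?L n = 2 - r (k - e)" by (simp_all add: n)
  have sg: "h k = 0 \<longleftrightarrow> ?R n < ?L n" unfolding at by (rule sign_at[OF k e])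
  have "?R n \<noteq> ?L n" using e(3) at by simp
  hence "seq_less ?R ?L \<longleftrightarrow> ?R n < ?L n" "seq_less ?L ?R \<longleftrightarrow> ?L n < ?R n"
    using eq seq_less_trans[of ?R ?L ?R] seq_less_irrefl by (auto simp: seq_less_def not_less) (metis linorder_neqE_nat)+
  thus "h k = 0 \<longleftrightarrow> seq_less ?R ?L" "h k = 2 \<longleftrightarrow> seq_less ?L ?R"
    using sg h_K[OF k] \<open>?R n \<noteq> ?L n\<close> by auto
qed

end

section \<open>Ranks and the order of words\<close>

lemma rank_linv: "rank (linv l) = 2 - rank l"
  by (cases l) auto

lemma rank_le: "rank l \<le> 2"
  by (cases l) auto

lemma letter_less_rank:
  assumes "a \<in> letters (hatQ Q)" "b \<in> letters (hatQ Q)" "ltgt (hatQ Q) a = Some p" "ltgt (hatQ Q) b = Some p"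
  shows "letter_less (hatQ Q) a b \<longleftrightarrow> rank a < rank b"
  using assms unfolding letter_less_def by (cases a; cases b) (auto simp: letters_hatQ)

lemma word_less_at:
  assumes m: "m < length A" "m < length B" "\<And>j. j < m \<Longrightarrow> A ! j = B ! j" "A ! m \<noteq> B ! m"
    and l: "A ! m \<in> letters (hatQ Q)" "B ! m \<in> letters (hatQ Q)"
      "ltgt (hatQ Q) (A ! m) = Some p" "ltgt (hatQ Q) (B ! m) = Some p"
  shows "word_less (hatQ Q) A B \<longleftrightarrow> rank (A ! m) < rank (B ! m)"
proof -
  have "k = m" if k: "k < length A" "k < length B" "take k A = take k B" "letter_less (hatQ Q) (A ! k) (B ! k)" for k
  proof -
    have "\<not> k < m" using m(3)[of k] k(4) by (auto simp: letter_less_def)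
    moreover have "\<not> m < k" using m(4) k(3) by (metis nth_take)
    ultimately show ?thesis by simp
  qed
  moreover have "take m A = take m B" using m by (intro nth_take_lemma) auto
  ultimately show ?thesis unfolding word_less_def letter_less_rank[OF l, symmetric] using m by blast
qed

section \<open>Reading a word from a half-edge\<close>

context adm_word
begin

abbreviation R :: "nat \<Rightarrow> half_edge" where "R i \<equiv> (i, rp i)"
abbreviation Lf :: "nat \<Rightarrow> half_edge" where "Lf i \<equiv> opp (i, rp i)"

definition base :: "half_edge \<Rightarrow> 'v \<times> polarity" where
  "base s = (G (fst s), snd s)"

definition Fr :: "half_edge \<Rightarrow> nat" where
  "Fr s = (if spc s then 1 else rank (hl s))"

text \<open>Reading on means crossing the edge and leaving through the opposite half-edge. At an end
  this turns round, which for a punctured end is the reflection in the completion; at the other ends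
  \<open>w\<close> stops.\<close>

definition wstep :: "half_edge \<Rightarrow> half_edge" where
  "wstep s = opp (oe s)"

text \<open>The ranks of the letters of the word read from a half-edge, continued by \<open>1\<close> after its end.\<close>

primrec w :: "nat \<Rightarrow> half_edge \<Rightarrow> nat" where
  "w 0 = Fr"
| "w (Suc m) = (\<lambda>s. if live s then w m (wstep s) else 1)"

abbreviation wd :: "half_edge \<Rightarrow> nat \<Rightarrow> nat" where "wd s \<equiv> \<lambda>m. w m s"

lemma spc_oe: "fst s \<in> V \<Longrightarrow> spc (oe s) \<longleftrightarrow> spc s"
proof -
  have "spc s \<Longrightarrow> spc (oe s)" if "fst s \<in> V" for s
    using oe_base(1)[OF that] by (auto simp: spc_def)
  thus "fst s \<in> V \<Longrightarrow> ?thesis" using oe_oe fst_oe by metis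
qed

lemma Fr_le: "Fr s \<le> 2"
  by (simp add: Fr_def rank_le)

lemma Fr_end: "fst s \<in> V \<Longrightarrow> is_end s \<Longrightarrow> Fr s = 1"
  by (simp add: Fr_def is_end_iff)

lemma Fr_oe: "fst s \<in> V \<Longrightarrow> Fr (oe s) = 2 - Fr s"
  using spc_oe[of s] hl_oe[of s] Fr_end[of s] oe_end[of s] by (cases "is_end s") (auto simp: Fr_def rank_linv)

lemma w_le: "w m s \<le> 2"
  by (induction m arbitrary: s) (auto simp: Fr_le)

lemma w_dead: "fst s \<in> V \<Longrightarrow> \<not> live s \<Longrightarrow> w m s = 1"
  by (cases m) (auto simp: live_def Fr_end)

lemma fst_wstep: "fst s \<in> V \<Longrightarrow> fst (wstep s) \<in> V"
  by (simp add: wstep_def fst_oe)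

lemma base_wstep:
  assumes s: "fst s \<in> V" and s': "fst s' \<in> V" and b: "base s = base s'" and h: "hl s = hl s'" and e: "\<not> is_end s"
  shows "base (wstep s) = base (wstep s')"
proof -
  have "opp (G (fst (oe s)), snd (oe s)) = opp (G (fst (oe s')), snd (oe s'))"
    using oe_base(2,3)[OF s] oe_base(2,3)[OF s'] h hl_cases[OF s] is_end_iff[OF s] e by (metis (no_types, lifting))
  moreover have "base (opp q) = opp (G (fst q), snd q)" for q by (cases q rule: opp.cases) (auto simp: base_def)
  ultimately show ?thesis by (simp add: wstep_def)
qed

lemma spc_base: "base s = base s' \<Longrightarrow> spc s \<longleftrightarrow> spc s'"
  by (auto simp: base_def spc_def)

lemma hl_eqI:
  assumes s: "fst s \<in> V" and s': "fst s' \<in> V" and b: "base s = base s'" and r: "rank (hl s) = rank (hl s')"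
  shows "hl s = hl s'"
proof -
  have b': "G (fst s) = G (fst s')" "snd s = snd s'" using b by (auto simp: base_def)
  from hl_cases[OF s] hl_cases[OF s'] r consider
    \<alpha> \<beta> where "hl s = Dir \<alpha>" "hl s' = Dir \<beta>" | \<alpha> \<beta> where "hl s = Inv \<alpha>" "hl s' = Inv \<beta>"
    | "hl s = Triv (G (fst s)) (snd s)" "hl s' = Triv (G (fst s')) (snd s')" by fastforce
  thus ?thesis
  proof cases
    case 1
    hence "\<alpha> = \<beta>" using hl_Dir[OF s 1(1)] hl_Dir[OF s' 1(2)] b' inj_tgt[of \<alpha> \<beta>] by simp
    thus ?thesis using 1 by simp
  next
    case 2
    hence "\<alpha> = \<beta>" using hl_Inv[OF s 2(1)] hl_Inv[OF s' 2(2)] b' inj_src[of \<alpha> \<beta>] by simp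
    thus ?thesis using 2 by simp
  qed (use b' in simp)
qed

lemma right_step:
  assumes "i \<in> V" "band \<or> i \<noteq> len - 1"
  shows "\<not> is_end (R i)" "wstep (R i) = R (H_next Q x i)" "H_next Q x i \<in> V"
  using assms prv_nxt by (auto simp: is_end_def wstep_def oe_def)

lemma left_step:
  assumes "i \<in> V" "band \<or> i \<noteq> 1"
  shows "\<not> is_end (Lf i)" "wstep (Lf i) = Lf (prv i)" "prv i \<in> V"
  using assms nxt_prv by (auto simp: is_end_def wstep_def oe_def)

lemma left_oe:
  assumes "i \<in> V" "band \<or> i \<noteq> 1" shows "Lf i = oe (R (prv i))"
proof -
  have "prv i \<in> V" "band \<or> prv i \<noteq> len - 1" "H_next Q x (prv i) = i"
    using nxt_prv[OF assms] assms by (auto simp: prv_def H_verts_iff split: if_splits)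
  hence "opp (oe (R (prv i))) = R i" using right_step(2)[of "prv i"] by (simp add: wstep_def)
  thus ?thesis by (metis polarity_swap)
qed

lemma string_end_right: "\<not> band \<Longrightarrow> is_end (R (len - 1)) \<and> len - 1 \<in> V \<and> wstep (R (len - 1)) = Lf (len - 1)"
  using len_ge2 by (auto simp: is_end_def H_verts_iff wstep_def oe_end)

lemma string_end_left: "\<not> band \<Longrightarrow> is_end (Lf 1) \<and> 1 \<in> V \<and> wstep (Lf 1) = R 1"
proof -
  assume "\<not> band"
  hence "is_end (Lf 1)" "1 \<in> V" using len_ge2 by (auto simp: is_end_def H_verts_iff)
  thus ?thesis by (simp add: wstep_def oe_end)
qed

lemma hl_right: "hl (R i) = x ! i"
  by (simp add: hl_def)

lemma hl_left: "hl (Lf i) = linv (x ! prv i)"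
  by (simp add: hl_def)

lemma wpow_right_string:
  assumes "\<not> band" "1 \<le> i" "i + j \<le> len - 1" shows "(wstep ^^ j) (R i) = R (i + j)"
  using assms(3)
proof (induction j)
  case (Suc j)
  hence "i + j \<in> V" "i + j \<noteq> len - 1" using assms by (auto simp: H_verts_iff)
  thus ?case using Suc right_step(2)[of "i + j"] assms(1) by (simp add: H_next_def)
qed simp

lemma wpow_left_string:
  assumes "\<not> band" "i \<le> len - 1" "j < i" shows "(wstep ^^ j) (Lf i) = Lf (i - j)"
  using assms(3)
proof (induction j)
  case (Suc j)
  hence "i - j \<in> V" "i - j \<noteq> 1" using assms by (auto simp: H_verts_iff)
  thus ?case using Suc left_step(2)[of "i - j"] assms(1) by (simp add: prv_def)
qed simp

lemma wpow_right_band: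
  assumes "band" "i < len" shows "(wstep ^^ j) (R i) = R ((i + j) mod len)"
proof (induction j)
  case (Suc j)
  have "(i + j) mod len \<in> V" using assms len_pos by (simp add: H_verts_iff)
  thus ?case using Suc right_step(2) assms(1) by (simp add: H_next_def mod_Suc_eq)
qed (use assms in simp)

lemma prv_band: "band \<Longrightarrow> i < len \<Longrightarrow> int (prv i) = (int i - 1) mod int len"
  using len_pos by (simp add: prv_def zmod_int of_nat_diff) (metis add.commute add_diff_eq mod_add_self2 diff_add_eq)

lemma wpow_left_band:
  assumes "band" "i < len" shows "(wstep ^^ j) (Lf i) = Lf (nat ((int i - int j) mod int len))"
proof (induction j)
  case (Suc j)
  let ?k = "nat ((int i - int j) mod int len)"
  have k: "?k < len" using len_pos by (simp add: nat_less_iff)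
  hence "?k \<in> V" using assms by (simp add: H_verts_iff)
  moreover have "prv ?k = nat ((int i - int (Suc j)) mod int len)"
    using prv_band[OF assms(1) k] len_pos by (simp add: mod_diff_left_eq algebra_simps nat_eq_iff)
  ultimately show ?case using Suc left_step(2)[of ?k] assms(1) by simp
qed (use assms in simp)

text \<open>One sequence over the integers holds all words read from half-edges, rightwards as it
  stands and leftwards inverted. For a string the numbers below 1 come from reading leftwards at
  vertex 1: the word reflects at a punctured beginning and stays at rank 1 before an unpunctured
  one.\<close>

definition rr :: "int \<Rightarrow> nat" where
  "rr k = (if band then Fr (R (nat (k mod int len)))
     else if k \<ge> 1 then w (nat (k - 1)) (R 1) else 2 - w (nat (- k)) (Lf 1))"

definition hh :: "int \<Rightarrow> nat" where
  "hh k = rank (x ! (if band then nat (k mod int len) else nat k))"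

lemma rr_mod: "band \<Longrightarrow> a mod int len = b mod int len \<Longrightarrow> rr a = rr b"
  by (simp add: rr_def)

lemma rr_le: "rr k \<le> 2"
  by (simp add: rr_def Fr_le w_le)

lemma w_right: "i \<in> V \<Longrightarrow> w m (R i) = rr (int i + int m)"
proof (cases band)
  case True
  assume "i \<in> V"
  thus ?thesis
  proof (induction m arbitrary: i)
    case 0
    thus ?case using True by (simp add: rr_def H_verts_iff)
  next
    case (Suc m)
    have "w (Suc m) (R i) = w m (R (H_next Q x i))"
      using right_step[OF Suc.prems] True by (simp add: live_def)
    also have "\<dots> = rr (int (H_next Q x i) + int m)" using right_step[OF Suc.prems] True Suc.IH by simp
    also have "int (H_next Q x i) = (int i + 1) mod int len" using True by (simp add: H_next_def zmod_int algebra_simps)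
    also have "rr ((int i + 1) mod int len + int m) = rr (int i + int (Suc m))"
    proof (rule rr_mod[OF True])
      have "((int i + 1) mod int len + int m) mod int len = (int i + 1 + int m) mod int len"
        by (rule mod_add_left_eq)
      thus "((int i + 1) mod int len + int m) mod int len = (int i + int (Suc m)) mod int len"
        by (simp add: algebra_simps)
    qed
    finally show ?case .
  qed
next
  case False
  assume i: "i \<in> V"
  have "w (i - 1 + m) (R 1) = w m (R i)" using i
  proof (induction "i - 1" arbitrary: i m)
    case 0
    hence "i = 1" using False by (simp add: H_verts_iff)
    thus ?case by simp
  next
    case (Suc j)
    hence i: "i - 1 \<in> V" "i - 1 \<noteq> len - 1" "i \<ge> 2" using False by (auto simp: H_verts_iff)
    hence "w (Suc m) (R (i - 1)) = w m (R i)"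
      using right_step[OF i(1)] False by (simp add: live_def H_next_def)
    moreover have "w (i - 1 - 1 + Suc m) (R 1) = w (Suc m) (R (i - 1))"
      using Suc.hyps(1)[of "i - 1" "Suc m"] Suc.hyps(2) i by simp
    ultimately show ?case using i(3) by (simp add: Suc_diff_Suc numeral_2_eq_2)
  qed
  thus ?thesis using i False by (simp add: rr_def H_verts_iff nat_diff_distrib nat_add_distrib)
qed

lemma w_left: "i \<in> V \<Longrightarrow> w m (Lf i) = 2 - rr (int i - 1 - int m)"
proof (cases band)
  case True
  have zero: "w 0 (Lf i) = 2 - rr (int i - 1)" if i: "i \<in> V" for i
  proof -
    have "Lf i = oe (R (prv i))" using left_oe[OF i] True by simp
    hence "w 0 (Lf i) = 2 - Fr (R (prv i))" using Fr_oe[of "R (prv i)"] left_step[OF i] True by simp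
    moreover have "prv i = nat ((int i - 1) mod int len)" using prv_band[OF True, of i] i True by (simp add: H_verts_iff)
    ultimately show ?thesis using True by (simp add: rr_def)
  qed
  assume "i \<in> V"
  thus ?thesis
  proof (induction m arbitrary: i)
    case 0
    thus ?case using zero by simp
  next
    case (Suc m)
    have "w (Suc m) (Lf i) = w m (Lf (prv i))"
      using left_step[OF Suc.prems] True by (simp add: live_def)
    also have "\<dots> = 2 - rr (int (prv i) - 1 - int m)" using left_step[OF Suc.prems] True Suc.IH by simp
    also have "int (prv i) = (int i - 1) mod int len" using prv_band True Suc.prems by (simp add: H_verts_iff)
    also have "rr ((int i - 1) mod int len - 1 - int m) = rr (int i - 1 - int (Suc m))"
    proof (rule rr_mod[OF True])
      have "((int i - 1) mod int len - (1 + int m)) mod int len = ((int i - 1) - (1 + int m)) mod int len"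
        by (rule mod_diff_left_eq)
      thus "((int i - 1) mod int len - 1 - int m) mod int len = (int i - 1 - int (Suc m)) mod int len"
        by (simp add: algebra_simps)
    qed
    finally show ?case .
  qed
next
  case False
  assume "i \<in> V"
  thus ?thesis
  proof (induction m arbitrary: i)
    case 0
    show ?case
    proof (cases "i = 1")
      case True
      thus ?thesis using False w_le[of 0 "Lf 1"] by (simp add: rr_def)
    next
      case i: False
      hence "Lf i = oe (R (prv i))" using left_oe[OF 0] by simp
      hence "w 0 (Lf i) = 2 - w 0 (R (prv i))" using Fr_oe[of "R (prv i)"] left_step[OF 0] i by simp
      also have "w 0 (R (prv i)) = rr (int (prv i))" using w_right[of "prv i" 0] left_step[OF 0] i by simp
      finally show ?thesis using False 0 by (simp add: prv_def H_verts_iff)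
    qed
  next
    case (Suc m)
    show ?case
    proof (cases "i = 1")
      case True
      thus ?thesis using False w_le[of "Suc m" "Lf 1"] by (simp add: rr_def nat_add_distrib del: w.simps)
    next
      case i: False
      have "w (Suc m) (Lf i) = w m (Lf (prv i))"
        using left_step[OF Suc.prems] i by (simp add: live_def)
      also have "\<dots> = 2 - rr (int (prv i) - 1 - int m)" using left_step[OF Suc.prems] i Suc.IH by simp
      also have "int (prv i) = int i - 1" using False Suc.prems by (simp add: prv_def H_verts_iff)
      finally show ?thesis by (simp add: algebra_simps)
    qed
  qed
qed

definition KK :: "int set" where
  "KK = (if band then {k. spc (R (nat (k mod int len)))} else {k. 1 \<le> k \<and> k < int len - 1 \<and> spc (R (nat k))})"

definition NN :: "int set" where
  "NN = (if band then {} else {k. k = 0 \<and> spc (Lf 1) \<or> k = int len - 1 \<and> spc (R (len - 1))})"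

lemma special_F_iff: "i \<in> V \<Longrightarrow> band \<or> i \<noteq> len - 1 \<Longrightarrow> is_special (F Q (x ! i)) \<longleftrightarrow> spc (R i)"
proof -
  assume i: "i \<in> V" and ne: "band \<or> i \<noteq> len - 1"
  have s: "fst (R i) \<in> V" using i by simp
  have "\<not> is_end (R i)" using right_step[OF i ne] by simp
  then obtain \<alpha> where \<alpha>: "hl (R i) = Dir \<alpha> \<or> hl (R i) = Inv \<alpha>" using hl_cases[OF s] is_end_iff[OF s] by auto
  hence "\<alpha> \<in> sp_arrows Q \<longleftrightarrow> spc (R i)"
    using hl_Dir[OF s, of \<alpha>] hl_Inv[OF s, of \<alpha>] sp_arrow_iff[of \<alpha>] sp_arrow_iff_src[of \<alpha>] by (auto simp: spc_def)
  thus ?thesis using \<alpha> by (auto simp: hl_right)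
qed

lemma hl_wpow_right: "band \<Longrightarrow> i < len \<Longrightarrow> hl ((wstep ^^ k) (R i)) = x ! ((i + k) mod len)"
  by (simp add: wpow_right_band hl_right)

lemma prv_wpow_left: "band \<Longrightarrow> i < len \<Longrightarrow> prv (nat ((int i - int k) mod int len)) = nat ((int i - 1 - int k) mod int len)"
proof -
  assume b: band "i < len"
  have "nat ((int i - int k) mod int len) < len" using len_pos by (simp add: nat_less_iff)
  hence "int (prv (nat ((int i - int k) mod int len))) = ((int i - int k) mod int len - 1) mod int len"
    using prv_band[OF b(1)] len_pos by simp
  also have "\<dots> = (int i - int k - 1) mod int len" by (rule mod_diff_left_eq)
  also have "int i - int k - 1 = int i - 1 - int k" by simp
  finally show ?thesis by (metis nat_int)
qed

lemma hl_wpow_left: "band \<Longrightarrow> i < len \<Longrightarrow> hl ((wstep ^^ k) (Lf i)) = linv (x ! nat ((int i - 1 - int k) mod int len))"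
  by (simp add: wpow_left_band hl_left prv_wpow_left)

text \<open>Turns the comparison of lists in the definition of admissibility into one of the words
  read from the two half-edges beside a special letter, located at their first difference.\<close>

lemma admissible_half_edge:
  assumes i: "i \<in> V" and ne: "band \<or> i \<noteq> len - 1" and sp: "spc (R i)"
  defines "a \<equiv> \<lambda>j. (wstep ^^ j) (wstep (R i))" and "b \<equiv> \<lambda>j. (wstep ^^ j) (Lf i)"
  shows "\<exists>m. (\<forall>j<m. hl (a j) = hl (b j)) \<and> hl (a m) \<noteq> hl (b m) \<and> (\<forall>j\<le>m. base (a j) = base (b j)) \<and>
    (is_direct (x ! i) \<longleftrightarrow> rank (hl (a m)) < rank (hl (b m))) \<and>
    (\<not> band \<longrightarrow> i + 1 + m \<le> len - 1 \<and> m < i)"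
proof -
  have aS: "a (Suc j) = wstep (a j)" and bS: "b (Suc j) = wstep (b j)" for j by (simp_all add: a_def b_def)
  have aV: "fst (a j) \<in> V" for j using i fst_wstep by (induction j) (auto simp: a_def)
  have bV: "fst (b j) \<in> V" for j using i fst_wstep by (induction j) (auto simp: b_def)
  have base0: "base (a 0) = base (b 0)"
  proof -
    have "(G (fst (oe (R i))), snd (oe (R i))) = (G i, Neg)" using oe_base(1)[of "R i"] i sp by simp
    hence "base (opp (oe (R i))) = (G i, Pos)" by (cases "oe (R i)" rule: opp.cases) (auto simp: base_def)
    moreover have "base (Lf i) = (G i, Pos)" using sp by (cases "R i" rule: opp.cases) (auto simp: base_def spc_def)
    ultimately show ?thesis by (simp add: a_def b_def wstep_def)
  qed
  have base: "base (a m) = base (b m)" if "\<And>j. j < m \<Longrightarrow> hl (a j) = hl (b j) \<and> \<not> is_end (a j)" for m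
    using that
  proof (induction m)
    case (Suc m)
    have "base (a m) = base (b m)" using Suc by (metis less_Suc_eq)
    thus ?case using Suc.prems[of m] base_wstep[OF aV bV] by (simp add: aS bS)
  qed (rule base0)
  have ltgt: "ltgt hQ (hl s) = Some (base s)" if "fst s \<in> V" for s using ltgt_hl[OF that] by (simp add: base_def)
  have special: "is_special (F Q (x ! i))" using special_F_iff[OF i ne] sp by simp
  \<comment> \<open>\<open>A\<close> is the part of the word after position \<open>i\<close> and
    \<open>B\<close> the inverse of the part before it; for a band, \<open>A\<close> is its rotation
    without the letter \<open>i\<close>, and \<open>B\<close> is the inverse of
    \<open>A\<close>.\<close>
  have "\<exists>A B. (\<forall>j<length A. A ! j = hl (a j) \<and> (is_end (a j) \<longleftrightarrow> \<not> band \<and> j = length A - 1)) \<and>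
    (\<forall>j<length B. B ! j = hl (b j) \<and> (is_end (b j) \<longleftrightarrow> \<not> band \<and> j = length B - 1)) \<and> B \<noteq> A \<and> A \<noteq> [] \<and> B \<noteq> [] \<and>
    (is_direct (x ! i) \<longleftrightarrow> word_less hQ A B) \<and> (if band then length A = length B else length A = len - 1 - i \<and> length B = i)"
  proof (cases band)
    case True
    have il: "i < len" using i V_less by simp
    define z where "z = drop (Suc i) x @ take i x"
    have lz: "length z = len - 1" using il by (simp add: z_def)
    have zn: "z ! j = x ! ((Suc i + j) mod len)" if j: "j < len - 1" for j
    proof (cases "j < len - Suc i")
      case True
      thus ?thesis using il by (simp add: z_def nth_append)
    next
      case False
      hence "(Suc i + j) mod len = j - (len - Suc i)" "j - (len - Suc i) < i"
        using j il by (auto simp: mod_if)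
      thus ?thesis using False il by (simp add: z_def nth_append)
    qed
    have z: "z ! j = hl (a j)" if "j < len - 1" for j
      using hl_wpow_right[OF True, of "Suc i mod len" j] right_step(2)[OF i ne] len_pos True zn[OF that]
      by (simp add: a_def H_next_def mod_add_left_eq)
    have wz: "winv z ! j = hl (b j)" if "j < len - 1" for j
    proof -
      have "int (Suc i + (len - 2 - j)) = int i - 1 - int j + int len" using that by linarith
      hence "(int i - 1 - int j) mod int len = int ((Suc i + (len - 2 - j)) mod len)" by (metis mod_add_self2 zmod_int)
      hence "hl (b j) = linv (x ! ((Suc i + (len - 2 - j)) mod len))" using hl_wpow_left[OF True il, of j] by (simp add: b_def)
      thus ?thesis using that lz zn[of "len - 2 - j"] by (simp add: winv_def rev_nth)
    qed
    have "admissible_band Q x" using band_cases True by simp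
    hence "winv z \<noteq> z \<and> (is_direct (x ! i) \<longleftrightarrow> word_less hQ z (winv z))"
      using special il unfolding admissible_band_def Let_def z_def by blast
    moreover have "z \<noteq> []" "winv z \<noteq> []" "length (winv z) = length z" using lz len_ge2 by (auto simp: winv_def)
    moreover have "\<not> is_end s" for s using True by (simp add: is_end_def)
    ultimately show ?thesis using z wz lz True by (intro exI[of _ z] exI[of _ "winv z"]) simp
  next
    case False
    have iN: "1 \<le> i" "i < len - 1" using i ne False by (auto simp: H_verts_iff)
    define A where "A = drop (Suc i) x"
    define B where "B = winv (take i x)"
    have lA: "length A = len - 1 - i" and lB: "length B = i" using iN by (auto simp: A_def B_def winv_def)
    have aj: "a j = R (i + 1 + j)" if "i + 1 + j \<le> len - 1" for j
      using wpow_right_string[OF False, of "i + 1" j] right_step(2)[OF i] that False ne by (simp add: a_def H_next_def)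
    have bj: "b j = Lf (i - j)" if "j < i" for j
      using wpow_left_string[OF False, of i j] that iN by (simp add: b_def)
    have A: "A ! j = hl (a j)" if "j < length A" for j
      using that lA aj[of j] by (simp add: A_def hl_right)
    have B: "B ! j = hl (b j)" if "j < length B" for j
      using that lB bj[of j] iN False by (simp add: B_def winv_def rev_nth hl_left prv_def)
    have eA: "is_end (a j) \<longleftrightarrow> j = length A - 1" if "j < length A" for j
      using that lA aj[of j] False by (auto simp: is_end_def)
    have eB: "is_end (b j) \<longleftrightarrow> j = length B - 1" if "j < length B" for j
      using that lB bj[of j] False by (auto simp: is_end_def)
    have "admissible_string Q x" using string_cases False by simp
    hence "B \<noteq> A \<and> (is_direct (x ! i) \<longleftrightarrow> word_less hQ A B)"
      using special iN unfolding admissible_string_def A_def B_def by simp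
    moreover have "A \<noteq> []" "B \<noteq> []" using lA lB iN by auto
    ultimately show ?thesis using A B eA eB lA lB False by (intro exI[of _ A] exI[of _ B]) simp
  qed
  then obtain A B where A: "\<And>j. j < length A \<Longrightarrow> A ! j = hl (a j)" "\<And>j. j < length A \<Longrightarrow> is_end (a j) \<longleftrightarrow> \<not> band \<and> j = length A - 1"
    and B: "\<And>j. j < length B \<Longrightarrow> B ! j = hl (b j)" "\<And>j. j < length B \<Longrightarrow> is_end (b j) \<longleftrightarrow> \<not> band \<and> j = length B - 1"
    and AB: "B \<noteq> A" "A \<noteq> []" "B \<noteq> []" and adm: "is_direct (x ! i) \<longleftrightarrow> word_less hQ A B"
    and l: "if band then length A = length B else length A = len - 1 - i \<and> length B = i" by blast
  have e_hl: "is_end s \<longleftrightarrow> is_end s'" if "hl s = hl s'" "base s = base s'" "fst s \<in> V" "fst s' \<in> V" for s s'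
    using is_end_iff that by (auto simp: base_def)
  \<comment> \<open>If the lists agreed up to the end of the shorter one, both would end there,
    since for strings an end shows in the letter and for bands the lengths are equal. Then
    \<open>A\<close> and \<open>B\<close> would coincide.\<close>
  have "\<exists>m<min (length A) (length B). hl (a m) \<noteq> hl (b m)"
  proof (rule ccontr)
    assume "\<not> ?thesis"
    hence eq: "hl (a m) = hl (b m)" if "m < length A" "m < length B" for m using that by auto
    define c where "c = min (length A) (length B)"
    have c: "c > 0" using AB by (simp add: c_def)
    have cl: "c - 1 < length A" "c - 1 < length B" using c unfolding c_def by linarith+
    have bc: "base (a (c - 1)) = base (b (c - 1))"
      by (rule base) (use eq A(2) c in \<open>auto simp: c_def\<close>)
    have "is_end (a (c - 1)) \<longleftrightarrow> is_end (b (c - 1))"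
      using e_hl[OF eq[OF cl] bc aV bV] .
    hence "length A = length B" using A(2)[OF cl(1)] B(2)[OF cl(2)] c l unfolding c_def by (cases band) (simp, linarith)
    hence "A = B" using A(1) B(1) eq by (intro nth_equalityI) auto
    thus False using AB by simp
  qed
  then obtain k where k: "k < min (length A) (length B)" "hl (a k) \<noteq> hl (b k)" by blast
  define m where "m = (LEAST k. hl (a k) \<noteq> hl (b k))"
  have m: "hl (a m) \<noteq> hl (b m)" unfolding m_def by (rule LeastI) (rule k)
  have mk: "m \<le> k" unfolding m_def by (rule Least_le) (rule k)
  have lm: "hl (a j) = hl (b j)" if "j < m" for j using not_less_Least[of j "\<lambda>k. hl (a k) \<noteq> hl (b k)"] that by (auto simp: m_def)
  have b: "base (a j) = base (b j)" if "j \<le> m" for j by (rule base) (use lm A(2) mk k that in auto)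
  have "word_less hQ A B \<longleftrightarrow> rank (A ! m) < rank (B ! m)"
    using m mk k lm A(1) B(1) hl_letters[OF aV] hl_letters[OF bV] ltgt[OF aV] ltgt[OF bV] b
    by (intro word_less_at[of m]) auto
  thus ?thesis using m lm b adm A(1) B(1) mk k l by (intro exI[of _ m]) auto
qed

text \<open>Locates the letters met on the two walks among the integers. The first letter of each
  walk is at distance 1 from \<open>k\<close>, whence \<open>1 + int j\<close>.\<close>

lemma around:
  assumes i: "i \<in> V" and ne: "band \<or> i \<noteq> len - 1" and k: "if band then int i = k mod int len else k = int i"
    and j: "\<not> band \<Longrightarrow> i + 1 + j \<le> len - 1 \<and> j < i"
  defines "a \<equiv> (wstep ^^ j) (wstep (R i))" and "b \<equiv> (wstep ^^ j) (Lf i)"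
  shows "rr (k + (1 + int j)) = Fr a" (is ?A1) "2 - rr (k - (1 + int j)) = Fr b" (is ?A2)
    "hh (k + (1 + int j)) = rank (hl a)" (is ?A3) "2 - hh (k - (1 + int j)) = rank (hl b)" (is ?A4)
    "spc a \<Longrightarrow> k + (1 + int j) \<in> KK \<union> NN" "spc b \<Longrightarrow> k - (1 + int j) \<in> KK \<union> NN"
proof -
  let ?p = "k + (1 + int j)" and ?m = "k - (1 + int j)"
  have Fr: "Fr (R q) = rr (int q)" "Fr (Lf q) = 2 - rr (int q - 1)" if "q \<in> V" for q
    using w_right[OF that, of 0] w_left[OF that, of 0] by auto
  have "?A1 \<and> ?A2 \<and> ?A3 \<and> ?A4 \<and>
    (spc a \<longrightarrow> ?p \<in> KK \<union> NN) \<and> (spc b \<longrightarrow> ?m \<in> KK \<union> NN)"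
  proof (cases band)
    case True
    have il: "i < len" using i V_less by simp
    have kk: "k mod int len = int i" using k True by simp
    define q where "q = nat (?p mod int len)"
    have q: "int q = ?p mod int len" "q < len" "q \<in> V"
      using len_pos True by (auto simp: q_def nat_less_iff H_verts_iff)
    have "int ((Suc i mod len + j) mod len) = int q"
    proof -
      have "(Suc i mod len + j) mod len = (Suc i + j) mod len" by (rule mod_add_left_eq)
      hence "int ((Suc i mod len + j) mod len) = (int i + (1 + int j)) mod int len"
        by (simp add: zmod_int algebra_simps)
      also have "\<dots> = (k mod int len + (1 + int j)) mod int len" by (simp add: kk)
      also have "\<dots> = int q" unfolding q by (rule mod_add_left_eq)
      finally show ?thesis .
    qed
    hence a: "a = R q"
      using wpow_right_band[OF True, of "Suc i mod len" j] right_step(2)[OF i ne] len_pos True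
      by (simp add: a_def H_next_def)
    define p where "p = nat ((k - int j) mod int len)"
    have p: "int p = (k - int j) mod int len" "p < len" "p \<in> V"
      using len_pos True by (auto simp: p_def nat_less_iff H_verts_iff)
    have "(int i - int j) mod int len = int p"
      unfolding p kk[symmetric] by (rule mod_diff_left_eq)
    hence b: "b = Lf p" using wpow_left_band[OF True il, of j] by (simp add: b_def)
    have pp: "int (prv p) = ?m mod int len"
      using prv_band[OF True p(2)] mod_diff_left_eq[of "k - int j" "int len" 1] by (simp add: p(1) algebra_simps)
    have npp: "nat (?m mod int len) = prv p" using pp by (metis nat_int)
    have "rr (int p - 1) = rr ?m"
    proof (rule rr_mod[OF True])
      show "(int p - 1) mod int len = ?m mod int len"
        using prv_band[OF True p(2)] pp by simp
    qed
    moreover have "rr (int q) = rr ?p" by (rule rr_mod[OF True]) (simp add: q)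
    moreover have "spc (R (prv p)) \<longleftrightarrow> spc b"
      using left_oe[OF p(3)] True spc_oe[of "R (prv p)"] left_step(3)[OF p(3)] b by simp
    moreover have "2 - (2 - rank l) = rank l" for l :: "('v, 'a) letter" using rank_le[of l] by simp
    ultimately show ?thesis using Fr[OF q(3)] Fr[OF p(3)] True
      by (auto simp: a b hh_def hl_right hl_left q_def[symmetric] npp rank_linv KK_def)
  next
    case False
    note j = j[OF False] and k = k[unfolded if_not_P[OF False]]
    have qV: "i + 1 + j \<in> V" using j False by (simp add: H_verts_iff)
    have a: "a = R (i + 1 + j)"
      using wpow_right_string[OF False, of "i + 1" j] right_step(2)[OF i ne] j False by (simp add: a_def H_next_def)
    have iN: "i \<le> len - 1" using i False by (simp add: H_verts_iff)
    have b: "b = Lf (i - j)" using wpow_left_string[OF False iN] j by (simp add: b_def)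
    have pV: "i - j \<in> V" using j iN False by (auto simp: H_verts_iff)
    have nk: "nat ?m = i - j - 1" "?m = int (i - j - 1)" "nat ?p = i + 1 + j"
      using k j by auto
    have "spc b \<longrightarrow> ?m \<in> KK \<union> NN"
    proof (cases "i - j = 1")
      case True
      hence "?m = 0" using k j by simp
      moreover have "b = Lf 1" using b True by simp
      ultimately show ?thesis using False by (simp add: NN_def)
    next
      case ne1: False
      hence "spc (R (i - j - 1)) \<longleftrightarrow> spc b"
        using left_oe[OF pV] spc_oe[of "R (prv (i - j))"] left_step(3)[OF pV] b False by (simp add: prv_def)
      moreover have "1 \<le> ?m" "?m < int len - 1" using k j iN ne1 by auto
      ultimately show ?thesis using False nk by (auto simp: KK_def)
    qed
    moreover have "spc a \<longrightarrow> ?p \<in> KK \<union> NN"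
    proof (cases "i + 1 + j = len - 1")
      case True
      thus ?thesis using a k False len_pos by (auto simp: NN_def)
    next
      case False
      thus ?thesis using \<open>\<not> band\<close> a nk(3) k j by (auto simp: KK_def)
    qed
    moreover have ?A3
      unfolding hh_def if_not_P[OF False] nk a hl_right ..
    moreover have ?A4
      unfolding hh_def if_not_P[OF False] nk b hl_left rank_linv using False by (simp add: prv_def)
    moreover have ?A1 using Fr(1)[OF qV] k by (simp add: a algebra_simps)
    moreover have ?A2 using Fr(2)[OF pV] k j by (simp add: b algebra_simps)
    ultimately show ?thesis by blast
  qed
  thus ?A1 ?A2 ?A3 ?A4
    "spc a \<Longrightarrow> ?p \<in> KK \<union> NN" "spc b \<Longrightarrow> ?m \<in> KK \<union> NN" by blast+
qed

lemma KK_cases: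
  assumes "k \<in> KK"
  obtains i where "i \<in> V" "band \<or> i \<noteq> len - 1" "if band then int i = k mod int len else k = int i" "spc (R i)"
    "hh k = rank (x ! i)" "rr k = 1"
proof (cases band)
  case True
  thus thesis using assms len_pos
    by (intro that[of "nat (k mod int len)"]) (auto simp: KK_def H_verts_iff hh_def rr_def Fr_def nat_less_iff)
next
  case False
  hence k: "nat k \<in> V" "spc (R (nat k))" "k \<ge> 1" "k < int len - 1" using assms by (auto simp: KK_def H_verts_iff)
  hence "rr k = 1" using w_right[of "nat k" 0] by (simp add: Fr_def)
  thus thesis using False k by (intro that[of "nat k"]) (auto simp: hh_def)
qed

lemma rr_sym_iff: "rr a = 2 - rr b \<longleftrightarrow> rr b = 2 - rr a"
  using rr_le[of a] rr_le[of b] by linarith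

lemma NN_cases:
  assumes "k \<in> NN"
  shows "\<not> band" "k = 0 \<and> spc (Lf 1) \<or> k = int (len - 1) \<and> spc (R (len - 1))"
proof -
  have "int (len - 1) = int len - 1" using len_pos by linarith
  thus "\<not> band" "k = 0 \<and> spc (Lf 1) \<or> k = int (len - 1) \<and> spc (R (len - 1))"
    using assms by (auto simp: NN_def simp del: of_nat_diff split: if_splits)
qed

text \<open>Reading across a punctured end continues with the word read backwards from it.\<close>

lemma NN_symmetric:
  assumes k: "k \<in> NN" shows "rr (k + i) = 2 - rr (k - i)"
proof -
  have nb: "\<not> band" using NN_cases[OF k] by simp
  have *: "rr (k + int j) = 2 - rr (k - int j)" for j
  proof (cases j)
    case 0
    have "rr k = 1" using NN_cases[OF k] nb string_end_right[OF nb] string_end_left[OF nb]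
        w_right[of "len - 1" 0] w_left[of 1 0] rr_le[of 0] by (auto simp: Fr_def)
    thus ?thesis using 0 by simp
  next
    case (Suc m)
    from NN_cases(2)[OF k] show ?thesis
    proof (elim disjE conjE)
      assume k: "k = 0" and sp: "spc (Lf 1)"
      have "w (Suc m) (Lf 1) = w m (R 1)" using string_end_left[OF nb] sp by (simp add: live_def)
      thus ?thesis using k Suc w_left[of 1 "Suc m"] w_right[of 1 m] string_end_left[OF nb]
          rr_sym_iff[of "1 + int m" "- 1 - int m"] by (simp del: w.simps add: algebra_simps) 
    next
      assume k: "k = int (len - 1)" and sp: "spc (R (len - 1))"
      have "w (Suc m) (R (len - 1)) = w m (Lf (len - 1))" using string_end_right[OF nb] sp by (simp add: live_def)
      thus ?thesis using k Suc w_right[of "len - 1" "Suc m"] w_left[of "len - 1" m] string_end_right[OF nb]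
        by (simp del: w.simps add: algebra_simps)
    qed
  qed
  show ?thesis
  proof (cases "i \<ge> 0")
    case True
    thus ?thesis using *[of "nat i"] by simp
  next
    case False
    thus ?thesis using *[of "nat (- i)"] rr_sym_iff[of "k + i" "k - i"] by simp
  qed
qed

text \<open>The first difference of the letters of \<open>hatQ Q\<close> is visible in
  \<open>Q\<close> unless it lies over a special base; there only the signs differ, and both
  positions belong to \<open>KK \<union> NN\<close>.\<close>

lemma rr_admissible:
  assumes k: "k \<in> KK"
  shows "\<exists>m>0. (\<forall>i. 0 < i \<longrightarrow> i < m \<longrightarrow> rr (k + i) = 2 - rr (k - i)) \<and>
      (if rr (k + m) = 2 - rr (k - m)
       then k + m \<in> KK \<union> NN \<and> k - m \<in> KK \<union> NN \<and> hh (k + m) \<noteq> 2 - hh (k - m) \<and> (hh k = 0 \<longleftrightarrow> hh (k + m) < 2 - hh (k - m))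
       else hh k = 0 \<longleftrightarrow> rr (k + m) < 2 - rr (k - m))"
proof -
  obtain i where i: "i \<in> V" "band \<or> i \<noteq> len - 1" "if band then int i = k mod int len else k = int i" "spc (R i)"
    "hh k = rank (x ! i)" using KK_cases[OF k] by blast
  define a where "a = (\<lambda>j. (wstep ^^ j) (wstep (R i)))"
  define b where "b = (\<lambda>j. (wstep ^^ j) (Lf i))"
  obtain m where m: "\<forall>j<m. hl (a j) = hl (b j)" "hl (a m) \<noteq> hl (b m)" "\<forall>j\<le>m. base (a j) = base (b j)"
    "is_direct (x ! i) \<longleftrightarrow> rank (hl (a m)) < rank (hl (b m))" "\<not> band \<longrightarrow> i + 1 + m \<le> len - 1 \<and> m < i"
    using admissible_half_edge[OF i(1,2,4)] unfolding a_def b_def by blast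
  have aV: "fst (a j) \<in> V" for j using i fst_wstep by (induction j) (auto simp: a_def)
  have bV: "fst (b j) \<in> V" for j using i fst_wstep by (induction j) (auto simp: b_def)
  have ar: "rr (k + (1 + int j)) = Fr (a j)" "2 - rr (k - (1 + int j)) = Fr (b j)"
    "hh (k + (1 + int j)) = rank (hl (a j))" "2 - hh (k - (1 + int j)) = rank (hl (b j))"
    "spc (a j) \<Longrightarrow> k + (1 + int j) \<in> KK \<union> NN" "spc (b j) \<Longrightarrow> k - (1 + int j) \<in> KK \<union> NN" if "j \<le> m" for j
    using around[OF i(1,2,3), of j] m(5) that unfolding a_def b_def by auto
  have h0: "hh k = 0 \<longleftrightarrow> is_direct (x ! i)" using i(5) by (cases "x ! i") auto
  have sp: "spc (a m) \<longleftrightarrow> spc (b m)" using m(3) spc_base by blast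
  have rk: "rank (hl (a m)) \<noteq> rank (hl (b m))" using hl_eqI[OF aV bV, of m m] m(2,3) by blast
  show ?thesis
  proof (intro exI[of _ "1 + int m"] conjI allI impI)
    fix i' :: int assume i': "0 < i'" "i' < 1 + int m"
    define j where "j = nat (i' - 1)"
    have j: "i' = 1 + int j" "j < m" using i' by (auto simp: j_def)
    have "Fr (a j) = Fr (b j)" using m(1,3) j spc_base[of "a j" "b j"] by (simp add: Fr_def)
    thus "rr (k + i') = 2 - rr (k - i')" using ar(1,2)[of j] j by simp
  next
    show "if rr (k + (1 + int m)) = 2 - rr (k - (1 + int m))
       then k + (1 + int m) \<in> KK \<union> NN \<and> k - (1 + int m) \<in> KK \<union> NN \<and> hh (k + (1 + int m)) \<noteq> 2 - hh (k - (1 + int m)) \<and>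
         (hh k = 0 \<longleftrightarrow> hh (k + (1 + int m)) < 2 - hh (k - (1 + int m)))
       else hh k = 0 \<longleftrightarrow> rr (k + (1 + int m)) < 2 - rr (k - (1 + int m))"
    proof (cases "spc (a m)")
      case True
      hence "Fr (a m) = Fr (b m)" using sp by (simp add: Fr_def)
      thus ?thesis using ar[OF order_refl] True sp rk h0 m(4) by simp
    next
      case False
      hence "Fr (a m) = rank (hl (a m))" "Fr (b m) = rank (hl (b m))" using sp by (auto simp: Fr_def)
      thus ?thesis using ar[OF order_refl] rk h0 m(4) by simp
    qed
  qed simp
qed

end

section \<open>Walking in two words at once\<close>

context adm_pair
begin

lemma hl_eqI:
  assumes h: "fst h \<in> VP" and r: "rank (X.hl (hx h)) = rank (Y.hl (hy h))"
  shows "X.hl (hx h) = Y.hl (hy h)"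
proof -
  have s: "fst (hx h) \<in> X.V" "fst (hy h) \<in> Y.V" and G: "Y.G (fst (fst h)) = X.G (snd (fst h))" using VP_D[OF h] by auto
  from X.hl_cases[OF s(1)] Y.hl_cases[OF s(2)] r consider
    \<alpha> \<beta> where "X.hl (hx h) = Dir \<alpha>" "Y.hl (hy h) = Dir \<beta>" | \<alpha> \<beta> where "X.hl (hx h) = Inv \<alpha>" "Y.hl (hy h) = Inv \<beta>"
    | "X.hl (hx h) = Triv (X.G (snd (fst h))) (snd h)" "Y.hl (hy h) = Triv (Y.G (fst (fst h))) (snd h)" by fastforce
  thus ?thesis
  proof cases
    case (1 \<alpha> \<beta>)
    hence "\<alpha> = \<beta>" using X.hl_Dir[OF s(1) 1(1)] Y.hl_Dir[OF s(2) 1(2)] G X.inj_tgt[of \<alpha> \<beta>] by simp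
    thus ?thesis using 1 by simp
  next
    case (2 \<alpha> \<beta>)
    hence "\<alpha> = \<beta>" using X.hl_Inv[OF s(1) 2(1)] Y.hl_Inv[OF s(2) 2(2)] G X.inj_src[of \<alpha> \<beta>] by simp
    thus ?thesis using 2 by simp
  qed (use G in simp)
qed

lemma on_iff: "fst h \<in> VP \<Longrightarrow> on h \<longleftrightarrow> X.Fr (hx h) = Y.Fr (hy h) \<and> X.live (hx h)"
  using spc_iff[of h] hl_eqI[of h] by (auto simp: on_def X.Fr_def Y.Fr_def X.live_def)

lemma live_iff: "fst h \<in> VP \<Longrightarrow> X.Fr (hx h) = Y.Fr (hy h) \<Longrightarrow> X.live (hx h) \<longleftrightarrow> Y.live (hy h)"
proof -
  assume h: "fst h \<in> VP" and F: "X.Fr (hx h) = Y.Fr (hy h)"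
  show ?thesis
  proof (cases "X.spc (hx h)")
    case True
    thus ?thesis using spc_iff[OF h] by (simp add: X.live_def Y.live_def)
  next
    case False
    hence "X.hl (hx h) = Y.hl (hy h)" using hl_eqI[OF h] F spc_iff[OF h] by (simp add: X.Fr_def Y.Fr_def)
    thus ?thesis using False spc_iff[OF h] X.is_end_iff[of "hx h"] Y.is_end_iff[of "hy h"] VP_D[OF h]
      by (simp add: X.live_def Y.live_def)
  qed
qed

lemma F_eq: "fst h \<in> VP \<Longrightarrow> X.Fr (hx h) = Y.Fr (hy h) \<Longrightarrow> F Q (X.hl (hx h)) = F Q (Y.hl (hy h))"
proof -
  assume h: "fst h \<in> VP" and F: "X.Fr (hx h) = Y.Fr (hy h)"
  have s: "fst (hx h) \<in> X.V" "fst (hy h) \<in> Y.V" and G: "Y.G (fst (fst h)) = X.G (snd (fst h))" using VP_D[OF h] by auto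
  show ?thesis
  proof (cases "X.spc (hx h)")
    case True
    hence "F Q (X.hl (hx h)) = Special (X.G (snd (fst h)))" "F Q (Y.hl (hy h)) = Special (Y.G (fst (fst h)))"
      using X.spc_hl[OF s(1)] Y.spc_hl[OF s(2)] spc_iff[OF h] X.sp_loop[of "X.G (snd (fst h))"] G
      by (auto simp: X.spc_def)
    thus ?thesis using G by simp
  next
    case False
    thus ?thesis using hl_eqI[OF h] F spc_iff[OF h] by (simp add: X.Fr_def Y.Fr_def)
  qed
qed

definition pstep :: "pair_half_edge \<Rightarrow> pair_half_edge" where
  "pstep h = opp (oe h)"

lemma hx_opp: "hx (opp h) = opp (hx h)" and hy_opp: "hy (opp h) = opp (hy h)"
  by (cases h rule: opp.cases; simp)+

lemma pstep_on:
  assumes "on h"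
  shows "hx (pstep h) = X.wstep (hx h)" "hy (pstep h) = Y.wstep (hy h)" "fst (pstep h) \<in> VP" "on (opp (pstep h))"
    "pstep (opp (pstep h)) = opp h"
proof -
  show "hx (pstep h) = X.wstep (hx h)" "hy (pstep h) = Y.wstep (hy h)"
    unfolding pstep_def hx_opp hy_opp on_oe(1,2)[OF assms] X.wstep_def Y.wstep_def by (rule refl)+
  show "fst (pstep h) \<in> VP" "on (opp (pstep h))" "pstep (opp (pstep h)) = opp h"
    using on_oe[OF assms] by (simp_all add: pstep_def)
qed

text \<open>Equal ranks at a common base mean equal letters of \<open>Q\<close>, hence an edge of
  the pair as long as the word of \<open>x\<close> goes on, and crossing it keeps the rank words
  equal.\<close>

lemma words_equal:
  assumes h: "fst h \<in> VP" and w: "X.wd (hx h) = Y.wd (hy h)" and l: "\<And>j. j < m \<Longrightarrow> X.live ((X.wstep ^^ j) (hx h))"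
  shows "hx ((pstep ^^ m) h) = (X.wstep ^^ m) (hx h) \<and> hy ((pstep ^^ m) h) = (Y.wstep ^^ m) (hy h) \<and>
    fst ((pstep ^^ m) h) \<in> VP \<and> X.wd (hx ((pstep ^^ m) h)) = Y.wd (hy ((pstep ^^ m) h)) \<and> (\<forall>j<m. on ((pstep ^^ j) h))"
  using l
proof (induction m)
  case (Suc m)
  let ?g = "(pstep ^^ m) h"
  have IH: "hx ?g = (X.wstep ^^ m) (hx h)" "hy ?g = (Y.wstep ^^ m) (hy h)" "fst ?g \<in> VP" "X.wd (hx ?g) = Y.wd (hy ?g)"
    "\<forall>j<m. on ((pstep ^^ j) h)" using Suc by auto
  have F: "X.Fr (hx ?g) = Y.Fr (hy ?g)" using fun_cong[OF IH(4), of 0] by simp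
  have l: "X.live (hx ?g)" "Y.live (hy ?g)" using Suc.prems[of m] IH(1) live_iff[OF IH(3) F] by auto
  have o: "on ?g" using on_iff[OF IH(3)] F l by simp
  have "X.w j (hx (pstep ?g)) = Y.w j (hy (pstep ?g))" for j
    using fun_cong[OF IH(4), of "Suc j"] l pstep_on(1,2)[OF o] by simp
  thus ?case using IH pstep_on[OF o] o by (auto simp: less_Suc_eq)
qed (use h w in simp)

lemma words_equal_F:
  assumes h: "fst h \<in> VP" and w: "X.wd (hx h) = Y.wd (hy h)" and l: "\<And>j. X.live ((X.wstep ^^ j) (hx h))"
  shows "F Q (X.hl ((X.wstep ^^ m) (hx h))) = F Q (Y.hl ((Y.wstep ^^ m) (hy h)))"
  using words_equal[OF h w l, of m] F_eq[of "(pstep ^^ m) h"] fun_cong[of "X.wd _" "Y.wd _" 0] by (metis X.w.simps(1) Y.w.simps(1))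

end

section \<open>Periods and symmetries of words\<close>

lemma F_linv: "F Q (linv l) = linv (F Q l)"
  by (cases l) auto

lemma nth_drop_take:
  assumes "c < length u" "q < length u"
  shows "(drop (Suc c) u @ take (Suc c) u) ! q = u ! ((Suc c + q) mod length u)"
proof (cases "q < length u - Suc c")
  case True
  thus ?thesis using assms by (simp add: nth_append)
next
  case False
  hence "(Suc c + q) mod length u = q - (length u - Suc c)" using assms by (auto simp: mod_if)
  thus ?thesis using False assms by (simp add: nth_append)
qed

lemma nth_concat_replicate: "i < m * length v \<Longrightarrow> concat (replicate m v) ! i = v ! (i mod length v)"
proof (induction m arbitrary: i)
  case (Suc m)
  show ?case
  proof (cases "i < length v")
    case False
    hence "i - length v < m * length v" using Suc.prems by simp
    thus ?thesis using Suc.IH[of "i - length v"] False by (simp add: nth_append le_mod_geq)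
  qed (simp add: nth_append)
qed simp

text \<open>By Bezout the greatest common divisor of \<open>d\<close> and the length is also a
  period. It divides the length properly, so the word is a power of its prefix of this
  length.\<close>

lemma not_primitive_period:
  assumes ne: "c \<noteq> []" and per: "\<And>j. c ! ((j + d) mod length c) = c ! (j mod length c)" and d: "\<not> length c dvd d"
  shows "\<not> primitive c"
proof -
  define n where "n = length c"
  define g where "g = gcd d n"
  have d0: "d \<noteq> 0" using d by (metis dvd_0_right)
  have n: "n > 0" using ne by (simp add: n_def)
  obtain a b where ab: "d * a = n * b + g" using bezout_nat[OF d0, of n] by (auto simp: g_def)
  have "c ! ((j + d * k) mod n) = c ! (j mod n)" for j k
  proof (induction k)
    case (Suc k)
    thus ?case using per[of "j + d * k"] by (simp add: n_def[symmetric] algebra_simps)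
  qed simp
  hence perg: "c ! ((j + g) mod n) = c ! (j mod n)" for j
    using ab by (metis (no_types, lifting) add.commute add.left_commute mod_mult_self2)
  have pergk: "c ! ((j + g * k) mod n) = c ! (j mod n)" for j k
  proof (induction k)
    case (Suc k)
    thus ?case using perg[of "j + g * k"] by (simp add: algebra_simps)
  qed simp
  have gn: "g dvd n" "g dvd d" "g > 0" using n by (auto simp: g_def)
  hence "g \<noteq> n" using d by (auto simp: n_def)
  define m where "m = n div g"
  have m: "m * g = n" using gn by (simp add: m_def)
  have "m \<ge> 2"
  proof -
    have "m \<noteq> 0" "m \<noteq> 1" using m \<open>g \<noteq> n\<close> n by auto
    thus ?thesis by linarith
  qed
  moreover have gle: "g \<le> n" using gn n by (simp add: dvd_imp_le)
  have "c = concat (replicate m (take g c))"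
  proof (rule nth_equalityI)
    show len: "length c = length (concat (replicate m (take g c)))"
      using m gle by (simp add: length_concat sum_list_replicate n_def min_def)
    fix i assume i: "i < length c"
    have "concat (replicate m (take g c)) ! i = take g c ! (i mod g)"
      using nth_concat_replicate[of i m "take g c"] i m gle by (simp add: n_def min_def)
    also have "\<dots> = c ! (i mod g)" using gn by simp
    also have "\<dots> = c ! ((i mod g) mod n)"
    proof -
      have "i mod g < n" using gn(3) gle by (meson mod_less_divisor less_le_trans)
      thus ?thesis by simp
    qed
    also have "\<dots> = c ! ((i mod g + g * (i div g)) mod n)" by (rule pergk[symmetric])
    also have "\<dots> = c ! i" using i by (simp add: n_def)
    finally show "c ! i = concat (replicate m (take g c)) ! i" by simp
  qed
  ultimately show ?thesis unfolding primitive_def by blast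
qed

context adm_word
begin

text \<open>The comparison of two words is applied to \<open>x\<close> paired with itself.\<close>

lemma equal_words_F:
  assumes "fst s \<in> V" "fst s' \<in> V" "base s = base s'" "wd s = wd s'" "\<And>j. live ((wstep ^^ j) s)"
  shows "F Q (hl ((wstep ^^ m) s)) = F Q (hl ((wstep ^^ m) s'))"
proof -
  interpret P: adm_pair Q x x by unfold_locales
  have "snd s = snd s'" using assms(3) by (simp add: base_def)
  hence h: "fst ((fst s', fst s), snd s) \<in> P.VP" "(snd (fst ((fst s', fst s), snd s)), snd ((fst s', fst s), snd s)) = s"
    "(fst (fst ((fst s', fst s), snd s)), snd ((fst s', fst s), snd s)) = s'"
    using assms(1-3) by (simp_all add: P.VP_iff base_def prod_eq_iff)
  show ?thesis using P.words_equal_F[OF h(1), unfolded h(2,3), OF assms(4,5)] .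
qed

lemma symmetric_words:
  assumes k: "k \<in> KK" and sym: "\<And>i. rr (k + i) = 2 - rr (k - i)"
    and i: "i \<in> V" "band \<or> i \<noteq> len - 1" "if band then int i = k mod int len else k = int i" "spc (R i)"
  shows "wd (wstep (R i)) = wd (Lf i)" "base (wstep (R i)) = base (Lf i)"
proof -
  obtain m where "\<forall>j\<le>m. base ((wstep ^^ j) (wstep (R i))) = base ((wstep ^^ j) (Lf i))"
    using admissible_half_edge[OF i(1,2,4)] by blast
  from this[rule_format, of 0] show "base (wstep (R i)) = base (Lf i)" by simp
  show "wd (wstep (R i)) = wd (Lf i)"
  proof
    fix m
    have "w m (wstep (R i)) = rr (int i + 1 + int m)"
      using w_right[OF i(1), of "Suc m"] right_step(1)[OF i(1,2)] by (simp add: live_def algebra_simps)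
    moreover have "w m (Lf i) = 2 - rr (int i - 1 - int m)" using w_left[OF i(1)] .
    moreover have "rr (int i + 1 + int m) = rr (k + (1 + int m)) \<and> rr (int i - 1 - int m) = rr (k - (1 + int m))"
    proof (cases band)
      case True
      hence "int i = k mod int len" using i by simp
      hence "(int i + 1 + int m) mod int len = (k + (1 + int m)) mod int len"
        "(int i - 1 - int m) mod int len = (k - (1 + int m)) mod int len"
        by (simp_all add: mod_simps add.assoc diff_diff_eq)
      thus ?thesis using rr_mod[OF True] by blast
    qed (use i in \<open>simp add: algebra_simps\<close>)
    ultimately show "w m (wstep (R i)) = w m (Lf i)" using sym[of "1 + int m"] by simp
  qed
qed

text \<open>A reflection of the cyclic word \<open>F(x)\<close> exhibits its inverse as a rotation,
  which asymmetry excludes.\<close>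

lemma not_self_inverse_band:
  assumes b: band and sym: "\<And>a. F Q (x ! nat (a mod int len)) = linv (F Q (x ! nat ((s - a) mod int len)))"
  shows False
proof -
  define u where "u = map (F Q) x"
  \<comment> \<open>The letter \<open>q\<close> of the inverse is the inverse of the letter
    \<open>len - 1 - q\<close>, which the reflection moves to \<open>s - (len - 1 - q)\<close>, that
    is to \<open>c + 1 + q\<close> modulo \<open>len\<close>.\<close>
  define c where "c = nat (s mod int len)"
  have c: "c < length u" "int c = s mod int len" using len_pos by (simp_all add: c_def u_def nat_less_iff)
  have "rotation_of (winv u) u"
    unfolding rotation_of_def
  proof (intro exI[of _ c] conjI nth_equalityI)
    fix q assume "q < length (winv u)"
    hence q: "q < len" by (simp add: winv_def u_def)
    have "(drop (Suc c) u @ take (Suc c) u) ! q = u ! ((Suc c + q) mod len)"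
      using nth_drop_take[OF c(1)] q by (simp add: u_def)
    also have "\<dots> = F Q (x ! ((Suc c + q) mod len))" using len_pos by (simp add: u_def)
    also have "(Suc c + q) mod len = nat ((s - (int len - 1 - int q)) mod int len)"
    proof -
      have "int ((Suc c + q) mod len) = (s mod int len + (1 + int q)) mod int len" by (simp add: zmod_int c(2) algebra_simps)
      also have "\<dots> = (s + (1 + int q)) mod int len" by (rule mod_add_left_eq)
      also have "\<dots> = (s + (1 + int q) - int len) mod int len" by simp
      also have "s + (1 + int q) - int len = s - (int len - 1 - int q)" by simp
      finally show ?thesis by (metis nat_int)
    qed
    also have "F Q (x ! \<dots>) = linv (F Q (x ! nat ((int len - 1 - int q) mod int len)))"
      using sym[of "int len - 1 - int q"] by (metis linv_linv)
    also have "nat ((int len - 1 - int q) mod int len) = len - 1 - q"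
    proof -
      have "int len - 1 - int q = int (len - 1 - q)" using q by linarith
      thus ?thesis using q by simp
    qed
    also have "linv (F Q (x ! (len - 1 - q))) = winv u ! q" using q by (simp add: winv_def rev_nth u_def)
    finally show "winv u ! q = (drop (Suc c) u @ take (Suc c) u) ! q" by simp
  qed (use c in \<open>simp_all add: winv_def\<close>)
  thus False using band_cases[OF b] by (simp add: admissible_band_def symmetric_band_def u_def)
qed

lemma band_asymmetric:
  assumes band and k: "k \<in> KK" and sym: "\<And>i. rr (k + i) = 2 - rr (k - i)"
  shows False
proof -
  obtain i where i: "i \<in> V" "band \<or> i \<noteq> len - 1" "if band then int i = k mod int len else k = int i" "spc (R i)"
    using KK_cases[OF k] by blast
  note sw = symmetric_words[OF k sym i]
  have il: "i < len" using i V_less by simp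
  have live: "live s" for s using assms(1) by (simp add: live_def is_end_def)
  have F: "F Q (x ! ((Suc i mod len + m) mod len)) = linv (F Q (x ! nat ((int i - 1 - int m) mod int len)))" for m
  proof -
    have "F Q (hl ((wstep ^^ m) (wstep (R i)))) = F Q (hl ((wstep ^^ m) (Lf i)))"
      using i fst_wstep sw live by (intro equal_words_F) auto
    thus ?thesis
      using hl_wpow_right[OF assms(1), of "Suc i mod len" m] hl_wpow_left[OF assms(1) il, of m] right_step(2)[OF i(1,2)] assms(1) len_pos
      by (simp add: H_next_def F_linv)
  qed
  have "F Q (x ! nat (a mod int len)) = linv (F Q (x ! nat ((2 * int i - a) mod int len)))" for a
  proof -
    define m where "m = nat ((a - (1 + int i)) mod int len)"
    have m: "int m = (a - (1 + int i)) mod int len" using len_pos by (simp add: m_def)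
    have "(Suc i mod len + m) mod len = (Suc i + m) mod len" by (rule mod_add_left_eq)
    hence "int ((Suc i mod len + m) mod len) = ((1 + int i) + int m) mod int len" by (simp add: zmod_int add.assoc)
    also have "\<dots> = ((1 + int i) + (a - (1 + int i)) mod int len) mod int len" unfolding m ..
    also have "\<dots> = ((1 + int i) + (a - (1 + int i))) mod int len" by (rule mod_add_right_eq)
    finally have "(Suc i mod len + m) mod len = nat (a mod int len)" by (simp add: nat_int_comparison(1))
    moreover have "(int i - 1 - int m) mod int len = (2 * int i - a) mod int len"
      using mod_diff_right_eq[of "int i - 1" "a - (1 + int i)" "int len"] by (simp add: m algebra_simps)
    ultimately show ?thesis using F[of m] by simp
  qed
  thus False by (rule not_self_inverse_band[OF assms(1)])
qed

lemma punctured_ends: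
  assumes "\<not> band"
  shows "spc (Lf 1) \<longleftrightarrow> punctured Q (hd x)" "spc (R (len - 1)) \<longleftrightarrow> punctured Q (last x)"
proof -
  have "hl (Lf 1) = Triv (G 1) (snd (Lf 1))" "hl (R (len - 1)) = Triv (G (len - 1)) (rp (len - 1))"
    using is_end_iff[of "Lf 1"] is_end_iff[of "R (len - 1)"] string_end_left[OF assms] string_end_right[OF assms] by auto
  hence "linv (hd x) = Triv (G 1) (snd (Lf 1))" "last x = Triv (G (len - 1)) (rp (len - 1))"
    using assms len_pos by (auto simp: hl_left hl_right prv_def hd_conv_nth last_conv_nth)
  hence "hd x = TrivInv (G 1) (snd (Lf 1))" "last x = Triv (G (len - 1)) (rp (len - 1))"
    by (metis linv.simps(4) linv_linv)+
  thus "spc (Lf 1) \<longleftrightarrow> punctured Q (hd x)" "spc (R (len - 1)) \<longleftrightarrow> punctured Q (last x)"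
    by (auto simp: spc_def punctured_def)
qed

lemma wtype_PP: "\<not> band \<Longrightarrow> wtype_of Q x = PP \<longleftrightarrow> spc (Lf 1) \<and> spc (R (len - 1))"
  using string_cases[THEN conjunct1] punctured_ends by (auto simp: wtype_of_def split: if_splits)

lemma funpow_Suc_arg: "n > 0 \<Longrightarrow> (f ^^ (n - 1)) a = b \<Longrightarrow> f b = c \<Longrightarrow> (f ^^ n) a = c"
  by (cases n) auto

lemma around_right_end: "\<not> band \<Longrightarrow> (wstep ^^ (len - 1)) (R 1) = Lf (len - 1)"
  and around_left_end: "\<not> band \<Longrightarrow> (wstep ^^ (len - 1)) (Lf (len - 1)) = R 1"
proof -
  assume nb: "\<not> band"
  obtain m where m: "len = Suc (Suc m)" using len_ge2 by (metis add_2_eq_Suc le_Suc_ex)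
  have "(wstep ^^ m) (R 1) = R (len - 1)" using wpow_right_string[OF nb, of 1 m] by (simp add: m)
  thus "(wstep ^^ (len - 1)) (R 1) = Lf (len - 1)"
    using string_end_right[OF nb] funpow_Suc_arg[of "len - 1" wstep "R 1" "R (len - 1)" "Lf (len - 1)"] by (simp add: m)
  have "(wstep ^^ m) (Lf (len - 1)) = Lf 1" using wpow_left_string[OF nb, of "len - 1" m] by (simp add: m)
  thus "(wstep ^^ (len - 1)) (Lf (len - 1)) = R 1"
    using string_end_left[OF nb] funpow_Suc_arg[of "len - 1" wstep "Lf (len - 1)" "Lf 1" "R 1"] by (simp add: m)
qed

text \<open>Reading starts at vertex 1 with letter number 1 of the completion, whence the shift;
  after \<open>len - 1\<close> steps it has turned round at the second puncture. The length counts
  each puncture once and every other letter twice.\<close>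

lemma PP_completion:
  assumes PP: "wtype_of Q x = PP"
  shows "q < 2 * (len - 1) \<Longrightarrow> F Q (hl ((wstep ^^ q) (R 1))) = completion Q x ! ((q + 1) mod (2 * (len - 1)))"
    "length (completion Q x) = 2 * (len - 1)"
proof -
  define n where "n = len - 1"
  have nb: "\<not> band" using PP by simp
  have n: "n \<ge> 1" "len = Suc n" using len_ge2 by (simp_all add: n_def)
  have c: "completion Q x = map (F Q) (x @ winv (tl (butlast x)))" using PP by (simp add: completion_def)
  have l: "length (completion Q x) = 2 * n" using n by (simp add: c winv_def)
  thus "length (completion Q x) = 2 * (len - 1)" by (simp add: n_def)
  have c1: "completion Q x ! j = F Q (x ! j)" if "j \<le> n" for j using that n(2) by (auto simp: c nth_append)
  have c2: "completion Q x ! j = linv (F Q (x ! (2 * n - j)))" if "n < j" "j < 2 * n" for j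
  proof -
    define i where "i = j - len"
    have i: "j = len + i" "i < n - 1" using that n by (auto simp: i_def)
    have "completion Q x ! j = map (F Q) (winv (tl (butlast x))) ! i" by (simp add: c i nth_append)
    also have "\<dots> = F Q (linv (tl (butlast x) ! (n - 1 - Suc i)))" using i n by (simp add: winv_def rev_nth rev_map)
    also have "tl (butlast x) ! (n - 1 - Suc i) = x ! (2 * n - j)"
    proof -
      have "Suc (n - 1 - Suc i) = 2 * n - j" using i n by arith
      thus ?thesis using i n by (simp add: nth_tl nth_butlast)
    qed
    finally show ?thesis by (simp add: F_linv)
  qed
  have "F Q (hl ((wstep ^^ q) (R 1))) = completion Q x ! ((q + 1) mod (2 * n))" if q': "q < 2 * n"
  proof (cases "q < n")
    case True
    hence "(wstep ^^ q) (R 1) = R (1 + q)" using wpow_right_string[OF nb, of 1 q] by (simp add: n_def)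
    moreover have "(q + 1) mod (2 * n) = q + 1" using True by simp
    ultimately show ?thesis using True c1[of "q + 1"] by (simp add: hl_right)
  next
    case False
    define t where "t = q - n"
    have t: "q = t + n" "t < n" using False q' by (auto simp: t_def)
    have "(wstep ^^ q) (R 1) = (wstep ^^ t) (Lf n)"
      using around_right_end[OF nb] by (simp only: t funpow_add comp_apply n_def)
    also have "\<dots> = Lf (n - t)" using wpow_left_string[OF nb, of n t] t by (simp add: n_def)
    finally have *: "F Q (hl ((wstep ^^ q) (R 1))) = linv (F Q (x ! (n - t - 1)))"
      using nb by (simp add: hl_left prv_def F_linv)
    show ?thesis
    proof (cases "t = n - 1")
      case True
      have "F Q (x ! 0) = Special (G 1)"
      proof -
        have sp: "spc (Lf 1)" using wtype_PP[OF nb] PP by simp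
        have "hl (Lf 1) = Triv (G 1) (snd (Lf 1))" using is_end_iff[of "Lf 1"] string_end_left[OF nb] by simp
        hence "linv (x ! 0) = Triv (G 1) Neg" using sp nb by (simp add: hl_left prv_def spc_def)
        hence "x ! 0 = TrivInv (G 1) Neg" by (metis linv.simps(4) linv_linv)
        thus ?thesis using sp by (simp add: spc_def)
      qed
      moreover have "q + 1 = 2 * n" using True t n by simp
      moreover have "n - t - 1 = 0" using True by simp
      ultimately show ?thesis using * c1[of 0] by simp
    next
      case False
      hence "(q + 1) mod (2 * n) = q + 1" "2 * n - (q + 1) = n - t - 1" "n < q + 1" "q + 1 < 2 * n" using t by auto
      thus ?thesis using * c2[of "q + 1"] by simp
    qed
  qed
  thus "q < 2 * (len - 1) \<Longrightarrow> F Q (hl ((wstep ^^ q) (R 1))) = completion Q x ! ((q + 1) mod (2 * (len - 1)))"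
    by (simp add: n_def)
qed

text \<open>A band admits not even one centre. For strings, two reflections compose to a
  translation: in type \<open>PP\<close> the reflections about \<open>k\<close> and at a puncture
  give the primitive completion too short a period; otherwise the period carries the constant rank 1
  beyond an unpunctured end to a place where it cannot occur.\<close>

lemma two_centres:
  assumes k: "k \<in> KK" and k': "k' \<in> KK \<union> NN" and ne: "k \<noteq> k'"
    and sym: "\<And>i. rr (k + i) = 2 - rr (k - i)" and sym': "\<And>i. rr (k' + i) = 2 - rr (k' - i)"
  shows False
proof (cases band)
  case True
  thus False using band_asymmetric[OF _ k sym] by blast
next
  case nb: False
  obtain i where i: "i \<in> V" "band \<or> i \<noteq> len - 1" "if band then int i = k mod int len else k = int i" "spc (R i)"
    using KK_cases[OF k] by blast
  show False
  proof (cases "wtype_of Q x = PP")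
    case True
    define n where "n = len - 1"
    have iN: "1 \<le> i" "i < n" using i nb by (auto simp: H_verts_iff n_def)
    have lv: "live s" if "fst s \<in> V" for s
    proof (cases "is_end s")
      case True
      hence "s = R (len - 1) \<or> s = Lf 1" using nb polarity_cases[of s "R (fst s)"]
        by (auto simp: is_end_def prod_eq_iff split: if_splits)
      thus ?thesis using wtype_PP[OF nb] \<open>wtype_of Q x = PP\<close> by (auto simp: live_def)
    qed (simp add: live_def)
    have V: "fst ((wstep ^^ j) s) \<in> V" if "fst s \<in> V" for j s using that by (induction j) (auto simp: fst_wstep)
    note sw = symmetric_words[OF k sym i]
    define Fl where "Fl q = F Q (hl ((wstep ^^ q) (R 1)))" for q
    have R1: "(wstep ^^ (i - 1)) (R 1) = R i" using wpow_right_string[OF nb, of 1 "i - 1"] iN by (simp add: n_def)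
    have Li: "(wstep ^^ i) (Lf i) = R 1"
    proof -
      have "(wstep ^^ (i - 1)) (Lf i) = Lf 1" using wpow_left_string[OF nb, of i "i - 1"] iN by (simp add: n_def)
      thus ?thesis using string_end_left[OF nb] iN by (intro funpow_Suc_arg[of i _ _ "Lf 1"]) simp_all
    qed
    have wR: "wstep (R i) = (wstep ^^ i) (R 1)"
      using R1 iN by (intro funpow_Suc_arg[of i _ _ "R i", symmetric]) simp_all
    have per: "Fl (q + 2 * i) = Fl q" for q
    proof -
      have "F Q (hl ((wstep ^^ (q + i)) (wstep (R i)))) = F Q (hl ((wstep ^^ (q + i)) (Lf i)))"
        using i fst_wstep sw lv V by (intro equal_words_F) auto
      moreover have "(wstep ^^ (q + i)) (wstep (R i)) = (wstep ^^ (q + 2 * i)) (R 1)"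
        unfolding wR by (metis add.assoc comp_apply funpow_add mult_2)
      moreover have "(wstep ^^ (q + i)) (Lf i) = (wstep ^^ q) (R 1)" using Li by (simp add: funpow_add)
      ultimately show ?thesis by (simp add: Fl_def)
    qed
    have n1: "n \<ge> 1" using iN by simp
    have W2n: "(wstep ^^ (2 * n)) (R 1) = R 1"
      using around_right_end[OF nb] around_left_end[OF nb] by (simp only: mult_2 funpow_add comp_apply n_def)
    have Flc: "Fl q = completion Q x ! ((q + 1) mod (2 * n))" for q
    proof -
      have "(wstep ^^ q) (R 1) = (wstep ^^ (q mod (2 * n))) (R 1)" using funpow_mod_eq[OF W2n] by metis
      moreover have "q mod (2 * n) < 2 * n" using n1 by simp
      ultimately show ?thesis using PP_completion(1)[OF True, of "q mod (2 * n)", folded n_def]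
        by (simp add: Fl_def mod_Suc_eq)
    qed
    have "\<not> primitive (completion Q x)"
    proof (rule not_primitive_period[where d = "2 * i"])
      show "completion Q x \<noteq> []" using PP_completion(2)[OF True] n1 by (auto simp: n_def)
      have l: "length (completion Q x) = 2 * n" using PP_completion(2)[OF True] n1 by (simp add: n_def)
      show "completion Q x ! ((j + 2 * i) mod length (completion Q x)) = completion Q x ! (j mod length (completion Q x))" for j
      proof -
        have "Fl (j + (2 * n - 1) + 2 * i) = Fl (j + (2 * n - 1))" by (rule per)
        moreover have "j + (2 * n - 1) + 2 * i + 1 = j + 2 * i + 2 * n" "j + (2 * n - 1) + 1 = j + 2 * n" using n1 by auto
        ultimately have "completion Q x ! ((j + 2 * i + 2 * n) mod (2 * n)) = completion Q x ! ((j + 2 * n) mod (2 * n))"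
          unfolding Flc by metis
        thus ?thesis unfolding l by simp
      qed
      show "\<not> length (completion Q x) dvd 2 * i" unfolding l using iN by (auto dest: dvd_imp_le)
    qed
    moreover have "primitive (completion Q x)"
      using string_cases[OF nb] True by (simp add: admissible_string_def)
    ultimately show False by simp
  next
    case False
    have range: "0 \<le> k" "k \<le> int len - 1" "0 \<le> k'" "k' \<le> int len - 1"
      using k k' len_pos nb by (auto simp: KK_def NN_def split: if_splits)
    define k1 where "k1 = min k k'"
    define k2 where "k2 = max k k'"
    have k12: "k1 < k2" "k1 \<in> KK \<union> NN" "k2 \<in> KK \<union> NN" using k k' ne by (auto simp: k1_def k2_def min_def max_def)
    define d where "d = 2 * (k2 - k1)"
    have d: "d \<ge> 2" using k12 by (simp add: d_def)
    have "rr (j + 2 * (b - a)) = rr j" if "\<And>i. rr (a + i) = 2 - rr (a - i)" "\<And>i. rr (b + i) = 2 - rr (b - i)" for a b j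
      using that(1)[of "j - a"] that(2)[of "b - 2 * a + j"] rr_le[of j] rr_le[of "2 * a - j"] by (simp add: algebra_simps)
    from this[of k k'] this[of k' k] have per: "rr (j + d) = rr j" for j
      using sym sym' by (auto simp: d_def k1_def k2_def min_def max_def)
    have pern: "rr (j + int t * d) = rr j" for j t
    proof (induction t)
      case (Suc t)
      thus ?case using per[of "j + int t * d"] by (simp add: algebra_simps)
    qed simp
    \<comment> \<open>After a special letter the word goes on with polarity \<open>Pos\<close>, so
      the next letter is not over a special one. It is not the final trivial letter either, as that
      would have to be the second, punctured centre.\<close>
    have "rr (k1 + 1) \<noteq> 1"
    proof -
      define q where "q = nat (k1 + 1)"
      have k1r: "0 \<le> k1" "k1 < int len - 1" using range k12 by (auto simp: k1_def k2_def min_def max_def split: if_splits)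
      have q: "int q = k1 + 1" "q \<in> V" using k1r nb by (auto simp: q_def H_verts_iff)
      have pos: "snd (R q) = Pos"
      proof (cases "k1 = 0")
        case True
        hence "spc (Lf 1)" using k12(2) nb len_ge2 by (auto simp: KK_def NN_def)
        thus ?thesis using q True by (cases "rp 1") (auto simp: spc_def)
      next
        case False
        hence "k1 \<in> KK" using k12(2) k1r nb by (auto simp: NN_def)
        hence p: "q - 1 \<in> V" "q - 1 \<noteq> len - 1" "spc (R (q - 1))" "q \<ge> 2"
          using q False k1r nb by (auto simp: KK_def H_verts_iff q_def nat_add_distrib)
        have "wstep (R (q - 1)) = R q" using right_step(2)[OF p(1)] p nb by (simp add: H_next_def)
        moreover have "snd (oe (R (q - 1))) = Neg" using oe_base(1)[of "R (q - 1)"] p by simp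
        ultimately show ?thesis by (cases "oe (R (q - 1))" rule: opp.cases) (auto simp: wstep_def)
      qed
      hence nsp: "\<not> spc (R q)" by (simp add: spc_def)
      have "q \<noteq> len - 1"
      proof
        assume "q = len - 1"
        hence "k2 = int (len - 1)" using q k12 range by (auto simp: k1_def k2_def min_def max_def split: if_splits)
        hence "spc (R (len - 1))" using k12(3) nb len_ge2 by (auto simp: KK_def NN_def)
        thus False using nsp \<open>q = len - 1\<close> by simp
      qed
      hence "\<not> is_end (R q)" using right_step[OF q(2)] by simp
      hence "rank (hl (R q)) \<noteq> 1" using hl_cases[of "R q"] is_end_iff[of "R q"] q by auto
      thus ?thesis using w_right[OF q(2), of 0] nsp q by (simp add: Fr_def)
    qed
    \<comment> \<open>As the type is not \<open>PP\<close>, one end is unpunctured; the translation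
      by \<open>int len * d\<close> moves \<open>k1 + 1\<close> beyond it.\<close>
    moreover have "rr (k1 + 1) = 1"
    proof (cases "spc (R (len - 1))")
      case False
      have rE: "rr (int (len - 1) + int j) = 1" for j
        using w_right[of "len - 1" j] w_dead[of "R (len - 1)" j] string_end_right[OF nb] False by (simp add: live_def)
      hence *: "rr j = 1" if "j \<ge> int len - 1" for j
      proof -
        have "int (len - 1) = int len - 1" using len_ge2 by (simp add: of_nat_diff)
        hence "int (len - 1) + int (nat (j - int (len - 1))) = j" using that by simp
        thus ?thesis using rE[of "nat (j - int (len - 1))"] by simp
      qed
      have "int len \<le> int len * d" using d by (simp add: mult_le_cancel_left1)
      hence "rr (k1 + 1 + int len * d) = 1" using range by (intro *) (auto simp: k1_def)
      thus ?thesis by (simp add: pern)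
    next
      case True
      hence ns: "\<not> spc (Lf 1)" using False wtype_PP[OF nb] by simp
      have rE: "rr (- int j) = 1" for j
        using w_left[of 1 j] w_dead[of "Lf 1" j] string_end_left[OF nb] ns rr_le[of "- int j"] by (simp add: live_def)
      hence *: "rr j = 1" if "j \<le> 0" for j
        using that rE[of "nat (- j)"] by simp
      have "int len \<le> int len * d" using d by (simp add: mult_le_cancel_left1)
      hence "rr (k1 + 1 - int len * d) = 1" using range by (intro *) (auto simp: k1_def)
      thus ?thesis using pern[of "k1 + 1 - int len * d" len] by simp
    qed
    ultimately show False by simp
  qed
qed

sublocale signed_word rr hh KK NN
proof
  fix k assume "k \<in> KK \<union> NN"
  thus "rr k = 1"
  proof
    assume "k \<in> NN"
    thus ?thesis using NN_symmetric[of k 0] rr_le[of k] by simp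
  qed (use KK_cases in blast)
next
  fix k assume k: "k \<in> KK"
  then obtain i where i: "i \<in> V" "band \<or> i \<noteq> len - 1" "hh k = rank (x ! i)" using KK_cases by blast
  hence "\<not> is_end (R i)" using right_step by simp
  thus "hh k = 0 \<or> hh k = 2" using hl_cases[of "R i"] is_end_iff[of "R i"] i by (auto simp: hl_right)
next
  fix k assume k: "k \<in> NN"
  hence nb: "\<not> band" by (rule NN_cases)
  have "nat k = 0 \<or> nat k = len - 1" using NN_cases(2)[OF k] by auto
  thus "hh k = 1" using string_ends(1,2)[OF nb] nb by (auto simp: hh_def)
qed (use rr_le NN_symmetric rr_admissible two_centres in blast)+

text \<open>The result for half-edges facing right passes to those facing left, because the other
  half of an edge has the inverse letter and exchanges the two words. At a punctured end the two
  words coincide and the rank is 1.\<close>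

theorem sign_compare:
  assumes s: "fst s \<in> V" and sp: "spc s"
  shows "rank (hl s) = 0 \<longleftrightarrow> seq_less (wd (wstep s)) (wd (opp s))"
    "rank (hl s) = 2 \<longleftrightarrow> seq_less (wd (opp s)) (wd (wstep s))"
proof -
  have *: "(rank (hl (R i)) = 0 \<longleftrightarrow> seq_less (wd (wstep (R i))) (wd (Lf i))) \<and>
    (rank (hl (R i)) = 2 \<longleftrightarrow> seq_less (wd (Lf i)) (wd (wstep (R i))))"
    if i: "i \<in> V" "band \<or> i \<noteq> len - 1" "spc (R i)" for i
  proof -
    have k: "int i \<in> KK" using i V_less[OF i(1)] by (auto simp: KK_def H_verts_iff)
    have h: "hh (int i) = rank (hl (R i))" using V_less[OF i(1)] by (simp add: hh_def hl_right)
    have r: "wd (wstep (R i)) = (\<lambda>m. rr (int i + 1 + int m))"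
      using w_right[OF i(1), of "Suc _"] right_step(1)[OF i(1,2)] by (auto simp: live_def algebra_simps fun_eq_iff)
    have l: "wd (Lf i) = (\<lambda>m. 2 - rr (int i - 1 - int m))" using w_left[OF i(1)] by auto
    show ?thesis using sign_less[OF k] unfolding h r l by simp
  qed
  consider "is_end s" | "\<not> is_end s" "s = R (fst s)" | "\<not> is_end s" "s = Lf (fst s)"
    using polarity_cases[of s "R (fst s)"] by auto
  hence "(rank (hl s) = 0 \<longleftrightarrow> seq_less (wd (wstep s)) (wd (opp s))) \<and>
    (rank (hl s) = 2 \<longleftrightarrow> seq_less (wd (opp s)) (wd (wstep s)))"
  proof cases
    case 1
    thus ?thesis using is_end_iff[OF s] seq_less_irrefl by (simp add: wstep_def oe_end)
  next
    case 2
    hence "band \<or> fst s \<noteq> len - 1" using string_end_right by metis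
    thus ?thesis using *[of "fst s"] 2 s sp by metis
  next
    case 3
    hence ne: "band \<or> fst s \<noteq> 1" using string_end_left by metis
    define p where "p = prv (fst s)"
    have p: "p \<in> V" "s = oe (R p)" "wstep s = Lf p" using left_step[OF s ne] left_oe[OF s ne] 3 by (auto simp: p_def)
    have pe: "\<not> is_end (R p)" using oe_not_end(6)[OF s 3(1)] p oe_oe[of "R p"] by simp
    have ne': "band \<or> p \<noteq> len - 1" using pe string_end_right by metis
    have "spc (R p)" using spc_oe[of "R p"] p sp by simp
    moreover have "hl s = linv (hl (R p))" using p hl_oe[of "R p"] pe by simp
    moreover have "wstep (R p) = opp s" using p by (simp add: wstep_def)
    moreover have "rank (hl (R p)) \<le> 2" by (rule rank_le)
    ultimately show ?thesis using *[OF p(1) ne'] p by (auto simp: rank_linv)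
  qed
  thus "rank (hl s) = 0 \<longleftrightarrow> seq_less (wd (wstep s)) (wd (opp s))"
    "rank (hl s) = 2 \<longleftrightarrow> seq_less (wd (opp s)) (wd (wstep s))" by blast+
qed

end

section \<open>The quiver of a pair of words\<close>

context adm_word
begin

lemma rank_hl:
  assumes "fst s \<in> V"
  shows "rank (hl s) = 0 \<longleftrightarrow> (\<exists>\<alpha>. hl s = Dir \<alpha>)" "rank (hl s) = 1 \<longleftrightarrow> is_end s" "rank (hl s) = 2 \<longleftrightarrow> (\<exists>\<alpha>. hl s = Inv \<alpha>)"
  using hl_cases[OF assms] is_end_iff[OF assms] by auto

lemma arrow_ends:
  assumes "fst s \<in> V"
  shows "H_tgt Q x (ar s) = (if rank (hl s) = 0 then fst s else fst (oe s))"
    "H_src Q x (ar s) = (if rank (hl s) = 2 then fst s else fst (oe s))"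
  using rank_hl[OF assms] oe_not_end(9,10)[OF assms] end_punctured(2,3)[OF assms] oe_end[of s] hl_cases[OF assms]
  by (auto split: if_splits)

lemma G_arr_special:
  assumes s: "fst s \<in> V" and sp: "spc s" shows "G_arr Q x (ar s) = sp_loop Q (G (fst s))"
proof (cases "is_end s")
  case True
  thus ?thesis by (rule end_punctured(4)[OF s])
next
  case False
  hence "G_arr Q x (ar s) = letter_arrow (hl s)" "hl s \<noteq> Triv (G (fst s)) Neg"
    using oe_not_end(8)[OF s] rank_hl(2)[OF s] by auto
  thus ?thesis using spc_hl[OF s sp] by auto
qed

lemma ltgt_F: "ltgt (hatQ Q) l = Some p \<Longrightarrow> l \<in> letters (hatQ Q) \<Longrightarrow> ltgt Q (F Q l) = Some p"
  using sp_arrowsD by (cases l) (force simp: letters_hatQ split: if_splits)+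

lemma dbl_nth: "k < len \<Longrightarrow> dbl Q x (int k) = Some (F Q (x ! k))"
proof -
  assume k: "k < len"
  have l: "length (butlast x) = len - 1" "length (tl x) = len - 1" "length (winv u) = length u" for u :: "('v, 'a) letter list"
    by (simp_all add: winv_def)
  show ?thesis
  proof (cases "wtype_of Q x")
    case PU
    obtain m where m: "len = Suc m" using len_pos by (cases len) auto
    have n: "nat (int k + int m) = k + m" by simp
    show ?thesis using PU k by (simp add: dbl_def completion_def Let_def nth_append winv_def m n)
  next
    case PP
    have c: "length (completion Q x) = 2 * (len - 1)" by (rule PP_completion(2)[OF PP])
    moreover have "len \<le> 2 * (len - 1)" using len_ge2 by simp
    ultimately have "int k mod int (length (completion Q x)) = int k" using k by simp
    thus ?thesis using PP k by (simp add: dbl_def Let_def) (simp add: completion_def nth_append)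
  qed (use k in \<open>simp_all add: dbl_def completion_def Let_def nth_append\<close>)
qed

lemma dbl_prv: "i \<in> V \<Longrightarrow> dbl Q x (int i - 1) = Some (F Q (x ! prv i))"
proof (cases "i = 0")
  case True
  assume "i \<in> V"
  hence b: "band" using True by (auto simp: H_verts_iff split: if_splits)
  obtain m where m: "len = Suc m" using len_pos by (cases len) auto
  have "int (len - 1) mod int len = (- 1) mod int len" using zmod_minus1[of "int len"] by (simp add: m)
  hence "dbl Q x (int i - 1) = dbl Q x (int (len - 1))" using b True by (simp add: dbl_def Let_def completion_def)
  also have "\<dots> = Some (F Q (x ! (len - 1)))" using len_pos by (intro dbl_nth) simp
  finally show ?thesis using b True len_pos by (simp add: prv_def)
next
  case False
  assume i: "i \<in> V"
  have "dbl Q x (int (i - 1)) = Some (F Q (x ! (i - 1)))" using V_less[OF i] by (intro dbl_nth) simp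
  moreover have "int (i - 1) = int i - 1" using False by linarith
  moreover have "prv i = i - 1"
  proof (cases band)
    case True
    have "i + len - 1 = (i - 1) + len" using False by simp
    hence "prv i = (i - 1) mod len" using True by (simp only: prv_def if_P mod_add_self2)
    thus ?thesis using V_less[OF i] by simp
  qed (simp add: prv_def)
  ultimately show ?thesis by simp
qed

lemma reading_hl: "i \<in> V \<Longrightarrow> reading Q x i \<rho> 0 = Some (F Q (hl (i, \<rho>)))"
proof -
  assume i: "i \<in> V"
  have "ltgt Q (F Q (x ! i)) = Some (G i, rp i)" using ltgt_F[OF ltgt_right[OF i]] letter_in[OF V_less[OF i]] .
  thus ?thesis using dbl_nth[OF V_less[OF i]] dbl_prv[OF i] by (simp add: reading_def hl_def F_linv)
qed

lemma F_hl:
  assumes "fst s \<in> V"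
  shows "spc s \<Longrightarrow> F Q (hl s) = Special (G (fst s))" "\<not> spc s \<Longrightarrow> F Q (hl s) = hl s \<and> hl s \<in> letters Q"
proof -
  show "F Q (hl s) = Special (G (fst s))" if "spc s"
    using spc_hl[OF assms that] sp_loop[of "G (fst s)"] that by (auto simp: spc_def)
  show "F Q (hl s) = hl s \<and> hl s \<in> letters Q" if n: "\<not> spc s"
  proof -
    have "\<alpha> \<in> ord_arrows Q \<and> \<alpha> \<notin> sp_arrows Q" if h: "hl s = Dir \<alpha> \<or> hl s = Inv \<alpha>" for \<alpha>
    proof -
      have a: "\<alpha> \<in> arrows Q" using h hl_Dir[OF assms] hl_Inv[OF assms] by blast
      have "\<alpha> \<notin> sp_arrows Q"
      proof
        assume "\<alpha> \<in> sp_arrows Q"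
        moreover have "tgt Q \<alpha> = (G (fst s), snd s) \<or> src Q \<alpha> = (G (fst s), snd s)"
          using h hl_Dir[OF assms] hl_Inv[OF assms] by blast
        ultimately show False using n sp_arrowsD[of \<alpha>] by (auto simp: spc_def)
      qed
      thus ?thesis using a by (auto simp: arrows_def)
    qed
    moreover have "hl s = Triv (G (fst s)) (snd s) \<Longrightarrow> G (fst s) \<in> verts Q"
      using hl_letters[OF assms] by (auto simp: letters_hatQ)
    ultimately show ?thesis using hl_cases[OF assms] n by (auto simp: letters_def spc_def)
  qed
qed

end

context half_edge_graph
begin

lemma subgraph:
  assumes "\<And>h. on' h \<Longrightarrow> on h" "\<And>h. on' h \<Longrightarrow> on' (oe h)"
  shows "half_edge_graph V on' oe ed s t (ed ` {h. on' h})"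
proof
  show "ed h = ed h' \<longleftrightarrow> h' = h \<or> h' = oe h" if "on' h" "on' h'" for h h' using ed_eq assms(1) that by metis
  show "{s (ed h), t (ed h)} = {fst h, fst (oe h)}" if "on' h" for h using ends assms(1) that by metis
  show "on' (oe h)" "oe (oe h) = h" "fst h \<in> V" if "on' h" for h using assms oe_oe on_V that by metis+
  show "oe h = h" if "on' h" "fst (oe h) = fst h" for h using assms fst_oe that by metis
qed (rule finite refl)+

end

section \<open>Half-edges and arrows of the pair\<close>

context adm_pair
begin

abbreviation rx :: "pair_half_edge \<Rightarrow> nat" where "rx h \<equiv> rank (X.hl (hx h))"
abbreviation ry :: "pair_half_edge \<Rightarrow> nat" where "ry h \<equiv> rank (Y.hl (hy h))"

lemma red_eq: "red Q x y = {fst h |h. redh h}"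
proof -
  have "(\<exists>a b. reading Q x (snd (fst h)) (snd h) 0 = Some a \<and> reading Q y (fst (fst h)) (snd h) 0 = Some b \<and> letter_less Q a b)
      \<longleftrightarrow> redh h" if h: "fst h \<in> VP" for h
  proof -
    have v: "fst (hx h) \<in> X.V" "fst (hy h) \<in> Y.V" "Y.G (fst (fst h)) = X.G (snd (fst h))" using VP_D[OF h] by auto
    have r: "reading Q x (snd (fst h)) (snd h) 0 = Some (F Q (X.hl (hx h)))" "reading Q y (fst (fst h)) (snd h) 0 = Some (F Q (Y.hl (hy h)))"
      using v by (auto simp: X.reading_hl Y.reading_hl)
    have "letter_less Q (F Q (X.hl (hx h))) (F Q (Y.hl (hy h))) \<longleftrightarrow> redh h"
    proof (cases "X.spc (hx h)")
      case True
      thus ?thesis using X.F_hl(1)[OF v(1)] by (simp add: redh_def letter_less_def)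
    next
      case False
      have t: "ltgt (hatQ Q) (X.hl (hx h)) = Some (X.G (snd (fst h)), snd h)" "ltgt (hatQ Q) (Y.hl (hy h)) = Some (X.G (snd (fst h)), snd h)"
        using X.ltgt_hl[OF v(1)] Y.ltgt_hl[OF v(2)] v(3) by simp_all
      have F: "F Q (X.hl (hx h)) = X.hl (hx h) \<and> X.hl (hx h) \<in> letters Q" "F Q (Y.hl (hy h)) = Y.hl (hy h) \<and> Y.hl (hy h) \<in> letters Q"
        using X.F_hl(2)[OF v(1) False] Y.F_hl(2)[OF v(2)] spc_iff[OF h] False by auto
      have "ltgt Q l = ltgt (hatQ Q) l" for l by (cases l) auto
      thus ?thesis
        using letter_less_rank[OF X.hl_letters[OF v(1)] Y.hl_letters[OF v(2)] t] X.hl_letters[OF v(1)] Y.hl_letters[OF v(2)] t F False h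
        by (simp add: letter_less_def redh_def)
    qed
    thus ?thesis by (simp add: r)
  qed
  note * = this
  show ?thesis
  proof (intro equalityI subsetI)
    fix v assume "v \<in> red Q x y"
    then obtain \<rho> a b where "v \<in> VP" "reading Q x (snd v) \<rho> 0 = Some a \<and> reading Q y (fst v) \<rho> 0 = Some b \<and> letter_less Q a b"
      by (auto simp: red_def)
    thus "v \<in> {fst h |h. redh h}" using *[of "(v, \<rho>)"] by (intro CollectI exI[of _ "(v, \<rho>)"]) auto
  next
    fix v assume "v \<in> {fst h |h. redh h}"
    then obtain h where h: "redh h" "v = fst h" by blast
    hence "fst h \<in> VP" by (simp add: redh_def)
    thus "v \<in> red Q x y" using *[of h] h by (auto simp: red_def) (metis prod.collapse)
  qed
qed

text \<open>Equal ranks mean that both arrows are crossed in the same sense or both are special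
  loops. Otherwise the edge lies over a special loop of \<open>Q\<close>: rank 1 marks a special
  loop of H(x) or H(y), and ranks 0 and 2 are ordinary arrows crossed in opposite senses.\<close>

definition pa :: "pair_half_edge \<Rightarrow> qarrow" where
  "pa h = (if rx h = ry h then HPlus else if rx h = 1 then HOminus else if ry h = 1 then HOplus else HTimes)
     (Y.ar (hy h)) (X.ar (hx h))"

lemma rx_le: "rx h \<le> 2" and ry_le: "ry h \<le> 2"
  by (rule rank_le)+

lemma rx_oe: "on h \<Longrightarrow> rx (oe h) = 2 - rx h" and ry_oe: "on h \<Longrightarrow> ry (oe h) = 2 - ry h"
proof -
  assume h: "on h"
  note v = on_live[OF h]
  show "rx (oe h) = 2 - rx h"
    using on_oe(1)[OF h] X.hl_oe[OF v(1)] X.oe_end[of "hx h"] X.rank_hl(2)[OF v(1)]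
    by (cases "X.is_end (hx h)") (simp_all add: rank_linv)
  show "ry (oe h) = 2 - ry h"
    using on_oe(2)[OF h] Y.hl_oe[OF v(2)] Y.oe_end[of "hy h"] Y.rank_hl(2)[OF v(2)]
    by (cases "Y.is_end (hy h)") (simp_all add: rank_linv)
qed

text \<open>Every arrow of the pair follows the arrow of \<open>x\<close>, and outside
  \<open>HQ_plus\<close> it runs against that of \<open>y\<close>. So outside \<open>HQ_plus\<close>
  it points to the half where \<open>x\<close> has the smaller rank: \<open>rx h < ry h\<close> says
  that it enters at \<open>h\<close>.\<close>

lemma pa_ends:
  assumes h: "on h"
  shows "HQ_tgt Q x y (pa h) = (if rx h = 0 \<or> rx h < ry h then fst h else fst (oe h))"
    "HQ_src Q x y (pa h) = (if rx h = 0 \<or> rx h < ry h then fst (oe h) else fst h)"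
proof -
  note v = on_live[OF h]
  have e: "rx h = 1 \<Longrightarrow> fst (X.oe (hx h)) = snd (fst h)" "ry h = 1 \<Longrightarrow> fst (Y.oe (hy h)) = fst (fst h)"
    using X.rank_hl(2)[OF v(1)] Y.rank_hl(2)[OF v(2)] X.oe_end[of "hx h"] Y.oe_end[of "hy h"] by auto
  have r: "rx h = 0 \<or> rx h = 1 \<or> rx h = 2" "ry h = 0 \<or> ry h = 1 \<or> ry h = 2" using rx_le[of h] ry_le[of h] by linarith+
  have f: "fst (oe h) = (fst (Y.oe (hy h)), fst (X.oe (hx h)))" by (simp add: oe_def)
  show "HQ_tgt Q x y (pa h) = (if rx h = 0 \<or> rx h < ry h then fst h else fst (oe h))"
    "HQ_src Q x y (pa h) = (if rx h = 0 \<or> rx h < ry h then fst (oe h) else fst h)"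
    using r(1)
    by (rule disjE; use r(2) in \<open>elim disjE; simp add: pa_def f e X.arrow_ends[OF v(1)] Y.arrow_ends[OF v(2)] prod_eq_iff\<close>)+
qed

lemma on_pair:
  assumes "fst s \<in> X.V" "fst q \<in> Y.V" "(X.G (fst s), snd s) = (Y.G (fst q), snd q)"
    and "X.spc s \<or> \<not> X.is_end s \<and> X.hl s = Y.hl q"
  shows "on ((fst q, fst s), snd s) \<and> hx ((fst q, fst s), snd s) = s \<and> hy ((fst q, fst s), snd s) = q"
proof -
  obtain i j \<rho> where "s = (i, \<rho>)" "q = (j, \<rho>)" using assms(3) by (cases s; cases q) auto
  thus ?thesis using assms by (auto simp: on_def VP_iff)
qed

lemma G_arr_ar:
  assumes h: "on h"
  shows "G_arr Q y (Y.ar (hy h)) = G_arr Q x (X.ar (hx h))" (is ?A1)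
    "rx h \<noteq> ry h \<Longrightarrow> G_arr Q x (X.ar (hx h)) \<in> sp_arrows Q"
    "if rx h = 1 then X.ar (hx h) \<in> H_sp Q x else X.ar (hx h) \<in> H_ord Q x" (is ?A2)
    "if ry h = 1 then Y.ar (hy h) \<in> H_sp Q y else Y.ar (hy h) \<in> H_ord Q y" (is ?A3)
proof -
  note v = on_live[OF h]
  have VP: "fst h \<in> VP" using h by (simp add: on_def)
  have G: "Y.G (fst (fst h)) = X.G (snd (fst h))" using VP_D[OF VP] by simp
  have sp: "X.spc (hx h) \<Longrightarrow> G_arr Q x (X.ar (hx h)) = sp_loop Q (X.G (snd (fst h)))"
    using X.G_arr_special[OF v(1)] by simp
  have sp': "Y.spc (hy h) \<Longrightarrow> G_arr Q y (Y.ar (hy h)) = sp_loop Q (Y.G (fst (fst h)))"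
    using Y.G_arr_special[OF v(2)] by simp
  have ne: "\<not> X.spc (hx h) \<Longrightarrow> X.hl (hx h) = Y.hl (hy h) \<and> \<not> X.is_end (hx h) \<and> \<not> Y.is_end (hy h)"
    using v(5) X.is_end_iff[OF v(1)] Y.is_end_iff[OF v(2)] by auto
  show ?A1
    using sp sp' ne spc_iff[OF VP] G X.oe_not_end(8)[OF v(1)] Y.oe_not_end(8)[OF v(2)] by (cases "X.spc (hx h)") auto
  show "rx h \<noteq> ry h \<Longrightarrow> G_arr Q x (X.ar (hx h)) \<in> sp_arrows Q"
    using sp ne X.sp_loop[of "X.G (snd (fst h))"] by (cases "X.spc (hx h)") (auto simp: X.spc_def)
  show ?A2
    using X.rank_hl(2)[OF v(1)] X.oe_not_end(7)[OF v(1)] X.end_punctured(1)[OF v(1)] v(3) by (auto simp: X.live_def)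
  show ?A3
    using Y.rank_hl(2)[OF v(2)] Y.oe_not_end(7)[OF v(2)] Y.end_punctured(1)[OF v(2)] v(4) by (auto simp: Y.live_def)
qed

lemma pa_plus: "on h \<Longrightarrow> rx h = ry h \<Longrightarrow> pa h \<in> HQ_plus Q x y"
  and pa_not_plus: "on h \<Longrightarrow> rx h \<noteq> ry h \<Longrightarrow> pa h \<in> HQ_times Q x y \<union> HQ_o Q x y"
  and pa_o: "on h \<Longrightarrow> pa h \<in> HQ_o Q x y \<longleftrightarrow> (rx h = 1) \<noteq> (ry h = 1)"
  using G_arr_ar[of h] by (auto simp: pa_def HQ_plus_def HQ_times_def HQ_o_def split: if_splits)

lemma plus_pa: "HQ_plus Q x y \<subseteq> pa ` {h. on h \<and> rx h = ry h}"
proof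
  fix e assume "e \<in> HQ_plus Q x y"
  then obtain \<beta> \<alpha> where e: "e = HPlus \<beta> \<alpha>" "G_arr Q y \<beta> = G_arr Q x \<alpha>"
    "\<beta> \<in> H_ord Q y \<and> \<alpha> \<in> H_ord Q x \<or> \<beta> \<in> H_sp Q y \<and> \<alpha> \<in> H_sp Q x" by (auto simp: HQ_plus_def)
  have "\<exists>s q. fst s \<in> X.V \<and> fst q \<in> Y.V \<and> (X.G (fst s), snd s) = (Y.G (fst q), snd q) \<and>
    (X.spc s \<or> \<not> X.is_end s \<and> X.hl s = Y.hl q) \<and> X.ar s = \<alpha> \<and> Y.ar q = \<beta> \<and> rank (X.hl s) = rank (Y.hl q)"
    using e(3)
  proof
    assume "\<beta> \<in> H_ord Q y \<and> \<alpha> \<in> H_ord Q x"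
    then obtain s q where s: "fst s \<in> X.V" "\<not> X.is_end s" "X.ar s = \<alpha>" "X.hl s = Dir (G_arr Q x \<alpha>)"
      and q: "fst q \<in> Y.V" "\<not> Y.is_end q" "Y.ar q = \<beta>" "Y.hl q = Dir (G_arr Q y \<beta>)"
      using X.H_ord_half_edge(1) Y.H_ord_half_edge(1) by metis
    thus ?thesis using X.hl_Dir[OF s(1,4)] Y.hl_Dir[OF q(1,4)] e(2) by (intro exI[of _ s] exI[of _ q]) auto
  next
    assume "\<beta> \<in> H_sp Q y \<and> \<alpha> \<in> H_sp Q x"
    then obtain s q where s: "fst s \<in> X.V" "X.is_end s" "X.ar s = \<alpha>" "X.spc s"
      and q: "fst q \<in> Y.V" "Y.is_end q" "Y.ar q = \<beta>" "Y.spc q"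
      using X.H_sp_half_edge Y.H_sp_half_edge by metis
    have "sp_loop Q (X.G (fst s)) = sp_loop Q (Y.G (fst q))"
      using e(2) X.end_punctured(4)[OF s(1,2)] Y.end_punctured(4)[OF q(1,2)] s q by simp
    hence "X.G (fst s) = Y.G (fst q)" using s(4) q(4) X.sp_loop(3) by (metis X.spc_def Y.spc_def prod.inject)
    thus ?thesis using s q X.rank_hl(2)[OF s(1)] Y.rank_hl(2)[OF q(1)]
      by (intro exI[of _ s] exI[of _ q]) (auto simp: X.spc_def Y.spc_def)
  qed
  then obtain s q where sq: "X.ar s = \<alpha>" "Y.ar q = \<beta>" "rank (X.hl s) = rank (Y.hl q)"
    and h: "on ((fst q, fst s), snd s) \<and> hx ((fst q, fst s), snd s) = s \<and> hy ((fst q, fst s), snd s) = q"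
    using on_pair by blast
  show "e \<in> pa ` {h. on h \<and> rx h = ry h}"
  proof (rule image_eqI)
    show "((fst q, fst s), snd s) \<in> {h. on h \<and> rx h = ry h}" using sq(3) h by (simp only: mem_Collect_eq)
    show "e = pa ((fst q, fst s), snd s)" unfolding pa_def using h sq e(1) by (simp only: if_P)
  qed
qed

lemma not_plus_pa: "HQ_times Q x y \<union> HQ_o Q x y \<subseteq> pa ` {h. on h \<and> rx h \<noteq> ry h}"
proof
  fix e assume e: "e \<in> HQ_times Q x y \<union> HQ_o Q x y"
  have "\<exists>s q. fst s \<in> X.V \<and> fst q \<in> Y.V \<and> X.G (fst s) = Y.G (fst q) \<and> X.spc s \<and> Y.spc q \<and> rank (X.hl s) \<noteq> rank (Y.hl q) \<and>
    e = (if rank (X.hl s) = 1 then HOminus else if rank (Y.hl q) = 1 then HOplus else HTimes) (Y.ar q) (X.ar s)"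
  proof -
    have inv: "X.spc s \<and> X.G (fst s) = i" if "fst s \<in> X.V" "X.hl s = Inv \<gamma> \<or> X.hl s = Dir \<gamma>" "\<gamma> = sp_loop Q i" "i \<in> sp_verts Q" for s \<gamma> i
      using X.hl_Inv[OF that(1)] X.hl_Dir[OF that(1)] X.sp_loop[OF that(4)] that by (auto simp: X.spc_def)
    have inv': "Y.spc s \<and> Y.G (fst s) = i" if "fst s \<in> Y.V" "Y.hl s = Inv \<gamma> \<or> Y.hl s = Dir \<gamma>" "\<gamma> = sp_loop Q i" "i \<in> sp_verts Q" for s \<gamma> i
      using Y.hl_Inv[OF that(1)] Y.hl_Dir[OF that(1)] X.sp_loop[OF that(4)] that by (auto simp: Y.spc_def)
    consider (t) \<nu> \<mu> where "e = HTimes \<nu> \<mu>" "\<nu> \<in> H_ord Q y" "\<mu> \<in> H_ord Q x" "G_arr Q y \<nu> = G_arr Q x \<mu>" "G_arr Q x \<mu> \<in> sp_arrows Q"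
      | (m) \<nu> \<eta> where "e = HOminus \<nu> \<eta>" "\<nu> \<in> H_ord Q y" "\<eta> \<in> H_sp Q x" "G_arr Q y \<nu> = G_arr Q x \<eta>"
      | (p) \<eta> \<mu> where "e = HOplus \<eta> \<mu>" "\<eta> \<in> H_sp Q y" "\<mu> \<in> H_ord Q x" "G_arr Q y \<eta> = G_arr Q x \<mu>"
      using e by (auto simp: HQ_times_def HQ_o_def)
    thus ?thesis
    proof cases
      case t
      obtain s q where s: "fst s \<in> X.V" "X.ar s = \<mu>" "X.hl s = Dir (G_arr Q x \<mu>)"
        and q: "fst q \<in> Y.V" "Y.ar q = \<nu>" "Y.hl q = Inv (G_arr Q y \<nu>)"
        using X.H_ord_half_edge(1) Y.H_ord_half_edge(2) t by metis
      have a: "G_arr Q x \<mu> \<in> arrows Q" using X.sp_arrowsD(1) t by blast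
      obtain i where i: "i \<in> sp_verts Q" "G_arr Q x \<mu> = sp_loop Q i"
        using X.sp_arrowsD[OF t(5)] X.special_base_arrow[OF a] by metis
      show ?thesis using t s q inv[OF s(1) _ i(2,1)] inv'[OF q(1), of "G_arr Q y \<nu>" i] i
        by (intro exI[of _ s] exI[of _ q]) auto
    next
      case m
      obtain s q where s: "fst s \<in> X.V" "X.is_end s" "X.ar s = \<eta>" "X.spc s"
        and q: "fst q \<in> Y.V" "Y.ar q = \<nu>" "Y.hl q = Inv (G_arr Q y \<nu>)"
        using X.H_sp_half_edge Y.H_ord_half_edge(2) m by metis
      have "G_arr Q y \<nu> = sp_loop Q (X.G (fst s))" "X.G (fst s) \<in> sp_verts Q"
        using X.end_punctured(4)[OF s(1,2)] m s by (auto simp: X.spc_def)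
      thus ?thesis using m s q inv'[OF q(1), of "G_arr Q y \<nu>"] X.rank_hl(2)[OF s(1)]
        by (intro exI[of _ s] exI[of _ q]) auto
    next
      case p
      obtain s q where s: "fst s \<in> Y.V" "Y.is_end s" "Y.ar s = \<eta>" "Y.spc s"
        and q: "fst q \<in> X.V" "X.ar q = \<mu>" "X.hl q = Inv (G_arr Q x \<mu>)"
        using Y.H_sp_half_edge X.H_ord_half_edge(2) p by metis
      have "G_arr Q x \<mu> = sp_loop Q (Y.G (fst s))" "Y.G (fst s) \<in> sp_verts Q"
        using Y.end_punctured(4)[OF s(1,2)] p s by (auto simp: Y.spc_def)
      thus ?thesis using p s q inv[OF q(1), of "G_arr Q x \<mu>"] Y.rank_hl(2)[OF s(1)]
        by (intro exI[of _ q] exI[of _ s]) auto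
    qed
  qed
  then obtain s q where sq: "fst s \<in> X.V" "fst q \<in> Y.V" "X.G (fst s) = Y.G (fst q)" "X.spc s" "Y.spc q" "rank (X.hl s) \<noteq> rank (Y.hl q)"
    and e: "e = (if rank (X.hl s) = 1 then HOminus else if rank (Y.hl q) = 1 then HOplus else HTimes) (Y.ar q) (X.ar s)" by blast
  hence h: "on ((fst q, fst s), snd s) \<and> hx ((fst q, fst s), snd s) = s \<and> hy ((fst q, fst s), snd s) = q"
    by (intro on_pair) (auto simp: X.spc_def Y.spc_def)
  show "e \<in> pa ` {h. on h \<and> rx h \<noteq> ry h}"
  proof (rule image_eqI)
    show "((fst q, fst s), snd s) \<in> {h. on h \<and> rx h \<noteq> ry h}" using sq(6) h by (simp only: mem_Collect_eq not_False_eq_True simp_thms)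
    show "e = pa ((fst q, fst s), snd s)" unfolding pa_def using h sq(6) e by (simp only: if_False)
  qed
qed

lemma HQ_arrows_eq: "HQ_arrows Q x y = pa ` {h. on h}"
  and HQ_plus_eq: "HQ_plus Q x y = pa ` {h. on h \<and> rx h = ry h}"
proof -
  have "pa ` {h. on h} = pa ` {h. on h \<and> rx h = ry h} \<union> pa ` {h. on h \<and> rx h \<noteq> ry h}" by blast
  moreover show p: "HQ_plus Q x y = pa ` {h. on h \<and> rx h = ry h}" using plus_pa pa_plus by blast
  moreover have "HQ_times Q x y \<union> HQ_o Q x y = pa ` {h. on h \<and> rx h \<noteq> ry h}" using not_plus_pa pa_not_plus by blast
  ultimately show "HQ_arrows Q x y = pa ` {h. on h}" unfolding HQ_arrows_def by (simp add: Un_assoc)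
qed

lemma orange_purple: "orange Q x y \<union> purple Q x y = {fst h |h. on h \<and> rx h < ry h}"
proof -
  have eq: "orange Q x y \<union> purple Q x y = HQ_tgt Q x y ` (pa ` {h. on h \<and> rx h \<noteq> ry h})"
    using not_plus_pa pa_not_plus unfolding orange_def purple_def by blast
  show ?thesis
  proof (intro equalityI subsetI)
    fix v assume "v \<in> orange Q x y \<union> purple Q x y"
    then obtain h where h: "on h" "rx h \<noteq> ry h" "v = HQ_tgt Q x y (pa h)" unfolding eq by blast
    show "v \<in> {fst h |h. on h \<and> rx h < ry h}"
    proof (cases "rx h < ry h")
      case True
      hence "v = fst h" using h(3) pa_ends(1)[OF h(1)] by simp
      thus ?thesis using h(1) True by (intro CollectI exI[of _ h] conjI)
    next
      case False
      hence "v = fst (oe h)" "rx (oe h) < ry (oe h)" using h pa_ends(1)[OF h(1)] rx_oe ry_oe rx_le[of h] by auto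
      thus ?thesis using on_oe(4)[OF h(1)] by blast
    qed
  next
    fix v assume "v \<in> {fst h |h. on h \<and> rx h < ry h}"
    then obtain h where h: "on h" "rx h < ry h" "v = fst h" by blast
    hence "v = HQ_tgt Q x y (pa h)" using pa_ends(1)[OF h(1)] by simp
    moreover have "h \<in> {h. on h \<and> rx h \<noteq> ry h}" using h(1,2) by simp
    ultimately show "v \<in> orange Q x y \<union> purple Q x y" unfolding eq by (simp only: imageI)
  qed
qed

lemma pa_eq:
  assumes h: "on h" and h': "on h'"
  shows "pa h = pa h' \<longleftrightarrow> h' = h \<or> h' = oe h"
proof
  note v = on_live[OF h] and v' = on_live[OF h']
  have eqI: "h' = g" if "hx h' = hx g" "hy h' = hy g" for g using that by (simp add: prod_eq_iff)
  assume p: "pa h = pa h'"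
  have ar: "X.ar (hx h) = X.ar (hx h')" "Y.ar (hy h) = Y.ar (hy h')" using p by (auto simp: pa_def split: if_splits)
  have same: "(rx h = ry h) = (rx h' = ry h')"
    using p by (auto simp: pa_def split: if_splits)
  show "h' = h \<or> h' = oe h"
  proof (cases "X.is_end (hx h)")
    case True
    hence x: "hx h' = hx h" using X.ar_inj_end[OF v(1) v'(1) True ar(1)] by simp
    show ?thesis
    proof (cases "Y.is_end (hy h)")
      case True
      thus ?thesis using x Y.ar_inj_end[OF v(2) v'(2) True ar(2)] eqI by auto
    next
      case False
      thus ?thesis using x Y.ar_inj[OF v(2) v'(2) False ar(2)] eqI[of h] eqI[of "oe h"] on_oe(1,2)[OF h] X.oe_end[OF True] by metis
    qed
  next
    case False
    have x: "hx h' = hx h \<or> hx h' = X.oe (hx h)" using X.ar_inj[OF v(1) v'(1) False ar(1)] .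
    show ?thesis
    proof (cases "Y.is_end (hy h)")
      case True
      thus ?thesis using x Y.ar_inj_end[OF v(2) v'(2) True ar(2)] eqI[of h] eqI[of "oe h"] on_oe(1,2)[OF h] Y.oe_end[OF True] by metis
    next
      case nY: False
      have y: "hy h' = hy h \<or> hy h' = Y.oe (hy h)" using Y.ar_inj[OF v(2) v'(2) nY ar(2)] .
      have r: "rx h \<noteq> 1" "ry h \<noteq> 1" using X.rank_hl(2)[OF v(1)] Y.rank_hl(2)[OF v(2)] False nY by auto
      have le: "rx h \<le> 2" "ry h \<le> 2" by (rule rank_le)+
      have "rank (X.hl (X.oe (hx h))) = 2 - rx h" "rank (Y.hl (Y.oe (hy h))) = 2 - ry h"
        using rx_oe[OF h] ry_oe[OF h] on_oe(1,2)[OF h] by auto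
      \<comment> \<open>Exchanging the halves in one word only replaces one of the ranks 0 and 2 by
        the other and thus changes whether the two ranks agree, which the arrow remembers.\<close>
      hence "\<not> (hx h' = hx h \<and> hy h' = Y.oe (hy h))" "\<not> (hx h' = X.oe (hx h) \<and> hy h' = hy h)"
        using same r le by auto
      thus ?thesis using x y eqI[of h] eqI[of "oe h"] on_oe(1,2)[OF h] by metis
    qed
  qed
next
  assume "h' = h \<or> h' = oe h"
  moreover have "pa (oe h) = pa h"
  proof -
    note v = on_live[OF h]
    have "X.ar (hx (oe h)) = X.ar (hx h)" using on_oe(1)[OF h] X.oe_not_end(4)[OF v(1)] X.oe_end[of "hx h"] by metis
    moreover have "Y.ar (hy (oe h)) = Y.ar (hy h)" using on_oe(2)[OF h] Y.oe_not_end(4)[OF v(2)] Y.oe_end[of "hy h"] by metis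
    moreover have "(rx (oe h) = ry (oe h)) = (rx h = ry h)" "(rx (oe h) = 1) = (rx h = 1)" "(ry (oe h) = 1) = (ry h = 1)"
      using rx_oe[OF h] ry_oe[OF h] rx_le[of h] ry_le[of h] by auto
    ultimately show ?thesis by (simp only: pa_def)
  qed
  ultimately show "pa h = pa h'" by auto
qed

sublocale P: half_edge_graph VP on oe pa "HQ_src Q x y" "HQ_tgt Q x y" "HQ_arrows Q x y"
proof
  fix h assume h: "on h"
  note v = on_live[OF h]
  show "fst h \<in> VP" using h by (simp add: on_def)
  show "on (oe h)" "oe (oe h) = h" using on_oe[OF h] by auto
  show "{HQ_src Q x y (pa h), HQ_tgt Q x y (pa h)} = {fst h, fst (oe h)}" unfolding pa_ends[OF h] by auto
  show "oe h = h" if "fst (oe h) = fst h"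
  proof -
    have "fst (X.oe (hx h)) = fst (hx h)" "fst (Y.oe (hy h)) = fst (hy h)" using that by (simp_all add: oe_def prod_eq_iff)
    hence "X.is_end (hx h)" "Y.is_end (hy h)" using X.oe_not_end(5)[OF v(1)] Y.oe_not_end(5)[OF v(2)] by auto
    thus ?thesis using on_oe(1,2)[OF h] X.oe_end Y.oe_end by (simp add: prod_eq_iff)
  qed
next
  show "finite VP" by (rule finite_VP)
  show "HQ_arrows Q x y = pa ` {h. on h}" by (rule HQ_arrows_eq)
  show "pa h = pa h' \<longleftrightarrow> h' = h \<or> h' = oe h" if "on h" "on h'" for h h' using pa_eq that .
qed

text \<open>The real lines live in the subgraph of these half-edges. The same abstract results serve
  the whole graph as \<open>P\<close> and this subgraph as \<open>R\<close>.\<close>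

definition onp :: "pair_half_edge \<Rightarrow> bool" where
  "onp h \<longleftrightarrow> on h \<and> rx h = ry h"

sublocale R: half_edge_graph VP onp oe pa "HQ_src Q x y" "HQ_tgt Q x y" "HQ_plus Q x y"
  unfolding HQ_plus_eq onp_def[symmetric] using rx_oe ry_oe on_oe by (intro P.subgraph) (auto simp: onp_def)

lemma loop_iff: "on h \<Longrightarrow> oe h = h \<longleftrightarrow> rx h = 1 \<and> ry h = 1"
proof -
  assume h: "on h"
  note v = on_live[OF h]
  have "oe h = h \<longleftrightarrow> X.oe (hx h) = hx h \<and> Y.oe (hy h) = hy h" using on_oe(1,2)[OF h] by (auto simp: prod_eq_iff)
  moreover have "X.oe (hx h) = hx h \<longleftrightarrow> X.is_end (hx h)" using X.oe_not_end(5)[OF v(1)] X.oe_end by metis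
  moreover have "Y.oe (hy h) = hy h \<longleftrightarrow> Y.is_end (hy h)" using Y.oe_not_end(5)[OF v(2)] Y.oe_end by metis
  ultimately show ?thesis using X.rank_hl(2)[OF v(1)] Y.rank_hl(2)[OF v(2)] by simp
qed

end

section \<open>Long and real lines\<close>

lemma seq_le_prefix:
  assumes "\<forall>i<m. u i = v i" "\<And>i. u (m + i) = u' i" "\<And>i. v (m + i) = v' i" "seq_le u' v'"
  shows "seq_le u v"
proof (cases "u' = v'")
  case True
  have "u i = v i" for i
    using assms(1) assms(2)[of "i - m"] assms(3)[of "i - m"] True by (cases "i < m") auto
  thus ?thesis by (auto simp: seq_le_def)
next
  case False
  then obtain e where e: "\<forall>i<e. u' i = v' i" "u' e < v' e" using assms(4) by (auto simp: seq_le_def seq_less_def)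
  have "u i = v i" if "i < m + e" for i
    using assms(1) assms(2)[of "i - m"] assms(3)[of "i - m"] e(1) that by (cases "i < m") auto
  thus ?thesis using e(2) assms(2,3)[of e] by (auto simp: seq_le_def seq_less_def intro!: exI[of _ "m + e"])
qed

lemma seq_less_tail:
  assumes "\<forall>i<m. u i = v i" "\<And>i. u (m + i) = u' i" "\<And>i. v (m + i) = v' i" "seq_less u v"
  shows "seq_less u' v'"
proof -
  obtain e where e: "\<forall>i<e. u i = v i" "u e < v e" using assms(4) by (auto simp: seq_less_def)
  have "m \<le> e" using assms(1) e(2) by (metis less_irrefl not_le)
  then obtain d where d: "e = m + d" by (metis le_iff_add)
  have "\<forall>i<d. u' i = v' i" using e(1) d assms(2,3) by (metis nat_add_left_cancel_less)
  moreover have "u' d < v' d" using e(2) d assms(2,3) by metis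
  ultimately show ?thesis by (auto simp: seq_less_def)
qed

lemma seq_le_less_trans: "seq_le u v \<Longrightarrow> seq_less v w \<Longrightarrow> seq_less u w"
  and seq_less_le_trans: "seq_less u v \<Longrightarrow> seq_le v w \<Longrightarrow> seq_less u w"
  using seq_less_trans by (auto simp: seq_le_def)

lemma first_failure: "\<exists>a<k. \<not> A a \<Longrightarrow> \<exists>a<k. \<not> A a \<and> (\<forall>i<a. A i)" for k :: nat
proof -
  assume "\<exists>a<k. \<not> A a"
  then obtain a where a: "a < k" "\<not> A a" by blast
  obtain b where "b \<le> a" "\<forall>i<b. A i" "\<not> A b" using ex_least_nat_le[of "\<lambda>a. \<not> A a", OF a(2)] by auto
  thus ?thesis using a(1) by (intro exI[of _ b]) simp
qed

context half_edge_graph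
begin

lemma edges_of_loops: "{e \<in> edges_of (compo u). s e = t e} = ed ` loops (compo u)"
proof (intro equalityI subsetI)
  fix e assume "e \<in> {e \<in> edges_of (compo u). s e = t e}"
  then obtain h where "on h" "fst h \<in> compo u" "e = ed h" "s e = t e" unfolding edges_of_comp by blast
  thus "e \<in> ed ` loops (compo u)" using edge_loop_iff[of h] unfolding loops_def by blast
next
  fix e assume "e \<in> ed ` loops (compo u)"
  then obtain h where "on h" "fst h \<in> compo u" "e = ed h" "oe h = h" unfolding loops_def by blast
  thus "e \<in> {e \<in> edges_of (compo u). s e = t e}" using edge_loop_iff[of h] unfolding edges_of_comp by blast
qed

lemma closedD: "closed C \<Longrightarrow> on h \<Longrightarrow> fst h \<in> C \<Longrightarrow> fst (oe h) \<in> C"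
  unfolding closed_def by blast

lemma closed_step: "closed C \<Longrightarrow> fst h \<in> C \<Longrightarrow> fst (step h) \<in> C"
  by (simp add: step_def closedD)

lemma closed_W: "closed C \<Longrightarrow> fst h \<in> C \<Longrightarrow> fst (W h k) \<in> C"
  by (induction k) (auto simp: closed_step)

end

context adm_pair
begin

lemma plus_step: "R.closed C \<Longrightarrow> onp h \<Longrightarrow> fst h \<in> C \<Longrightarrow> fst (P.step h) \<in> C"
  using R.closedD[of C h] by (simp add: P.step_def onp_def)

abbreviation wX :: "pair_half_edge \<Rightarrow> nat \<Rightarrow> nat" where "wX h \<equiv> X.wd (hx h)"
abbreviation wY :: "pair_half_edge \<Rightarrow> nat \<Rightarrow> nat" where "wY h \<equiv> Y.wd (hy h)"

lemma step_on: "on h \<Longrightarrow> P.step h = pstep h"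
  by (simp add: P.step_def pstep_def)

lemma walk_words:
  assumes "\<And>j. j < m \<Longrightarrow> on (P.W h j)"
  shows "(\<forall>k. wX h (m + k) = wX (P.W h m) k \<and> wY h (m + k) = wY (P.W h m) k) \<and> (\<forall>i<m. wX h i = wY h i)"
  using assms
proof (induction m arbitrary: h)
  case (Suc m)
  have o: "on h" using Suc.prems[of 0] by simp
  note v = on_live[OF o]
  have VP: "fst h \<in> VP" using o by (simp add: on_def)
  have F: "X.Fr (hx h) = Y.Fr (hy h)" using on_iff[OF VP] o by blast
  have W: "P.W h (Suc k) = P.W (pstep h) k" for k using step_on[OF o] P.W_Suc(2)[of k h] by simp
  have "on (P.W (pstep h) j)" if "j < m" for j using Suc.prems[of "Suc j"] that W by simp
  note IH = Suc.IH[OF this]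
  have s: "wX h (Suc k) = wX (pstep h) k" "wY h (Suc k) = wY (pstep h) k" for k
    using v(3,4) pstep_on(1,2)[OF o] by auto
  show ?case
  proof (intro conjI allI impI)
    fix k show "wX h (Suc m + k) = wX (P.W h (Suc m)) k" "wY h (Suc m + k) = wY (P.W h (Suc m)) k"
      using s[of "m + k"] IH by (simp_all only: W add_Suc)
  next
    fix i assume "i < Suc m"
    thus "wX h i = wY h i" using F s IH by (cases i) auto
  qed
qed simp

lemma walk_back:
  assumes g: "g = P.W (opp h) m" and o: "\<And>j. j < m \<Longrightarrow> on (P.W (opp h) j)"
  shows "P.W (opp g) m = h" "\<And>j. j < m \<Longrightarrow> on (P.W (opp g) j)"
proof -
  show "P.W (opp g) m = h" using P.W_opp[of m m "opp h"] g by simp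
  fix j assume j: "j < m"
  have "P.W (opp g) j = opp (P.W (opp h) (m - j))" using P.W_opp[of j m "opp h"] g j by simp
  also have "P.W (opp h) (m - j) = P.step (P.W (opp h) (m - Suc j))" using j by (metis P.W_Suc(1) Suc_diff_Suc)
  also have "\<dots> = opp (oe (P.W (opp h) (m - Suc j)))" using o[of "m - Suc j"] j by (simp add: P.step_def)
  finally show "on (P.W (opp g) j)" using o[of "m - Suc j"] j by (simp add: on_oe(4))
qed

text \<open>At the first difference of the words the walk has reached a half-edge without an edge; a
  smaller rank of \<open>x\<close> there would make it red.\<close>

lemma word_le_closed:
  assumes C: "P.closed C" "C \<subseteq> VP" "\<And>h. fst h \<in> C \<Longrightarrow> \<not> redh h" and h: "fst h \<in> C"
  shows "seq_le (wY h) (wX h)"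
proof -
  have "\<not> wX h m < wY h m" if "fst h \<in> C" "\<forall>i<m. wX h i = wY h i" for m h
    using that
  proof (induction m arbitrary: h)
    case 0
    hence VP: "fst h \<in> VP" "\<not> redh h" using C by auto
    thus ?case using spc_iff[OF VP(1)] by (auto simp: redh_def X.Fr_def Y.Fr_def)
  next
    case (Suc m)
    hence VP: "fst h \<in> VP" using C by auto
    have F: "X.Fr (hx h) = Y.Fr (hy h)" using Suc.prems(2) by fastforce
    show ?case
    proof (cases "X.live (hx h)")
      case True
      hence o: "on h" using on_iff[OF VP] F by simp
      have s: "wX h (Suc k) = wX (pstep h) k" "wY h (Suc k) = wY (pstep h) k" for k
        using on_live(3,4)[OF o] pstep_on(1,2)[OF o] by auto
      have "fst (pstep h) \<in> C" using P.closedD[OF C(1) o Suc.prems(1)] by (simp add: pstep_def)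
      thus ?thesis using Suc.IH[of "pstep h"] Suc.prems(2) s by (metis Suc_less_eq)
    next
      case False
      thus ?thesis using live_iff[OF VP F] by simp
    qed
  qed
  hence "\<not> seq_less (wX h) (wY h)" using h unfolding seq_less_def by blast
  thus ?thesis using seq_not_le by blast
qed

text \<open>Ranks can differ only over a special base, where \<open>sign_compare\<close> applies to
  both words. If \<open>x\<close> has the smaller rank, its letter is not inverse and that of
  \<open>y\<close> is not direct, which gives the weak comparisons; moreover \<open>x\<close> has
  rank 0 or \<open>y\<close> has rank 2, which makes one of them strict.\<close>

lemma sign_lt:
    "on h \<Longrightarrow> rx h < ry h \<Longrightarrow> seq_le (wX (pstep h)) (wX (opp h)) \<and> seq_le (wY (opp h)) (wY (pstep h)) \<and>
      (seq_less (wX (pstep h)) (wX (opp h)) \<or> seq_less (wY (opp h)) (wY (pstep h)))"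
  and sign_gt: "on h \<Longrightarrow> ry h < rx h \<Longrightarrow> seq_le (wX (opp h)) (wX (pstep h)) \<and> seq_le (wY (pstep h)) (wY (opp h))"
proof -
  have sp: "X.spc (hx h) \<and> Y.spc (hy h)" if "on h" "rx h \<noteq> ry h" for h
    using that on_live(5)[OF that(1)] spc_iff[of h] by (auto simp: on_def)
  have c: "(rx h = 0 \<longleftrightarrow> seq_less (wX (pstep h)) (wX (opp h))) \<and> (rx h = 2 \<longleftrightarrow> seq_less (wX (opp h)) (wX (pstep h))) \<and>
    (ry h = 0 \<longleftrightarrow> seq_less (wY (pstep h)) (wY (opp h))) \<and> (ry h = 2 \<longleftrightarrow> seq_less (wY (opp h)) (wY (pstep h)))"
    if "on h" "rx h \<noteq> ry h" for h
    using X.sign_compare[OF on_live(1)[OF that(1)]] Y.sign_compare[OF on_live(2)[OF that(1)]] sp[OF that]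
    unfolding hx_opp hy_opp pstep_on(1,2)[OF that(1)] by blast
  have le: "rx h \<le> 2" "ry h \<le> 2" for h by (rule rank_le)+
  show "seq_le (wX (pstep h)) (wX (opp h)) \<and> seq_le (wY (opp h)) (wY (pstep h)) \<and>
      (seq_less (wX (pstep h)) (wX (opp h)) \<or> seq_less (wY (opp h)) (wY (pstep h)))" if h: "on h" "rx h < ry h"
  proof -
    have "rx h \<noteq> 2" "ry h \<noteq> 0" "rx h = 0 \<or> ry h = 2" using h le[of h] by linarith+
    thus ?thesis using c[OF h(1)] h(2) seq_not_le by (metis less_irrefl)
  qed
  show "seq_le (wX (opp h)) (wX (pstep h)) \<and> seq_le (wY (pstep h)) (wY (opp h))" if h: "on h" "ry h < rx h"
  proof -
    have "rx h \<noteq> 0" "ry h \<noteq> 2" using h le[of h] by linarith+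
    thus ?thesis using c[OF h(1)] h(2) seq_not_le by (metis less_irrefl)
  qed
qed

lemma walk_words_opp:
  assumes g: "g = P.W (opp h) m" and o: "\<And>j. j < m \<Longrightarrow> on (P.W (opp h) j)" "on g"
  shows "\<forall>i<Suc m. wX (opp h) i = wY (opp h) i" "wX (opp h) (Suc m + i) = wX (pstep g) i"
    "wY (opp h) (Suc m + i) = wY (pstep g) i"
proof -
  have "on (P.W (opp h) j)" if "j < Suc m" for j using o g that by (cases "j = m") auto
  note * = walk_words[OF this]
  have "P.W (opp h) (Suc m) = pstep g" using g step_on[OF o(2)] by simp
  thus "\<forall>i<Suc m. wX (opp h) i = wY (opp h) i" "wX (opp h) (Suc m + i) = wX (pstep g) i"
    "wY (opp h) (Suc m + i) = wY (pstep g) i" using * by metis+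
qed

text \<open>The arrows at \<open>h\<close> and \<open>g\<close> both point into the segment between
  them. Past \<open>h\<close> the word of \<open>y\<close> is smaller than that of \<open>x\<close>,
  and the signs at \<open>h\<close> place these two between the words read from \<open>h\<close>
  into the segment, which agree up to and across \<open>g\<close>. At \<open>g\<close> the same
  happens with the roles of \<open>h\<close> and \<open>g\<close> exchanged: the situation of
  \<open>mutual_descent\<close>.\<close>

lemma no_two_incoming:
  assumes C: "P.closed C" "C \<subseteq> VP" "\<And>k. fst k \<in> C \<Longrightarrow> \<not> redh k" and h: "fst h \<in> C" "on h" "rx h < ry h"
    and g: "g = P.W (opp h) m" "\<And>j. j < m \<Longrightarrow> on (P.W (opp h) j)" "on g" "rx g < ry g"
  shows False
proof -
  have le: "seq_le (wY k) (wX k)" if "fst k \<in> C" for k using word_le_closed[OF C(1,2) _ that] C(3) by blast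
  have fg: "fst g \<in> C" unfolding g(1) by (rule P.closed_W[OF C(1)]) (simp add: h)
  have hg: "h = P.W (opp g) m" "\<And>j. j < m \<Longrightarrow> on (P.W (opp g) j)" using walk_back[OF g(1,2)] by auto
  have st: "fst (pstep h) \<in> C" "fst (pstep g) \<in> C" using P.closedD[OF C(1) h(2,1)] P.closedD[OF C(1) g(3) fg] by (simp_all add: pstep_def)
  note sh = sign_lt[OF h(2,3)] and sg = sign_lt[OF g(3,4)]
  note wh = walk_words_opp[OF g(1,2,3)] and wg = walk_words_opp[OF hg h(2)]
  \<comment> \<open>Strictness comes from the signs at \<open>g\<close> together with the absence of
    red vertices; cutting off the common beginning moves it past \<open>h\<close>.\<close>
  have "seq_less (wY (opp g)) (wX (opp g))"
    using sg le[OF st(2)] seq_le_less_trans seq_less_le_trans seq_le_trans by blast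
  moreover have "\<forall>i<Suc m. wY (opp g) i = wX (opp g) i" using wg(1) by metis
  ultimately have "seq_less (wY (pstep h)) (wX (pstep h))"
    using seq_less_tail[of "Suc m" "wY (opp g)" "wX (opp g)" "wY (pstep h)" "wX (pstep h)"] wg(2,3) by blast
  thus False
    by (rule mutual_descent[of "Suc m" "wY (opp h)" "wY (pstep h)" "wX (pstep h)" "wX (opp h)" "wY (pstep g)" "wX (pstep g)"
        "wY (opp g)" "wX (opp g)" "Suc m", rotated 2]) (use sh sg wh wg in simp_all)
qed

section \<open>Long and real components\<close>

definition longc :: "(nat \<times> nat) set \<Rightarrow> bool" where
  "longc C \<longleftrightarrow> (\<exists>u\<in>VP. C = P.compo u) \<and> (\<forall>h. fst h \<in> C \<longrightarrow> \<not> redh h)"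

definition realc :: "(nat \<times> nat) set \<Rightarrow> bool" where
  "realc C \<longleftrightarrow> (\<exists>u\<in>VP. C = R.compo u) \<and> (\<forall>h. fst h \<in> C \<longrightarrow> \<not> redh h \<and> \<not> (on h \<and> rx h < ry h))"

lemma long_hlines_eq: "long_hlines Q x y = {(C, P.edges_of C) |C. longc C}"
proof -
  have "fst L \<inter> red Q x y = {} \<longleftrightarrow> (\<forall>h. fst h \<in> fst L \<longrightarrow> \<not> redh h)" for L :: hline
    unfolding red_eq by blast
  thus ?thesis unfolding long_hlines_def P.components_eq longc_def by auto
qed

lemma real_hlines_eq: "real_hlines Q x y = {(C, R.edges_of C) |C. realc C}"
proof -
  have "fst L \<inter> (red Q x y \<union> orange Q x y \<union> purple Q x y) = {} \<longleftrightarrow>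
    (\<forall>h. fst h \<in> fst L \<longrightarrow> \<not> redh h \<and> \<not> (on h \<and> rx h < ry h))" for L :: hline
    unfolding Un_assoc orange_purple unfolding red_eq by blast
  thus ?thesis unfolding real_hlines_def R.components_eq realc_def by auto
qed

lemma realc_closed: "realc C \<Longrightarrow> R.closed C" and realc_VP: "realc C \<Longrightarrow> C \<subseteq> VP"
  and longc_closed: "longc C \<Longrightarrow> P.closed C" and longc_VP: "longc C \<Longrightarrow> C \<subseteq> VP"
  unfolding realc_def longc_def using R.closed_comp R.comp_V P.closed_comp P.comp_V by blast+

lemma realcD: "realc C \<Longrightarrow> fst h \<in> C \<Longrightarrow> \<not> redh h \<and> (on h \<longrightarrow> ry h \<le> rx h)"
  and realc_comp: "realc C \<Longrightarrow> u \<in> C \<Longrightarrow> C = R.compo u"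
  and realc_ex: "realc C \<Longrightarrow> \<exists>u. u \<in> C"
  unfolding realc_def using R.comp_eq R.comp_refl by (metis not_le)+

lemma longcD: "longc C \<Longrightarrow> fst h \<in> C \<Longrightarrow> \<not> redh h"
  and longc_comp: "longc C \<Longrightarrow> u \<in> C \<Longrightarrow> C = P.compo u"
  and longc_ex: "longc C \<Longrightarrow> \<exists>u. u \<in> C"
  unfolding longc_def using P.comp_eq P.comp_refl by metis+

lemma off_le:
  assumes h: "fst h \<in> VP" "\<not> redh h" "\<not> on h" shows "seq_le (wY h) (wX h)"
proof -
  have le: "Y.Fr (hy h) \<le> X.Fr (hx h)" using h spc_iff[OF h(1)] by (auto simp: redh_def X.Fr_def Y.Fr_def)
  show ?thesis
  proof (cases "X.Fr (hx h) = Y.Fr (hy h)")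
    case True
    hence "\<not> X.live (hx h)" "\<not> Y.live (hy h)" using on_iff[OF h(1)] h(3) live_iff[OF h(1)] by auto
    hence "wX h = (\<lambda>_. 1)" "wY h = (\<lambda>_. 1)" using X.w_dead Y.w_dead VP_D[OF h(1)] by auto
    thus ?thesis by (simp add: seq_le_def)
  next
    case False
    hence "wY h 0 < wX h 0" using le by simp
    thus ?thesis unfolding seq_le_def seq_less_def by (metis not_less_zero)
  qed
qed

lemma exit_cases:
  assumes C: "R.closed C" and s: "fst s \<in> C"
  shows "wX s = wY s \<or> (\<exists>m. (\<forall>j<m. onp (P.W s j)) \<and> \<not> onp (P.W s m) \<and> fst (P.W s m) \<in> C)"
proof (cases "\<forall>m. onp (P.W s m)")
  case True
  hence "on (P.W s j)" for j by (simp add: onp_def)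
  hence "wX s i = wY s i" for i using walk_words[of "Suc i" s] by blast
  thus ?thesis by auto
next
  case False
  then obtain m where m: "\<not> onp (P.W s m)" "\<forall>j<m. onp (P.W s j)"
    using exists_least_iff[of "\<lambda>m. \<not> onp (P.W s m)"] by auto
  have "fst (P.W s j) \<in> C" if "j \<le> m" for j
    using that
  proof (induction j)
    case (Suc j)
    hence "onp (P.W s j)" "fst (P.W s j) \<in> C" using m by auto
    thus ?case using plus_step[OF C] by simp
  qed (use s in simp)
  thus ?thesis using m by blast
qed

text \<open>The signs at \<open>g\<close> reduce the comparison beyond it to that of the words read
  back through the component. These agree forever, or stop at a half-edge that is not red, or meet a
  second outgoing arrow; in the last case a failure would start the descent of
  \<open>mutual_descent\<close> with the roles of \<open>x\<close> and \<open>y\<close>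
  exchanged.\<close>

lemma real_outgoing_le:
  assumes r: "realc C" and g: "fst g \<in> C" "on g" "ry g < rx g"
  shows "seq_le (wY (pstep g)) (wX (pstep g))"
proof -
  note sg = sign_gt[OF g(2,3)]
  have fo: "fst (opp g) \<in> C" using g by simp
  from exit_cases[OF realc_closed[OF r] fo] show ?thesis
  proof
    assume "wX (opp g) = wY (opp g)"
    thus ?thesis using sg seq_le_trans[of "wY (pstep g)" "wY (opp g)" "wX (pstep g)"] by simp
  next
    assume "\<exists>m. (\<forall>j<m. onp (P.W (opp g) j)) \<and> \<not> onp (P.W (opp g) m) \<and> fst (P.W (opp g) m) \<in> C"
    then obtain m where m: "\<And>j. j < m \<Longrightarrow> on (P.W (opp g) j)" "\<not> onp (P.W (opp g) m)" "fst (P.W (opp g) m) \<in> C"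
      by (auto simp: onp_def)
    define h where "h = P.W (opp g) m"
    have nr: "\<not> redh h" "on h \<longrightarrow> ry h \<le> rx h" using realcD[OF r m(3)] by (simp_all add: h_def)
    show ?thesis
    proof (cases "on h")
      case False
      have "fst h \<in> VP" using m(3) realc_VP[OF r] by (auto simp: h_def)
      hence "seq_le (wY h) (wX h)" using off_le nr False by blast
      hence "seq_le (wY (opp g)) (wX (opp g))"
        using walk_words[OF m(1)] seq_le_prefix[of m "wY (opp g)" "wX (opp g)" "wY h" "wX h"] by (simp add: h_def)
      thus ?thesis using sg seq_le_trans by blast
    next
      case True
      hence gt: "ry h < rx h" using m(2) nr by (auto simp: onp_def h_def)
      note sh = sign_gt[OF True gt]
      have bck: "g = P.W (opp h) m" "\<And>j. j < m \<Longrightarrow> on (P.W (opp h) j)" using walk_back[OF h_def m(1)] by auto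
      note wg = walk_words_opp[OF h_def m(1) True] and wh = walk_words_opp[OF bck g(2)]
      show ?thesis
      proof (rule ccontr)
        assume "\<not> ?thesis"
        hence "seq_less (wX (pstep g)) (wY (pstep g))" by (simp add: seq_not_le)
        thus False
          by (rule mutual_descent[of "Suc m" "wX (opp g)" "wX (pstep g)" "wY (pstep g)" "wY (opp g)" "wX (pstep h)" "wY (pstep h)"
              "wX (opp h)" "wY (opp h)" "Suc m", rotated 2]) (use sg sh wg wh in simp_all)
      qed
    qed
  qed
qed

lemma real_word_le:
  assumes r: "realc C" and s: "fst s \<in> C"
  shows "seq_le (wY s) (wX s)"
  using exit_cases[OF realc_closed[OF r] s]
proof
  assume "\<exists>m. (\<forall>j<m. onp (P.W s j)) \<and> \<not> onp (P.W s m) \<and> fst (P.W s m) \<in> C"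
  then obtain m where m: "\<And>j. j < m \<Longrightarrow> on (P.W s j)" "\<not> onp (P.W s m)" "fst (P.W s m) \<in> C"
    by (auto simp: onp_def)
  define h where "h = P.W s m"
  have nr: "\<not> redh h" "on h \<longrightarrow> ry h \<le> rx h" using realcD[OF r m(3)] by (simp_all add: h_def)
  have "seq_le (wY h) (wX h)"
  proof (cases "on h")
    case False
    have "fst h \<in> VP" using m(3) realc_VP[OF r] by (auto simp: h_def)
    thus ?thesis using off_le nr False by blast
  next
    case True
    hence gt: "ry h < rx h" using m(2) nr by (auto simp: onp_def h_def)
    have "seq_le (wY (pstep h)) (wX (pstep h))" using real_outgoing_le[OF r _ True gt] m(3) by (simp add: h_def)
    moreover have "\<forall>i<1. wY h i = wX h i" "\<And>i. wY h (1 + i) = wY (pstep h) i" "\<And>i. wX h (1 + i) = wX (pstep h) i"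
      using walk_words[of 1 h] True step_on[OF True] by auto
    ultimately show ?thesis by (intro seq_le_prefix[of 1 "wY h" "wX h" "wY (pstep h)" "wX (pstep h)"])
  qed
  thus ?thesis
    using walk_words[OF m(1)] seq_le_prefix[of m "wY s" "wX s" "wY h" "wX h"] by (simp add: h_def)
qed (simp add: seq_le_def)

text \<open>A red half-edge faced by a walk from \<open>u\<close> would be the first difference of
  the words read from \<open>u\<close>, with the smaller rank in \<open>x\<close>, against
  \<open>real_word_le\<close>.\<close>

lemma real_long:
  assumes r: "realc C" and u: "u \<in> C"
  shows "longc (P.compo u)" "C = R.compo u" "C \<subseteq> P.compo u"
proof -
  have uV: "u \<in> VP" using realc_VP[OF r] u by auto
  show C: "C = R.compo u" by (rule realc_comp[OF r u])
  show "C \<subseteq> P.compo u"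
    unfolding C
  proof (rule R.comp_least)
    show "R.closed (P.compo u)" unfolding R.closed_def onp_def using P.closedD[OF P.closed_comp[of u]] by blast
  qed (rule P.comp_refl)
  have "\<not> redh h" if h: "fst h \<in> P.compo u" for h
  proof
    assume red: "redh h"
    obtain \<rho> k where k: "fst h = fst (P.W (u, \<rho>) k)" "\<And>i. i < k \<Longrightarrow> on (P.W (u, \<rho>) i)" using P.comp_walk[OF h] by blast
    have F: "X.Fr (hx h) < Y.Fr (hy h)" using red spc_iff[of h] by (auto simp: redh_def X.Fr_def Y.Fr_def)
    have no: "\<not> on h" using F on_iff[of h] by (auto simp: on_def)
    \<comment> \<open>The walk may face \<open>h\<close>, or \<open>h\<close> may be the half
      through which it arrived; the latter carries an edge and so is not red.\<close>
    consider "h = P.W (u, \<rho>) k" | "h = opp (P.W (u, \<rho>) k)" "k > 0" | "fst h = u"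
      using polarity_cases[of h "P.W (u, \<rho>) k"] k(1) by (cases k) auto
    thus False
    proof cases
      case 1
      have "seq_le (wY (u, \<rho>)) (wX (u, \<rho>))" using real_word_le[OF r, of "(u, \<rho>)"] u by simp
      hence "wY (u, \<rho>) k \<le> wX (u, \<rho>) k" using walk_words[OF k(2)] by (intro seq_le_at) auto
      thus False using walk_words[OF k(2)] 1 F
        by (metis X.w.simps(1) Y.w.simps(1) add_0_right not_less)
    next
      case 2
      hence "P.W (u, \<rho>) k = opp (oe (P.W (u, \<rho>) (k - 1)))" using k(2)[of "k - 1"]
        by (metis P.W_Suc(1) P.step_def Suc_diff_1 diff_less zero_less_one)
      hence "h = oe (P.W (u, \<rho>) (k - 1))" using 2 by simp
      thus False using no on_oe(4) k(2)[of "k - 1"] 2 by simp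
    next
      case 3
      thus False using realcD[OF r, of h] red u by simp
    qed
  qed
  thus "longc (P.compo u)" using uV by (auto simp: longc_def)
qed

lemma first_leaving:
  assumes r: "R.closed C" and k: "fst (P.W h 0) \<in> C" "fst (P.W h k) \<notin> C" "\<And>i. i < k \<Longrightarrow> on (P.W h i)"
  shows "\<exists>a<k. (\<forall>i<a. onp (P.W h i)) \<and> \<not> onp (P.W h a) \<and> fst (P.W h a) \<in> C"
proof -
  have "\<exists>a<k. \<not> onp (P.W h a)"
  proof (rule ccontr)
    assume n: "\<not> ?thesis"
    have "fst (P.W h j) \<in> C" if "j \<le> k" for j
      using that
    proof (induction j)
      case (Suc j)
      thus ?case using plus_step[OF r] n by simp
    qed (use k in simp)
    thus False using k by simp
  qed
  from first_failure[OF this] obtain a where a: "a < k" "\<not> onp (P.W h a)" "\<forall>i<a. onp (P.W h i)" by blast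
  have "fst (P.W h j) \<in> C" if "j \<le> a" for j
    using that
  proof (induction j)
    case (Suc j)
    thus ?case using plus_step[OF r] a by simp
  qed (use k in simp)
  thus ?thesis using a by blast
qed

lemma W_shift: "on (P.W h a) \<Longrightarrow> P.W (opp (oe (P.W h a))) j = P.W h (Suc a + j)"
proof -
  assume "on (P.W h a)"
  hence "opp (oe (P.W h a)) = P.W h (Suc a)" by (simp add: P.step_def)
  thus ?thesis by (simp only: P.W_add)
qed

lemma leaving:
  assumes r: "realc C" and k: "fst h \<in> C" "fst (P.W h k) \<notin> C" "\<And>i. i < k \<Longrightarrow> on (P.W h i)"
  shows "\<exists>a<k. (\<forall>i<a. onp (P.W h i)) \<and> ry (P.W h a) < rx (P.W h a)"
proof -
  obtain a where a: "a < k" "\<forall>i<a. onp (P.W h i)" "\<not> onp (P.W h a)" "fst (P.W h a) \<in> C"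
    using first_leaving[OF realc_closed[OF r], of h k] k by auto
  hence "ry (P.W h a) < rx (P.W h a)" using realcD[OF r a(4)] k(3)[OF a(1)] by (simp add: onp_def)
  thus ?thesis using a by blast
qed

lemma outgoing_incoming: "on g \<Longrightarrow> ry g < rx g \<Longrightarrow> on (oe g) \<and> rx (oe g) < ry (oe g)"
  using rx_oe[of g] ry_oe[of g] rx_le[of g] on_oe(4)[of g] by auto

text \<open>A walk from \<open>C1\<close> to \<open>C2\<close> leaves \<open>C1\<close> through an
  outgoing arrow, and the reversed walk leaves \<open>C2\<close> likewise. Seen from the part in
  between, both arrows are incoming.\<close>

lemma real_unique:
  assumes C: "longc C" and r: "realc C1" "realc C2" and sub: "C1 \<subseteq> C" "C2 \<subseteq> C"
  shows "C1 = C2"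
proof -
  obtain u where u: "u \<in> C1" using realc_ex[OF r(1)] by blast
  obtain v where v: "v \<in> C2" using realc_ex[OF r(2)] by blast
  have uC: "u \<in> C" using u sub(1) by blast
  have "v \<in> P.compo u" using v sub(2) longc_comp[OF C uC] by blast
  then obtain \<rho> k where k: "v = fst (P.W (u, \<rho>) k)" "\<And>i. i < k \<Longrightarrow> on (P.W (u, \<rho>) i)"
    using P.comp_walk by blast
  let ?h = "(u, \<rho>)"
  show ?thesis
  proof (cases "v \<in> C1")
    case True
    thus ?thesis using real_long(2)[OF r(1)] real_long(2)[OF r(2) v] by blast
  next
    case False
    then obtain a where a: "a < k" "\<And>i. i < a \<Longrightarrow> onp (P.W ?h i)" "ry (P.W ?h a) < rx (P.W ?h a)"
      using leaving[OF r(1), of ?h k] u k by auto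
    define g where "g = opp (P.W ?h k)"
    have g: "P.W g k = opp ?h" "\<And>j. j < k \<Longrightarrow> on (P.W g j)"
      using walk_back[of "P.W ?h k" k "opp ?h"] k(2) by (simp_all add: g_def)
    have "u \<notin> C2" using u False real_long(2)[OF r(1) u] real_long(2)[OF r(2)] v by blast
    then obtain b where b: "b < k" "ry (P.W g b) < rx (P.W g b)"
      using leaving[OF r(2), of g k] g v k(1) by (auto simp: g_def)
    define c where "c = k - Suc b"
    have c: "c < k" "k - b = Suc c" using b(1) by (auto simp: c_def)
    have "P.W g b = opp (P.W ?h (Suc c))" using P.W_opp[of b k ?h] b(1) c(2) by (simp add: g_def)
    hence "oe (P.W g b) = P.W ?h c" using k(2)[OF c(1)] on_oe(5) by (simp add: P.step_def)
    hence inc: "on (P.W ?h c)" "rx (P.W ?h c) < ry (P.W ?h c)" using outgoing_incoming[OF g(2)[OF b(1)] b(2)] by auto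
    \<comment> \<open>The steps before \<open>a\<close> belong to \<open>HQ_plus\<close>, and the
      arrow at \<open>a\<close> points forwards while the one at \<open>c\<close> points
      backwards.\<close>
    have ac: "a < c" using a(2)[of c] a(3) inc(2) by (cases a c rule: linorder_cases) (auto simp: onp_def)
    then obtain m where m: "c = Suc a + m" by (metis Suc_leI le_iff_add)
    define h where "h = oe (P.W ?h a)"
    have h: "on h" "rx h < ry h" using outgoing_incoming[OF k(2)[OF a(1)] a(3)] by (auto simp: h_def)
    have hC: "fst h \<in> C" unfolding h_def
      using P.closedD[OF longc_closed[OF C] k(2)[OF a(1)]] P.closed_W[OF longc_closed[OF C], of ?h a] uC by simp
    have W: "P.W (opp h) j = P.W ?h (Suc a + j)" for j unfolding h_def by (rule W_shift[OF k(2)[OF a(1)]])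
    have "on (P.W (opp h) j)" if "j < m" for j unfolding W by (rule k(2)) (use that m c(1) in simp)
    moreover have "P.W ?h c = P.W (opp h) m" unfolding W m ..
    ultimately have False
      using no_two_incoming[OF longc_closed[OF C] longc_VP[OF C] longcD[OF C] hC h _ _ inc, of m] by blast
    thus ?thesis ..
  qed
qed

text \<open>Without open ends the walk never stops, so the words of \<open>x\<close> and
  \<open>y\<close> agree from every half-edge of \<open>C\<close>. Unequal ranks would give opposite
  comparisons of the same two words, one of them strict.\<close>

lemma allon_plus:
  assumes C: "P.allon C" "P.closed C" and h: "fst h \<in> C"
  shows "wX h = wY h" "rx h = ry h" "onp h"
proof -
  have eq: "wX h = wY h" if h: "fst h \<in> C" for h
  proof -
    have "on (P.W h k)" for k using P.closed_W[OF C(2) h] C(1) unfolding P.allon_def by blast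
    hence "wX h i = wY h i" for i using walk_words[of "Suc i" h] by blast
    thus ?thesis by auto
  qed
  show "wX h = wY h" by (rule eq[OF h])
  have o: "on h" using C(1) h unfolding P.allon_def by blast
  have "fst (pstep h) \<in> C" "fst (opp h) \<in> C" using P.closedD[OF C(2) o h] h by (simp_all add: pstep_def)
  hence e: "wX (pstep h) = wY (pstep h)" "wX (opp h) = wY (opp h)" using eq by blast+
  show "rx h = ry h"
  proof (rule linorder_cases[of "rx h" "ry h"])
    assume "rx h < ry h"
    thus ?thesis using sign_lt[OF o] e seq_le_antisym seq_less_irrefl by metis
  next
    assume gt: "ry h < rx h"
    have o': "on (oe h)" using on_oe(4)[OF o] .
    have lt: "rx (oe h) < ry (oe h)" using rx_oe[OF o] ry_oe[OF o] gt rx_le[of h] by auto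
    have f: "fst (oe h) \<in> C" using P.closedD[OF C(2) o h] .
    have "fst (pstep (oe h)) \<in> C" "fst (opp (oe h)) \<in> C" using f h on_oe(5)[OF o] by (auto simp: pstep_def)
    hence e': "wX (pstep (oe h)) = wY (pstep (oe h))" "wX (opp (oe h)) = wY (opp (oe h))" using eq by blast+
    thus ?thesis using sign_lt[OF o' lt] e' seq_le_antisym seq_less_irrefl by metis
  qed simp
  thus "onp h" using o by (simp add: onp_def)
qed

lemma allon_real:
  assumes C: "longc C" and a: "P.allon C" shows "realc C"
proof -
  obtain u where u: "u \<in> C" using longc_ex[OF C] by blast
  note CC = longc_comp[OF C u]
  have plus: "onp h \<and> rx h = ry h" if "fst h \<in> C" for h using allon_plus[OF a longc_closed[OF C] that] by blast
  have "R.closed C" unfolding R.closed_def onp_def using P.closedD[OF longc_closed[OF C]] by blast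
  hence sub: "R.compo u \<subseteq> C" using u by (rule R.comp_least)
  have "P.closed (R.compo u)"
    unfolding P.closed_def using plus sub R.closedD[OF R.closed_comp[of u]] by blast
  hence "C \<subseteq> R.compo u" unfolding CC using R.comp_refl by (rule P.comp_least)
  hence "C = R.compo u" using sub by blast
  thus ?thesis unfolding realc_def using longcD[OF C] plus longc_VP[OF C] u by (metis less_irrefl subsetD)
qed

text \<open>The segment of a line between the last arrow backwards and the first arrow forwards.\<close>

lemma line_real:
  assumes C: "longc C" and l: "P.line h m" "fst h \<in> C"
  shows "\<exists>C'\<subseteq>C. realc C'"
proof -
  let ?t = "\<lambda>k. fst (P.W h k)"
  have CC: "C = P.compo (fst h)" by (rule longc_comp[OF C l(2)])
  have tC: "?t k \<in> C" for k using P.closed_W[OF longc_closed[OF C] l(2)] .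
  have inj: "k = k'" if "?t k = ?t k'" "k \<le> m" "k' \<le> m" for k k'
    using P.line_distinct[OF l(1)] that by (metis linorder_neqE_nat)
  have on: "on (P.W h k) \<and> fst (oe (P.W h k)) = ?t (Suc k)" if "k < m" for k
    using P.line_nonloop[OF l(1) that] by simp
  define B where "B = {k. k < m \<and> rx (P.W h k) < ry (P.W h k)}"
  define c where "c = (if B = {} then 0 else Suc (Max B))"
  have fB: "finite B" by (simp add: B_def)
  have cB: "k < c" if "k \<in> B" for k using that Max_ge[OF fB that] by (auto simp: c_def)
  have cs: "k \<in> B" if "c = Suc k" for k using that Max_in[OF fB] by (auto simp: c_def split: if_splits)
  have "Max B < m" if "B \<noteq> {}" using Max_in[OF fB that] unfolding B_def by blast
  hence cm: "c \<le> m" by (cases "B = {}") (simp_all add: c_def Suc_leI)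
  define d where "d = (LEAST k. c \<le> k \<and> (k < m \<longrightarrow> \<not> onp (P.W h k)))"
  have d: "c \<le> d \<and> (d < m \<longrightarrow> \<not> onp (P.W h d))" unfolding d_def by (rule LeastI[of _ m]) (simp add: cm)
  have dm: "d \<le> m" unfolding d_def by (rule Least_le) (simp add: cm)
  have cd: "onp (P.W h k)" if "c \<le> k" "k < d" for k
    using not_less_Least[of k "\<lambda>k. c \<le> k \<and> (k < m \<longrightarrow> \<not> onp (P.W h k))"] that by (simp add: d_def)
  define S where "S = ?t ` {c..d}"
  have S: "k \<in> {c..d}" if "?t k \<in> S" "k \<le> m" for k using that inj dm by (fastforce simp: S_def)
  have halves: "(\<exists>k<m. g = P.W h k \<or> g = oe (P.W h k)) \<or> oe g = g" if "on g" "fst g \<in> S" for g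
  proof -
    have "fst g \<in> P.compo (fst h)" using that(2) tC unfolding S_def CC[symmetric] by auto
    thus ?thesis using P.line_half_edges[OF l(1) _ that(1)] by blast
  qed
  have "R.closed S"
    unfolding R.closed_def
  proof (intro allI impI)
    fix g assume g: "onp g" "fst g \<in> S"
    hence o: "on g" by (simp add: onp_def)
    consider k where "k < m" "g = P.W h k" | k where "k < m" "g = oe (P.W h k)" | "oe g = g" using halves[OF o g(2)] by blast
    thus "fst (oe g) \<in> S"
    proof cases
      case 1
      hence "k \<in> {c..d}" "k \<noteq> d" using S g d by auto
      hence "Suc k \<in> {c..d}" by auto
      moreover have "fst (oe g) = ?t (Suc k)" using 1 on[of k] by simp
      ultimately show ?thesis unfolding S_def by (metis (no_types, lifting) image_eqI)
    next
      case 2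
      hence k: "Suc k \<in> {c..d}" using S[of "Suc k"] g on[of k] by simp
      have "rx (P.W h k) = ry (P.W h k)" using g 2 rx_oe[of "P.W h k"] ry_oe[of "P.W h k"] on[of k] rx_le[of "P.W h k"] ry_le[of "P.W h k"]
        by (simp add: onp_def)
      hence "k \<notin> B" by (simp add: B_def)
      hence "c \<noteq> Suc k" using cs by blast
      hence "k \<in> {c..d}" using k by auto
      thus ?thesis using 2 on[of k] on_oe(5) by (simp add: S_def)
    qed (use g in simp)
  qed
  moreover have "?t c \<in> S" using d by (simp add: S_def)
  ultimately have sub: "R.compo (?t c) \<subseteq> S" by (rule R.comp_least)
  have nin: "\<not> rx g < ry g" if o: "on g" and g: "fst g \<in> S" for g
  proof
    assume lt: "rx g < ry g"
    consider k where "k < m" "g = P.W h k" | k where "k < m" "g = oe (P.W h k)" | "oe g = g" using halves[OF o g] by blast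
    thus False
    proof cases
      case 1
      hence "k \<in> B" using lt by (simp add: B_def)
      thus False using cB[of k] S[of k] 1 g by simp
    next
      case 2
      hence k: "Suc k \<in> {c..d}" using S[of "Suc k"] g on[of k] by simp
      have gt: "ry (P.W h k) < rx (P.W h k)" using lt 2 rx_oe[of "P.W h k"] ry_oe[of "P.W h k"] on[of k] by simp
      hence "k \<notin> B" by (simp add: B_def)
      hence "c \<le> k" "k < d" using k cs by (auto simp: le_Suc_eq)
      thus False using cd[of k] gt by (simp add: onp_def)
    next
      case 3
      thus False using loop_iff[OF o] lt by simp
    qed
  qed
  have "S \<subseteq> C" using tC by (auto simp: S_def)
  moreover have "realc (R.compo (?t c))"
    unfolding realc_def using longc_VP[OF C] tC longcD[OF C] nin sub \<open>S \<subseteq> C\<close> by (metis subsetD)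
  ultimately show ?thesis using sub by blast
qed

lemma real_exists: "longc C \<Longrightarrow> \<exists>C'\<subseteq>C. realc C'"
proof -
  assume C: "longc C"
  obtain u where u: "u \<in> C" using longc_ex[OF C] by blast
  note CC = longc_comp[OF C u]
  from P.line_or_cycle[of u] show ?thesis
  proof
    show "u \<in> VP" using longc_VP[OF C] u by blast
  next
    assume "\<exists>h m. P.line h m \<and> fst h \<in> P.compo u"
    thus ?thesis using line_real[OF C] CC by blast
  next
    assume "\<exists>p. P.cycle (u, Pos) p"
    then obtain p where p: "P.cycle (u, Pos) p" by blast
    have "C = {fst (P.W (u, Pos) k) |k. k < p}" using P.cycle_comp[OF p] CC by simp
    hence "P.allon C" unfolding P.allon_def using P.cycle_on[OF p] by blast
    thus ?thesis using allon_real[OF C] by blast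
  qed
qed

text \<open>If a loop lay outside \<open>C'\<close>, the walk to it would leave \<open>C'\<close>
  through an outgoing arrow and, reflected at the loop, come back to the same arrow. This arrow then
  points into the segment from both ends, so \<open>no_two_incoming\<close> applies to
  \<open>h\<close> and itself.\<close>

lemma real_loops:
  assumes C: "longc C" and r: "realc C'" "C' \<subseteq> C"
  shows "R.loops C' = P.loops C"
proof (intro equalityI subsetI)
  fix g assume "g \<in> R.loops C'"
  thus "g \<in> P.loops C" using r(2) by (auto simp: R.loops_def P.loops_def onp_def)
next
  fix g assume "g \<in> P.loops C"
  hence g: "fst g \<in> C" "on g" "oe g = g" unfolding P.loops_def by blast+
  have "fst g \<in> C'"
  proof (rule ccontr)
    assume n: "fst g \<notin> C'"
    obtain u where u: "u \<in> C'" using realc_ex[OF r(1)] by blast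
    have "fst g \<in> P.compo u" using g(1) longc_comp[OF C] u r(2) by blast
    then obtain \<rho> k where k: "fst g = fst (P.W (u, \<rho>) k)" "\<And>i. i < k \<Longrightarrow> on (P.W (u, \<rho>) i)" using P.comp_walk by blast
    have "k \<noteq> 0" using k(1) u n by (auto intro: ccontr)
    have "\<exists>k. P.W (u, \<rho>) k = g \<and> (\<forall>i<k. on (P.W (u, \<rho>) i))"
    proof (cases "g = P.W (u, \<rho>) k")
      case False
      hence op: "g = opp (P.W (u, \<rho>) k)" using k(1) polarity_cases[of g "P.W (u, \<rho>) k"] by auto
      obtain k' where k': "k = Suc k'" using \<open>k \<noteq> 0\<close> by (cases k) auto
      hence o: "on (P.W (u, \<rho>) k')" using k(2) by simp
      hence "g = oe (P.W (u, \<rho>) k')" using op k' by (simp add: P.step_def)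
      hence "P.W (u, \<rho>) k' = g" using g(3) on_oe(5)[OF o] by simp
      thus ?thesis using k(2) k' by (intro exI[of _ k']) simp
    qed (use k in blast)
    then obtain k where k: "P.W (u, \<rho>) k = g" "\<And>i. i < k \<Longrightarrow> on (P.W (u, \<rho>) i)" by blast
    obtain a where a: "a < k" "ry (P.W (u, \<rho>) a) < rx (P.W (u, \<rho>) a)"
      using leaving[OF r(1), of "(u, \<rho>)" k] u n k by auto
    note oa = k(2)[OF a(1)]
    define h where "h = oe (P.W (u, \<rho>) a)"
    have h: "on h" "rx h < ry h" using outgoing_incoming[OF oa a(2)] by (auto simp: h_def)
    have hC: "fst h \<in> C" unfolding h_def
      using P.closedD[OF longc_closed[OF C] oa] P.closed_W[OF longc_closed[OF C], of "(u, \<rho>)" a] u r(2) by auto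
    have W: "P.W (opp h) j = P.W (u, \<rho>) (Suc a + j)" for j unfolding h_def by (rule W_shift[OF oa])
    obtain m where m: "k = Suc a + m" using a(1) by (metis Suc_leI le_iff_add)
    have ho: "on (P.W (opp h) j)" if "j < m" for j unfolding W by (rule k(2)) (use m that in simp)
    have gm: "g = P.W (opp h) m" using W[of m] k(1) m by simp
    note bck = walk_back[OF gm ho]
    \<comment> \<open>After the loop the walk retraces its steps, so \<open>h\<close> is reached
      again after \<open>Suc m + m\<close> of them.\<close>
    have Wg: "P.W (opp h) (Suc m + j) = P.W (opp g) j" for j
    proof -
      have "P.W (opp h) (Suc m) = opp g" using gm g(2,3) by (simp add: P.step_def)
      thus ?thesis by (metis P.W_add)
    qed
    have "h = P.W (opp h) (Suc m + m)" using bck(1) Wg by simp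
    moreover have "on (P.W (opp h) j)" if "j < Suc m + m" for j
    proof (cases j m rule: linorder_cases)
      case greater
      then obtain i where i: "j = Suc m + i" by (metis Suc_leI le_iff_add)
      hence "i < m" using that by simp
      thus ?thesis unfolding i Wg using bck(2) by blast
    qed (use ho gm g in auto)
    ultimately show False
      using no_two_incoming[OF longc_closed[OF C] longc_VP[OF C] longcD[OF C] hC h _ _ h, of "Suc m + m"] by blast
  qed
  thus "g \<in> R.loops C'" using g loop_iff[OF g(2)] unfolding R.loops_def onp_def by simp
qed

lemma real_allon:
  assumes C: "longc C" and r: "realc C'" "C' \<subseteq> C"
  shows "R.allon C' \<longleftrightarrow> P.allon C"
proof
  assume "P.allon C"
  thus "R.allon C'" unfolding R.allon_def using allon_plus(3)[OF _ longc_closed[OF C]] r(2) by blast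
next
  assume a: "R.allon C'"
  obtain u where u: "u \<in> C'" using realc_ex[OF r(1)] by blast
  have "P.closed C'" unfolding P.closed_def using a R.closedD[OF realc_closed[OF r(1)]] unfolding R.allon_def by blast
  hence "C \<subseteq> C'" using P.comp_least u longc_comp[OF C] r(2) by blast
  thus "P.allon C" using a unfolding P.allon_def R.allon_def onp_def by blast
qed

text \<open>Type and loop of a line depend only on its loops and on the absence of open ends, which
  the real and the long line share. Hence the algebra and its two homomorphisms are the
  same.\<close>

lemma line_Hom_real:
  assumes C: "longc C" and r: "realc C'" "C' \<subseteq> C"
  shows "line_Hom Q x y sX sY \<rho>X \<rho>Y (C', R.edges_of C') = line_Hom Q x y sX sY \<rho>X \<rho>Y (C, P.edges_of C)"
proof -
  obtain u where u: "u \<in> C'" using realc_ex[OF r(1)] by blast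
  have CC: "C = P.compo u" "C' = R.compo u" and uV: "u \<in> VP"
    using longc_comp[OF C] realc_comp[OF r(1)] u r(2) longc_VP[OF C] by blast+
  have t: "ltype_of Q x y (C', R.edges_of C') = ltype_of Q x y (C, P.edges_of C)"
    unfolding ltype_of_def using P.ltype_comp[OF uV] R.ltype_comp[OF uV] real_loops[OF C r] real_allon[OF C r] CC by simp
  have "e \<in> R.edges_of C' \<and> HQ_src Q x y e = HQ_tgt Q x y e \<longleftrightarrow> e \<in> P.edges_of C \<and> HQ_src Q x y e = HQ_tgt Q x y e" for e
    using P.edges_of_loops[of u] R.edges_of_loops[of u] real_loops[OF C r] CC by blast
  hence l: "line_loop Q x y (C', R.edges_of C') = line_loop Q x y (C, P.edges_of C)"
    unfolding line_loop_def by (simp only: snd_conv)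
  show ?thesis unfolding line_Hom_def line_alg_def f_x_def f_y_def t l ..
qed

end

section \<open>Homomorphisms supported on a long line\<close>

context kmodule
begin

lemma act_Units:
  assumes "a \<in> Units (kalg K)"
  shows "\<exists>a'\<in>Units (kalg K). (\<forall>v. \<rho> a (\<rho> a' v) = v) \<and> (\<forall>v. \<rho> a' (\<rho> a v) = v)"
  using assms A.Units_inv_Units[OF assms] A.Units_r_inv A.Units_l_inv A.Units_closed act_inverse by metis

end

context module_pair
begin

lemma linear_conjugate:
  assumes g: "klin g" and a: "a \<in> carrier (kalg X.K)" and b: "b \<in> carrier (kalg Y.K)"
  shows "klin (\<rho>Y b \<circ> g \<circ> \<rho>X a)"
  using a b by (intro linearI) (simp_all add: linearD[OF g] X.act_plus Y.act_plus X.act_scale Y.act_scale)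

definition fits :: "(nat \<times> nat \<Rightarrow> 'x \<Rightarrow> 'y) \<Rightarrow> pair_half_edge \<Rightarrow> bool" where
  "fits \<phi> h \<longleftrightarrow> (\<forall>u. \<phi> (fst (oe h)) (\<rho>X (X.cu (hx h)) u) = \<rho>Y (Y.cu (hy h)) (\<phi> (fst h) u))"

definition FL :: "(nat \<times> nat) set \<Rightarrow> (nat \<times> nat \<Rightarrow> 'x \<Rightarrow> 'y) set" where
  "FL C = {\<phi>. flat \<phi> \<and> (\<forall>v. v \<notin> C \<longrightarrow> \<phi> v = 0)}"

lemma fits_transport:
  assumes o: "on h"
  shows "fits \<phi> h \<longleftrightarrow> \<phi> (fst (oe h)) = \<rho>Y (Y.cu (hy h)) \<circ> \<phi> (fst h) \<circ> \<rho>X (X.cu (X.oe (hx h)))"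
proof
  assume f: "fits \<phi> h"
  show "\<phi> (fst (oe h)) = \<rho>Y (Y.cu (hy h)) \<circ> \<phi> (fst h) \<circ> \<rho>X (X.cu (X.oe (hx h)))"
  proof
    fix u
    have "\<phi> (fst (oe h)) u = \<phi> (fst (oe h)) (\<rho>X (X.cu (hx h)) (\<rho>X (X.cu (X.oe (hx h))) u))" using act_cu(1)[OF o] by simp
    thus "\<phi> (fst (oe h)) u = (\<rho>Y (Y.cu (hy h)) \<circ> \<phi> (fst h) \<circ> \<rho>X (X.cu (X.oe (hx h)))) u" using f by (simp add: fits_def)
  qed
qed (use act_cu(2)[OF o] in \<open>simp add: fits_def\<close>)

lemma fits_oe:
  assumes o: "on h" and f: "fits \<phi> h" shows "fits \<phi> (oe h)"
  unfolding fits_def on_oe(5)[OF o] on_oe(1,2)[OF o]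
proof
  fix u
  have "\<rho>Y (Y.cu (Y.oe (hy h))) (\<phi> (fst (oe h)) (\<rho>X (X.cu (hx h)) (\<rho>X (X.cu (X.oe (hx h))) u))) =
      \<phi> (fst h) (\<rho>X (X.cu (X.oe (hx h))) u)"
    using f act_cu(4)[OF o] by (simp add: fits_def)
  thus "\<phi> (fst h) (\<rho>X (X.cu (X.oe (hx h))) u) = \<rho>Y (Y.cu (Y.oe (hy h))) (\<phi> (fst (oe h)) u)"
    using act_cu(1)[OF o] by simp
qed

lemma FL_fits: "\<phi> \<in> FL C \<Longrightarrow> on h \<Longrightarrow> fits \<phi> h"
  by (simp add: FL_def fits_def flat_on)

lemma FL_outside: "\<phi> \<in> FL C \<Longrightarrow> v \<notin> C \<Longrightarrow> \<phi> v = 0"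
  unfolding FL_def by blast

lemma FL_linear: "\<phi> \<in> FL C \<Longrightarrow> klin (\<phi> v)"
  by (simp add: FL_def flat_linear')

lemma FL_I:
  assumes C: "longc C" and "\<And>v. v \<in> C \<Longrightarrow> klin (\<phi> v)" "\<And>v. v \<notin> C \<Longrightarrow> \<phi> v = 0"
    and "\<And>h. on h \<Longrightarrow> fst h \<in> C \<Longrightarrow> fits \<phi> h"
  shows "\<phi> \<in> FL C"
proof -
  have z: "klin (0 :: 'x \<Rightarrow> 'y)" by (intro linearI) (simp_all add: Y.scale_zero_right)
  have "\<phi> (fst (oe h)) (\<rho>X (X.cu (hx h)) u) = \<rho>Y (Y.cu (hy h)) (\<phi> (fst h) u)" if o: "on h" for h u
  proof (cases "fst h \<in> C")
    case True
    thus ?thesis using assms(4)[OF o] by (simp add: fits_def)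
  next
    case False
    hence "fst (oe h) \<notin> C" using P.closedD[OF longc_closed[OF C] on_oe(4)[OF o]] on_oe(5)[OF o] by auto
    thus ?thesis using False assms(3) Y.act_zero[OF Y.cu_carrier] on_live[OF o] by simp
  qed
  hence "flat \<phi>" unfolding flat_def
    using assms(2,3) z longcD[OF C] longc_VP[OF C] by (metis subsetD)
  thus ?thesis using assms(3) by (simp add: FL_def)
qed

text \<open>Blocks at neighbouring vertices differ by units, and the vertices related to
  \<open>v\<close> in this way form a closed set. The units are chosen before \<phi>, so evaluations
  at \<open>v\<close> and \<open>w\<close> differ by one fixed bijection.\<close>

lemma FL_units:
  assumes C: "longc C" and v: "v \<in> C" "w \<in> C"
  shows "\<exists>a\<in>Units (kalg X.K). \<exists>b\<in>Units (kalg Y.K). \<forall>\<phi>\<in>FL C. \<phi> w = \<rho>Y b \<circ> \<phi> v \<circ> \<rho>X a"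
proof -
  let ?S = "{w. \<exists>a\<in>Units (kalg X.K). \<exists>b\<in>Units (kalg Y.K). \<forall>\<phi>\<in>FL C. \<phi> w = \<rho>Y b \<circ> \<phi> v \<circ> \<rho>X a}"
  have "P.closed ?S"
    unfolding P.closed_def
  proof (intro allI impI)
    fix h assume h: "on h" "fst h \<in> ?S"
    note l = on_live[OF h(1)]
    obtain a b where ab: "a \<in> Units (kalg X.K)" "b \<in> Units (kalg Y.K)"
      "\<And>\<phi>. \<phi> \<in> FL C \<Longrightarrow> \<phi> (fst h) = \<rho>Y b \<circ> \<phi> v \<circ> \<rho>X a" using h(2) by blast
    have l': "fst (X.oe (hx h)) \<in> X.V" "X.live (X.oe (hx h))" using X.fst_oe[OF l(1)] X.live_oe[OF l(1)] l by auto
    have cX: "X.cu (X.oe (hx h)) \<in> Units (kalg X.K :: 'k alg_elt ring)" by (rule X.cu_Units[OF l'])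
    have cY: "Y.cu (hy h) \<in> Units (kalg Y.K :: 'k alg_elt ring)" by (rule Y.cu_Units[OF l(2,4)])
    have "\<forall>\<phi>\<in>FL C. \<phi> (fst (oe h)) = \<rho>Y (Y.cu (hy h) \<otimes>\<^bsub>kalg Y.K\<^esub> b) \<circ> \<phi> v \<circ> \<rho>X (a \<otimes>\<^bsub>kalg X.K\<^esub> X.cu (X.oe (hx h)))"
    proof
      fix \<phi> assume f: "\<phi> \<in> FL C"
      hence "\<phi> (fst (oe h)) = \<rho>Y (Y.cu (hy h)) \<circ> \<phi> (fst h) \<circ> \<rho>X (X.cu (X.oe (hx h)))"
        using FL_fits[OF f h(1)] fits_transport[OF h(1)] by blast
      thus "\<phi> (fst (oe h)) = \<rho>Y (Y.cu (hy h) \<otimes>\<^bsub>kalg Y.K\<^esub> b) \<circ> \<phi> v \<circ> \<rho>X (a \<otimes>\<^bsub>kalg X.K\<^esub> X.cu (X.oe (hx h)))"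
        unfolding ab(3)[OF f] using X.A.Units_closed[OF ab(1)] X.A.Units_closed[OF cX] Y.A.Units_closed[OF ab(2)] Y.A.Units_closed[OF cY]
        by (auto simp: fun_eq_iff X.act_mult Y.act_mult)
    qed
    thus "fst (oe h) \<in> ?S" using X.A.Units_m_closed[OF ab(1) cX] Y.A.Units_m_closed[OF cY ab(2)] by blast
  qed
  moreover have "v \<in> ?S"
  proof -
    have "\<forall>\<phi>\<in>FL C. \<phi> v = \<rho>Y \<one>\<^bsub>kalg Y.K\<^esub> \<circ> \<phi> v \<circ> \<rho>X \<one>\<^bsub>kalg X.K\<^esub>" by (auto simp: fun_eq_iff)
    thus ?thesis using X.A.Units_one_closed Y.A.Units_one_closed by blast
  qed
  ultimately have "C \<subseteq> ?S" unfolding longc_comp[OF C v(1)] by (rule P.comp_least)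
  thus ?thesis using v(2) by blast
qed

lemma FL_inj:
  assumes C: "longc C" and v: "v \<in> C"
  shows "inj_on (\<lambda>\<phi>. \<phi> v) (FL C)"
proof (rule inj_onI)
  fix \<phi> \<psi> assume f: "\<phi> \<in> FL C" "\<psi> \<in> FL C" "\<phi> v = \<psi> v"
  show "\<phi> = \<psi>"
  proof
    fix w show "\<phi> w = \<psi> w"
    proof (cases "w \<in> C")
      case True
      thus ?thesis using FL_units[OF C v True] f by metis
    qed (use f FL_outside in simp)
  qed
qed

section \<open>Extension of a block along a line\<close>

primrec carry :: "pair_half_edge \<Rightarrow> ('x \<Rightarrow> 'y) \<Rightarrow> nat \<Rightarrow> 'x \<Rightarrow> 'y" where
  "carry h g 0 = g"
| "carry h g (Suc k) = \<rho>Y (Y.cu (hy (P.W h k))) \<circ> carry h g k \<circ> \<rho>X (X.cu (X.oe (hx (P.W h k))))"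

lemma carry_linear:
  assumes "klin g" "\<And>j. j < k \<Longrightarrow> on (P.W h j)"
  shows "klin (carry h g k)"
  using assms(2)
proof (induction k)
  case (Suc k)
  note o = Suc.prems[of k, simplified] note l = on_live[OF o]
  have "fst (X.oe (hx (P.W h k))) \<in> X.V" "X.live (X.oe (hx (P.W h k)))" using X.fst_oe[OF l(1)] X.live_oe[OF l(1)] l by auto
  thus ?case unfolding carry.simps using Suc l by (intro linear_conjugate X.cu_carrier Y.cu_carrier) auto
qed (use assms in simp)

lemma FL_carry:
  assumes f: "\<phi> \<in> FL C" and o: "\<And>j. j < k \<Longrightarrow> on (P.W h j)"
  shows "\<phi> (fst (P.W h k)) = carry h (\<phi> (fst h)) k"
  using o
proof (induction k)
  case (Suc k)
  have o: "on (P.W h k)" using Suc.prems[of k] by simp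
  hence "fst (P.W h (Suc k)) = fst (oe (P.W h k))" by (simp add: P.step_def)
  thus ?case using Suc FL_fits[OF f o] fits_transport[OF o, of \<phi>] by simp
qed simp

lemma fits_carry:
  assumes o: "on (P.W h k)" and "\<phi> (fst (P.W h k)) = carry h g k" "\<phi> (fst (P.W h (Suc k))) = carry h g (Suc k)"
  shows "fits \<phi> (P.W h k)"
proof -
  have "fst (P.W h (Suc k)) = fst (oe (P.W h k))" using o by (simp add: P.step_def)
  thus ?thesis using assms fits_transport[OF o, of \<phi>] by simp
qed

text \<open>On a path no vertex is reached twice, so transport defines the blocks consistently, and
  only loops at the two ends impose conditions.\<close>

lemma line_extend:
  assumes C: "longc C" and l: "P.line h m" "fst h \<in> C" and g: "klin g"
    and start: "on (opp h) \<Longrightarrow> \<forall>u. g (\<rho>X (X.cu (hx (opp h))) u) = \<rho>Y (Y.cu (hy (opp h))) (g u)"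
    and stop: "on (P.W h m) \<Longrightarrow> \<forall>u. carry h g m (\<rho>X (X.cu (hx (P.W h m))) u) = \<rho>Y (Y.cu (hy (P.W h m))) (carry h g m u)"
  shows "\<exists>\<phi>\<in>FL C. \<phi> (fst h) = g"
proof -
  have CC: "C = P.compo (fst h)" by (rule longc_comp[OF C l(2)])
  let ?t = "\<lambda>k. fst (P.W h k)"
  have Ct: "C = {?t k |k. k \<le> m}" using P.line_comp[OF l(1)] CC by simp
  have inj: "k = k'" if "?t k = ?t k'" "k \<le> m" "k' \<le> m" for k k'
    using P.line_distinct[OF l(1)] that by (metis linorder_neqE_nat)
  have on: "on (P.W h k)" if "k < m" for k using P.line_nonloop[OF l(1) that] by simp
  define \<phi> where "\<phi> v = (if v \<in> C then carry h g (SOME k. k \<le> m \<and> v = ?t k) else 0)" for v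
  have \<phi>: "\<phi> (?t k) = carry h g k" if "k \<le> m" for k
  proof -
    have "(SOME k'. k' \<le> m \<and> ?t k = ?t k') = k" by (rule some_equality) (use that inj in auto)
    moreover have "?t k \<in> C" using that Ct by blast
    ultimately show ?thesis by (simp add: \<phi>_def)
  qed
  have h0: "\<phi> (fst h) = g" using \<phi>[of 0] by simp
  have "\<phi> \<in> FL C"
  proof (rule FL_I[OF C])
    fix v assume "v \<in> C"
    then obtain k where "k \<le> m" "v = ?t k" using Ct by blast
    thus "klin (\<phi> v)" using \<phi> carry_linear[OF g, of k h] on by simp
  next
    fix q assume q: "on q" "fst q \<in> C"
    consider k where "k < m" "q = P.W h k" | k where "k < m" "q = oe (P.W h k)"
      | "q = opp h" "oe q = q" | "q = P.W h m" "oe q = q"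
      using P.line_half_edges[OF l(1) _ q(1)] q(2) CC by blast
    thus "fits \<phi> q"
    proof cases
      case 1
      thus ?thesis using fits_carry[where h = h and k = k and g = g and \<phi> = \<phi>] on \<phi>[of k] \<phi>[of "Suc k"] by simp
    next
      case 2
      thus ?thesis using fits_oe[OF on[OF 2(1)]] fits_carry[where h = h and k = k and g = g and \<phi> = \<phi>] on \<phi>[of k] \<phi>[of "Suc k"] by simp
    next
      case 3
      have "\<phi> (fst q) = g" using 3(1) h0 by simp
      moreover have "\<forall>u. g (\<rho>X (X.cu (hx q)) u) = \<rho>Y (Y.cu (hy q)) (g u)" using start q(1) unfolding 3(1) by blast
      ultimately show ?thesis unfolding fits_def 3(2) by simp
    next
      case 4
      have "\<phi> (fst q) = carry h g m" using 4(1) \<phi>[of m] by simp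
      moreover have "\<forall>u. carry h g m (\<rho>X (X.cu (hx q)) u) = \<rho>Y (Y.cu (hy q)) (carry h g m u)" using stop q(1) unfolding 4(1) by blast
      ultimately show ?thesis unfolding fits_def 4(2) by simp
    qed
  qed (simp add: \<phi>_def)
  thus ?thesis using h0 by blast
qed

lemma cycle_extend:
  assumes C: "longc C" and l: "P.cycle h p" "fst h \<in> C" and g: "klin g"
    and stop: "carry h g p = g"
  shows "\<exists>\<phi>\<in>FL C. \<phi> (fst h) = g"
proof -
  have CC: "C = P.compo (fst h)" by (rule longc_comp[OF C l(2)])
  let ?t = "\<lambda>k. fst (P.W h k)"
  have Ct: "C = {?t k |k. k < p}" using P.cycle_comp[OF l(1)] CC by simp
  have inj: "k = k'" if "?t k = ?t k'" "k < p" "k' < p" for k k'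
    using P.cycle_distinct[OF l(1)] that by (metis linorder_neqE_nat)
  have on: "on (P.W h k)" for k using P.cycle_on[OF l(1)] by blast
  have p: "p > 0" "P.W h p = h" using l(1) by (auto simp: P.cycle_def)
  define \<phi> where "\<phi> v = (if v \<in> C then carry h g (SOME k. k < p \<and> v = ?t k) else 0)" for v
  have \<phi>': "\<phi> (?t k) = carry h g k" if "k < p" for k
  proof -
    have "(SOME k'. k' < p \<and> ?t k = ?t k') = k" by (rule some_equality) (use that inj in auto)
    moreover have "?t k \<in> C" using that Ct by blast
    ultimately show ?thesis by (simp add: \<phi>_def)
  qed
  have h0: "\<phi> (fst h) = g" using \<phi>'[of 0] p by simp
  have \<phi>: "\<phi> (?t k) = carry h g k" if "k \<le> p" for k
    using \<phi>'[of k] that stop p(2) h0 by (cases "k = p") auto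
  have fit: "fits \<phi> (P.W h k)" if "k < p" for k
    using fits_carry[OF on, where k = k and g = g and \<phi> = \<phi>] \<phi>[of k] \<phi>[of "Suc k"] that by simp
  have "\<phi> \<in> FL C"
  proof (rule FL_I[OF C])
    fix v assume "v \<in> C"
    then obtain k where "k < p" "v = ?t k" using Ct by blast
    thus "klin (\<phi> v)" using \<phi>' carry_linear[OF g, of k h] on by simp
  next
    fix q assume q: "on q" "fst q \<in> C"
    then obtain k where k: "k < p" "fst q = ?t k" using Ct by blast
    consider "q = P.W h k" | "q = opp (P.W h k)" using polarity_cases[of q "P.W h k"] k(2) by auto
    thus "fits \<phi> q"
    proof cases
      case 1
      thus ?thesis using fit k by simp
    next
      case 2
      obtain k' where k': "k' < p" "P.W h (Suc k') = P.W h k"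
      proof (cases k)
        case 0
        thus thesis using that[of "p - 1"] p by simp
      next
        case (Suc k')
        thus thesis using that[of k'] k by simp
      qed
      have "P.W h (Suc k') = opp (oe (P.W h k'))" using on[of k'] by (simp add: P.step_def)
      hence "q = oe (P.W h k')" using 2 k'(2) by (metis polarity_swap)
      thus ?thesis using fits_oe[OF on fit[OF k'(1)]] by simp
    qed
  qed (simp add: \<phi>_def)
  thus ?thesis using h0 by blast
qed

section \<open>Evaluation on a path with at most one loop\<close>

abbreviation LH :: "(nat \<times> nat) set \<Rightarrow> ('x \<Rightarrow> 'y) set" where
  "LH C \<equiv> line_Hom Q x y sX sY \<rho>X \<rho>Y (C, P.edges_of C)"

abbreviation lt :: "(nat \<times> nat) set \<Rightarrow> ltype" where
  "lt C \<equiv> ltype_of Q x y (C, P.edges_of C)"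

abbreviation KL :: "(nat \<times> nat) set \<Rightarrow> akind" where
  "KL C \<equiv> akind_of_ltype (lt C)"

abbreviation fX :: "(nat \<times> nat) set \<Rightarrow> 'k alg_elt \<Rightarrow> 'k alg_elt" where
  "fX C \<equiv> f_x Q x y (C, P.edges_of C)"

abbreviation fY :: "(nat \<times> nat) set \<Rightarrow> 'k alg_elt \<Rightarrow> 'k alg_elt" where
  "fY C \<equiv> f_y Q x y (C, P.edges_of C)"

lemma lt_eq:
  assumes C: "longc C"
  shows "lt C = (if P.allon C then if P.loops C = {} then LA_tilde else LD'_tilde else if P.loops C = {} then LA else LD')"
proof -
  obtain u where u: "u \<in> C" using longc_ex[OF C] by blast
  hence "u \<in> VP" using longc_VP[OF C] by blast
  thus ?thesis unfolding ltype_of_def using P.ltype_comp[of u] longc_comp[OF C u] by simp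
qed

lemma LH_gens:
  assumes C: "longc C" and fX: "kalg_hom (KL C) X.K (fX C)"
    and fY: "kalg_hom (KL C) Y.K (fY C)"
  shows "g \<in> LH C \<longleftrightarrow> klin g \<and>
    (\<forall>a\<in>gens (KL C). \<forall>v. g (\<rho>X (fX C (kgen (KL C) a)) v) =
       \<rho>Y (fY C (kgen (KL C) a)) (g v))"
  unfolding line_Hom_def line_alg_def mem_Collect_eq
  using intertwining_generators[OF X.module Y.module fX fY] by blast

lemma line_ex:
  assumes C: "longc C" and "\<not> (P.allon C \<and> P.loops C = {})"
  shows "\<exists>h m. P.line h m \<and> fst h \<in> C"
proof -
  obtain u where u: "u \<in> C" using longc_ex[OF C] by blast
  have "u \<in> VP" using longc_VP[OF C] u by blast
  from P.line_or_cycle[OF this] show ?thesis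
  proof
    assume "\<exists>p. P.cycle (u, Pos) p"
    then obtain p where p: "P.cycle (u, Pos) p" by blast
    have CC: "C = {fst (P.W (u, Pos) k) |k. k < p}" using P.cycle_comp[OF p] longc_comp[OF C u] by simp
    have "P.allon C" "P.loops C = {}" unfolding P.allon_def P.loops_def CC using P.cycle_on[OF p] by blast+
    thus ?thesis using assms(2) by blast
  qed (use longc_comp[OF C u] in blast)
qed

text \<open>An open line imposes no condition at its first vertex; the units of
  \<open>FL_units\<close> carry surjectivity from there to \<open>v\<close>.\<close>

lemma ev_LA:
  assumes C: "longc C" and t: "lt C = LA" and v: "v \<in> C"
  shows "bij_betw (\<lambda>\<phi>. \<phi> v) (FL C) (LH C)"
proof -
  have n: "\<not> P.allon C" "P.loops C = {}" using t lt_eq[OF C] by (auto split: if_splits)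
  have LH: "g \<in> LH C \<longleftrightarrow> klin g" for g
  proof -
    have "kalg_hom (KL C) X.K (fX C)"
      "kalg_hom (KL C) Y.K (fY C)"
      unfolding f_x_def f_y_def t by (simp_all add: kalg_map_triv)
    from LH_gens[OF C this] show ?thesis by (simp add: t)
  qed
  obtain h m where l: "P.line h m" "fst h \<in> C" using line_ex[OF C] n by blast
  have CC: "C = P.compo (fst h)" by (rule longc_comp[OF C l(2)])
  have off: "\<not> on (opp h)" "\<not> on (P.W h m)" using P.line_loops(1)[OF l(1)] n(2) unfolding CC by blast+
  obtain a b where ab: "a \<in> Units (kalg X.K)" "b \<in> Units (kalg Y.K)"
    "\<forall>\<phi>\<in>FL C. \<phi> v = \<rho>Y b \<circ> \<phi> (fst h) \<circ> \<rho>X a" using FL_units[OF C l(2) v] by blast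
  obtain a' b' where a': "a' \<in> Units (kalg X.K)" "\<And>u. \<rho>X a' (\<rho>X a u) = u"
    and b': "b' \<in> Units (kalg Y.K)" "\<And>u. \<rho>Y b (\<rho>Y b' u) = u"
    using X.act_Units[OF ab(1)] Y.act_Units[OF ab(2)] by blast
  have "\<exists>\<phi>\<in>FL C. \<phi> v = g" if g: "klin g" for g
  proof -
    have "klin (\<rho>Y b' \<circ> g \<circ> \<rho>X a')"
      by (rule linear_conjugate[OF g X.A.Units_closed[OF a'(1)] Y.A.Units_closed[OF b'(1)]])
    from line_extend[OF C l this] obtain \<phi> where "\<phi> \<in> FL C" "\<phi> (fst h) = \<rho>Y b' \<circ> g \<circ> \<rho>X a'" using off by blast
    thus ?thesis using ab(3) a'(2) b'(2) by (intro bexI[of _ \<phi>]) (auto simp: fun_eq_iff)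
  qed
  hence "g \<in> (\<lambda>\<phi>. \<phi> v) ` FL C \<longleftrightarrow> g \<in> LH C" for g using LH[of g] FL_linear by blast
  hence "(\<lambda>\<phi>. \<phi> v) ` FL C = LH C" by blast
  thus ?thesis using FL_inj[OF C v] by (simp add: bij_betw_def)
qed

lemma loop_ends:
  assumes "g \<in> P.loops C"
  shows "on g" "oe g = g" "X.is_end (hx g)" "Y.is_end (hy g)" "pa g = HPlus (Y.ar (hy g)) (X.ar (hx g))"
    "X.ar (hx g) \<in> H_sp Q x" "Y.ar (hy g) \<in> H_sp Q y"
proof -
  show o: "on g" "oe g = g" using assms by (auto simp: P.loops_def)
  hence r: "rx g = 1" "ry g = 1" using loop_iff by auto
  thus "X.is_end (hx g)" "Y.is_end (hy g)" using X.rank_hl(2) Y.rank_hl(2) on_live[OF o(1)] by auto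
  show "pa g = HPlus (Y.ar (hy g)) (X.ar (hx g))" using r by (simp add: pa_def)
  show "X.ar (hx g) \<in> H_sp Q x" "Y.ar (hy g) \<in> H_sp Q y" using G_arr_ar(3,4)[OF o(1)] r by auto
qed

lemma loop_strings:
  assumes "g \<in> P.loops C" shows "\<not> X.band" "\<not> Y.band"
  using loop_ends(3,4)[OF assms] by (auto simp: X.is_end_def Y.is_end_def)

end

context adm_word
begin

lemma cu_end: "is_end s \<Longrightarrow> cu s = U_val Q x (ar s)"
  by (auto simp: cu_def ar_def)

lemma U_sp:
  assumes "\<eta> \<in> H_sp Q x"
  shows "\<exists>g\<in>gens K. U_val Q x \<eta> = kgen K g" "K \<in> {K_T, K_ST}"
  using assms by (auto simp: H_sp_def akind_of_def)

end

context module_pair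
begin

text \<open>For strings the only units different from 1 belong to special loops. The condition on
  ranks excludes that exactly one word is at such a loop; if both are, the edge is itself a
  loop.\<close>

lemma FL_constant:
  assumes f: "\<phi> \<in> FL C" and s: "\<not> X.band" "\<not> Y.band" and o: "on h" and n: "(rx h = 1) = (ry h = 1)"
  shows "\<phi> (fst (oe h)) = \<phi> (fst h)"
proof (cases "rx h = 1")
  case True
  thus ?thesis using loop_iff[OF o] n by simp
next
  case False
  note l = on_live[OF o]
  have e: "\<not> X.is_end (hx h)" "\<not> Y.is_end (hy h)" using False n X.rank_hl(2)[OF l(1)] Y.rank_hl(2)[OF l(2)] by auto
  hence "\<not> X.is_end (X.oe (hx h))" using X.oe_not_end(6)[OF l(1)] by simp
  thus ?thesis using FL_fits[OF f o] fits_transport[OF o, of \<phi>] e s by (simp add: X.cu_ordinary Y.cu_ordinary comp_def)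
qed

lemma LD'_setup:
  assumes C: "longc C" and t: "lt C = LD'"
  shows "\<exists>g. P.loops C = {g} \<and> line_loop Q x y (C, P.edges_of C) = (Y.ar (hy g), X.ar (hx g)) \<and>
    bij_betw (\<lambda>\<phi>. \<phi> (fst g)) (FL C) (LH C)"
proof -
  have n: "\<not> P.allon C" "P.loops C \<noteq> {}" using t lt_eq[OF C] by (auto split: if_splits)
  obtain h' m where l': "P.line h' m" "fst h' \<in> C" using line_ex[OF C] n by blast
  \<comment> \<open>Orients the line so that its loop is at the beginning, the vertex at which the
    block is prescribed.\<close>
  have "\<exists>h. P.line h m \<and> fst h \<in> C \<and> on (opp h) \<and> \<not> on (P.W h m)"
  proof -
    have CC: "C = P.compo (fst h')" by (rule longc_comp[OF C l'(2)])
    obtain q where "q \<in> P.loops C" using n(2) by blast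
    hence "(q = opp h' \<or> q = P.W h' m) \<and> on q" using P.line_loops(1)[OF l'(1)] CC by blast
    hence "on (opp h') \<or> on (P.W h' m)" by metis
    moreover have "\<not> (on (opp h') \<and> on (P.W h' m))" using P.line_allon[OF l'(1)] n(1) CC by simp
    moreover have "fst (opp (P.W h' m)) \<in> C" using P.closed_W[OF longc_closed[OF C] l'(2)] by simp
    moreover have "on (P.W h' m) \<Longrightarrow> on (opp (opp (P.W h' m)))" by simp
    ultimately show ?thesis using l' P.line_reverse[OF l'(1)] by metis
  qed
  then obtain h where l: "P.line h m" "fst h \<in> C" and o: "on (opp h)" "\<not> on (P.W h m)" by blast
  have CC: "C = P.compo (fst h)" by (rule longc_comp[OF C l(2)])
  define g where "g = opp h"
  have loops: "P.loops C = {g}" using P.line_loops(1)[OF l(1)] o unfolding CC g_def by blast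
  hence gl: "g \<in> P.loops C" by simp
  note e = loop_ends[OF gl] and st = loop_strings[OF gl]
  have "{e \<in> P.edges_of C. HQ_src Q x y e = HQ_tgt Q x y e} = {HPlus (Y.ar (hy g)) (X.ar (hx g))}"
    using P.edges_of_loops[of "fst h"] loops e(5) CC by simp
  hence le: "e \<in> P.edges_of C \<and> HQ_src Q x y e = HQ_tgt Q x y e \<longleftrightarrow> e = HPlus (Y.ar (hy g)) (X.ar (hx g))" for e by blast
  have ll: "line_loop Q x y (C, P.edges_of C) = (Y.ar (hy g), X.ar (hx g))"
    unfolding line_loop_def snd_conv le by (intro the_equality) (simp_all add: prod_eq_iff)
  have "\<exists>gx\<in>gens X.K. U_val Q x (X.ar (hx g)) = (kgen X.K gx :: 'k alg_elt)"
    by (rule X.U_sp(1)[OF e(6)])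
  then obtain gx where gx: "gx \<in> gens X.K" "U_val Q x (X.ar (hx g)) = (kgen X.K gx :: 'k alg_elt)"
    by blast
  have "\<exists>gy\<in>gens Y.K. U_val Q y (Y.ar (hy g)) = (kgen Y.K gy :: 'k alg_elt)"
    by (rule Y.U_sp(1)[OF e(7)])
  then obtain gy where gy: "gy \<in> gens Y.K" "U_val Q y (Y.ar (hy g)) = (kgen Y.K gy :: 'k alg_elt)"
    by blast
  have LH: "q \<in> LH C \<longleftrightarrow> klin q \<and> (\<forall>u. q (\<rho>X (X.cu (hx g)) u) = \<rho>Y (Y.cu (hy g)) (q u))" for q
  proof -
    have kx: "kalg_hom K_T X.K (kalg_map K_T X.K (\<lambda>_. kgen X.K gx) :: 'k alg_elt \<Rightarrow> _)"
      "kalg_map K_T X.K (\<lambda>_. kgen X.K gx) (kgen K_T gT) = (kgen X.K gx :: 'k alg_elt)"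
      by (rule kalg_map_T[OF X.U_sp(2)[OF e(6)] gx(1)])+
    have ky: "kalg_hom K_T Y.K (kalg_map K_T Y.K (\<lambda>_. kgen Y.K gy) :: 'k alg_elt \<Rightarrow> _)"
      "kalg_map K_T Y.K (\<lambda>_. kgen Y.K gy) (kgen K_T gT) = (kgen Y.K gy :: 'k alg_elt)"
      by (rule kalg_map_T[OF Y.U_sp(2)[OF e(7)] gy(1)])+
    have fx: "fX C = (kalg_map K_T X.K (\<lambda>_. kgen X.K gx) :: 'k alg_elt \<Rightarrow> _)"
      and fy: "fY C = (kalg_map K_T Y.K (\<lambda>_. kgen Y.K gy) :: 'k alg_elt \<Rightarrow> _)"
      unfolding f_x_def f_y_def t ll by (simp_all add: gx(2) gy(2))
    have cu: "X.cu (hx g) = (kgen X.K gx :: 'k alg_elt)" "Y.cu (hy g) = (kgen Y.K gy :: 'k alg_elt)"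
      by (simp_all only: X.cu_end[OF e(3)] Y.cu_end[OF e(4)] gx(2) gy(2))
    have "kalg_hom (KL C) X.K (fX C)"
      "kalg_hom (KL C) Y.K (fY C)"
      unfolding fx fy t using kx(1) ky(1) by simp_all
    from LH_gens[OF C this] show ?thesis by (simp add: t fx fy kx(2) ky(2) cu)
  qed
  have "(\<lambda>\<phi>. \<phi> (fst g)) ` FL C = LH C"
  proof (intro equalityI subsetI)
    fix q assume "q \<in> (\<lambda>\<phi>. \<phi> (fst g)) ` FL C"
    then obtain \<phi> where f: "\<phi> \<in> FL C" "q = \<phi> (fst g)" by blast
    thus "q \<in> LH C" using LH FL_linear[OF f(1)] FL_fits[OF f(1) e(1)] e(2) by (simp add: fits_def)
  next
    fix q assume "q \<in> LH C"
    hence q: "klin q" "\<forall>u. q (\<rho>X (X.cu (hx g)) u) = \<rho>Y (Y.cu (hy g)) (q u)" using LH by auto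
    from line_extend[OF C l q(1)] q(2) o obtain \<phi> where "\<phi> \<in> FL C" "\<phi> (fst h) = q" unfolding g_def by blast
    moreover have "fst h = fst g" by (simp add: g_def)
    ultimately show "q \<in> (\<lambda>\<phi>. \<phi> (fst g)) ` FL C" by (intro image_eqI[of _ _ \<phi>]) simp_all
  qed
  moreover have "fst g \<in> C" using l(2) by (simp add: g_def)
  ultimately have "bij_betw (\<lambda>\<phi>. \<phi> (fst g)) (FL C) (LH C)" using FL_inj[OF C] by (simp add: bij_betw_def)
  thus ?thesis using loops ll by blast
qed

text \<open>The claim is known at the vertex of the loop. Blocks do not change along arrows outside
  \<open>HQ_o\<close>, which settles the vertices that are not separated; at the others the units
  between the two vertices remain.\<close>

lemma ev_LD':
  assumes C: "longc C" and t: "lt C = LD'" and v: "v \<in> C"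
  shows "\<not> separated Q x y (C, P.edges_of C) v \<Longrightarrow> bij_betw (\<lambda>\<phi>. \<phi> v) (FL C) (LH C)"
    "\<exists>a\<in>Units (kalg X.K). \<exists>b\<in>Units (kalg Y.K). bij_betw (\<lambda>\<phi>. \<rho>Y b \<circ> \<phi> v \<circ> \<rho>X a) (FL C) (LH C)" (is ?A1)
proof -
  obtain g where g: "P.loops C = {g}" "line_loop Q x y (C, P.edges_of C) = (Y.ar (hy g), X.ar (hx g))"
    "bij_betw (\<lambda>\<phi>. \<phi> (fst g)) (FL C) (LH C)" using LD'_setup[OF C t] by blast
  hence gl: "g \<in> P.loops C" by simp
  note e = loop_ends[OF gl] and st = loop_strings[OF gl]
  have gC: "fst g \<in> C" using gl by (auto simp: P.loops_def)
  have src: "HQ_src Q x y (HPlus (Y.ar (hy g)) (X.ar (hx g))) = fst g"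
    using pa_ends(2)[OF e(1)] e(2,5) by auto
  show "bij_betw (\<lambda>\<phi>. \<phi> v) (FL C) (LH C)" if "\<not> separated Q x y (C, P.edges_of C) v"
  proof -
    have "(fst g, v) \<in> connected (HQ_src Q x y) (HQ_tgt Q x y) (P.edges_of C - HQ_o Q x y)"
      using that t src unfolding separated_def by (simp add: g(2))
    hence "\<forall>\<phi>\<in>FL C. \<phi> v = \<phi> (fst g)"
      unfolding connected_def
    proof (induction rule: rtrancl_induct)
      case (step a b)
      obtain ed where ed: "ed \<in> P.edges_of C" "ed \<notin> HQ_o Q x y" "{HQ_src Q x y ed, HQ_tgt Q x y ed} = {a, b}" using step(2) by blast
      hence "ed \<in> HQ_arrows Q x y" unfolding P.edges_of_def by blast
      then obtain h where h: "on h" "ed = pa h" unfolding HQ_arrows_eq by blast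
      have "(rx h = 1) = (ry h = 1)" using pa_o[OF h(1)] ed(2) h(2) by simp
      hence "\<forall>\<phi>\<in>FL C. \<phi> (fst (oe h)) = \<phi> (fst h)" using FL_constant[OF _ st h(1)] by blast
      moreover have "{fst h, fst (oe h)} = {a, b}" using P.ends[OF h(1)] ed(3) h(2) by simp
      ultimately show ?case using step.IH by (auto simp: doubleton_eq_iff)
    qed simp
    thus ?thesis using g(3) by (simp cong: bij_betw_cong)
  qed
  obtain a b where ab: "a \<in> Units (kalg X.K)" "b \<in> Units (kalg Y.K)"
    "\<forall>\<phi>\<in>FL C. \<phi> (fst g) = \<rho>Y b \<circ> \<phi> v \<circ> \<rho>X a" using FL_units[OF C v gC] by blast
  have "bij_betw (\<lambda>\<phi>. \<rho>Y b \<circ> \<phi> v \<circ> \<rho>X a) (FL C) (LH C) \<longleftrightarrow> bij_betw (\<lambda>\<phi>. \<phi> (fst g)) (FL C) (LH C)"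
    by (rule bij_betw_cong) (use ab(3) in metis)
  thus ?A1
    using ab(1,2) g(3) by blast
qed

end

section \<open>Cyclic lines\<close>

context adm_word
begin

text \<open>The exponent in \<open>U_val\<close> makes up for the direction of the letter 0, so the
  unit depends only on the direction of reading.\<close>

lemma cu_right:
  assumes band "i < len"
  shows "cu (R i) = (if i = 0 then kgen K gTinv else \<one>\<^bsub>kalg K\<^esub>)" "cu (oe (R i)) = (if i = 0 then kgen K gT else \<one>\<^bsub>kalg K\<^esub>)"
proof -
  have V: "fst (R i) \<in> V" "\<not> is_end (R i)" using assms by (auto simp: H_verts_iff is_end_def)
  have a: "ar (R i) = Nu i" using V by (simp add: ar_def)
  hence a': "ar (oe (R i)) = Nu i" using oe_not_end(4)[OF V] by simp
  have "hl (R i) = x ! i" "hl (oe (R i)) = linv (x ! i)" using hl_right hl_oe[OF V] by simp_all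
  moreover have "is_direct (linv (x ! i)) \<longleftrightarrow> \<not> is_direct (x ! i)"
    using hl_cases[OF V(1)] is_end_iff[OF V(1)] V(2) hl_right by auto
  ultimately show "cu (R i) = (if i = 0 then kgen K gTinv else \<one>\<^bsub>kalg K\<^esub>)" "cu (oe (R i)) = (if i = 0 then kgen K gT else \<one>\<^bsub>kalg K\<^esub>)"
    unfolding cu_def a a' using assms(1) by auto
qed

lemma left_right_band:
  assumes band "i < len" shows "Lf i = oe (R (prv i))" "oe (Lf i) = R (prv i)" "prv i < len"
proof -
  have i: "i \<in> V" using assms by (simp add: H_verts_iff)
  show "Lf i = oe (R (prv i))" using left_oe[OF i] assms(1) by simp
  show p: "prv i < len" by (rule prv_less[OF i])
  thus "oe (Lf i) = R (prv i)" using left_oe[OF i] oe_oe[of "R (prv i)"] assms(1) by (simp add: H_verts_iff)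
qed

lemma side_cases: "s = R (fst s) \<or> s = Lf (fst s)"
  using polarity_cases[of s "R (fst s)"] by auto

lemma wpow_len: "band \<Longrightarrow> fst s \<in> V \<Longrightarrow> (wstep ^^ len) s = s"
proof -
  assume b: band "fst s \<in> V"
  hence l: "fst s < len" by (simp add: H_verts_iff)
  from side_cases[of s] show ?thesis
  proof
    assume "s = R (fst s)"
    thus ?thesis using wpow_right_band[OF b(1) l, of len] l by (metis mod_add_self2 mod_less)
  next
    assume s: "s = Lf (fst s)"
    have "nat ((int (fst s) - int len) mod int len) = fst s" using l by simp
    thus ?thesis using wpow_left_band[OF b(1) l, of len] s by metis
  qed
qed

lemma wpow_fixed: "band \<Longrightarrow> i < len \<Longrightarrow> (wstep ^^ p) (R i) = R i \<Longrightarrow> len dvd p"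
proof -
  assume b: band "i < len" "(wstep ^^ p) (R i) = R i"
  hence "(i + p) mod len = i mod len" using wpow_right_band[OF b(1,2), of p] by simp
  thus ?thesis by (metis add_diff_cancel_left' le_add1 mod_eq_dvd_iff_nat)
qed

text \<open>Read in either direction, a period of the letters is one of the cyclic word, and
  primitivity allows only multiples of its length.\<close>

lemma band_period:
  assumes b: band "fst s \<in> V" and per: "\<And>k. F Q (hl ((wstep ^^ (k + d)) s)) = F Q (hl ((wstep ^^ k) s))"
  shows "len dvd d"
proof (rule ccontr)
  assume n: "\<not> len dvd d"
  have l: "fst s < len" using b by (simp add: H_verts_iff)
  let ?c = "map (F Q) x"
  have "\<not> primitive ?c"
  proof (rule not_primitive_period[where d = d])
    fix j
    from side_cases[of s] have "F Q (x ! ((j + d) mod len)) = F Q (x ! (j mod len))"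
    proof
      assume s: "s = R (fst s)"
      define k where "k = j + (len - fst s)"
      have e: "fst s + k = j + len" "fst s + (k + d) = j + d + len" using l by (simp_all add: k_def)
      have "F Q (x ! ((fst s + (k + d)) mod len)) = F Q (x ! ((fst s + k) mod len))"
        using per[of k] hl_wpow_right[OF b(1) l] s by metis
      thus ?thesis unfolding e by simp
    next
      assume s: "s = Lf (fst s)"
      \<comment> \<open>Congruent to \<open>fst s - 1 - (j + d)\<close> modulo \<open>len\<close>
        but not negative: read leftwards, the step \<open>k\<close> arrives at the letter
        \<open>j + d\<close>.\<close>
      define k where "k = (len - 1) * (j + d) + (len - 1) + fst s"
      have L: "int (len - 1) = int len - 1" using len_pos by linarith
      have "int k = (int len - 1) * (int j + int d) + (int len - 1) + int (fst s)" by (simp only: k_def of_nat_add of_nat_mult L)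
      hence e: "int (fst s) - 1 - int k = (int j + int d) + int len * (- (int j + int d) - 1)"
        "int (fst s) - 1 - int (k + d) = int j + int len * (- (int j + int d) - 1)" by (simp_all add: algebra_simps)
      have "linv (F Q (x ! nat ((int (fst s) - 1 - int (k + d)) mod int len))) = linv (F Q (x ! nat ((int (fst s) - 1 - int k) mod int len)))"
        using per[of k] hl_wpow_left[OF b(1) l] s F_linv by metis
      hence "F Q (x ! nat (int j mod int len)) = F Q (x ! nat ((int j + int d) mod int len))"
        unfolding e by simp
      thus ?thesis by (simp add: nat_mod_distrib nat_add_distrib)
    qed
    thus "?c ! ((j + d) mod length ?c) = ?c ! (j mod length ?c)" using len_pos by simp
  qed (use n len_pos in auto)
  thus False using band_cases[OF b(1)] by (simp add: admissible_band_def)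
qed

lemma reach_end:
  assumes "\<not> band" "fst s \<in> V" shows "\<exists>k. is_end ((wstep ^^ k) s)"
proof -
  have l: "1 \<le> fst s" "fst s \<le> len - 1" using assms by (auto simp: H_verts_iff)
  from side_cases[of s] show ?thesis
  proof
    assume s: "s = R (fst s)"
    have "(wstep ^^ (len - 1 - fst s)) (R (fst s)) = R (len - 1)"
      using wpow_right_string[OF assms(1), of "fst s" "len - 1 - fst s"] l by simp
    thus ?thesis using string_end_right[OF assms(1)] s by metis
  next
    assume s: "s = Lf (fst s)"
    have "(wstep ^^ (fst s - 1)) (Lf (fst s)) = Lf 1"
      using wpow_left_string[OF assms(1), of "fst s" "fst s - 1"] l by simp
    thus ?thesis using string_end_left[OF assms(1)] s by metis
  qed
qed

lemma walk_between_ends: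
  assumes s: "fst s \<in> V" "is_end s" and n: "\<And>k. k < m \<Longrightarrow> \<not> is_end ((wstep ^^ k) (opp s))" and e: "is_end ((wstep ^^ m) (opp s))"
  shows "m = len - 2 \<and> (s = Lf 1 \<and> (\<forall>k\<le>m. (wstep ^^ k) (opp s) = R (1 + k)) \<or>
    s = R (len - 1) \<and> (\<forall>k\<le>m. (wstep ^^ k) (opp s) = Lf (len - 1 - k)))"
proof -
  have nb: "\<not> band" using s by (auto simp: is_end_def)
  obtain M where M: "len = Suc (Suc M)" using len_ge2 by (metis add_2_eq_Suc le_Suc_ex)
  consider "s = Lf 1" | "s = R (len - 1)"
    using s nb side_cases[of s] polarity_cases[of s "R (fst s)"] by (auto simp: is_end_def prod_eq_iff split: if_splits)
  thus ?thesis
  proof cases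
    case 1
    have w: "(wstep ^^ k) (opp s) = R (1 + k)" if "k \<le> M" for k
      using wpow_right_string[OF nb, of 1 k] that 1 by (simp add: M)
    have "is_end (R (1 + M))" using string_end_right[OF nb] by (simp add: M)
    hence "\<not> M < m" using n[of M] w[of M] by auto
    moreover have "\<not> m < M" using e w[of m] nb by (auto simp: is_end_def M)
    ultimately show ?thesis using w 1 by (auto simp: M)
  next
    case 2
    have w: "(wstep ^^ k) (opp s) = Lf (Suc M - k)" if "k \<le> M" for k
      using wpow_left_string[OF nb, of "len - 1" k] that 2 by (simp add: M)
    have "is_end (Lf (Suc M - M))" using string_end_left[OF nb] by simp
    hence "\<not> M < m" using n[of M] w[of M] by auto
    moreover have "\<not> m < M" using e w[of m] nb by (auto simp: is_end_def M)
    ultimately show ?thesis using w 2 by (auto simp: M)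
  qed
qed

text \<open>In even length the two middle letters would be inverse to each other, although
  consecutive letters have opposite source and target. In odd length the middle letter would be its
  own inverse, hence special, and \<open>hatQ Q\<close> has no such letter.\<close>

lemma not_self_inverse_string:
  assumes "\<not> band" shows "\<not> (\<forall>q<len. x ! q = linv (x ! (len - 1 - q)))"
proof
  assume sym: "\<forall>q<len. x ! q = linv (x ! (len - 1 - q))"
  show False
  proof (cases "even len")
    case True
    define q where "q = len div 2 - 1"
    have q: "Suc q < len" "len - 1 - q = Suc q" using True len_ge2 by (auto simp: q_def elim!: evenE)
    hence "x ! q = linv (x ! Suc q)" using sym[rule_format, of q] by simp
    moreover obtain p where "ltgt hQ (x ! Suc q) = Some p" "lsrc hQ (x ! q) = Some (opp p)" using consecutive[OF q(1)] by blast
    ultimately show False by simp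
  next
    case False
    define q where "q = len div 2"
    have q: "q < len" "len - 1 - q = q" using False len_pos by (auto simp: q_def elim!: oddE)
    hence s: "x ! q = linv (x ! q)" using sym[rule_format, of q] by simp
    hence "\<exists>i. x ! q = Special i" by (cases "x ! q") auto
    thus False using letter_in[OF q(1)] by (auto simp: letters_hatQ)
  qed
qed

end

section \<open>Cyclic lines of a pair of bands\<close>

context module_pair
begin

lemma walk_half_edges:
  assumes "\<And>j. j < k \<Longrightarrow> on (P.W h j)"
  shows "hx (P.W h k) = (X.wstep ^^ k) (hx h)" "hy (P.W h k) = (Y.wstep ^^ k) (hy h)"
proof -
  have "hx (P.W h k) = (X.wstep ^^ k) (hx h) \<and> hy (P.W h k) = (Y.wstep ^^ k) (hy h)"
    using assms
  proof (induction k)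
    case (Suc k)
    have o: "on (P.W h k)" using Suc.prems by simp
    show ?case using Suc pstep_on(1,2)[OF o] step_on[OF o] by simp
  qed simp
  thus "hx (P.W h k) = (X.wstep ^^ k) (hx h)" "hy (P.W h k) = (Y.wstep ^^ k) (hy h)" by auto
qed

lemma carry_single:
  assumes "k0 < n" "k1 < n"
    and a: "\<And>k u. k < n \<Longrightarrow> \<rho>X (X.cu (X.oe (hx (P.W h k)))) u = (if k = k0 then \<rho>X A u else u)"
    and b: "\<And>k u. k < n \<Longrightarrow> \<rho>Y (Y.cu (hy (P.W h k))) u = (if k = k1 then \<rho>Y B u else u)"
  shows "carry h g n = \<rho>Y B \<circ> g \<circ> \<rho>X A"
proof -
  have "carry h g k u = (if k1 < k then \<rho>Y B else id) (g ((if k0 < k then \<rho>X A else id) u))" if "k \<le> n" for k u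
    using that
  proof (induction k arbitrary: u)
    case (Suc k)
    thus ?case using a[of k] b[of k] by (auto simp: less_Suc_eq)
  qed simp
  thus ?thesis using assms(1,2) by (auto simp: fun_eq_iff)
qed

lemma carry_constant:
  assumes "\<And>k u. k < n \<Longrightarrow> \<rho>X (X.cu (X.oe (hx (P.W h k)))) u = u" "\<And>k u. k < n \<Longrightarrow> \<rho>Y (Y.cu (hy (P.W h k))) u = u"
  shows "carry h g n = g"
  using assms by (induction n) (auto simp: fun_eq_iff)

text \<open>A string would run into an end, so both words are bands. Each is periodic with the
  length of the other, and primitivity makes the lengths equal; as the walk returns to a half-edge
  of H(x) only after full turns, the cycle has this length.\<close>

lemma LA_tilde_setup:
  assumes C: "longc C" and t: "lt C = LA_tilde" and v: "v \<in> C"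
  defines "h \<equiv> (v, X.rp (snd v))"
  shows "X.band" "Y.band" "length y = length x" "P.cycle h (length x)" "\<And>k. on (P.W h k)"
    "\<And>k. X.hl ((X.wstep ^^ k) (X.R (snd v))) = Y.hl ((Y.wstep ^^ k) (hy h))"
proof -
  have n: "P.allon C" "P.loops C = {}" using t lt_eq[OF C] by (auto split: if_splits)
  have WC: "fst (P.W h k) \<in> C" for k by (rule P.closed_W[OF longc_closed[OF C]]) (simp add: h_def v)
  have on: "on (P.W h k)" for k using n(1) WC unfolding P.allon_def by blast
  thus "on (P.W h k)" for k .
  have r: "rx (P.W h k) = ry (P.W h k)" for k by (rule allon_plus(2)[OF n(1) longc_closed[OF C] WC])
  have nl: "oe (P.W h k) \<noteq> P.W h k" for k using n(2) WC on unfolding P.loops_def by blast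
  have hh: "hx h = X.R (snd v)" by (simp add: h_def)
  note w = walk_half_edges[OF on]
  have VP: "fst (P.W h k) \<in> VP" for k using WC longc_VP[OF C] by blast
  show hl: "X.hl ((X.wstep ^^ k) (X.R (snd v))) = Y.hl ((Y.wstep ^^ k) (hy h))" for k
    using hl_eqI[OF VP r] w unfolding hh by metis
  have V: "fst (hx h) \<in> X.V" "fst (hy h) \<in> Y.V" using on_live[OF on[of 0]] by simp_all
  have ne: "\<not> X.is_end ((X.wstep ^^ k) (hx h))" "\<not> Y.is_end ((Y.wstep ^^ k) (hy h))" for k
  proof -
    have "\<not> (rx (P.W h k) = 1 \<and> ry (P.W h k) = 1)" using loop_iff[OF on] nl by blast
    hence "rx (P.W h k) \<noteq> 1" "ry (P.W h k) \<noteq> 1" using r[of k] by auto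
    thus "\<not> X.is_end ((X.wstep ^^ k) (hx h))" "\<not> Y.is_end ((Y.wstep ^^ k) (hy h))"
      using X.rank_hl(2)[OF on_live(1)[OF on[of k]]] Y.rank_hl(2)[OF on_live(2)[OF on[of k]]] w[of k] by auto
  qed
  show bX: "X.band" using X.reach_end[OF _ V(1)] ne by blast
  show bY: "Y.band" using Y.reach_end[OF _ V(2)] ne by blast
  have perX: "(X.wstep ^^ (k + length x)) (hx h) = (X.wstep ^^ k) (hx h)" for k
    using X.wpow_len[OF bX V(1)] by (simp only: funpow_add comp_apply)
  have perY: "(Y.wstep ^^ (k + length y)) (hy h) = (Y.wstep ^^ k) (hy h)" for k
    using Y.wpow_len[OF bY V(2)] by (simp only: funpow_add comp_apply)
  have "length x dvd length y" using hl perY by (intro X.band_period[OF bX V(1)]) (metis hh)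
  moreover have "length y dvd length x" using hl perX by (intro Y.band_period[OF bY V(2)]) (metis hh)
  ultimately show len: "length y = length x" by (simp add: dvd_antisym)
  obtain p where p: "P.cycle h p"
  proof -
    have "\<not> P.reflecting (P.W h k)" for k using on nl by (simp add: P.reflecting_iff)
    moreover have "fst h \<in> VP" using VP[of 0] by simp
    ultimately show thesis using P.cycleI that by blast
  qed
  have "hx (P.W h p) = hx h" using p by (simp add: P.cycle_def)
  hence "(X.wstep ^^ p) (X.R (snd v)) = X.R (snd v)" using w(1)[of p] unfolding hh by simp
  moreover have "snd v < length x" using V(1) X.V_less by (simp add: h_def)
  ultimately have dv: "length x dvd p" using X.wpow_fixed[OF bX] by blast
  have "hx (P.W h (length x)) = hx h" "hy (P.W h (length x)) = hy h"
    using w[of "length x"] perX[of 0] perY[of 0] len by simp_all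
  hence "P.W h (length x) = h" by (simp add: prod_eq_iff)
  hence "\<not> length x < p" using p X.len_pos unfolding P.cycle_def by blast
  moreover have "length x \<le> p" using dv p by (auto simp: P.cycle_def dest: dvd_imp_le)
  ultimately have "p = length x" by simp
  thus "P.cycle h (length x)" using p by simp
qed

text \<open>Read in the same direction, equal letters exhibit \<open>y\<close> as a rotation of
  \<open>x\<close>. Read in opposite directions they exhibit it as a rotation of the inverse, and if
  it were one of \<open>x\<close> as well, the band \<open>F(x)\<close> would be symmetric.\<close>

lemma LA_tilde_direction:
  assumes C: "longc C" and t: "lt C = LA_tilde" and v: "v \<in> C"
  defines "h \<equiv> (v, X.rp (snd v))"
  shows "hy h = Y.R (fst v) \<Longrightarrow> same_word Q x y" "hy h = Y.Lf (fst v) \<Longrightarrow> \<not> same_word Q x y"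
proof -
  note S = LA_tilde_setup[OF C t v, folded h_def]
  define n where "n = length x"
  define i where "i = snd v"
  define j where "j = fst v"
  have ij: "i < n" "j < n" using longc_VP[OF C] v X.V_less Y.V_less S(3) VP_iff[of "fst v" "snd v"] by (auto simp: i_def j_def n_def)
  have n0: "n > 0" using ij by simp
  show "same_word Q x y" if s: "hy h = Y.R (fst v)"
  proof -
    have eq: "x ! ((i + k) mod n) = y ! ((j + k) mod n)" for k
      using S(6)[of k] X.hl_wpow_right[OF S(1), of i k] Y.hl_wpow_right[OF S(2), of j k] ij S(3) unfolding s
      by (simp add: i_def[symmetric] j_def[symmetric] n_def[symmetric])
    \<comment> \<open>Congruent to \<open>i - j - 1\<close>, so that the rotation by
      \<open>c + 1\<close> letters moves position \<open>i\<close> of \<open>x\<close> to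
      \<open>j\<close>.\<close>
    define c where "c = (i + (n - j) + (n - 1)) mod n"
    have "rotation_of y x"
      unfolding rotation_of_def
    proof (intro exI[of _ c] conjI nth_equalityI)
      show cn: "c < length x" using n0 by (simp add: c_def n_def)
      show "length y = length (drop (Suc c) x @ take (Suc c) x)" using S(3) by simp
      fix q assume "q < length y"
      hence q: "q < n" using S(3) by (simp add: n_def)
      have "(drop (Suc c) x @ take (Suc c) x) ! q = x ! ((Suc c + q) mod n)" using nth_drop_take[OF cn] q by (simp add: n_def)
      also have "(Suc c + q) mod n = (i + (q + (n - j))) mod n"
      proof -
        have "Suc c + q = c + Suc q" by simp
        also have "(c + Suc q) mod n = (i + (n - j) + (n - 1) + Suc q) mod n" unfolding c_def by (rule mod_add_left_eq)
        also have "i + (n - j) + (n - 1) + Suc q = i + (q + (n - j)) + n" using n0 by simp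
        finally show ?thesis by simp
      qed
      also have "x ! \<dots> = y ! ((j + (q + (n - j))) mod n)" by (rule eq)
      also have "(j + (q + (n - j))) mod n = q" using ij q by simp
      finally show "y ! q = (drop (Suc c) x @ take (Suc c) x) ! q" by simp
    qed
    thus ?thesis using S(1) by (simp add: same_word_def)
  qed
  show "\<not> same_word Q x y" if s: "hy h = Y.Lf (fst v)"
  proof
    assume "same_word Q x y"
    hence "\<exists>d. \<forall>a. y ! nat (a mod int n) = x ! nat ((a + d) mod int n)"
      unfolding same_word_def
    proof
      assume "y = x"
      thus ?thesis by (intro exI[of _ 0]) simp
    next
      assume "X.band \<and> rotation_of y x"
      then obtain c where c: "c < n" "y = drop (Suc c) x @ take (Suc c) x" by (auto simp: rotation_of_def n_def)
      have "y ! nat (a mod int n) = x ! nat ((a + (1 + int c)) mod int n)" for a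
      proof -
        have q: "nat (a mod int n) < n" using n0 by (simp add: nat_less_iff)
        have "y ! nat (a mod int n) = x ! ((Suc c + nat (a mod int n)) mod n)"
          unfolding c(2) using nth_drop_take[of c x "nat (a mod int n)"] c(1) q by (simp add: n_def)
        moreover have "int ((Suc c + nat (a mod int n)) mod n) = (a mod int n + (1 + int c)) mod int n"
          using n0 by (simp add: zmod_int algebra_simps)
        ultimately show ?thesis by (metis mod_add_left_eq nat_int)
      qed
      thus ?thesis by blast
    qed
    then obtain d where d: "y ! nat (a mod int n) = x ! nat ((a + d) mod int n)" for a by blast
    have eq: "x ! ((i + k) mod n) = linv (y ! nat ((int j - 1 - int k) mod int n))" for k
      using S(6)[of k] X.hl_wpow_right[OF S(1), of i k] Y.hl_wpow_left[OF S(2), of j k] ij S(3) unfolding s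
      by (simp add: i_def[symmetric] j_def[symmetric] n_def[symmetric])
    have "x ! nat (a mod int (length x)) = linv (x ! nat ((int i + int j - 1 + d - a) mod int (length x)))" for a
    proof -
      define k where "k = nat ((a - int i) mod int n)"
      have k: "int k = (a - int i) mod int n" using n0 by (simp add: k_def)
      have "int ((i + k) mod n) = (int i + (a - int i) mod int n) mod int n" by (simp add: zmod_int k)
      also have "\<dots> = a mod int n" by (simp add: mod_add_right_eq)
      finally have "x ! nat (a mod int n) = linv (y ! nat ((int j - 1 - int k) mod int n))" using eq[of k] by (metis nat_int)
      also have "\<dots> = linv (x ! nat ((int j - 1 - int k + d) mod int n))" by (simp only: d)
      also have "(int j - 1 - int k + d) mod int n = (int i + int j - 1 + d - a) mod int n"
      proof -
        have "(int j - 1 - int k + d) mod int n = ((int j - 1 + d) - (a - int i) mod int n) mod int n" by (simp add: k algebra_simps)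
        also have "\<dots> = ((int j - 1 + d) - (a - int i)) mod int n" by (rule mod_diff_right_eq)
        finally show ?thesis by (simp add: algebra_simps)
      qed
      finally show ?thesis by (simp add: n_def)
    qed
    hence "F Q (x ! nat (a mod int (length x))) = linv (F Q (x ! nat ((int i + int j - 1 + d - a) mod int (length x))))" for a
      by (metis F_linv)
    thus False using X.not_self_inverse_band[OF S(1)] by blast
  qed
qed

text \<open>In one turn each word passes its letter 0 once. On the side of \<open>x\<close>, always
  read rightwards, transport contributes T; the exponent on the side of \<open>y\<close> depends on
  the direction in which \<open>y\<close> is read.\<close>

lemma LA_tilde_carry:
  assumes C: "longc C" and t: "lt C = LA_tilde" and v: "v \<in> C"
  defines "h \<equiv> (v, X.rp (snd v))"
  shows "carry h g (length x) = \<rho>Y (kgen K_Laurent (if same_word Q x y then gTinv else gT)) \<circ> g \<circ> \<rho>X (kgen K_Laurent gT)"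
proof -
  note S = LA_tilde_setup[OF C t v, folded h_def] and D = LA_tilde_direction[OF C t v, folded h_def]
  define n where "n = length x"
  define i where "i = snd v"
  define j where "j = fst v"
  have ij: "i < n" "j < n" using longc_VP[OF C] v X.V_less Y.V_less S(3) VP_iff[of "fst v" "snd v"] by (auto simp: i_def j_def n_def)
  have KX: "X.K = K_Laurent" and KY: "Y.K = K_Laurent" using S(1,2) by (simp_all add: akind_of_def)
  note w = walk_half_edges[OF S(5)]
  have n0: "n > 0" using ij by simp
  \<comment> \<open>The step at which \<open>x\<close> passes its letter 0; \<open>k1\<close> below
    is the one for \<open>y\<close>.\<close>
  define k0 where "k0 = (n - i) mod n"
  have k0: "k0 < n" "\<And>k. k < n \<Longrightarrow> (i + k) mod n = 0 \<longleftrightarrow> k = k0"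
  proof -
    show "k0 < n" using ij by (simp add: k0_def)
    show "(i + k) mod n = 0 \<longleftrightarrow> k = k0" if "k < n" for k
      using ij that by (cases "i = 0"; cases "i + k < n"; auto simp: k0_def mod_if)
  qed
  have a: "\<rho>X (X.cu (X.oe (hx (P.W h k)))) u = (if k = k0 then \<rho>X (kgen K_Laurent gT) u else u)" if k: "k < n" for k u
  proof -
    have "hx (P.W h k) = X.R ((i + k) mod n)" using w(1)[of k] X.wpow_right_band[OF S(1), of i k] ij by (simp add: h_def i_def n_def)
    moreover have "(i + k) mod n < length x" using n0 by (simp add: n_def)
    ultimately have "X.cu (X.oe (hx (P.W h k))) = (if k = k0 then kgen K_Laurent gT else \<one>\<^bsub>kalg K_Laurent\<^esub> :: 'k alg_elt)"
      using k0(2)[OF k] by (simp only: X.cu_right(2)[OF S(1)] KX)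
    thus ?thesis using X.act_one[unfolded KX] by simp
  qed
  have V: "fst (hy h) = j" by (simp add: h_def j_def)
  define B where "B = (if same_word Q x y then gTinv else gT)"
  have "\<exists>k1<n. \<forall>k<n. \<forall>u. \<rho>Y (Y.cu (hy (P.W h k))) u = (if k = k1 then \<rho>Y (kgen K_Laurent B) u else u)"
  proof (cases "hy h = Y.R j")
    case True
    define k1 where "k1 = (n - j) mod n"
    have k1: "k1 < n" "\<And>k. k < n \<Longrightarrow> (j + k) mod n = 0 \<longleftrightarrow> k = k1"
    proof -
      show "k1 < n" using ij by (simp add: k1_def)
      show "(j + k) mod n = 0 \<longleftrightarrow> k = k1" if "k < n" for k
        using ij that by (cases "j = 0"; cases "j + k < n"; auto simp: k1_def mod_if)
    qed
    have B: "B = gTinv" using D(1) True by (simp add: B_def j_def)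
    have "\<rho>Y (Y.cu (hy (P.W h k))) u = (if k = k1 then \<rho>Y (kgen K_Laurent B) u else u)" if k: "k < n" for k u
    proof -
      have "hy (P.W h k) = Y.R ((j + k) mod n)" using w(2)[of k] Y.wpow_right_band[OF S(2), of j k] ij True S(3) by (simp add: n_def)
      moreover have "(j + k) mod n < length y" using n0 S(3) by (simp add: n_def)
      ultimately have "Y.cu (hy (P.W h k)) = (if k = k1 then kgen K_Laurent B else \<one>\<^bsub>kalg K_Laurent\<^esub> :: 'k alg_elt)"
        using k1(2)[OF k] by (simp only: Y.cu_right(1)[OF S(2)] KY B)
      thus ?thesis using Y.act_one[unfolded KY] by simp
    qed
    thus ?thesis using k1(1) by blast
  next
    case False
    hence L: "hy h = Y.Lf j" using Y.side_cases[of "hy h"] V by auto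
    have B: "B = gT" using D(2) L by (simp add: B_def j_def)
    define k1 where "k1 = (if j = 0 then n - 1 else j - 1)"
    have k1: "k1 < n" "\<And>k. k < n \<Longrightarrow> nat ((int j - 1 - int k) mod int n) = 0 \<longleftrightarrow> k = k1"
    proof -
      show "k1 < n" using ij by (auto simp: k1_def)
      show "nat ((int j - 1 - int k) mod int n) = 0 \<longleftrightarrow> k = k1" if k: "k < n" for k
      proof (cases "k < j")
        case True
        hence "(int j - 1 - int k) mod int n = int j - 1 - int k" using ij by (intro mod_pos_pos_trivial) auto
        thus ?thesis using True by (auto simp: k1_def)
      next
        case False
        have "(int j - 1 - int k) mod int n = (int j - 1 - int k + int n) mod int n" by simp
        also have "\<dots> = int j - 1 - int k + int n" using False k by (intro mod_pos_pos_trivial) auto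
        finally show ?thesis using False k ij by (auto simp: k1_def)
      qed
    qed
    have "\<rho>Y (Y.cu (hy (P.W h k))) u = (if k = k1 then \<rho>Y (kgen K_Laurent B) u else u)" if k: "k < n" for k u
    proof -
      define q where "q = nat ((int j - int k) mod int n)"
      have q: "q < length y" "Y.prv q = nat ((int j - 1 - int k) mod int n)"
        using n0 ij S(3) Y.prv_wpow_left[OF S(2), of j k] by (simp_all add: q_def n_def nat_less_iff)
      have "hy (P.W h k) = Y.Lf q" using w(2)[of k] Y.wpow_left_band[OF S(2), of j k] ij L S(3) by (simp add: n_def q_def)
      hence hyq: "hy (P.W h k) = Y.oe (Y.R (Y.prv q))" using Y.left_right_band(1)[OF S(2) q(1)] by simp
      have "Y.prv q = 0 \<longleftrightarrow> k = k1" using k1(2)[OF k] q(2) by simp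
      hence "Y.cu (hy (P.W h k)) = (if k = k1 then kgen K_Laurent B else \<one>\<^bsub>kalg K_Laurent\<^esub> :: 'k alg_elt)"
        by (simp only: hyq Y.cu_right(2)[OF S(2) Y.left_right_band(3)[OF S(2) q(1)]] KY B)
      thus ?thesis using Y.act_one[unfolded KY] by simp
    qed
    thus ?thesis using k1(1) by blast
  qed
  then obtain k1 where k1: "k1 < n" "\<And>k u. k < n \<Longrightarrow> \<rho>Y (Y.cu (hy (P.W h k))) u = (if k = k1 then \<rho>Y (kgen K_Laurent B) u else u)" by blast
  show ?thesis using carry_single[OF k0(1) k1(1) a k1(2), of g] by (simp add: n_def B_def)
qed

text \<open>A block closes up after one turn if and only if it intertwines T, and then it
  intertwines the inverse of T as well.\<close>

lemma ev_LA_tilde: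
  assumes C: "longc C" and t: "lt C = LA_tilde" and v: "v \<in> C"
  shows "bij_betw (\<lambda>\<phi>. \<phi> v) (FL C) (LH C)"
proof -
  define h where "h = (v, X.rp (snd v))"
  note S = LA_tilde_setup[OF C t v, folded h_def] and T = LA_tilde_carry[OF C t v, folded h_def]
  have KX: "X.K = K_Laurent" and KY: "Y.K = K_Laurent" using S(1,2) by (simp_all add: akind_of_def)
  define d where "d = (\<lambda>g. if same_word Q x y then g else dual_gen K_Laurent g)"
  have fy: "kalg_hom K_Laurent K_Laurent (fY C)"
    "a \<in> gens K_Laurent \<Longrightarrow> fY C (kgen K_Laurent a) = (kgen K_Laurent (d a) :: 'k alg_elt)" for a
    unfolding f_y_def t identification_def d_def by (simp_all add: KX KY kalg_hom_id kalg_map_dual)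
  have fx: "fX C = (\<lambda>a. a)" by (simp add: f_x_def t)
  have dT: "d gT \<in> {gT, gTinv}" "d gTinv \<in> {gT, gTinv}" "d gT \<noteq> d gTinv" by (auto simp: d_def)
  have dd: "(if same_word Q x y then gTinv else gT) = d gTinv" by (simp add: d_def)
  have inv: "\<rho>X (kgen K_Laurent gT) (\<rho>X (kgen K_Laurent gTinv) u) = u" "\<rho>X (kgen K_Laurent gTinv) (\<rho>X (kgen K_Laurent gT) u) = u" for u
    using X.act_inverse[unfolded KX, OF kgen_carrier kgen_carrier] kgen_relations(4,5) by auto
  have invY: "\<rho>Y (kgen K_Laurent gT) (\<rho>Y (kgen K_Laurent gTinv) u) = u" "\<rho>Y (kgen K_Laurent gTinv) (\<rho>Y (kgen K_Laurent gT) u) = u" for u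
    using Y.act_inverse[unfolded KY, OF kgen_carrier kgen_carrier] kgen_relations(4,5) by auto
  have invd: "\<rho>Y (kgen K_Laurent (d gT)) (\<rho>Y (kgen K_Laurent (d gTinv)) u) = u" "\<rho>Y (kgen K_Laurent (d gTinv)) (\<rho>Y (kgen K_Laurent (d gT)) u) = u" for u
    using invY dT by auto
  have LH: "g \<in> LH C \<longleftrightarrow> klin g \<and> carry h g (length x) = g" for g
  proof -
    have "kalg_hom (KL C) X.K (fX C)"
      "kalg_hom (KL C) Y.K (fY C)"
      using fy(1) by (simp_all add: t KX KY fx kalg_hom_id)
    from LH_gens[OF C this] have "g \<in> LH C \<longleftrightarrow> klin g \<and>
      (\<forall>u. g (\<rho>X (kgen K_Laurent gT) u) = \<rho>Y (kgen K_Laurent (d gT)) (g u)) \<and>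
      (\<forall>u. g (\<rho>X (kgen K_Laurent gTinv) u) = \<rho>Y (kgen K_Laurent (d gTinv)) (g u))"
      by (simp add: t fx fy(2))
    moreover have "(\<forall>u. g (\<rho>X (kgen K_Laurent gT) u) = \<rho>Y (kgen K_Laurent (d gT)) (g u)) \<longleftrightarrow> carry h g (length x) = g"
      unfolding T dd fun_eq_iff comp_apply using invd by metis
    moreover have "(\<forall>u. g (\<rho>X (kgen K_Laurent gT) u) = \<rho>Y (kgen K_Laurent (d gT)) (g u)) \<Longrightarrow>
      (\<forall>u. g (\<rho>X (kgen K_Laurent gTinv) u) = \<rho>Y (kgen K_Laurent (d gTinv)) (g u))" using invd inv by metis
    ultimately show ?thesis by blast
  qed
  have hC: "fst h \<in> C" "fst h = v" using v by (simp_all add: h_def)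
  have "(\<lambda>\<phi>. \<phi> v) ` FL C = LH C"
  proof (intro equalityI subsetI)
    fix q assume "q \<in> (\<lambda>\<phi>. \<phi> v) ` FL C"
    then obtain \<phi> where f: "\<phi> \<in> FL C" "q = \<phi> v" by blast
    have "P.W h (length x) = h" using S(4) by (simp add: P.cycle_def)
    hence "carry h q (length x) = q" using FL_carry[OF f(1) S(5), of "length x"] f(2) hC(2) by simp
    thus "q \<in> LH C" using LH FL_linear[OF f(1)] f(2) by simp
  next
    fix q assume "q \<in> LH C"
    hence "klin q" "carry h q (length x) = q" using LH by auto
    from cycle_extend[OF C S(4) hC(1) this] show "q \<in> (\<lambda>\<phi>. \<phi> v) ` FL C" unfolding hC(2) by blast
  qed
  thus ?thesis using FL_inj[OF C v] by (simp add: bij_betw_def)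
qed

section \<open>Lines with a loop at each end\<close>

lemma LD'_tilde_walk:
  assumes C: "longc C" and t: "lt C = LD'_tilde" and l: "P.line h m" "fst h \<in> C"
  shows "\<And>k. on (P.W h k)" "opp h \<in> P.loops C" "P.W h m \<in> P.loops C"
    "\<And>k. k < m \<Longrightarrow> \<not> X.is_end (hx (P.W h k)) \<and> \<not> Y.is_end (hy (P.W h k))"
    "\<And>k. X.hl (hx (P.W h k)) = Y.hl (hy (P.W h k))" "X.hl (hx (opp h)) = Y.hl (hy (opp h))"
    "m = length x - 2 \<and> (hx (opp h) = X.Lf 1 \<and> (\<forall>k\<le>m. hx (P.W h k) = X.R (1 + k)) \<or>
       hx (opp h) = X.R (length x - 1) \<and> (\<forall>k\<le>m. hx (P.W h k) = X.Lf (length x - 1 - k)))"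
    "m = length y - 2 \<and> (hy (opp h) = Y.Lf 1 \<and> (\<forall>k\<le>m. hy (P.W h k) = Y.R (1 + k)) \<or>
       hy (opp h) = Y.R (length y - 1) \<and> (\<forall>k\<le>m. hy (P.W h k) = Y.Lf (length y - 1 - k)))"
proof -
  have n: "P.allon C" using t lt_eq[OF C] by (auto split: if_splits)
  have CC: "C = P.compo (fst h)" by (rule longc_comp[OF C l(2)])
  have WC: "fst (P.W h k) \<in> C" for k by (rule P.closed_W[OF longc_closed[OF C] l(2)])
  have oC: "fst (opp h) \<in> C" using l(2) by simp
  have on: "on (P.W h k)" for k using n WC unfolding P.allon_def by blast
  thus "on (P.W h k)" for k .
  have oh: "on (opp h)" using n oC unfolding P.allon_def by blast
  show lps: "opp h \<in> P.loops C" "P.W h m \<in> P.loops C"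
    unfolding CC using P.line_loops(1)[OF l(1)] oh on by blast+
  note e0 = loop_ends[OF lps(1)] and e1 = loop_ends[OF lps(2)]
  note w = walk_half_edges[OF on]
  have r: "rx (P.W h k) = ry (P.W h k)" for k by (rule allon_plus(2)[OF n longc_closed[OF C] WC])
  show ne: "\<not> X.is_end (hx (P.W h k)) \<and> \<not> Y.is_end (hy (P.W h k))" if "k < m" for k
  proof -
    have "oe (P.W h k) \<noteq> P.W h k" using P.line_nonloop[OF l(1) that] by blast
    hence "rx (P.W h k) \<noteq> 1" "ry (P.W h k) \<noteq> 1" using loop_iff[OF on] r[of k] by auto
    thus ?thesis using X.rank_hl(2) Y.rank_hl(2) on_live(1,2)[OF on[of k]] by metis
  qed
  show "X.hl (hx (P.W h k)) = Y.hl (hy (P.W h k))" for k using hl_eqI r WC longc_VP[OF C] by blast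
  show "X.hl (hx (opp h)) = Y.hl (hy (opp h))"
    using hl_eqI[of "opp h"] allon_plus(2)[OF n longc_closed[OF C] oC] oC longc_VP[OF C] by blast
  have ox: "opp (hx (opp h)) = hx h" and oy: "opp (hy (opp h)) = hy h" unfolding hx_opp hy_opp by simp_all
  show "m = length x - 2 \<and> (hx (opp h) = X.Lf 1 \<and> (\<forall>k\<le>m. hx (P.W h k) = X.R (1 + k)) \<or>
    hx (opp h) = X.R (length x - 1) \<and> (\<forall>k\<le>m. hx (P.W h k) = X.Lf (length x - 1 - k)))"
    unfolding w by (rule X.walk_between_ends[OF on_live(1)[OF oh] e0(3), unfolded ox]) (use ne e1(3) w in auto)
  show "m = length y - 2 \<and> (hy (opp h) = Y.Lf 1 \<and> (\<forall>k\<le>m. hy (P.W h k) = Y.R (1 + k)) \<or>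
    hy (opp h) = Y.R (length y - 1) \<and> (\<forall>k\<le>m. hy (P.W h k) = Y.Lf (length y - 1 - k)))"
    unfolding w by (rule Y.walk_between_ends[OF on_live(2)[OF oh] e0(4), unfolded oy]) (use ne e1(4) w in auto)
qed

text \<open>The line is oriented to begin at vertex 1 of \<open>x\<close>, with the loop of S. The
  direction in which \<open>y\<close> is passed then tells whether \<open>y\<close> is
  \<open>x\<close> or its inverse, and so which of its generators belongs to which end.\<close>

lemma LD'_tilde_setup:
  assumes C: "longc C" and t: "lt C = LD'_tilde"
  shows "\<exists>h m. P.line h m \<and> fst h \<in> C \<and> (\<forall>g. carry h g m = g) \<and> on (opp h) \<and> on (P.W h m) \<and>
    X.K = K_ST \<and> Y.K = K_ST \<and> \<not> X.band \<and> \<not> Y.band \<and>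
    X.cu (hx (opp h)) = (kgen K_ST gS :: 'k alg_elt) \<and> X.cu (hx (P.W h m)) = (kgen K_ST gT :: 'k alg_elt) \<and>
    Y.cu (hy (opp h)) = (kgen K_ST (if same_word Q x y then gS else gT) :: 'k alg_elt) \<and>
    Y.cu (hy (P.W h m)) = (kgen K_ST (if same_word Q x y then gT else gS) :: 'k alg_elt)"
proof -
  have "P.loops C \<noteq> {}" using t lt_eq[OF C] by (auto split: if_splits)
  then obtain h' m where l': "P.line h' m" "fst h' \<in> C" using line_ex[OF C] by blast
  define N where "N = length x - 1"
  have N: "length x = Suc N" "N \<ge> 1" using X.len_ge2 by (auto simp: N_def)
  have "\<exists>h. P.line h m \<and> fst h \<in> C \<and> hx (opp h) = X.Lf 1"
  proof -
    from LD'_tilde_walk(7)[OF C t l'] have "hx (opp h') = X.Lf 1 \<or> hx (P.W h' m) = X.Lf 1" using N by auto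
    moreover have "fst (opp (P.W h' m)) \<in> C" using P.closed_W[OF longc_closed[OF C] l'(2)] by simp
    moreover have "hx (opp (opp (P.W h' m))) = hx (P.W h' m)" by (simp only: polarity_swap)
    ultimately show ?thesis using l' P.line_reverse(1)[OF l'(1)] by metis
  qed
  then obtain h where l: "P.line h m" "fst h \<in> C" and h: "hx (opp h) = X.Lf 1" by blast
  note S = LD'_tilde_walk[OF C t l]
  note e0 = loop_ends[OF S(2)] and e1 = loop_ends[OF S(3)] and st = loop_strings[OF S(2)]
  have e: "X.Lf 1 \<noteq> X.R N" "Y.Lf 1 \<noteq> Y.R N" by (auto simp: prod_eq_iff)
  have len: "length y = Suc N" "m = N - 1" "m < N" "1 + m = N" "N - m = 1" using S(7,8) N Y.len_ge2 by auto
  have dX: "hx (P.W h k) = X.R (1 + k)" if "k < N" for k using S(7) N len that h e by (auto simp: N_def[symmetric])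
  have dY: "hy (opp h) = Y.Lf 1 \<and> (\<forall>k<N. hy (P.W h k) = Y.R (1 + k)) \<or> hy (opp h) = Y.R N \<and> (\<forall>k<N. hy (P.W h k) = Y.Lf (N - k))"
    using S(8) N len by auto
  have hl: "x ! Suc k = Y.hl (hy (P.W h k))" "linv (x ! 0) = Y.hl (hy (opp h))" if "k < N" for k
    using S(5)[of k] S(6) dX[OF that] h st by (simp_all add: X.hl_left X.hl_right X.prv_def)
  have sw: "same_word Q x y \<longleftrightarrow> hy (opp h) = Y.Lf 1"
    using dY
  proof (elim disjE conjE)
    assume y: "hy (opp h) = Y.Lf 1" "\<forall>k<N. hy (P.W h k) = Y.R (1 + k)"
    have "x ! q = y ! q" if "q < length x" for q
      using hl[of "q - 1"] that N y st by (cases q) (simp_all add: Y.hl_left Y.hl_right Y.prv_def)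
    hence "y = x" using N len by (intro nth_equalityI) auto
    thus ?thesis using y by (simp add: same_word_def)
  next
    assume y: "hy (opp h) = Y.R N" "\<forall>k<N. hy (P.W h k) = Y.Lf (N - k)"
    have "x ! q = linv (y ! (length x - 1 - q))" if "q < length x" for q
      using hl[of "q - 1"] that N y st by (cases q) (simp_all add: Y.hl_left Y.hl_right Y.prv_def, metis linv_linv)
    hence "y \<noteq> x" using X.not_self_inverse_string[OF st(1)] by blast
    thus ?thesis using y e st by (simp add: same_word_def)
  qed
  have endX: "hx (P.W h m) = X.R N" and endY: "hy (P.W h m) = (if hy (opp h) = Y.Lf 1 then Y.R N else Y.Lf 1)"
    using dX[OF len(3)] dY len(3-5) by auto
  have PX: "wtype_of Q x = PP"
    using X.wtype_PP[OF st(1)] on_live(3)[OF e0(1)] on_live(3)[OF e1(1)] e0(3) e1(3) endX h N by (simp add: X.live_def)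
  have PY: "wtype_of Q y = PP"
    using Y.wtype_PP[OF st(2)] on_live(4)[OF e0(1)] on_live(4)[OF e1(1)] e0(4) e1(4) endY dY len
    by (auto simp: Y.live_def split: if_splits)
  have cuX: "X.cu (X.Lf 1) = (kgen K_ST gS :: 'k alg_elt)" "X.cu (X.R N) = (kgen K_ST gT :: 'k alg_elt)"
    using X.cu_end[of "X.Lf 1"] X.cu_end[of "X.R N"] X.string_end_left[OF st(1)] X.string_end_right[OF st(1)] PX N
    by (simp_all add: X.ar_def akind_of_def)
  have cuY: "Y.cu (Y.Lf 1) = (kgen K_ST gS :: 'k alg_elt)" "Y.cu (Y.R N) = (kgen K_ST gT :: 'k alg_elt)"
    using Y.cu_end[of "Y.Lf 1"] Y.cu_end[of "Y.R N"] Y.string_end_left[OF st(2)] Y.string_end_right[OF st(2)] PY len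
    by (simp_all add: Y.ar_def akind_of_def)
  have "carry h g m = g" for g
  proof (rule carry_constant)
    fix k u assume k: "k < m"
    have "\<not> X.is_end (X.oe (hx (P.W h k)))" using S(4)[OF k] X.oe_not_end(6)[OF on_live(1)[OF S(1)]] by blast
    thus "\<rho>X (X.cu (X.oe (hx (P.W h k)))) u = u" by (simp add: X.cu_ordinary st)
  next
    fix k u assume k: "k < m"
    show "\<rho>Y (Y.cu (hy (P.W h k))) u = u" using S(4)[OF k] by (simp add: Y.cu_ordinary st)
  qed
  moreover have "Y.cu (hy (opp h)) = (kgen K_ST (if same_word Q x y then gS else gT) :: 'k alg_elt)"
    "Y.cu (hy (P.W h m)) = (kgen K_ST (if same_word Q x y then gT else gS) :: 'k alg_elt)"
    using dY cuY sw unfolding endY by auto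
  moreover have "X.cu (hx (opp h)) = (kgen K_ST gS :: 'k alg_elt)" "X.cu (hx (P.W h m)) = (kgen K_ST gT :: 'k alg_elt)"
    unfolding h endX cuX by (rule refl)+
  ultimately show ?thesis using l e0(1) e1(1) st PX PY by (intro exI[of _ h] exI[of _ m]) (simp add: akind_of_def)
qed

text \<open>All ranks agree on such a line, so its arrows lie outside \<open>HQ_o\<close> and all
  blocks are equal; the loops at the two ends demand compatibility with S and with T.\<close>

lemma ev_LD'_tilde:
  assumes C: "longc C" and t: "lt C = LD'_tilde" and v: "v \<in> C"
  shows "bij_betw (\<lambda>\<phi>. \<phi> v) (FL C) (LH C)"
proof -
  obtain h m where l: "P.line h m" "fst h \<in> C" and cc: "\<And>g. carry h g m = g" and on: "on (opp h)" "on (P.W h m)"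
    and K: "X.K = K_ST" "Y.K = K_ST" and nb: "\<not> X.band" "\<not> Y.band"
    and cX: "X.cu (hx (opp h)) = (kgen K_ST gS :: 'k alg_elt)" "X.cu (hx (P.W h m)) = (kgen K_ST gT :: 'k alg_elt)"
    and cY: "Y.cu (hy (opp h)) = (kgen K_ST (if same_word Q x y then gS else gT) :: 'k alg_elt)"
      "Y.cu (hy (P.W h m)) = (kgen K_ST (if same_word Q x y then gT else gS) :: 'k alg_elt)"
    using LD'_tilde_setup[OF C t] by blast
  have n: "P.allon C" using t lt_eq[OF C] by (auto split: if_splits)
  have const: "\<phi> w = \<phi> (fst h)" if f: "\<phi> \<in> FL C" and w: "w \<in> C" for \<phi> w
  proof -
    have "P.closed (C \<inter> {w. \<phi> w = \<phi> (fst h)})"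
      unfolding P.closed_def
    proof (intro allI impI)
      fix q assume q: "on q" "fst q \<in> C \<inter> {w. \<phi> w = \<phi> (fst h)}"
      hence "rx q = ry q" using allon_plus(2)[OF n longc_closed[OF C], of q] by blast
      hence "\<phi> (fst (oe q)) = \<phi> (fst q)" using FL_constant[OF f nb q(1)] by simp
      thus "fst (oe q) \<in> C \<inter> {w. \<phi> w = \<phi> (fst h)}" using q P.closedD[OF longc_closed[OF C] q(1)] by simp
    qed
    hence "P.compo (fst h) \<subseteq> C \<inter> {w. \<phi> w = \<phi> (fst h)}" using l(2) by (intro P.comp_least) auto
    thus ?thesis using w longc_comp[OF C l(2)] by blast
  qed
  define e where "e = (\<lambda>g. if same_word Q x y then g else dual_gen K_ST g)"
  have fy: "kalg_hom K_ST K_ST (fY C)"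
    "a \<in> gens K_ST \<Longrightarrow> fY C (kgen K_ST a) = (kgen K_ST (e a) :: 'k alg_elt)" for a
    unfolding f_y_def t identification_def e_def by (simp_all add: K kalg_hom_id kalg_map_dual)
  have fx: "fX C = (\<lambda>a. a)" by (simp add: f_x_def t)
  have LH: "g \<in> LH C \<longleftrightarrow> klin g \<and> (\<forall>a\<in>{gS, gT}. \<forall>u. g (\<rho>X (kgen K_ST a) u) = \<rho>Y (kgen K_ST (e a)) (g u))" for g
  proof -
    have "kalg_hom (KL C) X.K (fX C)"
      "kalg_hom (KL C) Y.K (fY C)"
      using fy(1) by (simp_all add: t K fx kalg_hom_id)
    from LH_gens[OF C this] show ?thesis by (simp add: t fx fy(2))
  qed
  have ce: "(if same_word Q x y then gS else gT) = e gS" "(if same_word Q x y then gT else gS) = e gT" by (simp_all add: e_def)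
  have LH': "g \<in> LH C \<longleftrightarrow> klin g \<and> (\<forall>u. g (\<rho>X (X.cu (hx (opp h))) u) = \<rho>Y (Y.cu (hy (opp h))) (g u)) \<and>
    (\<forall>u. g (\<rho>X (X.cu (hx (P.W h m))) u) = \<rho>Y (Y.cu (hy (P.W h m))) (g u))" for g
    unfolding LH cX cY ce by simp
  have lo: "oe (opp h) = opp h" "oe (P.W h m) = P.W h m" using l(1) on by (auto simp: P.line_def P.reflecting_iff)
  have "(\<lambda>\<phi>. \<phi> v) ` FL C = LH C"
  proof (intro equalityI subsetI)
    fix q assume "q \<in> (\<lambda>\<phi>. \<phi> v) ` FL C"
    then obtain \<phi> where f: "\<phi> \<in> FL C" "q = \<phi> v" by blast
    have "q = \<phi> (fst (opp h))" "q = \<phi> (fst (P.W h m))"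
      using const[OF f(1)] f(2) v P.closed_W[OF longc_closed[OF C] l(2), of m] by simp_all
    thus "q \<in> LH C" using LH' FL_linear[OF f(1)] f(2) FL_fits[OF f(1) on(1)] FL_fits[OF f(1) on(2)] lo
      by (simp add: fits_def)
  next
    fix q assume "q \<in> LH C"
    hence q: "klin q" "\<forall>u. q (\<rho>X (X.cu (hx (opp h))) u) = \<rho>Y (Y.cu (hy (opp h))) (q u)"
      "\<forall>u. q (\<rho>X (X.cu (hx (P.W h m))) u) = \<rho>Y (Y.cu (hy (P.W h m))) (q u)" using LH' by auto
    have "\<exists>\<phi>\<in>FL C. \<phi> (fst h) = q" by (rule line_extend[OF C l q(1)]) (use q(2,3) cc in auto)
    then obtain \<phi> where f: "\<phi> \<in> FL C" "\<phi> (fst h) = q" by blast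
    hence "\<phi> v = q" using const[OF f(1) v] by simp
    thus "q \<in> (\<lambda>\<phi>. \<phi> v) ` FL C" using f(1) by blast
  qed
  thus ?thesis using FL_inj[OF C v] by (simp add: bij_betw_def)
qed

end

section \<open>The decomposition\<close>

lemma linear_iso_image:
  assumes "vector_space s1" "vector_space s2" "module.subspace s1 V" "linear_on s1 s2 V h" "bij_betw h V W"
  shows "linear_iso s1 s2 h V W"
proof -
  have W: "W = h ` V" using assms(5) by (simp add: bij_betw_def)
  have V: "0 \<in> V" "\<And>u v. u \<in> V \<Longrightarrow> v \<in> V \<Longrightarrow> u + v \<in> V" "\<And>c u. u \<in> V \<Longrightarrow> s1 c u \<in> V"
    using assms(3) module_subspace_iff[OF assms(1)] by auto
  have h: "h (u + v) = h u + h v" "h (s1 c u) = s2 c (h u)" if "u \<in> V" "v \<in> V" for u v c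
    using assms(4) that by (auto simp: linear_on_def)
  have "h 0 = h 0 + h 0" using h(1)[OF V(1) V(1)] by simp
  hence "h 0 = 0" by simp
  hence "module.subspace s2 W"
    unfolding module_subspace_iff[OF assms(2)] W using V h by (auto simp: image_iff) metis+
  thus ?thesis using assms by (simp add: linear_iso_def)
qed

lemma fscale_apply: "fscale s c h z = s c (h z)"
  by (simp add: fscale_def)

lemma direct_sum_outside: "h \<in> direct_sum I W \<Longrightarrow> i \<notin> I \<Longrightarrow> h i = 0"
  and direct_sum_in: "h \<in> direct_sum I W \<Longrightarrow> i \<in> I \<Longrightarrow> h i \<in> W i"
  unfolding direct_sum_def by blast+

context module_pair
begin

abbreviation hscale :: "'k \<Rightarrow> ('v, 'x, 'y) hom \<Rightarrow> ('v, 'x, 'y) hom" where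
  "hscale \<equiv> fscale (fscale (fscale sY))"

abbreviation Hom_at :: "hline \<Rightarrow> ('v, 'x, 'y) hom set" where
  "Hom_at \<equiv> Mo_Hom_at Q x y sX sY \<rho>X \<rho>Y"
lemma block_add: "block Q x (f + g) v = block Q x f v + block Q x g v"
  and block_scale: "block Q x (hscale c f) v = fscale sY c (block Q x f v)"
  and block_zero: "block Q x 0 v = 0"
  by (auto simp: block_def fscale_def fun_eq_iff split: prod.split)

lemma block_sum:
  fixes f :: "'i \<Rightarrow> ('v, 'x, 'y) hom"
  shows "block Q x (\<Sum>i\<in>A. f i) v = (\<Sum>i\<in>A. block Q x (f i) v)"
  by (induction A rule: infinite_finite_induct) (simp_all only: sum.infinite sum.empty sum.insert block_add block_zero not_False_eq_True)

lemma vector_spaces: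
  "vector_space (fscale sY)" "vector_space (fscale (fscale sY))" "vector_space hscale"
  using Y.vector_space_axioms by (auto intro!: vector_space_fscale)

lemma subspace_Hom: "module.subspace hscale Hom"
proof -
  have lin: "linear_on (fscale sY) (fscale sY) (space Y.M (fst (src Q \<alpha>))) (act Y.M \<alpha>)" and sp: "module.subspace (fscale sY) (space Y.M a)"
    if "\<alpha> \<in> arrows Q" "a \<in> verts Q" for \<alpha> a
    using Y.kQ_rep_M that by (simp_all add: kQ_rep_def)
  have act: "w \<in> space Y.M (fst (src Q \<alpha>)) \<Longrightarrow> act Y.M \<alpha> (u + w) = act Y.M \<alpha> u + act Y.M \<alpha> w"
    "act Y.M \<alpha> (fscale sY c u) = fscale sY c (act Y.M \<alpha> u)"
    if "\<alpha> \<in> arrows Q" "u \<in> space Y.M (fst (src Q \<alpha>))" for \<alpha> u w c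
    using lin[OF that(1) X.arrow_verts(1)[OF that(1)]] that by (auto simp: linear_on_def)
  have s: "(0 :: nat \<Rightarrow> 'y) \<in> space Y.M a" "u \<in> space Y.M a \<Longrightarrow> w \<in> space Y.M a \<Longrightarrow> u + w \<in> space Y.M a"
    "u \<in> space Y.M a \<Longrightarrow> fscale sY c u \<in> space Y.M a" for a u w c
    by (auto simp: Y.space_M fscale_def Y.scale_zero_right)
  interpret V: vector_space "fscale sY" by (rule vector_spaces)
  show ?thesis
    unfolding module_subspace_iff[OF vector_spaces(3)]
  proof (intro conjI ballI allI)
    have "act Y.M \<alpha> 0 = 0" if "\<alpha> \<in> arrows Q" for \<alpha> using act(1)[OF that s(1) s(1)] by simp
    thus "0 \<in> Hom" by (auto simp: Mo_Hom_def kQ_Hom_def linear_on_def s V.scale_zero_right)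
  next
    fix f g assume fg: "f \<in> Hom" "g \<in> Hom"
    note f = HomD[OF fg(1)] and g = HomD[OF fg(2)]
    show "f + g \<in> Hom"
      unfolding Mo_Hom_def kQ_Hom_def linear_on_def
      using s(2) f g act(1) X.arrow_verts by (auto simp: V.scale_right_distrib)
  next
    fix c f assume fh: "f \<in> Hom"
    note f = HomD[OF fh]
    show "hscale c f \<in> Hom"
      unfolding Mo_Hom_def kQ_Hom_def linear_on_def fscale_def[of "fscale (fscale sY)"] fscale_def[of "fscale sY"]
      using s(3) f act(2) X.arrow_verts by (auto simp: V.scale_right_distrib V.scale_left_commute V.scale_zero_right)
  qed
qed

abbreviation HL :: "(nat \<times> nat) set \<Rightarrow> (('v, 'x, 'y) hom) set" where
  "HL C \<equiv> Hom_at (C, P.edges_of C)"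

lemma subspace_HL: "module.subspace hscale (HL C)"
  using subspace_Hom unfolding module_subspace_iff[OF vector_spaces(3)]
  by (auto simp: Mo_Hom_at_def block_add block_scale block_zero) (simp add: fscale_def fun_eq_iff Y.scale_zero_right)

lemma blk_VP: "v \<in> VP \<Longrightarrow> blk f v = block Q x f v"
  by (simp add: blk_def)

lemma HL_iff: "longc C \<Longrightarrow> f \<in> HL C \<longleftrightarrow> f \<in> Hom \<and> blk f \<in> FL C"
proof -
  assume C: "longc C"
  have "(\<forall>v\<in>VP - C. block Q x f v = 0) \<longleftrightarrow> (\<forall>v. v \<notin> C \<longrightarrow> blk f v = 0)"
    using longc_VP[OF C] unfolding blk_def by auto
  thus ?thesis using blk_flat by (auto simp: Mo_Hom_at_def FL_def)
qed

lemma blk_bij: "longc C \<Longrightarrow> bij_betw blk (HL C) (FL C)"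
proof -
  assume C: "longc C"
  have "\<phi> \<in> blk ` HL C" if f: "\<phi> \<in> FL C" for \<phi>
  proof (rule image_eqI)
    have fl: "flat \<phi>" using f by (simp add: FL_def)
    show "\<phi> = blk (mk \<phi>)" using blk_mk[OF fl] by simp
    show "mk \<phi> \<in> HL C" using HL_iff[OF C] mk_Hom[OF fl] blk_mk[OF fl] f by simp
  qed
  thus ?thesis unfolding bij_betw_def inj_on_def using HL_iff[OF C] blk_inj by blast
qed

lemma ev_bij:
  assumes C: "longc C" and v: "v \<in> C" and s: "\<not> separated Q x y (C, P.edges_of C) v"
  shows "bij_betw (\<lambda>\<phi>. \<phi> v) (FL C) (LH C)"
  using ev_LA[OF C _ v] ev_LD'(1)[OF C _ v s] ev_LA_tilde[OF C _ v] ev_LD'_tilde[OF C _ v] by (cases "lt C") auto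

lemma block_bij:
  assumes C: "longc C" and v: "v \<in> C" and s: "\<not> separated Q x y (C, P.edges_of C) v"
  shows "bij_betw (\<lambda>f. block Q x f v) (HL C) (LH C)"
proof -
  have "v \<in> VP" using longc_VP[OF C] v by blast
  hence e: "(\<lambda>\<phi>. \<phi> v) \<circ> blk = (\<lambda>f. block Q x f v)" by (simp add: fun_eq_iff blk_VP)
  show ?thesis using bij_betw_trans[OF blk_bij[OF C] ev_bij[OF C v s]] unfolding e .
qed

lemma block_iso:
  assumes C: "longc C" and v: "v \<in> C" and s: "\<not> separated Q x y (C, P.edges_of C) v"
  shows "linear_iso hscale (fscale sY) (\<lambda>f. block Q x f v) (HL C) (LH C)"
  by (rule linear_iso_image[OF vector_spaces(3,1) subspace_HL _ block_bij[OF C v s]])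
    (simp add: linear_on_def block_add block_scale)

lemma block_iso_separated:
  assumes C: "longc C" and v: "v \<in> C" and s: "separated Q x y (C, P.edges_of C) v"
  shows "\<exists>a\<in>Units (kalg (akind_of Q x)). \<exists>b\<in>Units (kalg (akind_of Q y)).
    linear_iso hscale (fscale sY) (\<lambda>f. \<rho>Y b \<circ> block Q x f v \<circ> \<rho>X a) (HL C) (LH C)"
proof -
  have t: "lt C = LD'" using s by (simp add: separated_def)
  obtain a b where ab: "a \<in> Units (kalg (akind_of Q x))" "b \<in> Units (kalg (akind_of Q y))"
    "bij_betw (\<lambda>\<phi>. \<rho>Y b \<circ> \<phi> v \<circ> \<rho>X a) (FL C) (LH C)" using ev_LD'(2)[OF C t v] by blast
  note b = Y.A.Units_closed[OF ab(2)]
  have "v \<in> VP" using longc_VP[OF C] v by blast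
  hence e: "(\<lambda>\<phi>. \<rho>Y b \<circ> \<phi> v \<circ> \<rho>X a) \<circ> blk = (\<lambda>f. \<rho>Y b \<circ> block Q x f v \<circ> \<rho>X a)" by (simp add: fun_eq_iff blk_VP)
  have "bij_betw (\<lambda>f. \<rho>Y b \<circ> block Q x f v \<circ> \<rho>X a) (HL C) (LH C)" using bij_betw_trans[OF blk_bij[OF C] ab(3)] unfolding e .
  hence "linear_iso hscale (fscale sY) (\<lambda>f. \<rho>Y b \<circ> block Q x f v \<circ> \<rho>X a) (HL C) (LH C)"
    by (rule linear_iso_image[OF vector_spaces(3,1) subspace_HL, rotated])
      (auto simp: linear_on_def block_add block_scale fun_eq_iff Y.act_plus[OF b] Y.act_scale[OF b] fscale_apply)
  thus ?thesis using ab(1,2) by blast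
qed

lemma finite_lines: "finite (long_hlines Q x y)" "finite (real_hlines Q x y)"
proof -
  have f: "finite {C. longc C}" "finite {C. realc C}"
    using finite_VP longc_VP realc_VP by (auto intro!: finite_subset[of _ "Pow VP"])
  have "long_hlines Q x y = (\<lambda>C. (C, P.edges_of C)) ` {C. longc C}" "real_hlines Q x y = (\<lambda>C. (C, R.edges_of C)) ` {C. realc C}"
    by (auto simp: long_hlines_eq real_hlines_eq)
  thus "finite (long_hlines Q x y)" "finite (real_hlines Q x y)" using f by simp_all
qed

lemma flat_restrict:
  assumes f: "flat \<phi>" and C: "longc C"
  shows "(\<lambda>v. if v \<in> C then \<phi> v else 0) \<in> FL C"
proof (rule FL_I[OF C])
  fix h assume h: "on h" "fst h \<in> C"
  hence "fst (oe h) \<in> C" using P.closedD[OF longc_closed[OF C]] by blast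
  thus "fits (\<lambda>v. if v \<in> C then \<phi> v else 0) h" using h flat_on[OF f h(1)] by (simp add: fits_def)
qed (use flat_linear'[OF f] in auto)

text \<open>The component of such a vertex contains a red one, and a vanishing block forces its
  neighbours to vanish, as they are equal to it up to units.\<close>

lemma flat_outside_lines:
  assumes f: "flat \<phi>" and v: "\<And>C. longc C \<Longrightarrow> v \<notin> C"
  shows "\<phi> v = 0"
proof (cases "v \<in> VP")
  case True
  hence "\<not> longc (P.compo v)" using v P.comp_refl by blast
  then obtain h where h: "fst h \<in> P.compo v" "redh h" using True unfolding longc_def by blast
  have "P.closed {w. \<phi> w = 0}"
    unfolding P.closed_def
  proof (intro allI impI)
    fix q assume q: "on q" "fst q \<in> {w. \<phi> w = 0}"
    have "fits \<phi> q" using flat_on[OF f q(1)] by (simp add: fits_def)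
    hence "\<phi> (fst (oe q)) = \<rho>Y (Y.cu (hy q)) \<circ> \<phi> (fst q) \<circ> \<rho>X (X.cu (X.oe (hx q)))" using fits_transport[OF q(1)] by blast
    thus "fst (oe q) \<in> {w. \<phi> w = 0}"
      using q(2) Y.act_zero[OF Y.cu_carrier[OF on_live(2,4)[OF q(1)]]] by (simp add: fun_eq_iff)
  qed
  hence "P.compo (fst h) \<subseteq> {w. \<phi> w = 0}" using flat_red[OF f h(2)] by (intro P.comp_least) auto
  thus ?thesis using P.comp_sym[OF h(1)] by blast
qed (use flat_outside[OF f] in blast)

lemma longc_disjoint: "longc C \<Longrightarrow> longc C' \<Longrightarrow> v \<in> C \<Longrightarrow> v \<in> C' \<Longrightarrow> C = C'"
  using longc_comp by blast

lemma Hom_sum: "(\<And>i. i \<in> A \<Longrightarrow> f i \<in> Hom) \<Longrightarrow> (\<Sum>i\<in>A. f i) \<in> Hom"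
proof -
  interpret H: vector_space hscale by (rule vector_spaces)
  show "(\<And>i. i \<in> A \<Longrightarrow> f i \<in> Hom) \<Longrightarrow> (\<Sum>i\<in>A. f i) \<in> Hom" using H.subspace_sum[OF subspace_Hom] by blast
qed

lemma block_sum_lines:
  assumes I: "finite I" "\<And>i. i \<in> I \<Longrightarrow> longc (c i)" "inj_on c I" and f: "\<And>i. i \<in> I \<Longrightarrow> f i \<in> HL (c i)"
    and i: "i \<in> I" "v \<in> c i"
  shows "block Q x (\<Sum>i\<in>I. f i) v = block Q x (f i) v"
proof -
  have "block Q x (f j) v = 0" if "j \<in> I - {i}" for j
  proof -
    have "v \<notin> c j" using longc_disjoint[OF I(2)[OF i(1)] I(2) i(2), of j] inj_onD[OF I(3), of i j] i(1) that by blast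
    moreover have "v \<in> VP" using longc_VP[OF I(2)[OF i(1)]] i(2) by blast
    ultimately show ?thesis using f[of j] that by (auto simp: Mo_Hom_at_def)
  qed
  hence "(\<Sum>j\<in>I - {i}. block Q x (f j) v) = 0" by (intro sum.neutral) blast
  thus ?thesis unfolding block_sum using sum.remove[OF I(1) i(1), of "\<lambda>j. block Q x (f j) v"] by simp
qed

lemma Hom_eqI:
  assumes "f \<in> Hom" "g \<in> Hom" "\<And>C v. longc C \<Longrightarrow> v \<in> C \<Longrightarrow> block Q x f v = block Q x g v"
  shows "f = g"
proof (rule blk_inj[OF assms(1,2)])
  show "blk f = blk g"
  proof
    fix v show "blk f v = blk g v"
    proof (cases "\<exists>C. longc C \<and> v \<in> C")
      case True
      thus ?thesis using assms(3) longc_VP blk_VP by (metis subsetD)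
    next
      case False
      thus ?thesis using flat_outside_lines[OF blk_flat[OF assms(1)]] flat_outside_lines[OF blk_flat[OF assms(2)]] by metis
    qed
  qed
qed

lemma Hom_direct_sum:
  "internal_direct_sum hscale Hom (long_hlines Q x y) Hom_at"
  unfolding internal_direct_sum_def
proof (intro conjI ballI subspace_Hom)
  fix L assume "L \<in> long_hlines Q x y"
  then obtain C where L: "L = (C, P.edges_of C)" unfolding long_hlines_eq by blast
  show "module.subspace hscale (Hom_at L)" unfolding L by (rule subspace_HL)
  show "Hom_at L \<subseteq> Hom" by (auto simp: Mo_Hom_at_def)
next
  let ?I = "long_hlines Q x y" and ?W = "Hom_at"
  have I: "finite ?I" "\<And>L. L \<in> ?I \<Longrightarrow> longc (fst L)" "inj_on fst ?I" "\<And>L. L \<in> ?I \<Longrightarrow> L = (fst L, P.edges_of (fst L))"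
    using finite_lines(1) by (auto simp: long_hlines_eq inj_on_def)
  have sum: "(\<Sum>L | h L \<noteq> 0. h L) = (\<Sum>L\<in>?I. h L)" if "h \<in> direct_sum ?I ?W" for h
    using that I(1) by (intro sum.mono_neutral_left) (auto simp: direct_sum_def)
  have at: "block Q x (\<Sum>L\<in>?I. h L) v = block Q x (h L) v" if h: "\<And>L. L \<in> ?I \<Longrightarrow> h L \<in> ?W L" and L: "L \<in> ?I" "v \<in> fst L" for h L v
    using block_sum_lines[OF I(1), of fst h L v] I h L by metis
  have inH: "(\<Sum>L\<in>?I. h L) \<in> Hom" if h: "\<And>L. L \<in> ?I \<Longrightarrow> h L \<in> ?W L" for h
    using h by (intro Hom_sum) (auto simp: Mo_Hom_at_def)
  show "bij_betw (\<lambda>h. \<Sum>L | h L \<noteq> 0. h L) (direct_sum ?I ?W) Hom"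
    unfolding bij_betw_def
  proof (intro conjI inj_onI equalityI subsetI)
    fix h h' assume h: "h \<in> direct_sum ?I ?W" "h' \<in> direct_sum ?I ?W" and eq: "(\<Sum>L | h L \<noteq> 0. h L) = (\<Sum>L | h' L \<noteq> 0. h' L)"
    have W: "h L \<in> ?W L" "h' L \<in> ?W L" if "L \<in> ?I" for L using h that by (auto simp: direct_sum_def)
    show "h = h'"
    proof
      fix L show "h L = h' L"
      proof (cases "L \<in> ?I")
        case True
        have H: "h L \<in> Hom" "h' L \<in> Hom" using W[OF True] by (auto simp: Mo_Hom_at_def)
        show ?thesis
        proof (rule Hom_eqI[OF H])
          fix C v assume C: "longc C" "v \<in> C"
          show "block Q x (h L) v = block Q x (h' L) v"
          proof (cases "v \<in> fst L")
            case vL: True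
            have "block Q x (h L) v = block Q x (\<Sum>L\<in>?I. h L) v" using at[OF W(1) True vL] by simp
            also have "\<dots> = block Q x (\<Sum>L\<in>?I. h' L) v" using eq sum[OF h(1)] sum[OF h(2)] by simp
            also have "\<dots> = block Q x (h' L) v" using at[OF W(2) True vL] by simp
            finally show ?thesis .
          next
            case False
            thus ?thesis using W[OF True] longc_VP[OF C(1)] C(2) by (auto simp: Mo_Hom_at_def)
          qed
        qed
      next
        case False
        thus ?thesis using h by (simp add: direct_sum_outside)
      qed
    qed
  next
    fix f assume "f \<in> (\<lambda>h. \<Sum>L | h L \<noteq> 0. h L) ` direct_sum ?I ?W"
    then obtain h where h: "h \<in> direct_sum ?I ?W" "f = (\<Sum>L\<in>?I. h L)" using sum by auto
    thus "f \<in> Hom" using inH[of h] by (simp add: direct_sum_def)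
  next
    fix f assume f: "f \<in> Hom"
    \<comment> \<open>The component of \<open>f\<close> along a line: its matrix restricted to the
      line stays flat, as no edge leaves a component.\<close>
    define r where "r L = (\<lambda>v. if v \<in> fst L then blk f v else 0)" for L :: hline
    define h where "h L = (if L \<in> ?I then mk (r L) else 0)" for L
    have r: "r L \<in> FL (fst L)" "flat (r L)" if "L \<in> ?I" for L
      using flat_restrict[OF blk_flat[OF f] I(2)[OF that]] by (auto simp: r_def FL_def)
    have W: "h L \<in> ?W L" if L: "L \<in> ?I" for L
    proof -
      have "mk (r L) \<in> HL (fst L)" using HL_iff[OF I(2)[OF L]] mk_Hom[OF r(2)[OF L]] blk_mk[OF r(2)[OF L]] r(1)[OF L] by simp
      thus ?thesis using I(4)[OF L] L by (simp add: h_def)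
    qed
    have hd: "h \<in> direct_sum ?I ?W"
      using W I(1) by (auto simp: direct_sum_def h_def intro: finite_subset[of _ ?I])
    have "(\<Sum>L\<in>?I. h L) = f"
    proof (rule Hom_eqI[OF inH[OF W] f])
      fix C v assume C: "longc C" "v \<in> C"
      define L where "L = (C, P.edges_of C)"
      have L: "L \<in> ?I" "v \<in> fst L" using C by (auto simp: long_hlines_eq L_def)
      have "block Q x (\<Sum>L\<in>?I. h L) v = block Q x (mk (r L)) v" using at[OF W L] L by (simp add: h_def)
      also have "\<dots> = blk (mk (r L)) v" using blk_VP longc_VP[OF C(1)] C(2) by (metis subsetD)
      also have "\<dots> = blk f v" unfolding blk_mk[OF r(2)[OF L(1)]] using L(2) by (simp add: r_def)
      also have "\<dots> = block Q x f v" using blk_VP longc_VP[OF C(1)] C(2) by (metis subsetD)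
      finally show "block Q x (\<Sum>L\<in>?I. h L) v = block Q x f v" .
    qed
    thus "f \<in> (\<lambda>h. \<Sum>L | h L \<noteq> 0. h L) ` direct_sum ?I ?W" using sum[OF hd] hd by (intro image_eqI[of _ _ h]) auto
  qed
qed

lemma unseparated_ex: "longc C \<Longrightarrow> \<exists>v\<in>C. \<not> separated Q x y (C, P.edges_of C) v"
proof -
  assume C: "longc C"
  show ?thesis
  proof (cases "lt C = LD'")
    case True
    obtain g where g: "P.loops C = {g}" "line_loop Q x y (C, P.edges_of C) = (Y.ar (hy g), X.ar (hx g))"
      using LD'_setup[OF C True] by blast
    have gl: "g \<in> P.loops C" using g by simp
    have "HQ_src Q x y (HPlus (Y.ar (hy g)) (X.ar (hx g))) = fst g"
      using pa_ends(2)[OF loop_ends(1)[OF gl]] loop_ends(2,5)[OF gl] by auto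
    hence "\<not> separated Q x y (C, P.edges_of C) (fst g)" by (simp add: separated_def g(2) connected_def)
    moreover have "fst g \<in> C" using gl by (auto simp: P.loops_def)
    ultimately show ?thesis by blast
  next
    case False
    thus ?thesis using longc_ex[OF C] unfolding separated_def by blast
  qed
qed

text \<open>Each real line lies in one long line, and each long line contains one real line. For
  every real line, \<open>\<Phi>\<close> reads off the block at an unseparated vertex of its long
  line, where evaluation is an isomorphism onto the homomorphisms over the common algebra.\<close>

lemma Hom_real_lines:
  "\<exists>\<Phi>. linear_iso hscale (fscale (fscale sY)) \<Phi> Hom
     (direct_sum (real_hlines Q x y) (line_Hom Q x y sX sY \<rho>X \<rho>Y))"
proof -
  let ?I = "real_hlines Q x y" and ?LH = "line_Hom Q x y sX sY \<rho>X \<rho>Y"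
  have "\<forall>L\<in>?I. \<exists>C. longc C \<and> fst L \<subseteq> C"
    using real_long(1,3) realc_ex by (auto simp: real_hlines_eq) metis
  then obtain c where c: "\<And>L. L \<in> ?I \<Longrightarrow> longc (c L)" "\<And>L. L \<in> ?I \<Longrightarrow> fst L \<subseteq> c L" by metis
  have "\<forall>L\<in>?I. \<exists>v\<in>c L. \<not> separated Q x y (c L, P.edges_of (c L)) v" using unseparated_ex c by blast
  then obtain r where r: "\<And>L. L \<in> ?I \<Longrightarrow> r L \<in> c L" "\<And>L. L \<in> ?I \<Longrightarrow> \<not> separated Q x y (c L, P.edges_of (c L)) (r L)" by metis
  have real: "realc (fst L)" "L = (fst L, R.edges_of (fst L))" if "L \<in> ?I" for L using that by (auto simp: real_hlines_eq)
  have LH: "?LH L = LH (c L)" if L: "L \<in> ?I" for L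
    using line_Hom_real[OF c(1)[OF L] real(1)[OF L] c(2)[OF L]] real(2)[OF L] by metis
  have inj: "inj_on c ?I"
  proof (rule inj_onI)
    fix L L' assume L: "L \<in> ?I" "L' \<in> ?I" "c L = c L'"
    hence "fst L = fst L'" using real_unique[OF c(1)[OF L(1)] real(1)[OF L(1)] real(1)[OF L(2)]] c(2) by metis
    thus "L = L'" using real(2) L by metis
  qed
  have surj: "\<exists>L\<in>?I. c L = C" if C: "longc C" for C
  proof -
    obtain C' where C': "C' \<subseteq> C" "realc C'" using real_exists[OF C] by blast
    define L where "L = (C', R.edges_of C')"
    have L: "L \<in> ?I" "fst L = C'" using C' by (auto simp: real_hlines_eq L_def)
    obtain u where "u \<in> C'" using realc_ex[OF C'(2)] by blast
    hence "c L = C" using longc_disjoint[OF c(1)[OF L(1)] C, of u] c(2)[OF L(1)] L(2) C'(1) by blast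
    thus ?thesis using L by blast
  qed
  define \<Phi> :: "(('v, 'x, 'y) hom) \<Rightarrow> hline \<Rightarrow> 'x \<Rightarrow> 'y" where "\<Phi> f L = (if L \<in> ?I then block Q x f (r L) else 0)" for f L
  note ev = ev_bij[OF c(1) r(1) r(2)]
  have rVP: "r L \<in> VP" if "L \<in> ?I" for L using longc_VP[OF c(1)[OF that]] r(1)[OF that] by blast
  have res: "(\<lambda>v. if v \<in> c L then blk f v else 0) \<in> FL (c L)" if "L \<in> ?I" "f \<in> Hom" for L f
    using flat_restrict[OF blk_flat[OF that(2)] c(1)[OF that(1)]] .
  have "bij_betw \<Phi> Hom (direct_sum ?I ?LH)"
    unfolding bij_betw_def
  proof (intro conjI inj_onI equalityI subsetI)
    fix f g assume fg: "f \<in> Hom" "g \<in> Hom" "\<Phi> f = \<Phi> g"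
    show "f = g"
    proof (rule Hom_eqI[OF fg(1,2)])
      fix C v assume C: "longc C" "v \<in> C"
      obtain L where L: "L \<in> ?I" "c L = C" using surj[OF C(1)] by blast
      have "blk f (r L) = blk g (r L)" using fun_cong[OF fg(3), of L] L(1) blk_VP[OF rVP[OF L(1)]] by (simp add: \<Phi>_def)
      hence "(\<lambda>v. if v \<in> c L then blk f v else 0) = (\<lambda>v. if v \<in> c L then blk g v else 0)"
        by (intro inj_onD[OF bij_betw_imp_inj_on[OF ev[OF L(1) L(1) L(1)]]] res[OF L(1)] fg) (simp add: r(1)[OF L(1)])
      from fun_cong[OF this, of v] have "blk f v = blk g v" using L(2) C(2) by simp
      moreover have "v \<in> VP" using longc_VP[OF C(1)] C(2) by blast
      ultimately show "block Q x f v = block Q x g v" by (simp add: blk_VP)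
    qed
  next
    fix h assume "h \<in> \<Phi> ` Hom"
    then obtain f where f: "f \<in> Hom" "h = \<Phi> f" by blast
    have "\<Phi> f L \<in> ?LH L" if L: "L \<in> ?I" for L
    proof -
      have "blk f (r L) \<in> LH (c L)"
        using bij_betwE[OF ev[OF L L L]] res[OF L f(1)] r(1)[OF L] by fastforce
      thus ?thesis using LH[OF L] L blk_VP[OF rVP[OF L]] by (simp add: \<Phi>_def)
    qed
    thus "h \<in> direct_sum ?I ?LH"
      using finite_lines(2) f(2) by (auto simp: direct_sum_def \<Phi>_def intro: finite_subset[of _ ?I])
  next
    fix h assume h: "h \<in> direct_sum ?I ?LH"
    have "\<exists>\<phi>\<in>FL (c L). \<phi> (r L) = h L" if L: "L \<in> ?I" for L
    proof -
      have "h L \<in> LH (c L)" using direct_sum_in[OF h L] LH[OF L] by simp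
      thus ?thesis using ev[OF L L L] unfolding bij_betw_def by (metis (mono_tags, lifting) imageE)
    qed
    then obtain \<phi> where \<phi>: "\<And>L. L \<in> ?I \<Longrightarrow> \<phi> L \<in> FL (c L)" "\<And>L. L \<in> ?I \<Longrightarrow> \<phi> L (r L) = h L" by metis
    have fl: "flat (\<phi> L)" if "L \<in> ?I" for L using \<phi>(1)[OF that] by (simp add: FL_def)
    have W: "mk (\<phi> L) \<in> HL (c L)" if L: "L \<in> ?I" for L
      using HL_iff[OF c(1)[OF L]] mk_Hom[OF fl[OF L]] blk_mk[OF fl[OF L]] \<phi>(1)[OF L] by simp
    define f where "f = (\<Sum>L\<in>?I. mk (\<phi> L))"
    have f: "f \<in> Hom" unfolding f_def using W by (intro Hom_sum) (auto simp: Mo_Hom_at_def)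
    have "\<Phi> f L = h L" for L
    proof (cases "L \<in> ?I")
      case True
      have "block Q x f (r L) = block Q x (mk (\<phi> L)) (r L)"
        unfolding f_def by (rule block_sum_lines[OF finite_lines(2) c(1) inj W True r(1)[OF True]])
      thus ?thesis using True blk_mk[OF fl[OF True]] blk_VP[OF rVP[OF True]] \<phi>(2)[OF True] by (metis \<Phi>_def)
    next
      case False
      thus ?thesis using direct_sum_outside[OF h] by (simp add: \<Phi>_def)
    qed
    thus "h \<in> \<Phi> ` Hom" using f by (intro image_eqI[of _ _ f]) auto
  qed
  moreover have "linear_on hscale (fscale (fscale sY)) Hom \<Phi>"
    by (auto simp: linear_on_def \<Phi>_def block_add block_scale fun_eq_iff) (auto simp: fscale_def Y.scale_zero_right \<Phi>_def block_def split: prod.split)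
  ultimately show ?thesis using linear_iso_image[OF vector_spaces(3,2) subspace_Hom] by blast
qed

end

theorem theorem5p5:
  fixes Q :: "('v, 'a) pquiver"
    and x y :: "('v, 'a) letter list"
    and sX :: "'k::field \<Rightarrow> 'x::ab_group_add \<Rightarrow> 'x"
    and sY :: "'k \<Rightarrow> 'y::ab_group_add \<Rightarrow> 'y"
    and BX :: "'x set" and BY :: "'y set"
    and \<rho>X :: "'k alg_elt \<Rightarrow> 'x \<Rightarrow> 'x"
    and \<rho>Y :: "'k alg_elt \<Rightarrow> 'y \<Rightarrow> 'y"
  assumes char: "CHAR('k) \<noteq> 2"
    and Q: "skewed_gentle Q"
    and x: "x \<in> Adm Q" and y: "y \<in> Adm Q"
    and X: "finite_dimensional_vector_space sX BX" "kalg_module (akind_of Q x) sX \<rho>X"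
    and Y: "finite_dimensional_vector_space sY BY" "kalg_module (akind_of Q y) sY \<rho>Y"
  shows
    "kQ_rep Q (fscale sX) (Mo Q x \<rho>X) \<and> kQ_rep Q (fscale sY) (Mo Q y \<rho>Y) \<and>
     internal_direct_sum (fscale (fscale (fscale sY)))
       (Mo_Hom Q x y sX sY \<rho>X \<rho>Y) (long_hlines Q x y) (Mo_Hom_at Q x y sX sY \<rho>X \<rho>Y) \<and>
     (\<exists>\<Phi>. linear_iso (fscale (fscale (fscale sY))) (fscale (fscale sY)) \<Phi>
       (Mo_Hom Q x y sX sY \<rho>X \<rho>Y)
       (direct_sum (real_hlines Q x y) (line_Hom Q x y sX sY \<rho>X \<rho>Y))) \<and>
     (\<forall>L\<in>long_hlines Q x y. \<forall>v\<in>fst L. \<not> separated Q x y L v \<longrightarrow>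
       linear_iso (fscale (fscale (fscale sY))) (fscale sY) (\<lambda>f. block Q x f v)
         (Mo_Hom_at Q x y sX sY \<rho>X \<rho>Y L) (line_Hom Q x y sX sY \<rho>X \<rho>Y L)) \<and>
     (\<forall>L\<in>long_hlines Q x y. \<forall>v\<in>fst L. separated Q x y L v \<longrightarrow>
       (\<exists>a\<in>Units (kalg (akind_of Q x)). \<exists>b\<in>Units (kalg (akind_of Q y)).
         linear_iso (fscale (fscale (fscale sY))) (fscale sY) (\<lambda>f. \<rho>Y b \<circ> block Q x f v \<circ> \<rho>X a)
           (Mo_Hom_at Q x y sX sY \<rho>X \<rho>Y L) (line_Hom Q x y sX sY \<rho>X \<rho>Y L)))"
proof -
  interpret module_pair Q x y sX \<rho>X sY \<rho>Y
    by unfold_locales (use Q x y X(2) Y(2) in auto)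
  show ?thesis
    using X.kQ_rep_M Y.kQ_rep_M Hom_direct_sum Hom_real_lines block_iso block_iso_separated
    unfolding long_hlines_eq by auto
qed

end
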